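(* Let $2<p<\infty$ and let $\omega\in\mathcal{R}$ be a regular weight, and let $\varphi$ be a bounded valent analytic self-map of $\mathbb{D}$. Then the composition operator $C_\varphi$ belongs to the Schatten $p$-class $\mathcal{S}_p(A^2_\omega)$ if and only if $$\int_{\mathbb{D}}\left(\frac{\omega^\star(z)}{\omega^\star(\varphi(z))}\right)^{\frac p2}\frac{\omega(z)}{\omega^\star(z)}\,dA(z)<\infty.$$
   Context: $\mathbb{D}$ is the open unit disc of $\mathbb{C}$ and $dA=\frac{dx\,dy}{\pi}$. A weight is a nonnegative integrable function $\omega$ on $\mathbb{D}$; it is radial if $\omega(z)=\omega(|z|)$. For a radial weight put $\widehat\omega(z)=\int_{|z|}^1\omega(s)\,ds$, and it is assumed throughout that $\widehat\omega(r)>0$ for $0\le r<1$. A radial weight is in $\widehat{\mathcal{D}}$ if there is $C>0$ with $\widehat\omega(r)\le C\widehat\omega(\frac{1+r}{2})$ for all $0\le r<1$. A radial weight $\omega\in\widehat{\mathcal D}$ is regular, $\omega\in\mathcal{R}$, if $\omega(r)\asymp\frac{1}{1-r}\int_r^1\omega(s)\,ds$ for $0\le r<1$, where $a\asymp b$ means $C^{-1}a\le b\le Ca$ for some constant $C>0$ independent of the relevant variable. Put $\omega^\star(z)=\int_{|z|}^1\omega(s)\log\frac{s}{|z|}\,s\,ds$ for $z\in\mathbb{D}\setminus\{0\}$ (the values at the origin play no role, since $\varphi$ vanishes only at finitely many points). $A^2_\omega$ is the Hilbert space of analytic functions $f$ in $\mathbb{D}$ with $\|f\|^2_{A^2_\omega}=\int_{\mathbb{D}}|f|^2\omega\,dA<\infty$.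 For an analytic self-map $\varphi$ of $\mathbb{D}$, $C_\varphi(f)=f\circ\varphi$. The map $\varphi$ is bounded valent if there is $N\in\mathbb{N}$ such that each point of $\mathbb{D}$ has at most $N$ preimages under $\varphi$. For a Hilbert space $H$, $\mathcal{S}_p(H)$ consists of the compact operators $T:H\to H$ whose sequence of singular values $\lambda_n(T)=\inf\{\|T-R\|:\operatorname{rank}(R)\le n\}$, $n\ge0$, is in $\ell^p$. *)

theory Defs
  imports "HOL-Analysis.Analysis"
begin

section \<open>Schatten classes\<close>

text \<open>
  A Hilbert space of complex-valued functions is given by its set \<open>H\<close> of elements and its norm
  \<open>N\<close>; vector space operations are pointwise. Operators are total HOL functions, of which only
  the values on \<open>H\<close> matter.
\<close>

definition linear_operator :: "('a \<Rightarrow> complex) set \<Rightarrow> (('a \<Rightarrow> complex) \<Rightarrow> ('a \<Rightarrow> complex)) \<Rightarrow> bool" where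
  "linear_operator H T \<longleftrightarrow> T ` H \<subseteq> H \<and>
     (\<forall>f\<in>H. \<forall>g\<in>H. \<forall>a b. T (\<lambda>x. a * f x + b * g x) = (\<lambda>x. a * T f x + b * T g x))"

definition bounded_operator ::
  "('a \<Rightarrow> complex) set \<Rightarrow> (('a \<Rightarrow> complex) \<Rightarrow> real) \<Rightarrow> (('a \<Rightarrow> complex) \<Rightarrow> ('a \<Rightarrow> complex)) \<Rightarrow> bool" where
  "bounded_operator H N T \<longleftrightarrow> linear_operator H T \<and> (\<exists>C. \<forall>f\<in>H. N (T f) \<le> C * N f)"

definition operator_norm ::
  "('a \<Rightarrow> complex) set \<Rightarrow> (('a \<Rightarrow> complex) \<Rightarrow> real) \<Rightarrow> (('a \<Rightarrow> complex) \<Rightarrow> ('a \<Rightarrow> complex)) \<Rightarrow> real" where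
  "operator_norm H N T = (SUP f\<in>{f\<in>H. N f \<le> 1}. N (T f))"

definition norm_topology ::
  "('a \<Rightarrow> complex) set \<Rightarrow> (('a \<Rightarrow> complex) \<Rightarrow> real) \<Rightarrow> ('a \<Rightarrow> complex) topology" where
  "norm_topology H N = Metric_space.mtopology H (\<lambda>f g. N (\<lambda>x. f x - g x))"

definition compact_operator ::
  "('a \<Rightarrow> complex) set \<Rightarrow> (('a \<Rightarrow> complex) \<Rightarrow> real) \<Rightarrow> (('a \<Rightarrow> complex) \<Rightarrow> ('a \<Rightarrow> complex)) \<Rightarrow> bool" where
  "compact_operator H N T \<longleftrightarrow> bounded_operator H N T \<and>
     compactin (norm_topology H N) (norm_topology H N closure_of (T ` {f\<in>H. N f \<le> 1}))"

text \<open>The range of \<open>R\<close> is spanned by at most \<open>n\<close> elements of \<open>H\<close>.\<close>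

definition rank_le :: "('a \<Rightarrow> complex) set \<Rightarrow> (('a \<Rightarrow> complex) \<Rightarrow> ('a \<Rightarrow> complex)) \<Rightarrow> nat \<Rightarrow> bool" where
  "rank_le H R n \<longleftrightarrow>
     (\<exists>e::nat \<Rightarrow> 'a \<Rightarrow> complex. (\<forall>i<n. e i \<in> H) \<and>
        (\<forall>f\<in>H. \<exists>c::nat \<Rightarrow> complex. R f = (\<lambda>x. \<Sum>i<n. c i * e i x)))"

definition singular_value ::
  "('a \<Rightarrow> complex) set \<Rightarrow> (('a \<Rightarrow> complex) \<Rightarrow> real) \<Rightarrow> (('a \<Rightarrow> complex) \<Rightarrow> ('a \<Rightarrow> complex)) \<Rightarrow> nat \<Rightarrow> real" where
  "singular_value H N T n =
     (INF R\<in>{R. bounded_operator H N R \<and> rank_le H R n}. operator_norm H N (\<lambda>f x. T f x - R f x))"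

definition Schatten_class ::
  "real \<Rightarrow> ('a \<Rightarrow> complex) set \<Rightarrow> (('a \<Rightarrow> complex) \<Rightarrow> real) \<Rightarrow> (('a \<Rightarrow> complex) \<Rightarrow> ('a \<Rightarrow> complex)) set" where
  "Schatten_class p H N =
     {T. compact_operator H N T \<and> summable (\<lambda>n. singular_value H N T n powr p)}"

section \<open>Weights on the unit disc\<close>

definition unit_disc :: "complex set" where
  "unit_disc = ball 0 1"

definition disc_area :: "complex measure" where
  "disc_area = density (lebesgue_on unit_disc) (\<lambda>_. ennreal (1 / pi))"

definition weight :: "(complex \<Rightarrow> real) \<Rightarrow> bool" where
  "weight \<omega> \<longleftrightarrow> (\<forall>z\<in>unit_disc. 0 \<le> \<omega> z) \<and> integrable disc_area \<omega>"

definition weight_hat :: "(complex \<Rightarrow> real) \<Rightarrow> complex \<Rightarrow> real" where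
  "weight_hat \<omega> z = (LINT s:{cmod z..<1}|lebesgue. \<omega> (complex_of_real s))"

text \<open>
  The Bochner integral of a non-integrable function is 0, so positivity of \<open>weight_hat\<close> at 0 also
  makes the integral over the whole of \<open>[0, 1)\<close> finite. For a radial weight only a divergence at
  the origin is excluded in this way, and the doubling condition (at \<open>r = 0\<close>) excludes it anyway.
\<close>

definition radial_weight :: "(complex \<Rightarrow> real) \<Rightarrow> bool" where
  "radial_weight \<omega> \<longleftrightarrow> weight \<omega> \<and>
     (\<forall>z\<in>unit_disc. \<omega> z = \<omega> (complex_of_real (cmod z))) \<and>
     (\<forall>r::real. 0 \<le> r \<and> r < 1 \<longrightarrow> 0 < weight_hat \<omega> (complex_of_real r))"

definition doubling_weight :: "(complex \<Rightarrow> real) \<Rightarrow> bool" where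
  "doubling_weight \<omega> \<longleftrightarrow> radial_weight \<omega> \<and>
     (\<exists>C>0. \<forall>r::real. 0 \<le> r \<and> r < 1 \<longrightarrow>
        weight_hat \<omega> (complex_of_real r) \<le> C * weight_hat \<omega> (complex_of_real ((1 + r) / 2)))"

definition regular_weight :: "(complex \<Rightarrow> real) \<Rightarrow> bool" where
  "regular_weight \<omega> \<longleftrightarrow> doubling_weight \<omega> \<and>
     (\<exists>C>0. \<forall>r::real. 0 \<le> r \<and> r < 1 \<longrightarrow>
        inverse C * \<omega> (complex_of_real r) \<le> 1 / (1 - r) * weight_hat \<omega> (complex_of_real r) \<and>
        1 / (1 - r) * weight_hat \<omega> (complex_of_real r) \<le> C * \<omega> (complex_of_real r))"

text \<open>At the origin the following evaluates to the junk value 0.\<close>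

definition weight_star :: "(complex \<Rightarrow> real) \<Rightarrow> complex \<Rightarrow> real" where
  "weight_star \<omega> z = (LINT s:{cmod z..<1}|lebesgue. \<omega> (complex_of_real s) * ln (s / cmod z) * s)"

section \<open>Weighted Bergman spaces and composition operators\<close>

text \<open>
  A function on the disc is represented by its extension by 0 to \<open>\<complex>\<close>, so that equality of functions
  on the disc is HOL equality.
\<close>

definition bergman_space :: "(complex \<Rightarrow> real) \<Rightarrow> (complex \<Rightarrow> complex) set" where
  "bergman_space \<omega> = {f. f holomorphic_on unit_disc \<and> (\<forall>z. z \<notin> unit_disc \<longrightarrow> f z = 0) \<and>
     integrable disc_area (\<lambda>z. (cmod (f z))\<^sup>2 * \<omega> z)}"

definition bergman_norm :: "(complex \<Rightarrow> real) \<Rightarrow> (complex \<Rightarrow> complex) \<Rightarrow> real" where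
  "bergman_norm \<omega> f = sqrt (\<integral>z. (cmod (f z))\<^sup>2 * \<omega> z \<partial>disc_area)"

definition analytic_self_map :: "(complex \<Rightarrow> complex) \<Rightarrow> bool" where
  "analytic_self_map \<phi> \<longleftrightarrow> \<phi> holomorphic_on unit_disc \<and> \<phi> ` unit_disc \<subseteq> unit_disc"

definition bounded_valent :: "(complex \<Rightarrow> complex) \<Rightarrow> bool" where
  "bounded_valent \<phi> \<longleftrightarrow>
     (\<exists>n::nat. \<forall>w\<in>unit_disc. finite {z\<in>unit_disc. \<phi> z = w} \<and> card {z\<in>unit_disc. \<phi> z = w} \<le> n)"

definition composition_operator ::
  "(complex \<Rightarrow> complex) \<Rightarrow> (complex \<Rightarrow> complex) \<Rightarrow> (complex \<Rightarrow> complex)" where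
  "composition_operator \<phi> f = (\<lambda>z. if z \<in> unit_disc then f (\<phi> z) else 0)"

end

theory Submission
  imports Defs "HOL-Complex_Analysis.Complex_Analysis"
begin

text \<open>
  Let \<open>\<omega>\<close> be regular, \<open>W r\<close> the integral of \<open>\<omega>\<close> over \<open>[r, 1)\<close> and \<open>\<tau> z = (1 - |z|) W |z|\<close>. Away from the
  origin \<open>\<omega>\<^sup>\<star>\<close> is comparable to \<open>\<tau>\<close>, and regularity makes \<open>\<omega>\<close> comparable to \<open>\<tau> / (1 - |z|)\<^sup>2\<close>; hence the
  integral of the theorem is finite exactly when the integral of
  \<open>(\<tau> / \<tau> \<circ> \<phi>)\<^bsup>p/2\<^esup> \<omega> / \<tau>\<close> is (\<open>star_integral_iff\<close>), and the whole argument is carried out with \<open>\<tau>\<close>. Since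
  \<open>\<omega>\<close> is radial, monomials are orthogonal, and norms are sums over Taylor coefficients. The two analytic
  inputs are the Littlewood-Paley estimate \<open>\<parallel>g\<parallel>\<^sup>2 \<le> C (|g 0|\<^sup>2 + \<integral> |g'|\<^sup>2 \<tau>)\<close> (\<open>littlewood_paley_upper\<close>), and the fact that
  the norm of the evaluation at \<open>z\<close> is comparable to \<open>\<tau> z\<close> to the power \<open>-1/2\<close> (\<open>point_evaluation\<close> from
  above, \<open>test_function\<close> from below).

  Necessity. Let \<open>h z = (\<tau> z / \<tau> (\<phi> z))\<^bsup>1/2\<^esup>\<close>. Applied to a test function at \<open>\<phi> z\<close>, the operator shows that
  \<open>h z\<close> is at most a constant times \<open>\<tau> z\<^bsup>1/2\<^esup>\<close> times the norm of \<open>f \<mapsto> T f z\<close>. Write \<open>T\<close> as a telescoping sum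
  of differences of almost best approximations \<open>R j\<close> of rank about \<open>2 ^ j\<close>. The remainder \<open>T - R J\<close> contributes at
  most a multiple of the singular value of index about \<open>2 ^ J\<close>, uniformly in \<open>z\<close>; the difference
  \<open>R (j+1) - R j\<close>, an operator of rank about \<open>2 ^ j\<close>, contributes a function whose square has
  \<open>\<omega> / \<tau>\<close>-integral at most \<open>2 ^ j\<close> times a squared singular value, because an orthonormal basis of its
  range has that many elements (\<open>finite_rank_pointwise\<close>). This is the situation of real interpolation
  between \<open>L\<^sup>2\<close> and \<open>L\<^sup>\<infinity>\<close>, and \<open>dyadic_interpolation\<close> turns \<open>p\<close>-summability of the singular values into
  \<open>h \<in> L\<^sup>p(\<omega> / \<tau>)\<close>, which is the integral condition (\<open>Schatten_imp_integral_tau\<close>).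

  Sufficiency. Divide the disc into Whitney cells \<open>Q j\<close> with centres \<open>w j\<close> (\<open>Whitney_cover\<close>) and let \<open>s j\<close> be
  the square root of the normalised \<open>|\<phi>'|\<^sup>2 \<tau>\<close>-mass of the preimage of \<open>Q j\<close> under \<open>\<phi>\<close>. As \<open>\<phi>\<close> has bounded
  valence, the \<open>|\<phi>'|\<^sup>2\<close>-mass of that preimage is at most a multiple of the area of \<open>Q j\<close>
  (\<open>bounded_valent_area\<close>); Jensen's inequality and the Schwarz-Pick inequality then bound the sum of
  the \<open>s j\<^bsup>p\<^esup>\<close> by the integral (\<open>s_summable\<close>). If the derivatives of \<open>f\<close> of orders \<open>1, \<dots>, d j\<close> vanish at
  every \<open>w j\<close>, then \<open>f'\<close> is smaller on \<open>Q j\<close> by a factor \<open>2\<close> to the power \<open>-d j\<close>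
  (\<open>deriv_L2_bound_vanishing\<close>), and by the Littlewood-Paley estimate \<open>\<parallel>T f\<parallel> \<le> C t \<parallel>f\<parallel>\<close> as soon as
  \<open>f (\<phi> 0) = 0\<close> and \<open>s j \<le> t 2 ^ d j\<close> for all \<open>j\<close> (\<open>composition_norm_bound\<close>). The number of conditions
  imposed on \<open>f\<close> is one more than the number of pairs \<open>(j, i)\<close> with \<open>s j / 2 ^ i > t\<close>, so the singular value
  of this index is at most \<open>C t\<close> (\<open>singular_value_estimate\<close>). Thus, up to a constant, the singular values are dominated by
  the decreasing rearrangement of the family \<open>s j / 2 ^ i\<close>, which is \<open>p\<close>-summable (\<open>greedy_summable\<close>,
  \<open>composition_Schatten\<close>). Compactness follows since the singular values tend to \<open>0\<close>
  (\<open>compact_operatorI\<close>).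
\<close>

unbundle no fps_syntax

section \<open>Area and holomorphic maps\<close>

text \<open>
  The identification of the complex plane with \<open>real ^ 2\<close> preserves Lebesgue measure; the change of variables formula for real
  coordinates thereby applies to complex maps.
\<close>

lemma lborel_complex_eq_distr:
  "(lborel :: complex measure) = distr lborel borel (\<lambda>x::real^2. Complex (x$1) (x$2))"
proof (rule lborel_eqI)
  fix l u :: complex
  let ?L = "\<lambda>x::real^2. Complex (x$1) (x$2)"
  have [measurable]: "?L \<in> borel_measurable borel"
    unfolding Complex_eq by (intro borel_measurable_continuous_onI continuous_intros)
  assume lu: "\<And>b. b \<in> Basis \<Longrightarrow> l \<bullet> b \<le> u \<bullet> b"
  have le: "Re l \<le> Re u" "Im l \<le> Im u" using lu[of 1] lu[of \<i>] by (auto simp: Basis_complex_def inner_complex_def)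
  have B: "(Basis::(real^2) set) = {axis 1 1, axis 2 1}" unfolding Basis_vec_def by (auto simp: UNIV_2)
  have "emeasure (distr lborel borel ?L) (box l u) = emeasure lborel (?L -` box l u)"
    by (subst emeasure_distr) auto
  also have "?L -` box l u = box (vector [Re l, Im l]) (vector [Re u, Im u])"
    by (auto simp: mem_box Basis_complex_def inner_complex_def B inner_axis)
  also have "emeasure lborel \<dots> = ennreal (\<Prod>b\<in>(Basis::(real^2) set). (vector [Re u, Im u] - vector [Re l, Im l]) \<bullet> b)"
    by (rule emeasure_lborel_box) (use le in \<open>auto simp: B inner_axis\<close>)
  also have "(\<Prod>b\<in>(Basis::(real^2) set). (vector [Re u, Im u] - vector [Re l, Im l]) \<bullet> b) = (Re u - Re l) * (Im u - Im l)"
  proof -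
    have "axis 1 1 \<noteq> (axis 2 1 :: real^2)" by (simp add: axis_eq_axis)
    then show ?thesis by (simp add: B inner_axis)
  qed
  also have "\<dots> = (\<Prod>b\<in>Basis. (u - l) \<bullet> b)" by (simp add: Basis_complex_def inner_complex_def)
  finally show "emeasure (distr lborel borel ?L) (box l u) = ennreal (\<Prod>b\<in>Basis. (u - l) \<bullet> b)" .
qed simp

text \<open>
  The Jacobian of a holomorphic map: its real derivative is multiplication by \<open>c\<close>, a similarity of ratio \<open>|c|\<close>.
\<close>

lemma det_complex_mult:
  "det (matrix (\<lambda>h::real^2. vector [Re (c * Complex (h$1) (h$2)), Im (c * Complex (h$1) (h$2))] :: real^2)) = (cmod c)\<^sup>2"
  by (simp add: det_2 matrix_def axis_def cmod_power2) (simp add: power2_eq_square)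

text \<open>
  The Jacobian \<open>|f'|\<^sup>2\<close> is put into the change of variables formula on \<open>real ^ 2\<close>. The image is Borel because it is a
  preimage under the holomorphic inverse, and its boundedness excludes an infinite integral.
\<close>

lemma area_formula_inj:
  fixes f :: "complex \<Rightarrow> complex"
  assumes U: "open U" and f: "f holomorphic_on U" and inj: "inj_on f U"
    and S: "S \<in> sets borel" "S \<subseteq> U" and bd: "bounded (f ` S)"
  shows "f ` S \<in> sets borel"
    and "(\<integral>\<^sup>+z. indicator S z * ennreal ((cmod (deriv f z))\<^sup>2) \<partial>lborel) = emeasure lborel (f ` S)"
proof -
  let ?L = "\<lambda>x::real^2. Complex (x$1) (x$2)"
  let ?K = "\<lambda>z. vector [Re z, Im z] :: real^2"
  have Lm[measurable]: "?L \<in> borel_measurable borel"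
    unfolding Complex_eq by (intro borel_measurable_continuous_onI continuous_intros)
  have LK[simp]: "?L (?K z) = z" for z by (simp add: complex_eq_iff)
  have KL[simp]: "?K (?L x) = x" for x by (simp add: vec_eq_iff forall_2)
  obtain g where g: "g holomorphic_on f ` U" "\<And>z. z \<in> U \<Longrightarrow> deriv f z * deriv g (f z) = 1"
    "\<And>z. z \<in> U \<Longrightarrow> g (f z) = z"
    using holomorphic_has_inverse[OF f U inj] by metis
  have opf: "open (f ` U)" by (rule open_mapping_thm3[OF f U inj])
  have "f ` S = f ` U \<inter> g -` S"
    using S(2) g(3) by force
  moreover have "g -` S \<inter> f ` U \<in> sets borel"
  proof -
    have "(\<lambda>x. if x \<in> f ` U then g x else 0) \<in> borel_measurable borel"
      by (intro borel_measurable_continuous_on_if continuous_on_const)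
         (use g(1) opf in \<open>auto intro: holomorphic_on_imp_continuous_on\<close>)
    from measurable_sets[OF this S(1)]
    have "(\<lambda>x. if x \<in> f ` U then g x else 0) -` S \<in> sets borel" by simp
    then have "(\<lambda>x. if x \<in> f ` U then g x else 0) -` S \<inter> f ` U \<in> sets borel"
      using opf by auto
    also have "(\<lambda>x. if x \<in> f ` U then g x else 0) -` S \<inter> f ` U = g -` S \<inter> f ` U" by auto
    finally show ?thesis .
  qed
  ultimately show fS: "f ` S \<in> sets borel" by (simp add: Int_commute)
  define h where "h = (\<lambda>x. ?K (f (?L x)))"
  define S' where "S' = ?L -` S"
  have S'b: "S' \<in> sets borel" unfolding S'_def using measurable_sets[OF Lm S(1)] by simp
  have der: "(h has_derivative (\<lambda>y. ?K (deriv f (?L x) * ?L y))) (at x within S')" if "x \<in> S'" for x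
  proof -
    have "?L x \<in> U" using that S unfolding S'_def by auto
    then have d: "(f has_derivative (*) (deriv f (?L x))) (at (?L x))"
      using f U has_field_derivative_imp_has_derivative holomorphic_derivI by blast
    have bl: "bounded_linear ?L"
    proof -
      have "linear ?L" by (auto intro!: linearI simp: complex_eq_iff)
      then show ?thesis by (simp add: linear_conv_bounded_linear)
    qed
    have bk: "bounded_linear ?K"
    proof -
      have "linear ?K" by (auto intro!: linearI simp: vec_eq_iff forall_2)
      then show ?thesis by (simp add: linear_conv_bounded_linear)
    qed
    have "((\<lambda>x. f (?L x)) has_derivative (\<lambda>y. deriv f (?L x) * ?L y)) (at x)"
      using has_derivative_compose[OF bounded_linear_imp_has_derivative[OF bl] d] .
    from has_derivative_compose[OF this bounded_linear_imp_has_derivative[OF bk]]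
    show ?thesis unfolding h_def by (rule has_derivative_at_withinI)
  qed
  have hS: "h ` S' = ?L -` (f ` S)"
  proof -
    have "h ` S' \<subseteq> ?L -` (f ` S)" by (auto simp: h_def S'_def)
    moreover have "y \<in> h ` S'" if "y \<in> ?L -` (f ` S)" for y
    proof -
      from that obtain z where "z \<in> S" "?L y = f z" by auto
      then have "h (?K z) = y" unfolding h_def by (metis LK KL)
      moreover have "?K z \<in> S'" using \<open>z \<in> S\<close> unfolding S'_def by simp
      ultimately show ?thesis by blast
    qed
    ultimately show ?thesis by blast
  qed
  have injh: "inj_on h S'"
  proof (rule inj_onI)
    fix x y assume "x \<in> S'" "y \<in> S'" "h x = h y"
    then have "f (?L x) = f (?L y)" unfolding h_def by (metis LK)
    then have "?L x = ?L y" using \<open>x \<in> S'\<close> \<open>y \<in> S'\<close> S(2) inj unfolding S'_def by (auto dest: inj_onD)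
    then show "x = y" by (metis KL)
  qed
  have em: "emeasure lborel (h ` S') = emeasure lborel (f ` S)"
  proof -
    have "emeasure lborel (f ` S) = emeasure (distr lborel borel ?L) (f ` S)"
      by (rule arg_cong[where f="\<lambda>M. emeasure M (f ` S)", OF lborel_complex_eq_distr])
    also have "\<dots> = emeasure lborel (?L -` (f ` S))"
      using fS by (subst emeasure_distr) auto
    finally show ?thesis unfolding hS by simp
  qed
  have hSb: "h ` S' \<in> sets borel" unfolding hS using measurable_sets[OF Lm fS] by simp
  have fin: "emeasure lborel (f ` S) < \<infinity>" by (rule emeasure_bounded_finite[OF bd])
  have lm: "h ` S' \<in> lmeasurable"
    using hSb em fin by (auto simp: fmeasurable_def)
  define m where "m = measure lebesgue (h ` S')"
  have "((\<lambda>x. \<bar>det (matrix (\<lambda>y. ?K (deriv f (?L x) * ?L y)))\<bar>) has_integral m) S'"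
    using has_measure_differentiable_image[OF _ der injh, of m] lm S'b m_def by auto
  then have "((\<lambda>x. (cmod (deriv f (?L x)))\<^sup>2) has_integral m) S'"
    unfolding det_complex_mult by simp
  from nn_integral_has_integral_lebesgue[OF _ this]
  have "(\<integral>\<^sup>+x. ennreal (indicator S' x * (cmod (deriv f (?L x)))\<^sup>2) \<partial>lborel) = ennreal m" by simp
  also have "ennreal m = emeasure lborel (h ` S')"
  proof -
    have "emeasure lebesgue (h ` S') = ennreal m" unfolding m_def by (rule emeasure_eq_measure2[OF lm])
    moreover have "emeasure lebesgue (h ` S') = emeasure lborel (h ` S')" using hSb by simp
    ultimately show ?thesis by simp
  qed
  also have "\<dots> = emeasure lborel (f ` S)" by (rule em)
  also have "(\<integral>\<^sup>+x. ennreal (indicator S' x * (cmod (deriv f (?L x)))\<^sup>2) \<partial>lborel) =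
    (\<integral>\<^sup>+z. indicator S z * ennreal ((cmod (deriv f z))\<^sup>2) \<partial>lborel)"
  proof -
    have "(\<lambda>z. if z \<in> U then deriv f z else 0) \<in> borel_measurable borel"
      by (intro borel_measurable_continuous_on_if continuous_on_const)
         (use f U in \<open>auto intro!: holomorphic_on_imp_continuous_on holomorphic_deriv\<close>)
    then have "(\<lambda>z. indicator S z * ennreal ((cmod (if z \<in> U then deriv f z else 0))\<^sup>2)) \<in> borel_measurable borel"
      using S(1) by measurable
    also have "(\<lambda>z. indicator S z * ennreal ((cmod (if z \<in> U then deriv f z else 0))\<^sup>2)) =
      (\<lambda>z. indicator S z * ennreal ((cmod (deriv f z))\<^sup>2))"
      using S(2) by (auto simp: fun_eq_iff indicator_def)
    finally have [measurable]: "(\<lambda>z. indicator S z * ennreal ((cmod (deriv f z))\<^sup>2)) \<in> borel_measurable borel" .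
    let ?F = "\<lambda>z. indicator S z * ennreal ((cmod (deriv f z))\<^sup>2)"
    have "(\<integral>\<^sup>+z. ?F z \<partial>lborel) = (\<integral>\<^sup>+z. ?F z \<partial>distr lborel borel ?L)"
      by (rule arg_cong[where f="\<lambda>M. nn_integral M ?F", OF lborel_complex_eq_distr])
    also have "\<dots> = (\<integral>\<^sup>+x. ?F (?L x) \<partial>lborel)" by (rule nn_integral_distr) auto
    finally show ?thesis by (auto simp: S'_def indicator_def intro!: nn_integral_cong)
  qed
  finally show "(\<integral>\<^sup>+z. indicator S z * ennreal ((cmod (deriv f z))\<^sup>2) \<partial>lborel) = emeasure lborel (f ` S)" .
qed

text \<open>
  A rotation is an injective holomorphic map whose derivative has modulus \<open>1\<close>.
\<close>

lemma lborel_rotation: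
  assumes c: "cmod c = 1"
  shows "distr lborel borel (\<lambda>z. c * z) = (lborel :: complex measure)"
proof (rule lborel_eqI[symmetric])
  have [simp]: "c \<noteq> 0" using c by auto
  fix l u :: complex
  assume lu: "\<And>b. b \<in> Basis \<Longrightarrow> l \<bullet> b \<le> u \<bullet> b"
  let ?S = "(\<lambda>z. c * z) -` box l u"
  have Sb: "?S \<in> sets borel"
    using measurable_sets[of "\<lambda>z. c * z" borel borel "box l u"] by auto
  have im: "(\<lambda>z. c * z) ` ?S = box l u"
    by (auto simp: image_iff intro!: exI[of _ "_ / c"] bexI[of _ "_ / c"])
  have d: "deriv (\<lambda>z. c * z) = (\<lambda>z. c)" by (auto simp: fun_eq_iff intro!: DERIV_imp_deriv derivative_eq_intros)
  have "emeasure (distr lborel borel (\<lambda>z. c * z)) (box l u) = emeasure lborel ?S"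
    by (subst emeasure_distr) auto
  also have "\<dots> = (\<integral>\<^sup>+z. indicator ?S z * ennreal ((cmod (deriv (\<lambda>z. c * z) z))\<^sup>2) \<partial>lborel)"
    using Sb by (simp add: d c)
  also have "\<dots> = emeasure lborel ((\<lambda>z. c * z) ` ?S)"
    by (rule area_formula_inj(2)[of UNIV])
       (use Sb in \<open>auto simp: im inj_on_def intro!: holomorphic_intros\<close>)
  also have "\<dots> = (\<Prod>b\<in>Basis. (u - l) \<bullet> b)"
    unfolding im by (rule emeasure_lborel_box[OF lu])
  finally show "emeasure (distr lborel borel (\<lambda>z. c * z)) (box l u) = (\<Prod>b\<in>Basis. (u - l) \<bullet> b)" .
qed simp

section \<open>The normalised area measure of the disc\<close>

lemma sets_disc_area: "A \<in> sets disc_area \<longleftrightarrow> A \<in> sets lebesgue \<and> A \<subseteq> unit_disc"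
  by (auto simp: disc_area_def sets_restrict_space_iff unit_disc_def)

lemma space_disc_area[simp]: "space disc_area = unit_disc"
  by (simp add: disc_area_def)

lemma open_unit_disc[simp]: "open unit_disc" by (simp add: unit_disc_def)
lemma unit_disc_iff: "z \<in> unit_disc \<longleftrightarrow> cmod z < 1" by (simp add: unit_disc_def)
lemma unit_disc_lebesgue[simp, measurable]: "unit_disc \<in> sets lebesgue" "unit_disc \<in> sets borel"
  by (auto simp: unit_disc_def)

lemma measurable_disc_areaI:
  "f \<in> borel_measurable (lebesgue_on unit_disc) \<Longrightarrow> f \<in> borel_measurable disc_area"
  by (simp add: disc_area_def)

lemma borel_measurable_disc_area_continuous:
  fixes f :: "complex \<Rightarrow> 'b::euclidean_space"
  assumes "continuous_on unit_disc f"
  shows "f \<in> borel_measurable disc_area"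
  by (intro measurable_disc_areaI continuous_imp_measurable_on_sets_lebesgue assms) simp

lemma borel_measurable_disc_area_borel:
  assumes "f \<in> borel_measurable borel"
  shows "f \<in> borel_measurable disc_area"
  using assms by (intro measurable_disc_areaI measurable_restrict_space1) (simp add: measurable_completion)

text \<open>
  The measure \<open>disc_area\<close> lives on the completed sigma-algebra; this
  formula reduces the integral of a Borel function to the Borel measure.
\<close>

lemma nn_integral_disc_area:
  assumes f: "f \<in> borel_measurable disc_area"
  shows "(\<integral>\<^sup>+z. f z \<partial>disc_area) = ennreal (1 / pi) * (\<integral>\<^sup>+z. f z * indicator unit_disc z \<partial>lborel)"
proof -
  have f': "f \<in> borel_measurable (lebesgue_on unit_disc)" using f by (simp add: disc_area_def)
  have "(\<integral>\<^sup>+z. f z \<partial>disc_area) = (\<integral>\<^sup>+z. ennreal (1 / pi) * f z \<partial>lebesgue_on unit_disc)"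
    unfolding disc_area_def by (rule nn_integral_density) (use f' in auto)
  also have "\<dots> = ennreal (1 / pi) * (\<integral>\<^sup>+z. f z \<partial>lebesgue_on unit_disc)"
    by (rule nn_integral_cmult[OF f'])
  also have "(\<integral>\<^sup>+z. f z \<partial>lebesgue_on unit_disc) = (\<integral>\<^sup>+z. f z * indicator unit_disc z \<partial>lebesgue)"
    by (rule nn_integral_restrict_space) simp
  also have "\<dots> = (\<integral>\<^sup>+z. f z * indicator unit_disc z \<partial>lborel)"
    by (rule nn_integral_completion)
  finally show ?thesis .
qed

lemma emeasure_disc_area:
  assumes "A \<in> sets disc_area"
  shows "emeasure disc_area A = ennreal (1 / pi) * emeasure lebesgue A"
proof -
  have A: "A \<in> sets lebesgue" "A \<subseteq> unit_disc" using assms by (auto simp: sets_disc_area)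
  have A': "A \<in> sets (lebesgue_on unit_disc)" using assms by (simp add: disc_area_def)
  have "emeasure disc_area A = (\<integral>\<^sup>+z. ennreal (1 / pi) * indicator A z \<partial>lebesgue_on unit_disc)"
    unfolding disc_area_def by (rule emeasure_density) (use A' in auto)
  also have "\<dots> = ennreal (1 / pi) * emeasure (lebesgue_on unit_disc) A"
    by (rule nn_integral_cmult_indicator[OF A'])
  also have "emeasure (lebesgue_on unit_disc) A = emeasure lebesgue A"
    by (rule emeasure_restrict_space) (use A in auto)
  finally show ?thesis .
qed

lemma emeasure_complex_ball:
  "r \<ge> 0 \<Longrightarrow> emeasure lborel (ball (z::complex) r) = ennreal (pi * r\<^sup>2)"
  "r \<ge> 0 \<Longrightarrow> emeasure lborel (cball (z::complex) r) = ennreal (pi * r\<^sup>2)"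
  using emeasure_ball[of r z] emeasure_cball[of r z] by (simp_all add: unit_ball_vol_2)

lemma emeasure_disc_area_space: "emeasure disc_area unit_disc = 1"
proof -
  have "emeasure disc_area unit_disc = ennreal (1 / pi) * emeasure lebesgue unit_disc"
    by (rule emeasure_disc_area) (simp add: sets_disc_area)
  also have "emeasure lebesgue unit_disc = ennreal pi"
    using emeasure_complex_ball(1)[of 1 0] by (simp add: unit_disc_def)
  also have "ennreal (1 / pi) * ennreal pi = 1" by (simp flip: ennreal_mult)
  finally show ?thesis .
qed

lemma finite_measure_disc_area: "finite_measure disc_area"
  by (rule finite_measureI) (simp add: emeasure_disc_area_space)

text \<open>
  Rotations map null sets to null sets, so the invariance of the Borel measure extends to its completion. The
  completion matters because the weight is only assumed to be Lebesgue measurable.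
\<close>

lemma lebesgue_rotation:
  assumes c: "cmod c = 1"
  shows "(\<lambda>z. c * z) \<in> measurable lebesgue (lebesgue :: complex measure)"
    and "A \<in> sets lebesgue \<Longrightarrow> emeasure lebesgue ((\<lambda>z. c * z) -` A) = emeasure lebesgue A"
proof -
  have d: "distr lborel lborel (\<lambda>z. c * z) = (lborel :: complex measure)"
    using lborel_rotation[OF c] by (simp add: distr_def cong: distr_cong)
  show m: "(\<lambda>z. c * z) \<in> measurable lebesgue (lebesgue :: complex measure)"
  proof (rule measurableI)
    fix A :: "complex set" assume A: "A \<in> sets lebesgue"
    then obtain S N N' where A': "A = S \<union> N" "N' \<in> null_sets lborel" "S \<in> sets lborel" "N \<subseteq> N'"
      by (rule sets_completionE)
    have "(\<lambda>z. c * z) -` S \<in> sets borel" using measurable_sets[of "\<lambda>z. c * z" borel borel S] A' by auto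
    moreover have "(\<lambda>z. c * z) -` N' \<in> null_sets lborel"
    proof -
      have b: "(\<lambda>z. c * z) -` N' \<in> sets borel" using measurable_sets[of "\<lambda>z. c * z" borel borel N'] A' by auto
      have "emeasure lborel ((\<lambda>z. c * z) -` N') = emeasure (distr lborel lborel (\<lambda>z. c * z)) N'"
        using A' by (subst emeasure_distr) auto
      also have "\<dots> = 0" using A' unfolding d by auto
      finally show ?thesis using b by auto
    qed
    ultimately show "(\<lambda>z. c * z) -` A \<inter> space lebesgue \<in> sets lebesgue"
      using A' by (intro sets_completionI[of _ "(\<lambda>z. c * z) -` S" "(\<lambda>z. c * z) -` N" "(\<lambda>z. c * z) -` N'"]) auto
  qed simp
  have m': "(\<lambda>z. c * z) \<in> measurable lborel lborel" by simp
  have d2: "distr lebesgue lborel (\<lambda>z. c * z) = (lborel :: complex measure)"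
    using distr_completion[OF m'] d by simp
  have "completion (distr lebesgue lborel (\<lambda>z. c * z)) = distr lebesgue (completion lborel) (\<lambda>z. c * z)"
    by (rule completion.completion_distr_eq) (auto simp: d2 intro: measurable_completion)
  then have "distr lebesgue lebesgue (\<lambda>z. c * z) = (lebesgue :: complex measure)" unfolding d2 by simp
  then show "A \<in> sets lebesgue \<Longrightarrow> emeasure lebesgue ((\<lambda>z. c * z) -` A) = emeasure lebesgue A"
    using m emeasure_distr[OF m, of A] by simp
qed

lemma disc_area_rotation:
  assumes c: "cmod c = 1"
  shows "(\<lambda>z. c * z) \<in> measurable disc_area disc_area" and "distr disc_area disc_area (\<lambda>z. c * z) = disc_area"
proof -
  have eq: "(\<lambda>z. c * z) -` A \<inter> unit_disc = (\<lambda>z. c * z) -` A" if "A \<subseteq> unit_disc" for A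
    using that c by (force simp: unit_disc_def norm_mult)
  have s: "(\<lambda>z. c * z) -` A \<in> sets lebesgue" if "A \<in> sets lebesgue" for A
    using measurable_sets[OF lebesgue_rotation(1)[OF c] that] by simp
  show m: "(\<lambda>z. c * z) \<in> measurable disc_area disc_area"
    using eq s c by (auto simp: measurable_def sets_disc_area unit_disc_iff norm_mult)
  show "distr disc_area disc_area (\<lambda>z. c * z) = disc_area"
  proof (rule measure_eqI)
    fix A assume "A \<in> sets (distr disc_area disc_area (\<lambda>z. c * z))"
    then have A: "A \<in> sets disc_area" by simp
    then have A': "A \<in> sets lebesgue" "A \<subseteq> unit_disc" by (auto simp: sets_disc_area)
    have "emeasure (distr disc_area disc_area (\<lambda>z. c * z)) A = emeasure disc_area ((\<lambda>z. c * z) -` A)"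
      using eq[OF A'(2)] by (subst emeasure_distr[OF m A]) simp
    also have "\<dots> = emeasure disc_area A"
    proof -
      have "(\<lambda>z. c * z) -` A \<in> sets disc_area"
        using eq[OF A'(2)] s[OF A'(1)] by (auto simp: sets_disc_area)
      from emeasure_disc_area[OF this] emeasure_disc_area[OF A] lebesgue_rotation(2)[OF c A'(1)]
      show ?thesis by simp
    qed
    finally show "emeasure (distr disc_area disc_area (\<lambda>z. c * z)) A = emeasure disc_area A" .
  qed simp
qed

text \<open>
  Polar coordinates for radial functions: the law of \<open>|z|\<close> is determined by its tails, and the annulus
  \<open>y < |z| < 1\<close> has normalised area \<open>1 - y\<^sup>2\<close>.
\<close>

lemma disc_area_polar:
  "distr disc_area borel cmod = density lborel (\<lambda>r. ennreal (2 * r) * indicator {0..<1} r)"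
proof (rule measure_eqI_lessThan)
  have cm: "cmod \<in> borel_measurable disc_area" by (intro borel_measurable_disc_area_borel) simp
  fix x :: real
  have M: "emeasure (distr disc_area borel cmod) {x<..} = emeasure disc_area {z\<in>unit_disc. x < cmod z}"
    by (subst emeasure_distr[OF cm]) (auto intro!: arg_cong[where f="emeasure disc_area"])
  also have "\<dots> \<le> emeasure disc_area (space disc_area)" by (rule emeasure_space)
  finally show "emeasure (distr disc_area borel cmod) {x<..} < \<infinity>"
    using emeasure_disc_area_space by (simp add: le_less_trans)
  \<comment> \<open>Clamping \<open>x\<close> to \<open>[0, 1]\<close> treats all tails at once.\<close>
  define y where "y = min 1 (max 0 x)"
  have y: "0 \<le> y" "y \<le> 1" by (auto simp: y_def)
  have D: "emeasure disc_area {z\<in>unit_disc. x < cmod z} = ennreal (1 - y\<^sup>2)"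
  proof -
    have s: "{z\<in>unit_disc. x < cmod z} \<in> sets borel" by measurable
    have ae: "emeasure lborel {z\<in>unit_disc. x < cmod z} = ennreal (pi - pi * y\<^sup>2)"
    proof -
      have "emeasure lborel {z\<in>unit_disc. x < cmod z} = emeasure lborel (ball (0::complex) 1 - (if x < 0 then {} else ball 0 1 \<inter> cball 0 y))"
        by (rule arg_cong[where f="emeasure lborel"]) (auto simp: unit_disc_iff y_def intro: less_le_trans[OF _ norm_ge_zero])
      also have "\<dots> = emeasure lborel (ball (0::complex) 1) - emeasure lborel (if x < 0 then {} else ball (0::complex) 1 \<inter> cball 0 y)"
        by (rule emeasure_Diff) (use emeasure_bounded_finite[of "ball (0::complex) 1 \<inter> cball 0 y"] in \<open>auto simp: bounded_Int\<close>)
      also have "emeasure lborel (if x < 0 then {} else ball (0::complex) 1 \<inter> cball 0 y) = ennreal (pi * y\<^sup>2)"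
      proof (cases "x < 0")
        case True then show ?thesis by (simp add: y_def)
      next
        case False
        show ?thesis
        proof (cases "y < 1")
          case True
          then have "ball (0::complex) 1 \<inter> cball 0 y = cball 0 y" by auto
          then show ?thesis using False emeasure_complex_ball(2)[OF y(1), of 0] by simp
        next
          case f: False
          then have "y = 1" using y by simp
          moreover have "ball (0::complex) 1 \<inter> cball 0 1 = ball 0 1" by auto
          ultimately show ?thesis using False emeasure_complex_ball(1)[of 1 0] by simp
        qed
      qed
      also have "emeasure lborel (ball (0::complex) 1) = ennreal pi" using emeasure_complex_ball(1)[of 1 0] by simp
      also have "ennreal pi - ennreal (pi * y\<^sup>2) = ennreal (pi - pi * y\<^sup>2)" by (rule ennreal_minus) simp
      finally show ?thesis .
    qed
    have "emeasure disc_area {z\<in>unit_disc. x < cmod z} = ennreal (1 / pi) * emeasure lebesgue {z\<in>unit_disc. x < cmod z}"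
      by (rule emeasure_disc_area) (use s in \<open>auto simp: sets_disc_area\<close>)
    also have "emeasure lebesgue {z\<in>unit_disc. x < cmod z} = ennreal (pi - pi * y\<^sup>2)" using ae s by simp
    also have "ennreal (1 / pi) * ennreal (pi - pi * y\<^sup>2) = ennreal (1 - y\<^sup>2)"
      using y by (subst ennreal_mult[symmetric]) (auto simp: field_simps power_le_one)
    finally show ?thesis .
  qed
  have "emeasure (density lborel (\<lambda>r. ennreal (2 * r) * indicator {0..<1} r)) {x<..} =
     (\<integral>\<^sup>+r. ennreal (2 * r) * indicator {0..<1} r * indicator {x<..} r \<partial>lborel)"
    by (rule emeasure_density) auto
  also have "\<dots> = (\<integral>\<^sup>+r. ennreal (2 * r) * indicator {y..1} r \<partial>lborel)"
  proof (rule nn_integral_cong_AE)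
    have "AE r in lborel. r \<noteq> 1 \<and> r \<noteq> x \<and> r \<noteq> 0 \<and> r \<noteq> y"
      using AE_lborel_singleton[of 1] AE_lborel_singleton[of x] AE_lborel_singleton[of 0] AE_lborel_singleton[of y] by eventually_elim auto
    then show "AE r in lborel. ennreal (2 * r) * indicator {0..<1} r * indicator {x<..} r = ennreal (2 * r) * indicator {y..1} r"
      by eventually_elim (auto simp: indicator_def y_def)
  qed
  also have "\<dots> = ennreal (1\<^sup>2 - y\<^sup>2)"
    by (rule nn_integral_FTC_Icc[where F="\<lambda>r. r\<^sup>2"]) (use y in \<open>auto intro!: derivative_eq_intros\<close>)
  finally show "emeasure (distr disc_area borel cmod) {x<..} = emeasure (density lborel (\<lambda>r. ennreal (2 * r) * indicator {0..<1} r)) {x<..}"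
    using M D by simp
qed auto

lemma nn_integral_disc_area_radial:
  assumes [measurable]: "F \<in> borel_measurable borel"
  shows "(\<integral>\<^sup>+z. F (cmod z) \<partial>disc_area) = (\<integral>\<^sup>+r. F r * ennreal (2 * r) * indicator {0..<1} r \<partial>lborel)"
proof -
  have cm: "cmod \<in> borel_measurable disc_area" by (intro borel_measurable_disc_area_borel) simp
  have "(\<integral>\<^sup>+z. F (cmod z) \<partial>disc_area) = (\<integral>\<^sup>+r. F r \<partial>distr disc_area borel cmod)"
    by (rule nn_integral_distr[symmetric]) (use cm in auto)
  also have "\<dots> = (\<integral>\<^sup>+r. ennreal (2 * r) * indicator {0..<1} r * F r \<partial>lborel)"
    unfolding disc_area_polar by (rule nn_integral_density) auto
  finally show ?thesis by (simp add: mult_ac)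
qed

section \<open>Parseval's formula for radial weights\<close>

text \<open>
  A rotation by \<open>c\<close> leaves the measure and the weight unchanged and multiplies the integrand by \<open>c\<close> to the
  power \<open>n - m\<close>. The angle \<open>pi / (n - m)\<close> makes this factor \<open>-1\<close>, so the integral equals its negative.
\<close>

lemma radial_monomials_orthogonal:
  fixes u :: "complex \<Rightarrow> real"
  assumes u: "integrable disc_area u" and rad: "\<And>z. z \<in> unit_disc \<Longrightarrow> u z = u (complex_of_real (cmod z))"
    and nm: "n \<noteq> m"
  shows "(\<integral>z. z ^ n * cnj z ^ m * of_real (u z) \<partial>disc_area) = 0"
proof -
  define \<theta> where "\<theta> = pi / (real n - real m)"
  define c where "c = cis \<theta>"
  have c: "cmod c = 1" by (simp add: c_def)
  have um[measurable]: "u \<in> borel_measurable disc_area" using u by auto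
  have idm[measurable]: "(\<lambda>z. z) \<in> borel_measurable disc_area" "cnj \<in> borel_measurable disc_area"
    by (auto intro!: borel_measurable_disc_area_continuous continuous_intros)
  let ?F = "\<lambda>z. z ^ n * cnj z ^ m * complex_of_real (u z)"
  have "(\<integral>z. ?F z \<partial>disc_area) = (\<integral>z. ?F z \<partial>distr disc_area disc_area (\<lambda>z. c * z))"
    using disc_area_rotation(2)[OF c] by simp
  also have "\<dots> = (\<integral>z. ?F (c * z) \<partial>disc_area)"
    by (rule integral_distr) (use disc_area_rotation(1)[OF c] in measurable)
  also have "\<dots> = (\<integral>z. - ?F z \<partial>disc_area)"
  proof (rule Bochner_Integration.integral_cong[OF refl])
    fix z assume "z \<in> space disc_area"
    then have z: "z \<in> unit_disc" "c * z \<in> unit_disc" using c by (auto simp: unit_disc_iff norm_mult)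
    have "u (c * z) = u z" using rad[OF z(1)] rad[OF z(2)] c by (simp add: norm_mult)
    moreover have "c ^ n * cnj c ^ m = -1"
    proof -
      have "c ^ n * cnj c ^ m = cis (real n * \<theta>) * cis (- (real m * \<theta>))"
        using Complex.DeMoivre[of \<theta> n] Complex.DeMoivre[of "- \<theta>" m] by (simp add: c_def cis_cnj)
      also have "\<dots> = cis ((real n - real m) * \<theta>)" by (simp add: cis_mult algebra_simps)
      also have "(real n - real m) * \<theta> = pi" using nm by (simp add: \<theta>_def)
      finally show ?thesis by simp
    qed
    moreover have "?F (c * z) = (c ^ n * cnj c ^ m) * (z ^ n * cnj z ^ m * complex_of_real (u (c * z)))"
      by (simp add: power_mult_distrib mult_ac)
    ultimately show "?F (c * z) = - ?F z" by simp
  qed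
  also have "\<dots> = - (\<integral>z. ?F z \<partial>disc_area)" by simp
  finally show ?thesis by (simp add: equal_neg_zero)
qed

lemma integrable_disc_area_bounded_mult:
  fixes u :: "complex \<Rightarrow> real" and f :: "complex \<Rightarrow> 'b::{real_normed_field,banach,second_countable_topology}"
  assumes u: "integrable disc_area u" and f: "f \<in> borel_measurable disc_area"
    and B: "\<And>z. z \<in> unit_disc \<Longrightarrow> norm (f z) \<le> B"
  shows "integrable disc_area (\<lambda>z. f z * of_real (u z))"
proof (rule Bochner_Integration.integrable_bound)
  show "integrable disc_area (\<lambda>z. B * u z)" using u by simp
  show "(\<lambda>z. f z * of_real (u z)) \<in> borel_measurable disc_area"
    using f borel_measurable_integrable[OF u] by measurable
  show "AE z in disc_area. norm (f z * of_real (u z)) \<le> norm (B * u z)"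
    by (rule AE_I2) (use B in \<open>auto simp: norm_mult abs_mult intro!: mult_right_mono order_trans[OF B abs_ge_self]\<close>)
qed

lemma parseval_polynomial:
  fixes u :: "complex \<Rightarrow> real" and a :: "nat \<Rightarrow> complex"
  assumes u: "integrable disc_area u" and rad: "\<And>z. z \<in> unit_disc \<Longrightarrow> u z = u (complex_of_real (cmod z))"
  shows "(\<integral>z. (cmod (\<Sum>n<M. a n * z ^ n))\<^sup>2 * u z \<partial>disc_area) = (\<Sum>n<M. (cmod (a n))\<^sup>2 * (\<integral>z. cmod z ^ (2 * n) * u z \<partial>disc_area))"
proof -
  have int: "integrable disc_area (\<lambda>z. (a n * cnj (a m)) * (z ^ n * cnj z ^ m * of_real (u z)))" for n m
  proof -
    have "integrable disc_area (\<lambda>z. z ^ n * cnj z ^ m * of_real (u z))"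
    proof (rule integrable_disc_area_bounded_mult[OF u, of _ 1])
      show "(\<lambda>z. z ^ n * cnj z ^ m) \<in> borel_measurable disc_area"
        by (intro borel_measurable_disc_area_continuous continuous_intros)
      fix z :: complex assume "z \<in> unit_disc"
      then show "norm (z ^ n * cnj z ^ m) \<le> 1"
        by (simp add: norm_mult norm_power unit_disc_iff mult_le_one power_le_one)
    qed
    then show ?thesis by simp
  qed
  have "complex_of_real (\<integral>z. (cmod (\<Sum>n<M. a n * z ^ n))\<^sup>2 * u z \<partial>disc_area) =
     (\<integral>z. of_real ((cmod (\<Sum>n<M. a n * z ^ n))\<^sup>2 * u z) \<partial>disc_area)"
    by (rule integral_complex_of_real[symmetric])
  also have "\<dots> = (\<integral>z. (\<Sum>n<M. \<Sum>m<M. (a n * cnj (a m)) * (z ^ n * cnj z ^ m * of_real (u z))) \<partial>disc_area)"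
    by (intro Bochner_Integration.integral_cong refl, simp only: of_real_mult complex_norm_square cnj_sum sum_product)
       (simp add: sum_distrib_left mult_ac)
  also have "\<dots> = (\<Sum>n<M. \<Sum>m<M. (\<integral>z. (a n * cnj (a m)) * (z ^ n * cnj z ^ m * of_real (u z)) \<partial>disc_area))"
    by (subst Bochner_Integration.integral_sum, intro Bochner_Integration.integrable_sum int,
        intro sum.cong refl Bochner_Integration.integral_sum int)
  also have "\<dots> = (\<Sum>n<M. \<Sum>m<M. if m = n then of_real ((cmod (a n))\<^sup>2 * (\<integral>z. cmod z ^ (2 * n) * u z \<partial>disc_area)) else 0)"
  proof (intro sum.cong refl)
    fix n m
    show "(\<integral>z. (a n * cnj (a m)) * (z ^ n * cnj z ^ m * of_real (u z)) \<partial>disc_area) =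
      (if m = n then of_real ((cmod (a n))\<^sup>2 * (\<integral>z. cmod z ^ (2 * n) * u z \<partial>disc_area)) else 0)"
    proof (cases "m = n")
      case True
      have "(\<integral>z. (a n * cnj (a n)) * (z ^ n * cnj z ^ n * of_real (u z)) \<partial>disc_area) =
         (a n * cnj (a n)) * (\<integral>z. of_real (cmod z ^ (2 * n) * u z) \<partial>disc_area)"
      proof -
        have "z ^ n * cnj z ^ n = of_real (cmod z ^ (2 * n))" for z
          by (simp add: power_mult_distrib[symmetric] complex_norm_square[symmetric] power_mult)
        then show ?thesis by simp
      qed
      also have "\<dots> = of_real ((cmod (a n))\<^sup>2 * (\<integral>z. cmod z ^ (2 * n) * u z \<partial>disc_area))"
        unfolding integral_complex_of_real by (simp only: of_real_mult complex_norm_square)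
      finally show ?thesis using True by simp
    next
      case False
      then show ?thesis using radial_monomials_orthogonal[OF u rad, of n m] by simp
    qed
  qed
  also have "\<dots> = of_real (\<Sum>n<M. (cmod (a n))\<^sup>2 * (\<integral>z. cmod z ^ (2 * n) * u z \<partial>disc_area))"
    by (simp add: sum.delta)
  finally show ?thesis by (simp only: of_real_eq_iff)
qed

lemma powser_disc_summable:
  assumes g: "\<And>z. z \<in> unit_disc \<Longrightarrow> (\<lambda>n. a n * z ^ n) sums g z" and r: "0 \<le> r" "r < 1"
  shows "summable (\<lambda>n. cmod (a n) * r ^ n)"
proof -
  obtain s where s: "r < s" "s < 1" using dense[OF r(2)] by blast
  have "summable (\<lambda>n. a n * complex_of_real s ^ n)"
    using g[of "of_real s"] s r by (auto simp: unit_disc_iff sums_iff)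
  then have "summable (\<lambda>n. norm (a n * complex_of_real r ^ n))"
    by (rule powser_insidea) (use s r in auto)
  then show ?thesis using r by (simp add: norm_mult norm_power)
qed

lemma powser_disc_continuous:
  assumes g: "\<And>z. z \<in> unit_disc \<Longrightarrow> (\<lambda>n. a n * z ^ n) sums g z"
  shows "g holomorphic_on unit_disc" "continuous_on unit_disc g" "g \<in> borel_measurable disc_area"
proof -
  show h: "g holomorphic_on unit_disc"
    unfolding unit_disc_def by (rule power_series_holomorphic[where a=a]) (use g in \<open>auto simp: unit_disc_def\<close>)
  then show "continuous_on unit_disc g" by (rule holomorphic_on_imp_continuous_on)
  then show "g \<in> borel_measurable disc_area" by (rule borel_measurable_disc_area_continuous)
qed

text \<open>
  On a disc of radius less than \<open>1\<close> the power series converges uniformly, and the formula for polynomials passes to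
  the limit by dominated convergence. Exhausting the unit disc by such discs gives the general case by
  monotone convergence; both sides may be infinite.
\<close>

theorem parseval_radial:
  fixes u :: "complex \<Rightarrow> real" and a :: "nat \<Rightarrow> complex"
  assumes u: "integrable disc_area u" and rad: "\<And>z. z \<in> unit_disc \<Longrightarrow> u z = u (complex_of_real (cmod z))"
    and nn: "\<And>z. z \<in> unit_disc \<Longrightarrow> 0 \<le> u z"
    and g: "\<And>z. z \<in> unit_disc \<Longrightarrow> (\<lambda>n. a n * z ^ n) sums g z"
  shows "(\<integral>\<^sup>+z. ennreal ((cmod (g z))\<^sup>2 * u z) \<partial>disc_area) =
    (\<Sum>n. ennreal ((cmod (a n))\<^sup>2) * (\<integral>\<^sup>+z. ennreal (cmod z ^ (2 * n) * u z) \<partial>disc_area))"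
proof -
  have um[measurable]: "u \<in> borel_measurable disc_area" using u by auto
  have gm[measurable]: "g \<in> borel_measurable disc_area" by (rule powser_disc_continuous(3)[OF g])
  have cm[measurable]: "cmod \<in> borel_measurable disc_area" "(\<lambda>z. z) \<in> borel_measurable disc_area"
    by (auto intro: borel_measurable_disc_area_borel)
  define \<rho> where "\<rho> k = 1 - 1 / (real k + 1)" for k :: nat
  \<comment> \<open>The cut-off weights \<open>u * I k\<close> are radial again, so the formula for polynomials applies to them.\<close>
  define I where "I k z = (indicator (cball 0 (\<rho> k)) z :: real)" for k and z :: complex
  have Im[measurable]: "I k \<in> borel_measurable disc_area" for k
    unfolding I_def by (intro borel_measurable_disc_area_borel borel_measurable_indicator) simp
  have \<rho>: "0 \<le> \<rho> k" "\<rho> k < 1" for k by (auto simp: \<rho>_def divide_simps)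
  have \<rho>_mono: "\<rho> k \<le> \<rho> l" if "k \<le> l" for k l using that by (simp add: \<rho>_def frac_le)
  have I01: "I k z = 0 \<or> I k z = 1" for k z by (auto simp: I_def indicator_def)
  have step: "(\<integral>\<^sup>+z. ennreal ((cmod (g z))\<^sup>2 * (u z * I k z)) \<partial>disc_area) =
    (\<Sum>n. ennreal ((cmod (a n))\<^sup>2) * (\<integral>\<^sup>+z. ennreal (cmod z ^ (2 * n) * (u z * I k z)) \<partial>disc_area))" for k
  proof -
    define v where "v z = u z * I k z" for z
    have v: "integrable disc_area v"
      unfolding v_def
      using integrable_disc_area_bounded_mult[OF u, of "I k" 1] I01 by (force simp: mult.commute I_def)
    note vm[measurable] = borel_measurable_integrable[OF v]
    have radv: "v z = v (complex_of_real (cmod z))" if "z \<in> unit_disc" for z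
      using rad[OF that] by (simp add: v_def I_def indicator_def)
    have nnv: "0 \<le> v z" if "z \<in> unit_disc" for z using nn[OF that] I01[of k z] by (auto simp: v_def)
    define B where "B = (\<Sum>n. cmod (a n) * \<rho> k ^ n)"
    have summ: "summable (\<lambda>n. cmod (a n) * \<rho> k ^ n)" by (rule powser_disc_summable[OF g \<rho>])
    have Bd: "cmod (\<Sum>n<M. a n * z ^ n) \<le> B" if "cmod z \<le> \<rho> k" for M z
    proof -
      have "cmod (\<Sum>n<M. a n * z ^ n) \<le> (\<Sum>n<M. cmod (a n) * \<rho> k ^ n)"
        by (rule sum_norm_le) (use that in \<open>auto simp: norm_mult norm_power intro!: mult_left_mono power_mono\<close>)
      also have "\<dots> \<le> B" unfolding B_def by (rule sum_le_suminf[OF summ]) (use \<rho> in auto)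
      finally show ?thesis .
    qed
    have vz: "v z = 0" if "\<not> cmod z \<le> \<rho> k" for z using that by (simp add: v_def I_def)
    have lim: "(\<lambda>M. \<integral>z. (cmod (\<Sum>n<M. a n * z ^ n))\<^sup>2 * v z \<partial>disc_area) \<longlonglongrightarrow> (\<integral>z. (cmod (g z))\<^sup>2 * v z \<partial>disc_area)"
    proof (rule integral_dominated_convergence[where w="\<lambda>z. B\<^sup>2 * v z"])
      show "AE z in disc_area. (\<lambda>M. (cmod (\<Sum>n<M. a n * z ^ n))\<^sup>2 * v z) \<longlonglongrightarrow> (cmod (g z))\<^sup>2 * v z"
        by (rule AE_I2) (use g in \<open>auto intro!: tendsto_intros simp: sums_def\<close>)
      show "AE z in disc_area. norm ((cmod (\<Sum>n<M. a n * z ^ n))\<^sup>2 * v z) \<le> B\<^sup>2 * v z" for M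
      proof (rule AE_I2)
        fix z assume z: "z \<in> space disc_area"
        show "norm ((cmod (\<Sum>n<M. a n * z ^ n))\<^sup>2 * v z) \<le> B\<^sup>2 * v z"
          using Bd[of z M] vz[of z] nnv[of z] z by (cases "cmod z \<le> \<rho> k") (auto intro!: mult_right_mono power_mono)
      qed
    qed (use v in auto)
    have int: "integrable disc_area (\<lambda>z. (cmod (g z))\<^sup>2 * v z)"
    proof (rule Bochner_Integration.integrable_bound[where f="\<lambda>z. B\<^sup>2 * v z"])
      show "AE z in disc_area. norm ((cmod (g z))\<^sup>2 * v z) \<le> norm (B\<^sup>2 * v z)"
      proof (rule AE_I2)
        fix z assume z: "z \<in> space disc_area"
        have "cmod (g z) \<le> B" if "cmod z \<le> \<rho> k"
        proof (rule LIMSEQ_le_const2)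
          show "(\<lambda>M. cmod (\<Sum>n<M. a n * z ^ n)) \<longlonglongrightarrow> cmod (g z)"
            using g[of z] z by (auto simp: sums_def intro!: tendsto_intros)
        qed (use Bd[OF that] in auto)
        then show "norm ((cmod (g z))\<^sup>2 * v z) \<le> norm (B\<^sup>2 * v z)"
          using vz[of z] nnv[of z] z by (cases "cmod z \<le> \<rho> k") (auto intro!: mult_right_mono power_mono)
      qed
    qed (use v in auto)
    have intn: "integrable disc_area (\<lambda>z. cmod z ^ (2 * n) * v z)" for n
      using integrable_disc_area_bounded_mult[OF v, of "\<lambda>z. cmod z ^ (2 * n)" 1]
      by (auto simp: unit_disc_iff power_le_one)
    have mom: "(\<integral>\<^sup>+z. ennreal (cmod z ^ (2 * n) * v z) \<partial>disc_area) = ennreal (\<integral>z. cmod z ^ (2 * n) * v z \<partial>disc_area)" for n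
      by (rule nn_integral_eq_integral[OF intn]) (use nnv in auto)
    have mnn: "0 \<le> (\<integral>z. cmod z ^ (2 * n) * v z \<partial>disc_area)" for n
      by (rule Bochner_Integration.integral_nonneg) (use nnv in auto)
    have "(\<lambda>n. (cmod (a n))\<^sup>2 * (\<integral>z. cmod z ^ (2 * n) * v z \<partial>disc_area)) sums (\<integral>z. (cmod (g z))\<^sup>2 * v z \<partial>disc_area)"
      unfolding sums_def using lim by (simp add: parseval_polynomial[OF v radv])
    then have "(\<Sum>n. ennreal ((cmod (a n))\<^sup>2 * (\<integral>z. cmod z ^ (2 * n) * v z \<partial>disc_area))) = ennreal (\<integral>z. (cmod (g z))\<^sup>2 * v z \<partial>disc_area)"
      by (intro suminf_ennreal_eq) (use mnn in auto)
    moreover have "(\<integral>\<^sup>+z. ennreal ((cmod (g z))\<^sup>2 * v z) \<partial>disc_area) = ennreal (\<integral>z. (cmod (g z))\<^sup>2 * v z \<partial>disc_area)"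
      by (rule nn_integral_eq_integral[OF int]) (use nnv in auto)
    ultimately show ?thesis
      unfolding v_def[symmetric] mom by (simp add: ennreal_mult mnn)
  qed
  have I_inc: "I k z \<le> I l z" if "k \<le> l" for k l z
    using \<rho>_mono[OF that] by (auto simp: I_def indicator_def)
  have mc: "(\<integral>\<^sup>+z. ennreal (f z * u z) \<partial>disc_area) = (SUP k. \<integral>\<^sup>+z. ennreal (f z * (u z * I k z)) \<partial>disc_area)"
    if f[measurable]: "f \<in> borel_measurable disc_area" and fnn: "\<And>z. 0 \<le> f z" for f :: "complex \<Rightarrow> real"
  proof -
    have mono: "ennreal (f z * (u z * I k z)) \<le> ennreal (f z * (u z * I l z))" if "k \<le> l" "z \<in> unit_disc" for k l z
      using I_inc[OF that(1), of z] nn[OF that(2)] fnn[of z] by (intro ennreal_leI mult_left_mono) auto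
    have "(SUP k. \<integral>\<^sup>+z. ennreal (f z * (u z * I k z)) \<partial>disc_area) = (\<integral>\<^sup>+z. (SUP k. ennreal (f z * (u z * I k z))) \<partial>disc_area)"
      by (rule nn_integral_monotone_convergence_SUP_AE[symmetric]) (use mono in \<open>auto intro!: AE_I2\<close>)
    also have "\<dots> = (\<integral>\<^sup>+z. ennreal (f z * u z) \<partial>disc_area)"
    proof (rule nn_integral_cong)
      fix z assume z: "z \<in> space disc_area"
      have "\<exists>k. cmod z \<le> \<rho> k"
      proof -
        obtain k :: nat where k: "1 / (1 - cmod z) < real k" using reals_Archimedean2 by blast
        have "1 / (real k + 1) \<le> 1 - cmod z"
        proof -
          have "0 < 1 - cmod z" using z by (simp add: unit_disc_iff)
          then have "1 < real k * (1 - cmod z)" using k by (simp add: divide_simps)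
          then show ?thesis using \<open>0 < 1 - cmod z\<close> by (simp add: divide_simps algebra_simps)
        qed
        then show ?thesis by (auto simp: \<rho>_def intro!: exI[of _ k])
      qed
      then obtain k where "cmod z \<le> \<rho> k" by blast
      then have k: "I k z = 1" by (simp add: I_def)
      show "(SUP k. ennreal (f z * (u z * I k z))) = ennreal (f z * u z)"
      proof (rule antisym)
        show "(SUP k. ennreal (f z * (u z * I k z))) \<le> ennreal (f z * u z)"
        proof (rule SUP_least)
          fix l show "ennreal (f z * (u z * I l z)) \<le> ennreal (f z * u z)"
            using I01[of l z] z nn[of z] fnn[of z] by (auto intro!: ennreal_leI)
        qed
        show "ennreal (f z * u z) \<le> (SUP k. ennreal (f z * (u z * I k z)))"
          by (rule SUP_upper2[of k]) (use k in auto)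
      qed
    qed
    finally show ?thesis by simp
  qed
  have inc: "incseq (\<lambda>k. \<integral>\<^sup>+z. ennreal (f z * (u z * I k z)) \<partial>disc_area)" if "\<And>z. 0 \<le> f z" for f
    using I_inc nn that by (auto simp: incseq_def intro!: nn_integral_mono ennreal_leI mult_left_mono)
  have "(\<integral>\<^sup>+z. ennreal ((cmod (g z))\<^sup>2 * u z) \<partial>disc_area) = (SUP k. \<integral>\<^sup>+z. ennreal ((cmod (g z))\<^sup>2 * (u z * I k z)) \<partial>disc_area)"
    by (rule mc) auto
  also have "\<dots> = (SUP k. \<Sum>n. ennreal ((cmod (a n))\<^sup>2) * (\<integral>\<^sup>+z. ennreal (cmod z ^ (2 * n) * (u z * I k z)) \<partial>disc_area))"
    unfolding step ..
  also have "\<dots> = (\<Sum>n. SUP k. ennreal ((cmod (a n))\<^sup>2) * (\<integral>\<^sup>+z. ennreal (cmod z ^ (2 * n) * (u z * I k z)) \<partial>disc_area))"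
    by (rule ennreal_suminf_SUP_eq[symmetric])
       (use inc[of "\<lambda>z. cmod z ^ (2 * _)"] in \<open>auto simp: incseq_def intro!: mult_left_mono\<close>)
  also have "\<dots> = (\<Sum>n. ennreal ((cmod (a n))\<^sup>2) * (SUP k. \<integral>\<^sup>+z. ennreal (cmod z ^ (2 * n) * (u z * I k z)) \<partial>disc_area))"
    by (simp add: SUP_mult_left_ennreal)
  also have "\<dots> = (\<Sum>n. ennreal ((cmod (a n))\<^sup>2) * (\<integral>\<^sup>+z. ennreal (cmod z ^ (2 * n) * u z) \<partial>disc_area))"
    by (subst mc) auto
  finally show ?thesis .
qed

section \<open>Local bounds for Taylor coefficients\<close>

lemma nn_integral_cmod_power:
  "(\<integral>\<^sup>+z. ennreal (cmod z ^ (2 * n)) \<partial>disc_area) = ennreal (1 / (real n + 1))"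
proof -
  have "(\<integral>\<^sup>+z. ennreal (cmod z ^ (2 * n)) \<partial>disc_area) = (\<integral>\<^sup>+r. ennreal (r ^ (2 * n)) * ennreal (2 * r) * indicator {0..<1} r \<partial>lborel)"
    by (rule nn_integral_disc_area_radial[where F="\<lambda>r. ennreal (r ^ (2 * n))"]) measurable
  also have "\<dots> = (\<integral>\<^sup>+r. ennreal (2 * r ^ (2 * n + 1)) * indicator {0..1} r \<partial>lborel)"
  proof (rule nn_integral_cong_AE)
    show "AE r in lborel. ennreal (r ^ (2 * n)) * ennreal (2 * r) * indicator {0..<1} r = ennreal (2 * r ^ (2 * n + 1)) * indicator {0..1} r"
      using AE_lborel_singleton[of "1::real"] by eventually_elim (auto simp: indicator_def ennreal_mult[symmetric] mult_ac)
  qed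
  also have "\<dots> = ennreal (1 ^ (2 * n + 2) / (real n + 1) - 0 ^ (2 * n + 2) / (real n + 1))"
  proof (rule nn_integral_FTC_Icc[where F="\<lambda>r. r ^ (2 * n + 2) / (real n + 1)"])
    fix r :: real assume "r \<in> {0..1}"
    show "((\<lambda>r. r ^ (2 * n + 2) / (real n + 1)) has_real_derivative 2 * r ^ (2 * n + 1)) (at r)"
      by (rule DERIV_cong[OF DERIV_cdivide[OF DERIV_pow[of "2 * n + 2" r]]]) (simp add: divide_simps algebra_simps)
  qed auto
  finally show ?thesis by simp
qed

lemma nn_integral_lborel_affine:
  fixes F :: "complex \<Rightarrow> ennreal"
  assumes [measurable]: "F \<in> borel_measurable borel" and \<rho>: "0 < \<rho>"
  shows "(\<integral>\<^sup>+z. F (w + \<rho> *\<^sub>R z) \<partial>lborel) = ennreal (1 / \<rho>\<^sup>2) * (\<integral>\<^sup>+z. F z \<partial>lborel)"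
proof -
  have "(\<integral>\<^sup>+z. F z \<partial>lborel) = (\<integral>\<^sup>+z. F z \<partial>density (distr lborel borel (\<lambda>x. w + \<rho> *\<^sub>R x)) (\<lambda>_. ennreal (\<bar>\<rho>\<bar> ^ DIM(complex))))"
    using lborel_affine[of \<rho> w] \<rho> by (simp add: ennreal_power)
  also have "\<dots> = (\<integral>\<^sup>+z. ennreal (\<rho>\<^sup>2) * F (w + \<rho> *\<^sub>R z) \<partial>lborel)"
    using \<rho> by (simp add: nn_integral_density nn_integral_distr)
  also have "\<dots> = ennreal (\<rho>\<^sup>2) * (\<integral>\<^sup>+z. F (w + \<rho> *\<^sub>R z) \<partial>lborel)"
    by (rule nn_integral_cmult) measurable
  finally show ?thesis using \<rho> by (simp add: mult.assoc[symmetric] ennreal_mult[symmetric])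
qed

lemma disc_average:
  fixes F :: "complex \<Rightarrow> ennreal"
  assumes F[measurable]: "F \<in> borel_measurable borel" and \<rho>: "0 < \<rho>" and sub: "ball w \<rho> \<subseteq> unit_disc"
  shows "(\<integral>\<^sup>+z. F (w + \<rho> *\<^sub>R z) \<partial>disc_area) = ennreal (1 / \<rho>\<^sup>2) * (\<integral>\<^sup>+z. F z * indicator (ball w \<rho>) z \<partial>disc_area)"
proof -
  have [measurable]: "ball w \<rho> \<in> sets borel" by simp
  have eq: "indicator unit_disc z = (indicator (ball w \<rho>) (w + \<rho> *\<^sub>R z) :: ennreal)" for z
    using \<rho> by (simp add: indicator_def unit_disc_iff dist_norm norm_minus_commute)
  have "(\<integral>\<^sup>+z. F (w + \<rho> *\<^sub>R z) \<partial>disc_area) = ennreal (1 / pi) * (\<integral>\<^sup>+z. F (w + \<rho> *\<^sub>R z) * indicator unit_disc z \<partial>lborel)"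
    by (rule nn_integral_disc_area) (auto intro: borel_measurable_disc_area_borel)
  also have "(\<integral>\<^sup>+z. F (w + \<rho> *\<^sub>R z) * indicator unit_disc z \<partial>lborel) = (\<integral>\<^sup>+z. (\<lambda>x. F x * indicator (ball w \<rho>) x) (w + \<rho> *\<^sub>R z) \<partial>lborel)"
    unfolding eq ..
  also have "\<dots> = ennreal (1 / \<rho>\<^sup>2) * (\<integral>\<^sup>+z. F z * indicator (ball w \<rho>) z \<partial>lborel)"
    by (rule nn_integral_lborel_affine[OF _ \<rho>]) measurable
  also have "(\<integral>\<^sup>+z. F z * indicator (ball w \<rho>) z \<partial>lborel) = (\<integral>\<^sup>+z. (F z * indicator (ball w \<rho>) z) * indicator unit_disc z \<partial>lborel)"
    using sub by (intro nn_integral_cong) (auto simp: indicator_def)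
  finally have "(\<integral>\<^sup>+z. F (w + \<rho> *\<^sub>R z) \<partial>disc_area) = ennreal (1 / \<rho>\<^sup>2) * (ennreal (1 / pi) * (\<integral>\<^sup>+z. (F z * indicator (ball w \<rho>) z) * indicator unit_disc z \<partial>lborel))"
    by (simp add: mult_ac)
  also have "ennreal (1 / pi) * (\<integral>\<^sup>+z. (F z * indicator (ball w \<rho>) z) * indicator unit_disc z \<partial>lborel) = (\<integral>\<^sup>+z. F z * indicator (ball w \<rho>) z \<partial>disc_area)"
    by (rule nn_integral_disc_area[symmetric]) (auto intro: borel_measurable_disc_area_borel)
  finally show ?thesis .
qed

text \<open>
  Parseval's formula for the constant weight, on the disc \<open>ball w \<rho>\<close> rescaled to the unit disc, where only one term
  of the series is kept. The case \<open>n = 0\<close> is the sub-mean-value property of \<open>|f|\<^sup>2\<close>.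
\<close>

lemma taylor_coeff_L2_bound:
  assumes f: "f holomorphic_on unit_disc" and \<rho>: "0 < \<rho>" and sub: "ball w \<rho> \<subseteq> unit_disc"
  shows "ennreal ((cmod ((deriv ^^ n) f w / fact n))\<^sup>2 * \<rho> ^ (2 * n + 2) / (real n + 1)) \<le>
    (\<integral>\<^sup>+z. ennreal ((cmod (f z))\<^sup>2) * indicator (ball w \<rho>) z \<partial>disc_area)"
proof -
  define a where "a = (\<lambda>n. (deriv ^^ n) f w / fact n * of_real \<rho> ^ n)"
  define F where "F z = ennreal ((cmod (if z \<in> ball w \<rho> then f z else 0))\<^sup>2)" for z
  have hol: "f holomorphic_on ball w \<rho>" using f sub by (rule holomorphic_on_subset)
  have "(\<lambda>z. if z \<in> ball w \<rho> then f z else 0) \<in> borel_measurable borel"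
    by (intro borel_measurable_continuous_on_if continuous_on_const) (use hol in \<open>auto intro: holomorphic_on_imp_continuous_on\<close>)
  then have Fm: "F \<in> borel_measurable borel" unfolding F_def by measurable
  have inb: "w + \<rho> *\<^sub>R z \<in> ball w \<rho>" if "z \<in> unit_disc" for z
    using that \<rho> by (simp add: unit_disc_iff dist_norm)
  have g: "(\<lambda>n. a n * z ^ n) sums f (w + \<rho> *\<^sub>R z)" if "z \<in> unit_disc" for z
  proof -
    from holomorphic_power_series[OF hol inb[OF that]]
    show ?thesis by (simp add: a_def power_mult_distrib scaleR_conv_of_real mult_ac)
  qed
  have int1: "integrable disc_area (\<lambda>z. 1 :: real)"
    by (rule finite_measure.integrable_const[OF finite_measure_disc_area])
  have "ennreal ((cmod (a n))\<^sup>2) * ennreal (1 / (real n + 1)) \<le> (\<Sum>n. ennreal ((cmod (a n))\<^sup>2) * (\<integral>\<^sup>+z. ennreal (cmod z ^ (2 * n) * 1) \<partial>disc_area))"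
  proof -
    have "(\<Sum>k\<in>{n}. ennreal ((cmod (a k))\<^sup>2) * (\<integral>\<^sup>+z. ennreal (cmod z ^ (2 * k) * 1) \<partial>disc_area)) \<le> (\<Sum>n. ennreal ((cmod (a n))\<^sup>2) * (\<integral>\<^sup>+z. ennreal (cmod z ^ (2 * n) * 1) \<partial>disc_area))"
      by (rule sum_le_suminf) auto
    then show ?thesis using nn_integral_cmod_power[of n] by simp
  qed
  also have "\<dots> = (\<integral>\<^sup>+z. ennreal ((cmod (f (w + \<rho> *\<^sub>R z)))\<^sup>2 * 1) \<partial>disc_area)"
    by (rule parseval_radial[OF int1 _ _ g, symmetric]) auto
  also have "\<dots> = (\<integral>\<^sup>+z. F (w + \<rho> *\<^sub>R z) \<partial>disc_area)"
    using inb by (intro nn_integral_cong) (auto simp: F_def)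
  also have "\<dots> = ennreal (1 / \<rho>\<^sup>2) * (\<integral>\<^sup>+z. F z * indicator (ball w \<rho>) z \<partial>disc_area)"
    by (rule disc_average[OF Fm \<rho> sub])
  also have "(\<integral>\<^sup>+z. F z * indicator (ball w \<rho>) z \<partial>disc_area) = (\<integral>\<^sup>+z. ennreal ((cmod (f z))\<^sup>2) * indicator (ball w \<rho>) z \<partial>disc_area)"
    by (intro nn_integral_cong) (auto simp: F_def indicator_def)
  finally have le: "ennreal ((cmod (a n))\<^sup>2) * ennreal (1 / (real n + 1)) \<le> ennreal (1 / \<rho>\<^sup>2) * (\<integral>\<^sup>+z. ennreal ((cmod (f z))\<^sup>2) * indicator (ball w \<rho>) z \<partial>disc_area)" .
  have "ennreal ((cmod ((deriv ^^ n) f w / fact n))\<^sup>2 * \<rho> ^ (2 * n + 2) / (real n + 1)) = ennreal (\<rho>\<^sup>2) * (ennreal ((cmod (a n))\<^sup>2) * ennreal (1 / (real n + 1)))"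
    using \<rho> by (simp add: a_def norm_mult norm_power norm_divide power_mult_distrib power_mult[symmetric] ennreal_mult[symmetric] mult_ac power2_eq_square)
       (simp add: mult_2_right power_add)
  also have "\<dots> \<le> ennreal (\<rho>\<^sup>2) * (ennreal (1 / \<rho>\<^sup>2) * (\<integral>\<^sup>+z. ennreal ((cmod (f z))\<^sup>2) * indicator (ball w \<rho>) z \<partial>disc_area))"
    by (intro mult_left_mono le) simp
  also have "\<dots> = (\<integral>\<^sup>+z. ennreal ((cmod (f z))\<^sup>2) * indicator (ball w \<rho>) z \<partial>disc_area)"
    using \<rho> by (simp add: mult.assoc[symmetric] ennreal_mult[symmetric])
  finally show ?thesis .
qed

text \<open>
  On a disc of an eighth of the radius the Taylor series of \<open>f'\<close> is dominated by a geometric series of ratio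
  \<open>1/2\<close>, so each vanishing coefficient gains a factor \<open>2\<close> in \<open>|f'|\<close>. This gain is what makes finitely many linear
  conditions on \<open>f\<close> sufficient to make a composition operator small.
\<close>

lemma deriv_L2_bound_vanishing:
  assumes f: "f holomorphic_on unit_disc" and \<rho>: "0 < \<rho>" and sub: "ball w \<rho> \<subseteq> unit_disc"
    and z: "z \<in> cball w (\<rho> / 8)"
    and van: "\<And>i. i < d \<Longrightarrow> (deriv ^^ Suc i) f w = 0"
    and J: "(\<integral>\<^sup>+z. ennreal ((cmod (f z))\<^sup>2) * indicator (ball w \<rho>) z \<partial>disc_area) \<le> ennreal J" "0 \<le> J"
  shows "(cmod (deriv f z))\<^sup>2 \<le> 16 / 4 ^ d * J / \<rho> ^ 4"
proof -
  have hol: "f holomorphic_on ball w \<rho>" using f sub by (rule holomorphic_on_subset)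
  have hol': "deriv f holomorphic_on ball w \<rho>" using hol by (intro holomorphic_deriv) auto
  have zb: "z \<in> ball w \<rho>" using z \<rho> by auto
  define t where "t n = (deriv ^^ n) (deriv f) w / fact n * (z - w) ^ n" for n
  have s: "t sums deriv f z"
    unfolding t_def by (rule holomorphic_power_series[OF hol' zb])
  define K where "K = 2 * sqrt J / \<rho>\<^sup>2"
  have K: "0 \<le> K" using J by (simp add: K_def)
  have d1: "(deriv ^^ n) (deriv f) w = (deriv ^^ Suc n) f w" for n by (simp add: funpow_swap1)
  have tb: "cmod (t n) \<le> K * (1/2) ^ n" for n
  proof -
    define c where "c = cmod ((deriv ^^ Suc n) f w / fact (Suc n))"
    have "ennreal (c\<^sup>2 * \<rho> ^ (2 * Suc n + 2) / (real (Suc n) + 1)) \<le> ennreal J"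
      unfolding c_def using taylor_coeff_L2_bound[OF f \<rho> sub, of "Suc n"] J(1) by (rule order_trans)
    then have "c\<^sup>2 * \<rho> ^ (2 * Suc n + 2) / (real (Suc n) + 1) \<le> J" using J(2) by (simp add: ennreal_le_iff)
    then have "c\<^sup>2 * (\<rho> ^ (n + 2))\<^sup>2 \<le> J * (real n + 2)"
      by (simp add: divide_simps power_mult[symmetric] power_add[symmetric] algebra_simps)
    then have "(c * \<rho> ^ (n + 2))\<^sup>2 \<le> (sqrt J * sqrt (real n + 2))\<^sup>2" using J(2) by (simp add: power_mult_distrib)
    then have "c * \<rho> ^ (n + 2) \<le> sqrt J * sqrt (real n + 2)" by (rule power2_le_imp_le) (use J in simp)
    also have "\<dots> \<le> sqrt J * (real n + 2)"
      by (intro mult_left_mono real_le_lsqrt) (use J in \<open>auto simp: power2_eq_square algebra_simps\<close>)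
    finally have c1: "c * \<rho> ^ n \<le> sqrt J * (real n + 2) / \<rho>\<^sup>2"
      using \<rho> by (simp add: divide_simps power_add power2_eq_square mult_ac)
    have fact_eq: "cmod (t n) = (real n + 1) * c * cmod (z - w) ^ n"
      unfolding t_def c_def d1 by (simp add: norm_mult norm_divide norm_power divide_simps norm_of_nat del: of_nat_Suc)
    have "cmod (z - w) \<le> \<rho> / 8" using z by (simp add: dist_norm norm_minus_commute)
    then have "cmod (z - w) ^ n \<le> (\<rho> / 8) ^ n" by (rule power_mono) simp
    then have "cmod (t n) \<le> (real n + 1) * c * (\<rho> / 8) ^ n" unfolding fact_eq by (rule mult_left_mono) (simp add: c_def)
    also have "\<dots> = (real n + 1) * (c * \<rho> ^ n) / 8 ^ n" by (simp add: power_divide)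
    also have "\<dots> \<le> (real n + 1) * (sqrt J * (real n + 2) / \<rho>\<^sup>2) / 8 ^ n"
      by (intro divide_right_mono mult_left_mono c1) auto
    also have "\<dots> = (real n + 1) * (real n + 2) * (sqrt J / \<rho>\<^sup>2) / 8 ^ n" by simp
    \<comment> \<open>The polynomial factor is absorbed by \<open>4 ^ n\<close>, which leaves \<open>4 ^ n / 8 ^ n\<close>, the geometric series.\<close>
    also have "\<dots> \<le> (2 * 4 ^ n) * (sqrt J / \<rho>\<^sup>2) / 8 ^ n"
    proof (intro divide_right_mono mult_right_mono)
      show "(real n + 1) * (real n + 2) \<le> 2 * 4 ^ n"
      proof (induction n)
        case (Suc n)
        have "(real (Suc n) + 1) * (real (Suc n) + 2) \<le> 4 * ((real n + 1) * (real n + 2))"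
          by (simp add: algebra_simps)
        then show ?case using Suc by simp
      qed simp
    qed (use J in auto)
    also have "\<dots> = K * (1/2) ^ n"
    proof -
      have "(8::real) ^ n = 4 ^ n * 2 ^ n" by (simp flip: power_mult_distrib)
      then show ?thesis by (simp add: K_def field_simps)
    qed
    finally show ?thesis .
  qed
  have t0: "t n = 0" if "n < d" for n using van[OF that] by (simp add: t_def d1)
  have "(\<lambda>n. t (n + d)) sums (deriv f z - (\<Sum>i<d. t i))" by (rule sums_split_initial_segment[OF s])
  then have s': "(\<lambda>n. t (n + d)) sums deriv f z" using t0 by simp
  have g: "(\<lambda>n. K * (1/2) ^ d * (1/2) ^ n) sums (K * (1/2) ^ d * 2)"
    using sums_mult[OF geometric_sums[of "1/2::real"], of "K * (1/2) ^ d"] by simp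
  have "cmod (deriv f z) \<le> K * (1/2) ^ d * 2"
  proof -
    have "cmod (\<Sum>n. t (n + d)) \<le> (\<Sum>n. K * (1/2) ^ d * (1/2) ^ n)"
      by (rule norm_suminf_le) (use tb g in \<open>auto simp: power_add mult_ac sums_iff intro: order_trans[OF tb]\<close>)
    then show ?thesis using s' g by (simp add: sums_iff)
  qed
  then have "(cmod (deriv f z))\<^sup>2 \<le> (K * (1/2) ^ d * 2)\<^sup>2" by (rule power_mono) simp
  also have "\<dots> = 16 / 4 ^ d * J / \<rho> ^ 4"
  proof -
    have "((1/2::real) ^ d)\<^sup>2 = 1 / 4 ^ d" by (simp add: power_divide power2_eq_square flip: power_mult_distrib)
    moreover have "(sqrt J)\<^sup>2 = J" using J by simp
    moreover have "(\<rho>\<^sup>2)\<^sup>2 = \<rho> ^ 4" by (simp flip: power_mult)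
    ultimately show ?thesis by (simp add: K_def power_mult_distrib power_divide)
  qed
  finally show ?thesis .
qed

section \<open>Regular weights\<close>

locale regular_radial_weight =
  fixes \<omega> :: "complex \<Rightarrow> real"
  assumes regular: "regular_weight \<omega>"
begin

text \<open>
  The tail integral of the weight, made constant on the negative axis. It is thereby decreasing on the whole real
  line, hence Borel measurable, and the doubling property holds for every \<open>r < 1\<close>.
\<close>

definition W :: "real \<Rightarrow> real" where
  "W r = weight_hat \<omega> (complex_of_real (max 0 r))"

text \<open>
  The model for \<open>weight_star \<omega>\<close>, to which it is comparable away from the origin.
\<close>

definition \<tau> :: "complex \<Rightarrow> real" where
  "\<tau> z = (1 - cmod z) * W (cmod z)"

lemma weight_facts:
  shows omega_nonneg: "z \<in> unit_disc \<Longrightarrow> 0 \<le> \<omega> z"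
    and omega_integrable: "integrable disc_area \<omega>"
    and omega_radial: "z \<in> unit_disc \<Longrightarrow> \<omega> z = \<omega> (complex_of_real (cmod z))"
    and W_pos: "r < 1 \<Longrightarrow> 0 < W r"
  using regular by (auto simp: regular_weight_def doubling_weight_def radial_weight_def weight_def W_def)

lemma omega_measurable[measurable]: "\<omega> \<in> borel_measurable disc_area"
  using omega_integrable by auto

lemma W_eq: "0 \<le> r \<Longrightarrow> W r = (LINT s:{r..<1}|lebesgue. \<omega> (complex_of_real s))"
  by (simp add: W_def weight_hat_def)

lemma omega_line_integrable:
  assumes "0 \<le> r" shows "set_integrable lebesgue {r..<1} (\<lambda>s. \<omega> (complex_of_real s))"
proof -
  have "set_integrable lebesgue {0..<1} (\<lambda>s. \<omega> (complex_of_real s))"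
    using W_pos[of 0] W_eq[of 0] not_integrable_integral_eq unfolding set_integrable_def set_lebesgue_integral_def by fastforce
  then show ?thesis by (rule set_integrable_subset) (use assms in auto)
qed

lemma omega_line_nonneg: "0 \<le> s \<Longrightarrow> s < 1 \<Longrightarrow> 0 \<le> \<omega> (complex_of_real s)"
  by (rule omega_nonneg) (simp add: unit_disc_iff)

lemma W_eq_nn: 
  assumes r: "0 \<le> r"
  shows "ennreal (W r) = (\<integral>\<^sup>+s. ennreal (\<omega> (complex_of_real s)) * indicator {r..<1} s \<partial>lborel)"
proof -
  have "(\<integral>\<^sup>+s. ennreal (\<omega> (complex_of_real s)) * indicator {r..<1} s \<partial>lborel) = (\<integral>\<^sup>+s. ennreal (indicator {r..<1} s * \<omega> (complex_of_real s)) \<partial>lebesgue)"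
    unfolding nn_integral_completion by (intro nn_integral_cong) (auto simp: indicator_def)
  also have "\<dots> = ennreal (\<integral>s. indicator {r..<1} s * \<omega> (complex_of_real s) \<partial>lebesgue)"
    by (rule nn_integral_eq_integral)
       (use omega_line_integrable[OF r] omega_line_nonneg r in \<open>auto simp: set_integrable_def indicator_def\<close>)
  finally show ?thesis by (simp add: W_eq[OF r] set_lebesgue_integral_def)
qed

lemma W_antimono: "r \<le> s \<Longrightarrow> W s \<le> W r"
proof -
  assume rs: "r \<le> s"
  have "ennreal (W (max 0 s)) \<le> ennreal (W (max 0 r))"
    unfolding W_eq_nn[OF max.cobounded1] using rs by (intro nn_integral_mono) (auto simp: indicator_def)
  moreover have "0 \<le> W (max 0 r)"
  proof (cases "r < 1")
    case True then show ?thesis using W_pos[of "max 0 r"] by simp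
  next
    case False then show ?thesis by (simp add: W_eq set_lebesgue_integral_def)
  qed
  ultimately show ?thesis by (simp add: W_def)
qed

lemma W_nonneg: "0 \<le> W r"
  using W_antimono[of r "max 1 r"] by (simp add: W_eq set_lebesgue_integral_def)

lemma W_measurable[measurable]: "W \<in> borel_measurable borel"
proof -
  have "mono (\<lambda>r. - W r)" using W_antimono by (auto simp: mono_def)
  then have "(\<lambda>r. - W r) \<in> borel_measurable borel" by (rule borel_measurable_mono)
  then show ?thesis using borel_measurable_uminus[of "\<lambda>r. - W r"] by simp
qed

lemma tau_measurable[measurable]: "\<tau> \<in> borel_measurable borel"
  unfolding \<tau>_def by measurable

lemma tau_pos: "z \<in> unit_disc \<Longrightarrow> 0 < \<tau> z"
  using W_pos[of "cmod z"] by (simp add: \<tau>_def unit_disc_iff)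

lemma tau_le: "z \<in> unit_disc \<Longrightarrow> \<tau> z \<le> W 0"
proof -
  assume z: "z \<in> unit_disc"
  have "\<tau> z \<le> 1 * W 0" unfolding \<tau>_def
    by (rule mult_mono) (use z W_antimono[of 0 "cmod z"] W_nonneg in auto)
  then show ?thesis by simp
qed

lemma W_doubling: "\<exists>C\<ge>1. \<forall>r<1. W r \<le> C * W ((1 + r) / 2)"
proof -
  obtain C where C: "C > 0" and d: "\<And>r. 0 \<le> r \<Longrightarrow> r < 1 \<Longrightarrow> weight_hat \<omega> (complex_of_real r) \<le> C * weight_hat \<omega> (complex_of_real ((1 + r) / 2))"
    using regular unfolding regular_weight_def doubling_weight_def by auto
  have "W r \<le> max 1 C * W ((1 + r) / 2)" if r: "r < 1" for r
  proof (cases "0 \<le> r")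
    case True
    then have "W r \<le> C * W ((1 + r) / 2)" using d[of r] r by (simp add: W_def)
    also have "\<dots> \<le> max 1 C * W ((1 + r) / 2)" by (intro mult_right_mono W_nonneg) simp
    finally show ?thesis .
  next
    case False
    have "W r = W 0" using False by (simp add: W_def)
    also have "\<dots> \<le> C * W (1 / 2)" using d[of 0] by (simp add: W_def)
    also have "\<dots> \<le> max 1 C * W ((1 + r) / 2)"
      using False C by (intro mult_mono W_antimono W_nonneg) auto
    finally show ?thesis .
  qed
  then show ?thesis by (intro exI[of _ "max 1 C"]) auto
qed

definition CD :: real where "CD = (SOME C. C \<ge> 1 \<and> (\<forall>r<1. W r \<le> C * W ((1 + r) / 2)))"

lemma CD: "CD \<ge> 1" "r < 1 \<Longrightarrow> W r \<le> CD * W ((1 + r) / 2)"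
  using someI_ex[OF W_doubling] by (auto simp: CD_def)

text \<open>
  Iterating the doubling property: each factor \<open>2\<close> between the distances to the circle costs a factor \<open>CD\<close>.
\<close>

lemma W_power_doubling:
  assumes rt: "1 - r \<le> 2 ^ k * (1 - t)" and r: "r < 1"
  shows "W r \<le> CD ^ k * W t"
proof -
  have "W r \<le> CD ^ k * W (1 - (1 - r) / 2 ^ k)"
  proof (induction k)
    case (Suc k)
    have "W r \<le> CD ^ k * W (1 - (1 - r) / 2 ^ k)" by (rule Suc)
    also have "\<dots> \<le> CD ^ k * (CD * W ((1 + (1 - (1 - r) / 2 ^ k)) / 2))"
      using CD(1) CD(2)[of "1 - (1 - r) / 2 ^ k"] r by (intro mult_left_mono) auto
    also have "(1 + (1 - (1 - r) / 2 ^ k)) / 2 = 1 - (1 - r) / 2 ^ Suc k" by (simp add: field_simps)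
    finally show ?case by (simp add: mult_ac)
  qed simp
  also have "\<dots> \<le> CD ^ k * W t"
    using CD(1) rt by (intro mult_left_mono W_antimono) (auto simp: field_simps)
  finally show ?thesis .
qed

lemma regular_ex: "\<exists>C\<ge>1. \<forall>z\<in>unit_disc. \<omega> z \<le> C * (W (cmod z) / (1 - cmod z)) \<and> W (cmod z) / (1 - cmod z) \<le> C * \<omega> z"
proof -
  obtain C where C: "C > 0" and d: "\<And>r. 0 \<le> r \<Longrightarrow> r < 1 \<Longrightarrow> inverse C * \<omega> (complex_of_real r) \<le> 1 / (1 - r) * weight_hat \<omega> (complex_of_real r) \<and>
        1 / (1 - r) * weight_hat \<omega> (complex_of_real r) \<le> C * \<omega> (complex_of_real r)"
    using regular unfolding regular_weight_def by auto
  have "\<omega> z \<le> max 1 C * (W (cmod z) / (1 - cmod z)) \<and> W (cmod z) / (1 - cmod z) \<le> max 1 C * \<omega> z" if z: "z \<in> unit_disc" for z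
  proof
    have w: "\<omega> z = \<omega> (complex_of_real (cmod z))" by (rule omega_radial[OF z])
    have z': "0 \<le> cmod z" "cmod z < 1" using z by (auto simp: unit_disc_iff)
    have W: "W (cmod z) = weight_hat \<omega> (complex_of_real (cmod z))" by (simp add: W_def)
    have "\<omega> z \<le> C * (W (cmod z) / (1 - cmod z))" using d[OF z'] C unfolding w W by (simp add: field_simps)
    also have "\<dots> \<le> max 1 C * (W (cmod z) / (1 - cmod z))" using W_nonneg z' by (intro mult_right_mono) auto
    finally show "\<omega> z \<le> max 1 C * (W (cmod z) / (1 - cmod z))" .
    have "W (cmod z) / (1 - cmod z) \<le> C * \<omega> z" using d[OF z'] unfolding w W by simp
    also have "\<dots> \<le> max 1 C * \<omega> z" using omega_nonneg[OF z] by (intro mult_right_mono) auto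
    finally show "W (cmod z) / (1 - cmod z) \<le> max 1 C * \<omega> z" .
  qed
  then show ?thesis by (intro exI[of _ "max 1 C"]) auto
qed

definition CR :: real where "CR = (SOME C. C \<ge> 1 \<and> (\<forall>z\<in>unit_disc. \<omega> z \<le> C * (W (cmod z) / (1 - cmod z)) \<and> W (cmod z) / (1 - cmod z) \<le> C * \<omega> z))"

lemma CR: "CR \<ge> 1" "z \<in> unit_disc \<Longrightarrow> \<omega> z \<le> CR * (W (cmod z) / (1 - cmod z))" "z \<in> unit_disc \<Longrightarrow> W (cmod z) / (1 - cmod z) \<le> CR * \<omega> z"
  using someI_ex[OF regular_ex] by (auto simp: CR_def)

lemma omega_tau:
  assumes z: "z \<in> unit_disc"
  shows "\<omega> z \<le> CR * (\<tau> z / (1 - cmod z)\<^sup>2)" "\<tau> z / (1 - cmod z)\<^sup>2 \<le> CR * \<omega> z"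
proof -
  have "\<tau> z / (1 - cmod z)\<^sup>2 = W (cmod z) / (1 - cmod z)"
    using z by (simp add: \<tau>_def unit_disc_iff power2_eq_square)
  then show "\<omega> z \<le> CR * (\<tau> z / (1 - cmod z)\<^sup>2)" "\<tau> z / (1 - cmod z)\<^sup>2 \<le> CR * \<omega> z" using CR(2,3)[OF z] by simp_all
qed

lemma tau_compare:
  assumes z: "z \<in> unit_disc" and w: "w \<in> unit_disc" and le: "1 - cmod z \<le> 2 ^ k * (1 - cmod w)"
  shows "\<tau> z \<le> (2 * CD) ^ k * \<tau> w"
proof -
  have "\<tau> z \<le> (2 ^ k * (1 - cmod w)) * (CD ^ k * W (cmod w))"
    unfolding \<tau>_def using z w le by (intro mult_mono W_power_doubling W_nonneg) (auto simp: unit_disc_iff)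
  then show ?thesis by (simp add: \<tau>_def power_mult_distrib mult_ac)
qed

text \<open>
  By regularity the integrand is at most \<open>CR * \<omega>\<close>, whose integral is \<open>CR * W\<close> by definition.
\<close>

lemma nn_integral_W_tail:
  assumes r: "0 \<le> r"
  shows "(\<integral>\<^sup>+s. ennreal (W s / (1 - s)) * indicator {r..<1} s \<partial>lborel) \<le> ennreal (CR * W r)"
proof -
  have "(\<integral>\<^sup>+s. ennreal (W s / (1 - s)) * indicator {r..<1} s \<partial>lborel) \<le>
     (\<integral>\<^sup>+s. ennreal CR * (ennreal (\<omega> (complex_of_real s)) * indicator {r..<1} s) \<partial>lebesgue)"
    unfolding nn_integral_completion
  proof (rule nn_integral_mono)
    fix s
    show "ennreal (W s / (1 - s)) * indicator {r..<1} s \<le> ennreal CR * (ennreal (\<omega> (complex_of_real s)) * indicator {r..<1} s)"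
    proof (cases "s \<in> {r..<1}")
      case True
      then have s: "complex_of_real s \<in> unit_disc" "0 \<le> s" using r by (auto simp: unit_disc_iff)
      have "W s / (1 - s) \<le> CR * \<omega> (complex_of_real s)" using CR(3)[OF s(1)] s(2) by simp
      then show ?thesis using True CR(1) by (simp add: ennreal_mult'[symmetric] ennreal_leI)
    qed simp
  qed
  also have "\<dots> = ennreal CR * (\<integral>\<^sup>+s. ennreal (\<omega> (complex_of_real s)) * indicator {r..<1} s \<partial>lebesgue)"
  proof (rule nn_integral_cmult)
    have "(\<lambda>s. ennreal (indicator {r..<1} s *\<^sub>R \<omega> (complex_of_real s))) \<in> borel_measurable lebesgue"
      using omega_line_integrable[OF r] by (auto simp: set_integrable_def)
    also have "(\<lambda>s. ennreal (indicator {r..<1} s *\<^sub>R \<omega> (complex_of_real s))) = (\<lambda>s. ennreal (\<omega> (complex_of_real s)) * indicator {r..<1} s)"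
      by (auto simp: indicator_def fun_eq_iff)
    finally show "(\<lambda>s. ennreal (\<omega> (complex_of_real s)) * indicator {r..<1} s) \<in> borel_measurable lebesgue" .
  qed
  also have "\<dots> = ennreal (CR * W r)"
    using CR(1) W_nonneg by (simp add: nn_integral_completion W_eq_nn[OF r] ennreal_mult)
  finally show ?thesis .
qed

text \<open>
  The weight is replaced by the Borel function \<open>W s / (1 - s)\<close> before polar coordinates are used, which are
  stated for Borel functions.
\<close>

lemma nn_integral_omega_tail:
  assumes r: "0 \<le> r"
  shows "(\<integral>\<^sup>+z. ennreal (\<omega> z) * indicator {r..<1} (cmod z) \<partial>disc_area) \<le> ennreal (2 * CR\<^sup>2 * W r)"
proof -
  let ?F = "\<lambda>s. ennreal (CR * (W s / (1 - s))) * indicator {r..<1} s"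
  have "(\<integral>\<^sup>+z. ennreal (\<omega> z) * indicator {r..<1} (cmod z) \<partial>disc_area) \<le> (\<integral>\<^sup>+z. ?F (cmod z) \<partial>disc_area)"
    by (intro nn_integral_mono) (use CR in \<open>auto simp: indicator_def intro!: ennreal_leI\<close>)
  also have "\<dots> = (\<integral>\<^sup>+s. ?F s * ennreal (2 * s) * indicator {0..<1} s \<partial>lborel)"
    by (rule nn_integral_disc_area_radial) measurable
  also have "\<dots> \<le> (\<integral>\<^sup>+s. ennreal (2 * CR) * (ennreal (W s / (1 - s)) * indicator {r..<1} s) \<partial>lborel)"
  proof (rule nn_integral_mono)
    fix s
    show "?F s * ennreal (2 * s) * indicator {0..<1} s \<le> ennreal (2 * CR) * (ennreal (W s / (1 - s)) * indicator {r..<1} s)"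
    proof (cases "s \<in> {r..<1}")
      case True
      have "CR * (W s / (1 - s)) * (2 * s) \<le> 2 * CR * (W s / (1 - s))"
      proof -
        have "(CR * (W s / (1 - s))) * (2 * s) \<le> (CR * (W s / (1 - s))) * 2"
          using True CR(1) W_nonneg[of s] by (intro mult_left_mono) auto
        then show ?thesis by (simp add: mult_ac)
      qed
      then show ?thesis using True CR(1) W_nonneg[of s] r by (simp add: ennreal_mult'[symmetric] ennreal_leI)
    qed simp
  qed
  also have "\<dots> = ennreal (2 * CR) * (\<integral>\<^sup>+s. ennreal (W s / (1 - s)) * indicator {r..<1} s \<partial>lborel)"
    by (rule nn_integral_cmult) measurable
  also have "\<dots> \<le> ennreal (2 * CR) * ennreal (CR * W r)"
    by (intro mult_left_mono nn_integral_W_tail[OF r]) simp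
  also have "\<dots> = ennreal (2 * CR\<^sup>2 * W r)"
    using CR(1) W_nonneg[of r] by (simp add: ennreal_mult[symmetric] power2_eq_square mult_ac)
  finally show ?thesis .
qed

end

section \<open>Moments and the Littlewood-Paley estimate\<close>

lemma power_le_fact_exp:
  fixes y :: real assumes "0 \<le> y" shows "y ^ n \<le> fact n * exp y"
proof -
  have "(\<Sum>k\<in>{n}. inverse (fact k) * y ^ k) \<le> (\<Sum>k. inverse (fact k) * y ^ k)"
    by (rule sum_le_suminf) (use summable_exp[of y] assms in auto)
  then show ?thesis using assms by (simp add: exp_def field_simps)
qed

lemma ex_power_two_between:
  fixes y :: real assumes "1 \<le> y" obtains k where "y \<le> 2 ^ k" "2 ^ k \<le> 2 * y"
proof -
  obtain k0 where k0: "y < 2 ^ k0" using real_arch_pow[of 2 y] by auto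
  define k where "k = (LEAST k. y \<le> 2 ^ k)"
  have k: "y \<le> 2 ^ k" unfolding k_def by (rule LeastI[of _ k0]) (use k0 in simp)
  have "2 ^ k \<le> 2 * y"
  proof (cases k)
    case (Suc j)
    have "\<not> y \<le> 2 ^ j" using not_less_Least[of j "\<lambda>k. y \<le> 2 ^ k"] Suc by (simp add: k_def)
    then show ?thesis using Suc by simp
  qed (use assms in auto)
  with k that show ?thesis by blast
qed

context regular_radial_weight
begin

text \<open>
  Doubling means that \<open>W\<close> decays at most polynomially, with exponent \<open>m\<close> when \<open>CD \<le> 2 ^ m\<close>: with
  \<open>y = (1 - r) / x\<close> one has \<open>W r \<le> (2 y) ^ m * W (1 - x)\<close>. The exponential beats this polynomial and one
  more factor \<open>y\<close>.
\<close>

lemma W_power_decay: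
  obtains K where "0 \<le> K"
    "\<And>r x. 0 \<le> r \<Longrightarrow> 0 < x \<Longrightarrow> r \<le> 1 - x \<Longrightarrow> W r * exp (- ((1 - r) / x)) \<le> K * (x / (1 - r)) * W (1 - x)"
proof -
  obtain m where m: "CD \<le> 2 ^ m" using real_arch_pow[of 2 CD] by (auto intro: less_imp_le)
  define K :: real where "K = 2 ^ m * fact (m + 1)"
  have "W r * exp (- ((1 - r) / x)) \<le> K * (x / (1 - r)) * W (1 - x)" if r: "0 \<le> r" "0 < x" "r \<le> 1 - x" for r x
  proof -
    define y where "y = (1 - r) / x"
    have y: "1 \<le> y" using r by (simp add: y_def)
    obtain k where k: "y \<le> 2 ^ k" "2 ^ k \<le> 2 * y" using ex_power_two_between[OF y] .
    have "W r \<le> CD ^ k * W (1 - x)"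
      by (rule W_power_doubling) (use k r in \<open>auto simp: y_def field_simps\<close>)
    also have "CD ^ k \<le> (2 ^ m) ^ k" using m CD(1) by (intro power_mono) auto
    also have "(2 ^ m) ^ k = ((2::real) ^ k) ^ m" by (simp add: power_mult[symmetric] mult.commute)
    also have "\<dots> \<le> (2 * y) ^ m" using k by (intro power_mono) auto
    finally have "W r \<le> (2 * y) ^ m * W (1 - x)" by (simp add: W_nonneg mult_right_mono)
    then have "W r * exp (- y) * y \<le> ((2 * y) ^ m * W (1 - x)) * exp (- y) * y"
      using y by (intro mult_right_mono) auto
    also have "\<dots> = 2 ^ m * W (1 - x) * (y ^ (m + 1) * exp (- y))" by (simp add: power_mult_distrib mult_ac)
    also have "\<dots> \<le> 2 ^ m * W (1 - x) * (fact (m + 1))"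
    proof (intro mult_left_mono)
      have "y ^ (m + 1) * exp (- y) \<le> (fact (m + 1) * exp y) * exp (- y)"
        by (intro mult_right_mono power_le_fact_exp) (use y in auto)
      also have "(fact (m + 1) * exp y) * exp (- y) = fact (m + 1)"
        by (simp only: mult.assoc mult_exp_exp) simp
      finally show "y ^ (m + 1) * exp (- y) \<le> fact (m + 1)" .
    qed (use W_nonneg in auto)
    finally have "W r * exp (- y) * y \<le> K * W (1 - x)" by (simp add: K_def mult_ac)
    then have "W r * exp (- y) \<le> K * W (1 - x) / y" using y by (simp add: pos_le_divide_eq)
    then show ?thesis using r by (simp add: y_def mult_ac)
  qed
  then show ?thesis using that[of K] by (simp add: K_def)
qed

text \<open>
  The moment of order \<open>2 n\<close> is governed by the annulus of width \<open>x = 1 / (2 n)\<close> at the boundary. Inside that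
  annulus \<open>|z|\<close> to the power \<open>2 n\<close> is bounded by \<open>1\<close>; further inside it is at most \<open>exp (- (1 - |z|) / x)\<close>, and
  \<open>W_power_decay\<close> leaves the integrable majorant \<open>x / (1 - |z|)\<^sup>2\<close>.
\<close>

lemma moment_upper:
  "\<exists>C\<ge>0. \<forall>n\<ge>1. (\<integral>\<^sup>+z. ennreal (cmod z ^ (2 * n) * \<omega> z) \<partial>disc_area) \<le> ennreal (C * W (1 - 1 / (2 * real n)))"
proof -
  obtain K where K: "0 \<le> K"
    "\<And>r x. 0 \<le> r \<Longrightarrow> 0 < x \<Longrightarrow> r \<le> 1 - x \<Longrightarrow> W r * exp (- ((1 - r) / x)) \<le> K * (x / (1 - r)) * W (1 - x)"
    by (rule W_power_decay) blast
  have "(\<integral>\<^sup>+z. ennreal (cmod z ^ (2 * n) * \<omega> z) \<partial>disc_area) \<le> ennreal ((2 * CR\<^sup>2 + 2 * CR * K) * W (1 - 1 / (2 * real n)))" if n: "1 \<le> n" for n :: nat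
  proof -
    define x where "x = 1 / (2 * real n)"
    have x: "0 < x" "x \<le> 1 / 2" using n by (auto simp: x_def divide_simps)
    define A where "A = CR * K * W (1 - x)"
    have A: "0 \<le> A" using K(1) CR(1) W_nonneg by (simp add: A_def)
    let ?G = "\<lambda>s. ennreal (A * (x / (1 - s)\<^sup>2)) * indicator {0..1-x} s"
    have m1: "(\<lambda>z. indicator {1-x..<1} (cmod z) :: ennreal) \<in> borel_measurable disc_area"
      by (rule borel_measurable_disc_area_borel) measurable
    have m2: "(\<lambda>z. ?G (cmod z)) \<in> borel_measurable disc_area"
      by (rule borel_measurable_disc_area_borel) measurable
    have "(\<integral>\<^sup>+z. ennreal (cmod z ^ (2 * n) * \<omega> z) \<partial>disc_area) \<le>
       (\<integral>\<^sup>+z. ennreal (\<omega> z) * indicator {1-x..<1} (cmod z) + ?G (cmod z) \<partial>disc_area)"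
    proof (rule nn_integral_mono)
      fix z assume "z \<in> space disc_area"
      then have z: "z \<in> unit_disc" "0 \<le> cmod z" "cmod z < 1" by (auto simp: unit_disc_iff)
      show "ennreal (cmod z ^ (2 * n) * \<omega> z) \<le> ennreal (\<omega> z) * indicator {1-x..<1} (cmod z) + ?G (cmod z)"
      proof (cases "1 - x \<le> cmod z")
        case True
        have "cmod z ^ (2 * n) * \<omega> z \<le> 1 * \<omega> z"
          using z omega_nonneg by (intro mult_right_mono power_le_one) auto
        then have "ennreal (cmod z ^ (2 * n) * \<omega> z) \<le> ennreal (\<omega> z)" by (intro ennreal_leI) simp
        then have "ennreal (cmod z ^ (2 * n) * \<omega> z) \<le> ennreal (\<omega> z) + ?G (cmod z)" by (rule add_increasing2[rotated]) simp
        then show ?thesis using True z by simp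
      next
        case False
        define r where "r = cmod z"
        have r: "0 \<le> r" "r \<le> 1 - x" "r < 1" using z False by (auto simp: r_def)
        have "r \<le> exp (- (1 - r))" using exp_ge_add_one_self[of "- (1 - r)"] by simp
        then have "r ^ (2 * n) \<le> exp (- (1 - r)) ^ (2 * n)" by (rule power_mono) (use r in simp)
        also have "\<dots> = exp (- ((1 - r) / x))"
          by (simp add: exp_of_nat_mult[symmetric] x_def algebra_simps)
        finally have "r ^ (2 * n) * \<omega> z \<le> exp (- ((1 - r) / x)) * (CR * (W r / (1 - r)))"
          using CR(2)[OF z(1)] omega_nonneg[OF z(1)] by (intro mult_mono) (auto simp: r_def)
        also have "\<dots> = (W r * exp (- ((1 - r) / x))) * (CR / (1 - r))" by simp
        also have "\<dots> \<le> (K * (x / (1 - r)) * W (1 - x)) * (CR / (1 - r))"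
          using K(2)[OF r(1) x(1) r(2)] CR(1) r by (intro mult_right_mono) auto
        also have "\<dots> = A * (x / (1 - r)\<^sup>2)" by (simp add: A_def power2_eq_square)
        finally show ?thesis using False r by (auto simp: r_def[symmetric] intro: ennreal_leI)
      qed
    qed
    also have "\<dots> = (\<integral>\<^sup>+z. ennreal (\<omega> z) * indicator {1-x..<1} (cmod z) \<partial>disc_area) + (\<integral>\<^sup>+z. ?G (cmod z) \<partial>disc_area)"
      by (intro nn_integral_add borel_measurable_times_ennreal m1 m2 measurable_compose[OF omega_measurable measurable_ennreal])
    also have "\<dots> \<le> ennreal (2 * CR\<^sup>2 * W (1 - x)) + ennreal (2 * A)"
    proof (intro add_mono nn_integral_omega_tail)
      show "0 \<le> 1 - x" using x by simp
      have "(\<integral>\<^sup>+z. ?G (cmod z) \<partial>disc_area) = (\<integral>\<^sup>+s. ?G s * ennreal (2 * s) * indicator {0..<1} s \<partial>lborel)"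
        by (rule nn_integral_disc_area_radial) measurable
      also have "\<dots> \<le> (\<integral>\<^sup>+s. ennreal (2 * A * x / (1 - s)\<^sup>2) * indicator {0..1-x} s \<partial>lborel)"
      proof (rule nn_integral_mono)
        fix s
        show "?G s * ennreal (2 * s) * indicator {0..<1} s \<le> ennreal (2 * A * x / (1 - s)\<^sup>2) * indicator {0..1-x} s"
        proof (cases "s \<in> {0..1-x}")
          case True
          have "(A * (x / (1 - s)\<^sup>2)) * (2 * s) \<le> (A * (x / (1 - s)\<^sup>2)) * 2"
            using True x A by (intro mult_left_mono) auto
          then show ?thesis using True x A by (auto simp: ennreal_mult'[symmetric] mult_ac intro!: ennreal_leI)
        qed simp
      qed
      also have "\<dots> = ennreal (2 * A * x / (1 - (1 - x)) - 2 * A * x / (1 - 0))"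
      proof (rule nn_integral_FTC_Icc[where F="\<lambda>s. 2 * A * x / (1 - s)"])
        fix s assume s: "s \<in> {0..1-x}"
        show "((\<lambda>s. 2 * A * x / (1 - s)) has_real_derivative 2 * A * x / (1 - s)\<^sup>2) (at s)"
          using s x by (auto intro!: derivative_eq_intros simp: power2_eq_square)
      qed (use x A in auto)
      also have "\<dots> \<le> ennreal (2 * A)" using x A by (intro ennreal_leI) simp
      finally show "(\<integral>\<^sup>+z. ?G (cmod z) \<partial>disc_area) \<le> ennreal (2 * A)" .
    qed
    also have "\<dots> = ennreal ((2 * CR\<^sup>2 + 2 * CR * K) * W (1 - x))"
      using A W_nonneg[of "1 - x"] by (simp add: ennreal_plus[symmetric] A_def algebra_simps del: ennreal_plus)
    finally show ?thesis by (simp add: x_def)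
  qed
  moreover have "0 \<le> 2 * CR\<^sup>2 + 2 * CR * K" using K CR(1) by simp
  ultimately show ?thesis by blast
qed

lemma integrable_tau: "integrable disc_area \<tau>"
proof (rule finite_measure.integrable_const_bound[OF finite_measure_disc_area, where B="W 0"])
  show "AE z in disc_area. norm (\<tau> z) \<le> W 0"
  proof (rule AE_I2)
    fix z assume z: "z \<in> space disc_area"
    have "\<tau> z \<le> W 0" by (rule tau_le) (use z in simp)
    then show "norm (\<tau> z) \<le> W 0" using tau_pos[of z] z by simp
  qed
qed (auto intro: borel_measurable_disc_area_borel)

text \<open>
  Only the annulus \<open>1 - x \<le> |z| \<le> 1 - x / 2\<close> with \<open>x = 1 / (2 (n + 1))\<close> is used: there \<open>|z|\<close> to the power \<open>2 n + 1\<close> is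
  at least \<open>1/4\<close> by Bernoulli's inequality, \<open>1 - |z|\<close> is at least \<open>x / 2\<close>, and \<open>W\<close> is comparable to \<open>W (1 - x)\<close>.
\<close>

lemma moment_tau_lower:
  "ennreal (W (1 - 1 / (2 * (real n + 1))) / (32 * CD * (real n + 1)\<^sup>2)) \<le> (\<integral>\<^sup>+z. ennreal (cmod z ^ (2 * n) * \<tau> z) \<partial>disc_area)"
proof -
  define x where "x = 1 / (2 * (real n + 1))"
  have x: "0 < x" "x \<le> 1 / 2" by (auto simp: x_def divide_simps)
  define A where "A = x * W (1 - x) / (4 * CD)"
  have A: "0 \<le> A" using x CD(1) W_nonneg by (simp add: A_def)
  have "ennreal (A * (x / 2)) = (\<integral>\<^sup>+s. ennreal A * indicator {1 - x .. 1 - x / 2} s \<partial>lborel)"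
    using x A by (simp add: nn_integral_cmult_indicator ennreal_mult[symmetric])
  also have "\<dots> \<le> (\<integral>\<^sup>+s. ennreal (s ^ (2 * n) * ((1 - s) * W s)) * ennreal (2 * s) * indicator {0..<1} s \<partial>lborel)"
  proof (rule nn_integral_mono)
    fix s
    show "ennreal A * indicator {1 - x .. 1 - x / 2} s \<le> ennreal (s ^ (2 * n) * ((1 - s) * W s)) * ennreal (2 * s) * indicator {0..<1} s"
    proof (cases "s \<in> {1 - x .. 1 - x / 2}")
      case True
      have s: "0 \<le> s" "s < 1" "1/2 \<le> s" using True x by auto
      have "1 / 2 \<le> (1 - x) ^ (n + 1)"
      proof -
        have "1 + real (n + 1) * (- x) \<le> (1 + (- x)) ^ (n + 1)" by (rule Bernoulli_inequality) (use x in auto)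
        moreover have "real (n + 1) * x = 1 / 2" by (simp add: x_def divide_simps)
        ultimately show ?thesis by simp
      qed
      then have "(1 / 2)\<^sup>2 \<le> ((1 - x) ^ (n + 1))\<^sup>2" by (rule power_mono) simp
      also have "\<dots> = (1 - x) ^ (2 * n + 2)" unfolding power_mult[symmetric]
        by (rule arg_cong[where f="\<lambda>k. (1 - x) ^ k"]) simp
      also have "\<dots> \<le> s ^ (2 * n + 2)" using True x by (intro power_mono) auto
      also have "\<dots> \<le> s ^ (2 * n + 1)" using s by (intro power_decreasing) auto
      finally have p: "1 / 4 \<le> s ^ (2 * n + 1)" by (simp add: power2_eq_square)
      have "W (1 - x) \<le> CD * W ((1 + (1 - x)) / 2)" by (rule CD(2)) (use x in simp)
      also have "\<dots> \<le> CD * W s" using True CD(1) by (intro mult_left_mono W_antimono) auto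
      finally have w: "W (1 - x) / CD \<le> W s" using CD(1) by (simp add: divide_simps mult.commute)
      have "A = (1 / 4) * 2 * ((x / 2) * (W (1 - x) / CD))" by (simp add: A_def)
      also have "\<dots> \<le> s ^ (2 * n + 1) * 2 * ((1 - s) * W s)"
        using True p w x CD(1) W_nonneg s by (intro mult_mono) auto
      finally have "A \<le> s ^ (2 * n) * ((1 - s) * W s) * (2 * s)" by (simp add: mult_ac)
      then show ?thesis using True s W_nonneg[of s] by (simp add: ennreal_mult'[symmetric] ennreal_leI)
    qed simp
  qed
  also have "\<dots> = (\<integral>\<^sup>+z. ennreal (cmod z ^ (2 * n) * ((1 - cmod z) * W (cmod z))) \<partial>disc_area)"
    by (rule nn_integral_disc_area_radial[symmetric]) measurable
  finally have "ennreal (A * (x / 2)) \<le> (\<integral>\<^sup>+z. ennreal (cmod z ^ (2 * n) * \<tau> z) \<partial>disc_area)" by (simp add: \<tau>_def)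
  moreover have "A * (x / 2) = W (1 - x) / (32 * CD * (real n + 1)\<^sup>2)"
  proof -
    have "x * x = 1 / (4 * (real n + 1)\<^sup>2)" by (simp add: x_def power2_eq_square field_simps)
    moreover have "A * (x / 2) = W (1 - x) * (x * x) / (8 * CD)" by (simp add: A_def)
    ultimately show ?thesis by simp
  qed
  ultimately show ?thesis by (simp add: x_def)
qed

text \<open>
  By Parseval's formula both sides are sums over the coefficients \<open>a n\<close> of \<open>g\<close>. Those of \<open>g'\<close> are \<open>(n + 1) * a (n + 1)\<close>, so it
  is enough that the moment of \<open>\<omega>\<close> of index \<open>n + 1\<close> is at most a multiple of \<open>(n + 1)\<^sup>2\<close> times that of \<open>\<tau>\<close> of index
  \<open>n\<close>; this is the combination of the two moment estimates. The coefficient \<open>a 0\<close> is not seen by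
  \<open>g'\<close> and gives the term \<open>|g 0|\<^sup>2\<close>.
\<close>

theorem littlewood_paley_upper:
  "\<exists>C\<ge>0. \<forall>g. g holomorphic_on unit_disc \<longrightarrow>
     (\<integral>\<^sup>+z. ennreal ((cmod (g z))\<^sup>2 * \<omega> z) \<partial>disc_area) \<le>
       ennreal C * (ennreal ((cmod (g 0))\<^sup>2) + (\<integral>\<^sup>+z. ennreal ((cmod (deriv g z))\<^sup>2 * \<tau> z) \<partial>disc_area))"
proof -
  obtain C where C: "0 \<le> C" and mom: "\<And>n. 1 \<le> n \<Longrightarrow> (\<integral>\<^sup>+z. ennreal (cmod z ^ (2 * n) * \<omega> z) \<partial>disc_area) \<le> ennreal (C * W (1 - 1 / (2 * real n)))"
    using moment_upper by blast
  define m where "m n = (\<integral>\<^sup>+z. ennreal (cmod z ^ (2 * n) * \<omega> z) \<partial>disc_area)" for n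
  define t where "t n = (\<integral>\<^sup>+z. ennreal (cmod z ^ (2 * n) * \<tau> z) \<partial>disc_area)" for n
  have m0: "m 0 \<le> ennreal (\<integral>z. \<omega> z \<partial>disc_area)"
    unfolding m_def using nn_integral_eq_integral[OF omega_integrable AE_I2] omega_nonneg by simp
  define C0 where "C0 = (\<integral>z. \<omega> z \<partial>disc_area)"
  have C0: "0 \<le> C0" unfolding C0_def by (rule Bochner_Integration.integral_nonneg) (simp add: omega_nonneg)
  define D where "D = max C0 (32 * CD * C)"
  have D: "0 \<le> D" "32 * CD * C \<le> D" using C0 by (auto simp: D_def)
  have mt: "m (Suc n) \<le> ennreal D * (ennreal ((real n + 1)\<^sup>2) * t n)" for n
  proof -
    have "m (Suc n) \<le> ennreal (C * W (1 - 1 / (2 * (real n + 1))))" unfolding m_def using mom[of "Suc n"] by (simp add: add.commute)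
    also have "C * W (1 - 1 / (2 * (real n + 1))) = (32 * CD * C * (real n + 1)\<^sup>2) * (W (1 - 1 / (2 * (real n + 1))) / (32 * CD * (real n + 1)\<^sup>2))"
      using CD(1) by (simp add: divide_simps)
    also have "ennreal \<dots> = ennreal (32 * CD * C * (real n + 1)\<^sup>2) * ennreal (W (1 - 1 / (2 * (real n + 1))) / (32 * CD * (real n + 1)\<^sup>2))"
      using C CD(1) W_nonneg by (intro ennreal_mult) auto
    also have "\<dots> \<le> ennreal (D * (real n + 1)\<^sup>2) * t n"
      unfolding t_def by (intro mult_mono moment_tau_lower ennreal_leI mult_right_mono D) auto
    also have "\<dots> = ennreal D * (ennreal ((real n + 1)\<^sup>2) * t n)"
      using C0 by (simp add: ennreal_mult mult.assoc D_def)
    finally show ?thesis .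
  qed
  have "(\<integral>\<^sup>+z. ennreal ((cmod (g z))\<^sup>2 * \<omega> z) \<partial>disc_area) \<le>
       ennreal D * (ennreal ((cmod (g 0))\<^sup>2) + (\<integral>\<^sup>+z. ennreal ((cmod (deriv g z))\<^sup>2 * \<tau> z) \<partial>disc_area))"
    if g: "g holomorphic_on unit_disc" for g
  proof -
    define a where "a n = (deriv ^^ n) g 0 / fact n" for n
    define b where "b n = (deriv ^^ n) (deriv g) 0 / fact n" for n
    have g': "deriv g holomorphic_on unit_disc" using g by (intro holomorphic_deriv) auto
    have b: "cmod (b n) = (real n + 1) * cmod (a (Suc n))" for n
    proof -
      have "(deriv ^^ n) (deriv g) 0 = (deriv ^^ Suc n) g 0" by (simp add: funpow_swap1)
      then show ?thesis unfolding a_def b_def by (simp add: norm_divide norm_mult divide_simps del: of_nat_Suc)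
    qed
    have ga: "(\<lambda>n. a n * z ^ n) sums g z" if "z \<in> unit_disc" for z
      using holomorphic_power_series[of g 0 1 z] g that by (simp add: a_def unit_disc_def)
    have gb: "(\<lambda>n. b n * z ^ n) sums deriv g z" if "z \<in> unit_disc" for z
      using holomorphic_power_series[of "deriv g" 0 1 z] g' that by (simp add: b_def unit_disc_def)
    let ?R = "\<integral>\<^sup>+z. ennreal ((cmod (deriv g z))\<^sup>2 * \<tau> z) \<partial>disc_area"
    have R: "?R = (\<Sum>n. ennreal ((cmod (b n))\<^sup>2) * t n)"
      unfolding t_def by (rule parseval_radial[OF integrable_tau _ _ gb]) (auto simp: \<tau>_def[of "complex_of_real _"] \<tau>_def unit_disc_iff W_nonneg)
    have "(\<integral>\<^sup>+z. ennreal ((cmod (g z))\<^sup>2 * \<omega> z) \<partial>disc_area) = (\<Sum>n. ennreal ((cmod (a n))\<^sup>2) * m n)"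
      unfolding m_def by (rule parseval_radial[OF omega_integrable omega_radial omega_nonneg ga])
    also have "\<dots> \<le> ennreal D * (ennreal ((cmod (g 0))\<^sup>2) + ?R)"
    proof (rule suminf_le_const[OF summableI])
      fix M
      have "(\<Sum>n<M. ennreal ((cmod (a n))\<^sup>2) * m n) \<le> (\<Sum>n<Suc M. ennreal ((cmod (a n))\<^sup>2) * m n)"
        by (rule sum_mono2) auto
      also have "\<dots> = ennreal ((cmod (a 0))\<^sup>2) * m 0 + (\<Sum>n<M. ennreal ((cmod (a (Suc n)))\<^sup>2) * m (Suc n))"
        by (rule sum.lessThan_Suc_shift)
      also have "\<dots> \<le> ennreal ((cmod (g 0))\<^sup>2) * ennreal D + (\<Sum>n<M. ennreal D * (ennreal ((cmod (b n))\<^sup>2) * t n))"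
      proof (intro add_mono sum_mono)
        have "m 0 \<le> ennreal D" using m0 by (rule order_trans) (auto simp: D_def C0_def intro!: ennreal_leI)
        then show "ennreal ((cmod (a 0))\<^sup>2) * m 0 \<le> ennreal ((cmod (g 0))\<^sup>2) * ennreal D"
          by (intro mult_mono) (auto simp: a_def)
        fix n
        have "ennreal ((cmod (a (Suc n)))\<^sup>2) * m (Suc n) \<le> ennreal ((cmod (a (Suc n)))\<^sup>2) * (ennreal D * (ennreal ((real n + 1)\<^sup>2) * t n))"
          by (intro mult_left_mono mt) simp
        also have "\<dots> = ennreal D * ((ennreal ((real n + 1)\<^sup>2) * ennreal ((cmod (a (Suc n)))\<^sup>2)) * t n)" by (simp add: mult_ac)
        also have "ennreal ((real n + 1)\<^sup>2) * ennreal ((cmod (a (Suc n)))\<^sup>2) = ennreal ((cmod (b n))\<^sup>2)"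
          unfolding b by (simp add: ennreal_mult[symmetric] power_mult_distrib)
        finally show "ennreal ((cmod (a (Suc n)))\<^sup>2) * m (Suc n) \<le> ennreal D * (ennreal ((cmod (b n))\<^sup>2) * t n)" .
      qed
      also have "\<dots> = ennreal D * (ennreal ((cmod (g 0))\<^sup>2) + (\<Sum>n<M. ennreal ((cmod (b n))\<^sup>2) * t n))"
        by (simp add: distrib_left sum_distrib_left mult_ac)
      also have "\<dots> \<le> ennreal D * (ennreal ((cmod (g 0))\<^sup>2) + ?R)"
        unfolding R by (intro mult_left_mono add_left_mono sum_le_suminf) auto
      finally show "(\<Sum>n<M. ennreal ((cmod (a n))\<^sup>2) * m n) \<le> ennreal D * (ennreal ((cmod (g 0))\<^sup>2) + ?R)" .
    qed
    finally show ?thesis .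
  qed
  moreover have "0 \<le> D" using C0 by (simp add: D_def)
  ultimately show ?thesis by blast
qed

end

section \<open>The Bergman space and its point evaluations\<close>

context regular_radial_weight
begin

abbreviation "H \<equiv> bergman_space \<omega>"
abbreviation "N \<equiv> bergman_norm \<omega>"

lemma H_holomorphic: "f \<in> H \<Longrightarrow> f holomorphic_on unit_disc"
  and H_outside: "f \<in> H \<Longrightarrow> z \<notin> unit_disc \<Longrightarrow> f z = 0"
  and H_integrable: "f \<in> H \<Longrightarrow> integrable disc_area (\<lambda>z. (cmod (f z))\<^sup>2 * \<omega> z)"
  by (auto simp: bergman_space_def)

lemma holomorphic_measurable: "f holomorphic_on unit_disc \<Longrightarrow> f \<in> borel_measurable disc_area"
  by (intro borel_measurable_disc_area_continuous holomorphic_on_imp_continuous_on)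

lemma H_measurable[measurable_dest]: "f \<in> H \<Longrightarrow> f \<in> borel_measurable disc_area"
  by (intro holomorphic_measurable H_holomorphic)

lemma norm_nonneg: "0 \<le> N f"
  by (auto simp: bergman_norm_def omega_nonneg intro!: Bochner_Integration.integral_nonneg)

lemma norm_sq: "(N f)\<^sup>2 = (\<integral>z. (cmod (f z))\<^sup>2 * \<omega> z \<partial>disc_area)"
  unfolding bergman_norm_def
  by (rule real_sqrt_pow2) (auto simp: omega_nonneg intro!: Bochner_Integration.integral_nonneg)

lemma norm_sq_nn: "f \<in> H \<Longrightarrow> (\<integral>\<^sup>+z. ennreal ((cmod (f z))\<^sup>2 * \<omega> z) \<partial>disc_area) = ennreal ((N f)\<^sup>2)"
  unfolding norm_sq by (rule nn_integral_eq_integral[OF H_integrable]) (auto simp: omega_nonneg)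

lemma H_memI:
  assumes "f holomorphic_on unit_disc" "\<And>z. z \<notin> unit_disc \<Longrightarrow> f z = 0"
    and "(\<integral>\<^sup>+z. ennreal ((cmod (f z))\<^sup>2 * \<omega> z) \<partial>disc_area) \<le> ennreal B" "0 \<le> B"
  shows "f \<in> H" and "(N f)\<^sup>2 \<le> B"
proof -
  have [measurable]: "f \<in> borel_measurable disc_area" by (rule holomorphic_measurable[OF assms(1)])
  have "integrable disc_area (\<lambda>z. (cmod (f z))\<^sup>2 * \<omega> z)"
    by (rule integrableI_nonneg) (use assms(3) in \<open>auto simp: omega_nonneg intro!: AE_I2 intro: le_less_trans\<close>)
  then show f: "f \<in> H" using assms by (auto simp: bergman_space_def)
  show "(N f)\<^sup>2 \<le> B" using norm_sq_nn[OF f] assms(3,4) by simp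
qed

lemma nn_norm_parseval:
  assumes "\<And>z. z \<in> unit_disc \<Longrightarrow> (\<lambda>n. a n * z ^ n) sums f z"
  shows "(\<integral>\<^sup>+z. ennreal ((cmod (f z))\<^sup>2 * \<omega> z) \<partial>disc_area) = (\<Sum>n. ennreal ((cmod (a n))\<^sup>2) * (\<integral>\<^sup>+z. ennreal (cmod z ^ (2 * n) * \<omega> z) \<partial>disc_area))"
  by (rule parseval_radial[OF omega_integrable omega_radial omega_nonneg assms])

definition moment :: "nat \<Rightarrow> real" where
  "moment n = (\<integral>z. cmod z ^ (2 * n) * \<omega> z \<partial>disc_area)"

lemma moment_integrable: "integrable disc_area (\<lambda>z. cmod z ^ (2 * n) * \<omega> z)"
proof -
  have "integrable disc_area (\<lambda>z. cmod z ^ (2 * n) * of_real (\<omega> z))"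
    by (rule integrable_disc_area_bounded_mult[OF omega_integrable, of _ 1])
       (auto simp: unit_disc_iff power_le_one intro!: borel_measurable_disc_area_borel)
  then show ?thesis by simp
qed

lemma moment_nn: "(\<integral>\<^sup>+z. ennreal (cmod z ^ (2 * n) * \<omega> z) \<partial>disc_area) = ennreal (moment n)"
  unfolding moment_def by (rule nn_integral_eq_integral[OF moment_integrable]) (auto simp: omega_nonneg)

lemma moment_nonneg: "0 \<le> moment n"
  unfolding moment_def by (rule Bochner_Integration.integral_nonneg) (auto simp: omega_nonneg)

lemma moment_antimono: "n \<le> m \<Longrightarrow> moment m \<le> moment n"
  unfolding moment_def
  by (rule integral_mono[OF moment_integrable moment_integrable])
     (auto simp: unit_disc_iff omega_nonneg intro!: mult_right_mono power_decreasing)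

text \<open>
  The part of the power series of \<open>1 / (1 - z * cnj w)\<close> with exponents \<open>n \<le> k < 2 n\<close>, where \<open>n\<close> is about
  \<open>1 / (2 (1 - |w|))\<close>. For these \<open>k\<close> the numbers \<open>|w| ^ (2 k)\<close> are bounded below, so \<open>f w\<close> is of size \<open>n\<close>, while the norm squared is at most
  \<open>n\<close> times a moment of size \<open>W |w|\<close>. The quotient of the norm squared and \<open>|f w|\<^sup>2\<close> is of size \<open>W |w| / n\<close>, that is, \<open>\<tau> w\<close>.
  Near the origin a constant function serves.
\<close>

lemma test_function:
  obtains B where "0 \<le> B"
    "\<And>w. w \<in> unit_disc \<Longrightarrow> \<exists>f\<in>H. f w \<noteq> 0 \<and> (N f)\<^sup>2 \<le> B * ((cmod (f w))\<^sup>2 * \<tau> w)"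
proof -
  obtain C where C: "0 \<le> C" and mom0: "\<And>n. 1 \<le> n \<Longrightarrow> (\<integral>\<^sup>+z. ennreal (cmod z ^ (2 * n) * \<omega> z) \<partial>disc_area) \<le> ennreal (C * W (1 - 1 / (2 * real n)))"
    using moment_upper by blast
  have mom: "moment n \<le> C * W (1 - 1 / (2 * real n))" if "1 \<le> n" for n
    using mom0[OF that] C W_nonneg unfolding moment_nn by (subst (asm) ennreal_le_iff) auto
  have poly: "\<exists>f\<in>H. (\<forall>z\<in>unit_disc. f z = (\<Sum>n\<in>A. a n * z ^ n)) \<and> (N f)\<^sup>2 \<le> (\<Sum>n\<in>A. (cmod (a n))\<^sup>2 * moment n)"
    if A: "finite A" for A and a :: "nat \<Rightarrow> complex"
  proof -
    define f where "f z = (if z \<in> unit_disc then \<Sum>n\<in>A. a n * z ^ n else 0)" for z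
    define b where "b n = (if n \<in> A then a n else 0)" for n
    have s: "(\<lambda>n. b n * z ^ n) sums f z" if "z \<in> unit_disc" for z
    proof -
      have "(\<lambda>n. b n * z ^ n) sums (\<Sum>n\<in>A. b n * z ^ n)" by (rule sums_finite[OF A]) (auto simp: b_def)
      then show ?thesis using that by (simp add: f_def b_def)
    qed
    have "(\<integral>\<^sup>+z. ennreal ((cmod (f z))\<^sup>2 * \<omega> z) \<partial>disc_area) = (\<Sum>n. ennreal ((cmod (b n))\<^sup>2) * ennreal (moment n))"
      unfolding moment_nn[symmetric] by (rule nn_norm_parseval[OF s])
    also have "\<dots> = (\<Sum>n\<in>A. ennreal ((cmod (b n))\<^sup>2) * ennreal (moment n))"
      by (rule suminf_finite[OF A]) (auto simp: b_def)
    also have "\<dots> = ennreal (\<Sum>n\<in>A. (cmod (a n))\<^sup>2 * moment n)"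
      by (subst sum_ennreal[symmetric]) (auto simp: b_def moment_nonneg ennreal_mult intro!: sum.cong)
    finally have le: "(\<integral>\<^sup>+z. ennreal ((cmod (f z))\<^sup>2 * \<omega> z) \<partial>disc_area) \<le> ennreal (\<Sum>n\<in>A. (cmod (a n))\<^sup>2 * moment n)" by simp
    have "f \<in> H" "(N f)\<^sup>2 \<le> (\<Sum>n\<in>A. (cmod (a n))\<^sup>2 * moment n)"
      by (rule H_memI[OF powser_disc_continuous(1)[OF s] _ le]; auto simp: f_def moment_nonneg intro!: sum_nonneg)+
    moreover have "\<forall>z\<in>unit_disc. f z = (\<Sum>n\<in>A. a n * z ^ n)" by (simp add: f_def)
    ultimately show ?thesis by blast
  qed
  define B1 where "B1 = moment 0 / ((1 / 2) * W (1 / 2))"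
  define B2 where "B2 = 2 * C * exp 24"
  have W2: "0 < W (1/2)" by (rule W_pos) simp
  have B12: "0 \<le> B1" "0 \<le> B2" "0 \<le> max B1 B2"
    using C W2 moment_nonneg[of 0] by (auto simp: B1_def B2_def le_max_iff_disj)
  have "\<exists>f\<in>H. f w \<noteq> 0 \<and> (N f)\<^sup>2 \<le> max B1 B2 * ((cmod (f w))\<^sup>2 * \<tau> w)" if w: "w \<in> unit_disc" for w
  proof (cases "cmod w < 1 / 2")
    case True
    from poly[of "{0}" "\<lambda>_. 1"] obtain f where f: "f \<in> H" "\<And>z. z \<in> unit_disc \<Longrightarrow> f z = 1" "(N f)\<^sup>2 \<le> moment 0" by auto
    have "(1 / 2) * W (1 / 2) \<le> \<tau> w" unfolding \<tau>_def
      using True by (intro mult_mono W_antimono W_nonneg) auto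
    then have "B1 * ((1 / 2) * W (1 / 2)) \<le> max B1 B2 * \<tau> w"
      using W2 B12 by (intro mult_mono) auto
    moreover have "moment 0 = B1 * ((1 / 2) * W (1 / 2))" using W2 by (simp add: B1_def)
    ultimately show ?thesis using f w by (intro bexI[of _ f]) auto
  next
    case False
    define r where "r = cmod w"
    have r: "1 / 2 \<le> r" "r < 1" using False w by (auto simp: r_def unit_disc_iff)
    define n where "n = nat \<lceil>1 / (2 * (1 - r))\<rceil>"
    have n1: "1 / (2 * (1 - r)) \<le> real n" unfolding n_def by linarith
    have n2: "real n \<le> 1 / (2 * (1 - r)) + 1" unfolding n_def using r by (simp add: of_nat_nat)
    have n0: "1 \<le> n" using n1 r by (metis One_nat_def Suc_leI divide_pos_pos diff_gt_0_iff_gt less_le_trans mult_pos_pos of_nat_0_less_iff zero_less_numeral zero_less_one)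
    have n3: "real n * (1 - r) \<le> 3 / 2"
    proof -
      have "real n * (1 - r) \<le> (1 / (2 * (1 - r)) + 1) * (1 - r)" using n2 r by (intro mult_right_mono) auto
      also have "\<dots> = 1 / 2 + (1 - r)" using r by (simp add: field_simps)
      finally show ?thesis using r by simp
    qed
    have n4: "1 \<le> 2 * (real n * (1 - r))" using n1 r by (simp add: field_simps)
    from poly[of "{n..<2*n}" "\<lambda>k. cnj w ^ k"] obtain f where f: "f \<in> H"
      "\<And>z. z \<in> unit_disc \<Longrightarrow> f z = (\<Sum>k\<in>{n..<2*n}. cnj w ^ k * z ^ k)"
      "(N f)\<^sup>2 \<le> (\<Sum>k\<in>{n..<2*n}. (cmod (cnj w ^ k))\<^sup>2 * moment k)" by auto
    have fw: "f w = of_real (\<Sum>k\<in>{n..<2*n}. r ^ (2 * k))"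
    proof -
      have "cnj w ^ k * w ^ k = of_real (r ^ (2 * k))" for k
        by (simp add: r_def power_mult_distrib[symmetric] mult.commute complex_norm_square[symmetric] power_mult[symmetric])
      then show ?thesis using f(2)[OF w] by simp
    qed
    \<comment> \<open>From \<open>exp (- 2 s) \<le> 1 - s\<close> for \<open>s \<le> 1/2\<close> and \<open>n * (1 - r) \<le> 3/2\<close>.\<close>
    have rexp: "exp (- 12) \<le> r ^ (4 * n)"
    proof -
      define s where "s = 1 - r"
      have s: "0 < s" "s \<le> 1 / 2" using r by (auto simp: s_def)
      have "1 \<le> (1 - s) * (1 + 2 * s)" using s by (simp add: algebra_simps)
      also have "\<dots> \<le> (1 - s) * exp (2 * s)" using s exp_ge_add_one_self[of "2 * s"] by (intro mult_left_mono) auto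
      finally have "exp (- (2 * s)) \<le> 1 - s" by (simp add: exp_minus field_simps)
      then have "exp (- (2 * s)) ^ (4 * n) \<le> r ^ (4 * n)" by (intro power_mono) (auto simp: s_def)
      moreover have "exp (- (2 * s)) ^ (4 * n) = exp (- (8 * (real n * (1 - r))))"
        by (simp add: exp_of_nat_mult[symmetric] s_def algebra_simps)
      moreover have "exp (- 12) \<le> exp (- (8 * (real n * (1 - r))))" using n3 by simp
      ultimately show ?thesis by linarith
    qed
    have fw2: "real n * exp (- 12) \<le> cmod (f w)"
    proof -
      have "real n * exp (- 12) = (\<Sum>k\<in>{n..<2*n}. exp (- 12))" by simp
      also have "\<dots> \<le> (\<Sum>k\<in>{n..<2*n}. r ^ (2 * k))"
      proof (rule sum_mono)
        fix k assume "k \<in> {n..<2*n}"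
        then have "r ^ (4 * n) \<le> r ^ (2 * k)" using r by (intro power_decreasing) auto
        then show "exp (- 12) \<le> r ^ (2 * k)" using rexp by simp
      qed
      also have "\<dots> = cmod (f w)" unfolding fw norm_of_real using r by (simp add: sum_nonneg)
      finally show ?thesis .
    qed
    have "(N f)\<^sup>2 \<le> (\<Sum>k\<in>{n..<2*n}. (cmod (cnj w ^ k))\<^sup>2 * moment k)" by (rule f(3))
    also have "\<dots> \<le> (\<Sum>k\<in>{n..<2*n}. 1 * moment n)"
    proof (intro sum_mono mult_mono moment_antimono)
      fix k show "(cmod (cnj w ^ k))\<^sup>2 \<le> 1"
        using r by (simp add: norm_power r_def[symmetric] power_mult[symmetric] power_le_one)
    qed (auto simp: moment_nonneg)
    also have "\<dots> = real n * moment n" by simp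
    also have "\<dots> \<le> real n * (C * W r)"
    proof (intro mult_left_mono order_trans[OF mom[OF n0]] W_antimono)
      have "1 / (2 * real n) \<le> 1 - r" using n4 n0 by (simp add: field_simps)
      then show "r \<le> 1 - 1 / (2 * real n)" by simp
    qed (use C in auto)
    also have "\<dots> \<le> B2 * ((real n * exp (- 12))\<^sup>2 * \<tau> w)"
    proof -
      have "(exp (- 12 :: real))\<^sup>2 = exp (- 24)" by (simp add: exp_double[symmetric])
      then have "B2 * ((real n * exp (- 12))\<^sup>2 * \<tau> w) = 2 * C * (exp 24 * exp (- 24)) * (real n)\<^sup>2 * \<tau> w"
        by (simp add: B2_def power_mult_distrib)
      also have "\<dots> = (2 * (real n * (1 - r))) * (real n * (C * W r))"
        by (simp add: mult_exp_exp \<tau>_def r_def power2_eq_square)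
      also have "\<dots> \<ge> 1 * (real n * (C * W r))"
        using n4 C W_nonneg by (intro mult_right_mono) auto
      finally show ?thesis by simp
    qed
    also have "\<dots> \<le> max B1 B2 * ((cmod (f w))\<^sup>2 * \<tau> w)"
      using fw2 tau_pos[OF w] B12
      by (intro mult_mono power_mono) auto
    finally have le: "(N f)\<^sup>2 \<le> max B1 B2 * ((cmod (f w))\<^sup>2 * \<tau> w)" .
    have "0 < real n * exp (- 12)" using n0 by simp
    then have "0 < cmod (f w)" using fw2 by (rule less_le_trans)
    then show ?thesis using f(1) le by (intro bexI[of _ f]) auto
  qed
  moreover have "0 \<le> max B1 B2" by (rule B12)
  ultimately show ?thesis using that by blast
qed

definition KB :: real where "KB = 8 * CD * CR"

lemma KB_ge: "1 \<le> KB"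
proof -
  have "1 * 1 \<le> CD * CR" using CD(1) CR(1) by (intro mult_mono) auto
  then show ?thesis by (simp add: KB_def)
qed

text \<open>
  In a disc around \<open>z\<close> of half the distance to the circle, the distance to the circle changes by a factor at most
  \<open>2\<close>, hence \<open>\<tau>\<close> and \<open>\<omega>\<close> by bounded factors.
\<close>

lemma ball_half:
  assumes z: "z \<in> unit_disc" and u: "u \<in> ball z ((1 - cmod z) / 2)"
  shows "u \<in> unit_disc" "1 - cmod z \<le> 2 * (1 - cmod u)" "1 - cmod u \<le> 2 * (1 - cmod z)" "\<tau> z \<le> KB * (1 - cmod z)\<^sup>2 * \<omega> u"
proof -
  have d: "cmod (z - u) < (1 - cmod z) / 2" using u by (simp add: dist_norm)
  have t: "cmod u - cmod z \<le> cmod (z - u)" "cmod z - cmod u \<le> cmod (z - u)"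
    using norm_triangle_ineq2[of u z] norm_triangle_ineq2[of z u] by (auto simp: norm_minus_commute)
  have d2: "2 * cmod (z - u) < 1 - cmod z" using d by simp
  show 1: "1 - cmod z \<le> 2 * (1 - cmod u)" using d2 t by (simp add: algebra_simps)
  have z1: "0 < 1 - cmod z" using z by (simp add: unit_disc_iff)
  show u: "u \<in> unit_disc" using 1 z1 by (simp add: unit_disc_iff)
  show 2: "1 - cmod u \<le> 2 * (1 - cmod z)" using d2 t z1 by (simp add: algebra_simps)
  have u1: "0 < 1 - cmod u" using u by (simp add: unit_disc_iff)
  have a: "\<tau> z \<le> 2 * CD * \<tau> u" using tau_compare[OF z u, of 1] 1 by simp
  have "\<tau> u \<le> CR * \<omega> u * (1 - cmod u)\<^sup>2" using omega_tau(2)[OF u] u1 by (simp add: pos_divide_le_eq)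
  also have "\<dots> \<le> CR * \<omega> u * (2 * (1 - cmod z))\<^sup>2"
    using 2 u1 CR(1) omega_nonneg[OF u] by (intro mult_left_mono power_mono) auto
  finally have "2 * CD * \<tau> u \<le> 2 * CD * (CR * \<omega> u * (2 * (1 - cmod z))\<^sup>2)"
    using CD(1) by (intro mult_left_mono) auto
  also have "\<dots> = KB * (1 - cmod z)\<^sup>2 * \<omega> u" unfolding KB_def power_mult_distrib by simp
  finally show "\<tau> z \<le> KB * (1 - cmod z)\<^sup>2 * \<omega> u" using a by linarith
qed

text \<open>
  Near \<open>z\<close> the weight is essentially the constant \<open>\<tau> z / (1 - |z|)\<^sup>2\<close>, so local area integrals of \<open>|f|\<^sup>2\<close> are controlled by the
  norm of \<open>f\<close>.
\<close>

lemma local_norm_compare: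
  assumes z: "z \<in> unit_disc" and \<rho>: "\<rho> \<le> (1 - cmod z) / 2" and f: "f holomorphic_on unit_disc"
  shows "ennreal (\<tau> z) * (\<integral>\<^sup>+u. ennreal ((cmod (f u))\<^sup>2) * indicator (ball z \<rho>) u \<partial>disc_area) \<le>
    ennreal (KB * (1 - cmod z)\<^sup>2) * (\<integral>\<^sup>+u. ennreal ((cmod (f u))\<^sup>2 * \<omega> u) * indicator (ball z \<rho>) u \<partial>disc_area)"
proof -
  have fm[measurable]: "f \<in> borel_measurable disc_area" by (rule holomorphic_measurable[OF f])
  have im[measurable]: "(\<lambda>u. indicator (ball z \<rho>) u :: ennreal) \<in> borel_measurable disc_area"
    by (intro borel_measurable_disc_area_borel borel_measurable_indicator) simp
  have "ennreal (\<tau> z) * (\<integral>\<^sup>+u. ennreal ((cmod (f u))\<^sup>2) * indicator (ball z \<rho>) u \<partial>disc_area) =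
    (\<integral>\<^sup>+u. ennreal (\<tau> z) * (ennreal ((cmod (f u))\<^sup>2) * indicator (ball z \<rho>) u) \<partial>disc_area)"
    by (rule nn_integral_cmult[symmetric]) measurable
  also have "\<dots> \<le> (\<integral>\<^sup>+u. ennreal (KB * (1 - cmod z)\<^sup>2) * (ennreal ((cmod (f u))\<^sup>2 * \<omega> u) * indicator (ball z \<rho>) u) \<partial>disc_area)"
  proof (rule nn_integral_mono)
    fix u
    show "ennreal (\<tau> z) * (ennreal ((cmod (f u))\<^sup>2) * indicator (ball z \<rho>) u) \<le> ennreal (KB * (1 - cmod z)\<^sup>2) * (ennreal ((cmod (f u))\<^sup>2 * \<omega> u) * indicator (ball z \<rho>) u)"
    proof (cases "u \<in> ball z \<rho>")
      case True
      then have u: "u \<in> ball z ((1 - cmod z) / 2)" using \<rho> by auto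
      have "\<tau> z * (cmod (f u))\<^sup>2 \<le> (KB * (1 - cmod z)\<^sup>2 * \<omega> u) * (cmod (f u))\<^sup>2"
        by (rule mult_right_mono[OF ball_half(4)[OF z u]]) simp
      then show ?thesis using True tau_pos[OF z] KB_ge omega_nonneg[OF ball_half(1)[OF z u]]
        by (simp add: ennreal_mult[symmetric] mult_ac ennreal_leI)
    qed simp
  qed
  also have "\<dots> = ennreal (KB * (1 - cmod z)\<^sup>2) * (\<integral>\<^sup>+u. ennreal ((cmod (f u))\<^sup>2 * \<omega> u) * indicator (ball z \<rho>) u \<partial>disc_area)"
    by (rule nn_integral_cmult) measurable
  finally show ?thesis .
qed

lemma point_evaluation:
  assumes f: "f \<in> H" and z: "z \<in> unit_disc"
  shows "(cmod (f z))\<^sup>2 * \<tau> z \<le> 4 * KB * (N f)\<^sup>2"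
proof -
  define \<rho> where "\<rho> = (1 - cmod z) / 2"
  have \<rho>: "0 < \<rho>" using z by (simp add: \<rho>_def unit_disc_iff)
  have sub: "ball z \<rho> \<subseteq> unit_disc" using ball_half(1)[OF z] by (auto simp: \<rho>_def)
  have "ennreal (\<tau> z) * ennreal ((cmod (f z))\<^sup>2 * \<rho>\<^sup>2) \<le> ennreal (\<tau> z) * (\<integral>\<^sup>+u. ennreal ((cmod (f u))\<^sup>2) * indicator (ball z \<rho>) u \<partial>disc_area)"
    using taylor_coeff_L2_bound[OF H_holomorphic[OF f] \<rho> sub, of 0] by (intro mult_left_mono) (auto simp: power2_eq_square)
  also have "\<dots> \<le> ennreal (KB * (1 - cmod z)\<^sup>2) * (\<integral>\<^sup>+u. ennreal ((cmod (f u))\<^sup>2 * \<omega> u) * indicator (ball z \<rho>) u \<partial>disc_area)"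
    by (rule local_norm_compare[OF z _ H_holomorphic[OF f]]) (simp add: \<rho>_def)
  also have "\<dots> \<le> ennreal (KB * (1 - cmod z)\<^sup>2) * ennreal ((N f)\<^sup>2)"
    unfolding norm_sq_nn[OF f, symmetric] by (intro mult_left_mono nn_integral_mono) (auto simp: indicator_def)
  finally have "\<tau> z * ((cmod (f z))\<^sup>2 * \<rho>\<^sup>2) \<le> KB * (1 - cmod z)\<^sup>2 * (N f)\<^sup>2"
    using tau_pos[OF z] KB_ge by (simp add: ennreal_mult[symmetric])
  also have "(1 - cmod z)\<^sup>2 = 4 * \<rho>\<^sup>2" by (simp add: \<rho>_def power2_eq_square)
  finally have "(\<tau> z * (cmod (f z))\<^sup>2) * \<rho>\<^sup>2 \<le> (4 * KB * (N f)\<^sup>2) * \<rho>\<^sup>2" by (simp add: mult_ac)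
  then have "\<tau> z * (cmod (f z))\<^sup>2 \<le> 4 * KB * (N f)\<^sup>2" using \<rho> by simp
  then show ?thesis by (simp add: mult.commute)
qed

end

section \<open>Hilbert space structure\<close>

context regular_radial_weight
begin

definition ip :: "(complex \<Rightarrow> complex) \<Rightarrow> (complex \<Rightarrow> complex) \<Rightarrow> complex" where
  "ip f g = (\<integral>z. f z * cnj (g z) * of_real (\<omega> z) \<partial>disc_area)"

lemma H_lincomb: 
  assumes f: "f \<in> H" and g: "g \<in> H" shows "(\<lambda>z. a * f z + b * g z) \<in> H"
proof -
  have fm: "f \<in> borel_measurable disc_area" "g \<in> borel_measurable disc_area" using f g by (auto intro: H_measurable)
  have "integrable disc_area (\<lambda>z. (cmod (a * f z + b * g z))\<^sup>2 * \<omega> z)"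
  proof (rule Bochner_Integration.integrable_bound)
    show "integrable disc_area (\<lambda>z. (2 * (cmod a)\<^sup>2) * ((cmod (f z))\<^sup>2 * \<omega> z) + (2 * (cmod b)\<^sup>2) * ((cmod (g z))\<^sup>2 * \<omega> z))"
      using H_integrable[OF f] H_integrable[OF g] by auto
    show "(\<lambda>z. (cmod (a * f z + b * g z))\<^sup>2 * \<omega> z) \<in> borel_measurable disc_area" using fm by measurable
    show "AE z in disc_area. norm ((cmod (a * f z + b * g z))\<^sup>2 * \<omega> z) \<le> norm ((2 * (cmod a)\<^sup>2) * ((cmod (f z))\<^sup>2 * \<omega> z) + (2 * (cmod b)\<^sup>2) * ((cmod (g z))\<^sup>2 * \<omega> z))"
    proof (rule AE_I2)
      fix z assume "z \<in> space disc_area"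
      then have w: "0 \<le> \<omega> z" by (simp add: omega_nonneg)
      have "(cmod (a * f z + b * g z))\<^sup>2 \<le> (cmod (a * f z) + cmod (b * g z))\<^sup>2"
        by (intro power_mono norm_triangle_ineq) simp
      also have "\<dots> \<le> 2 * (cmod (a * f z))\<^sup>2 + 2 * (cmod (b * g z))\<^sup>2" using sum_squares_bound[of "cmod (a * f z)" "cmod (b * g z)"] by (simp add: power2_sum)
      finally have "(cmod (a * f z + b * g z))\<^sup>2 * \<omega> z \<le> (2 * (cmod (a * f z))\<^sup>2 + 2 * (cmod (b * g z))\<^sup>2) * \<omega> z"
        using w by (rule mult_right_mono)
      then show "norm ((cmod (a * f z + b * g z))\<^sup>2 * \<omega> z) \<le> norm ((2 * (cmod a)\<^sup>2) * ((cmod (f z))\<^sup>2 * \<omega> z) + (2 * (cmod b)\<^sup>2) * ((cmod (g z))\<^sup>2 * \<omega> z))"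
        using w by (simp add: norm_mult power_mult_distrib algebra_simps)
    qed
  qed
  then show ?thesis using f g by (auto simp: bergman_space_def intro!: holomorphic_intros)
qed

lemma H_diff: "f \<in> H \<Longrightarrow> g \<in> H \<Longrightarrow> (\<lambda>z. f z - g z) \<in> H" using H_lincomb[of f g 1 "-1"] by simp
lemma H_scale: "f \<in> H \<Longrightarrow> (\<lambda>z. a * f z) \<in> H" using H_lincomb[of f f a 0] by simp
lemma H_zero: "(\<lambda>z. 0) \<in> H" by (auto simp: bergman_space_def)
lemma H_sum: "(\<And>i. i \<in> A \<Longrightarrow> e i \<in> H) \<Longrightarrow> (\<lambda>z. \<Sum>i\<in>A. c i * e i z) \<in> H"
proof (induction A rule: infinite_finite_induct)
  case (insert x F)
  then have "(\<lambda>z. c x * e x z + 1 * (\<Sum>i\<in>F. c i * e i z)) \<in> H" by (intro H_lincomb) auto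
  then show ?case using insert by simp
qed (auto intro: H_zero)

lemma ip_integrable:
  assumes f: "f \<in> H" and g: "g \<in> H"
  shows "integrable disc_area (\<lambda>z. f z * cnj (g z) * of_real (\<omega> z))"
proof (rule Bochner_Integration.integrable_bound)
  have fm: "f \<in> borel_measurable disc_area" "g \<in> borel_measurable disc_area" using f g by (auto intro: H_measurable)
  have cm: "cnj \<in> borel_measurable borel" by (intro borel_measurable_continuous_onI continuous_intros)
  have gm: "(\<lambda>z. cnj (g z)) \<in> borel_measurable disc_area" using measurable_compose[OF fm(2) cm] .
  show "integrable disc_area (\<lambda>z. ((cmod (f z))\<^sup>2 * \<omega> z) + ((cmod (g z))\<^sup>2 * \<omega> z))"
    using H_integrable[OF f] H_integrable[OF g] by auto
  show "(\<lambda>z. f z * cnj (g z) * of_real (\<omega> z)) \<in> borel_measurable disc_area" using fm gm by measurable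
  show "AE z in disc_area. norm (f z * cnj (g z) * of_real (\<omega> z)) \<le> norm (((cmod (f z))\<^sup>2 * \<omega> z) + ((cmod (g z))\<^sup>2 * \<omega> z))"
  proof (rule AE_I2)
    fix z assume "z \<in> space disc_area"
    then have w: "0 \<le> \<omega> z" by (simp add: omega_nonneg)
    have "cmod (f z) * cmod (g z) \<le> (cmod (f z))\<^sup>2 + (cmod (g z))\<^sup>2"
      using sum_squares_bound[of "cmod (f z)" "cmod (g z)"] by (simp add: mult.assoc) (smt (verit) mult_nonneg_nonneg norm_ge_zero)
    then have "cmod (f z) * cmod (g z) * \<omega> z \<le> ((cmod (f z))\<^sup>2 + (cmod (g z))\<^sup>2) * \<omega> z"
      using w by (rule mult_right_mono)
    then show "norm (f z * cnj (g z) * of_real (\<omega> z)) \<le> norm (((cmod (f z))\<^sup>2 * \<omega> z) + ((cmod (g z))\<^sup>2 * \<omega> z))"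
      using w by (simp add: norm_mult distrib_right)
  qed
qed

lemma ip_lincomb:
  assumes "f \<in> H" "g \<in> H" "h \<in> H"
  shows "ip (\<lambda>z. a * f z + b * g z) h = a * ip f h + b * ip g h"
proof -
  have "ip (\<lambda>z. a * f z + b * g z) h = (\<integral>z. a * (f z * cnj (h z) * of_real (\<omega> z)) + b * (g z * cnj (h z) * of_real (\<omega> z)) \<partial>disc_area)"
    unfolding ip_def by (intro Bochner_Integration.integral_cong refl) (simp add: algebra_simps)
  also have "\<dots> = a * ip f h + b * ip g h"
    unfolding ip_def using ip_integrable[OF assms(1,3)] ip_integrable[OF assms(2,3)] by simp
  finally show ?thesis .
qed

lemma ip_cnj: "ip g f = cnj (ip f g)"
proof -
  have "cnj (ip f g) = (\<integral>z. cnj (f z * cnj (g z) * of_real (\<omega> z)) \<partial>disc_area)" unfolding ip_def by (rule Bochner_Integration.integral_cnj[symmetric])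
  then show ?thesis by (simp add: ip_def mult_ac)
qed

lemma ip_self: "ip f f = of_real ((N f)\<^sup>2)"
proof -
  have "ip f f = (\<integral>z. of_real ((cmod (f z))\<^sup>2 * \<omega> z) \<partial>disc_area)"
    unfolding ip_def by (simp only: of_real_mult complex_norm_square)
  then show ?thesis unfolding norm_sq integral_complex_of_real .
qed

lemma ip_zero[simp]: "ip (\<lambda>z. 0) g = 0" "ip g (\<lambda>z. 0) = 0" by (simp_all add: ip_def)

lemma ip_sum:
  assumes "\<And>i. i \<in> A \<Longrightarrow> e i \<in> H" and h: "h \<in> H"
  shows "ip (\<lambda>z. \<Sum>i\<in>A. c i * e i z) h = (\<Sum>i\<in>A. c i * ip (e i) h)"
  using assms(1)
proof (induction A rule: infinite_finite_induct)
  case (insert x F)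
  have "ip (\<lambda>z. c x * e x z + 1 * (\<Sum>i\<in>F. c i * e i z)) h = c x * ip (e x) h + 1 * ip (\<lambda>z. \<Sum>i\<in>F. c i * e i z) h"
    by (rule ip_lincomb) (use insert h in \<open>auto intro!: H_sum\<close>)
  then show ?case using insert by simp
qed auto

text \<open>
  Point evaluations are bounded, so a function of norm \<open>0\<close> vanishes at every point.
\<close>

lemma norm_zero_iff:
  assumes f: "f \<in> H" shows "N f = 0 \<longleftrightarrow> f = (\<lambda>z. 0)"
proof
  assume 0: "N f = 0"
  show "f = (\<lambda>z. 0)"
  proof
    fix z show "f z = 0"
    proof (cases "z \<in> unit_disc")
      case True
      have "(cmod (f z))\<^sup>2 * \<tau> z \<le> 0" using point_evaluation[OF f True] 0 by simp
      then show ?thesis using tau_pos[OF True] by (simp add: mult_le_0_iff)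
    qed (use H_outside[OF f] in auto)
  qed
qed (simp add: bergman_norm_def)

lemma norm_zero[simp]: "N (\<lambda>z. 0) = 0" by (simp add: bergman_norm_def)

lemma norm_lincomb_sq:
  assumes f: "f \<in> H" and g: "g \<in> H"
  shows "(N (\<lambda>z. f z + c * g z))\<^sup>2 = (N f)\<^sup>2 + 2 * Re (cnj c * ip f g) + (cmod c)\<^sup>2 * (N g)\<^sup>2"
proof -
  let ?h = "\<lambda>z. 1 * f z + c * g z"
  have h: "?h \<in> H" by (rule H_lincomb[OF f g])
  have "ip ?h ?h = ip f ?h + c * ip g ?h" using ip_lincomb[OF f g h, of 1 c] by simp
  also have "ip f ?h = cnj (ip ?h f)" by (rule ip_cnj)
  also have "ip ?h f = ip f f + c * ip g f" using ip_lincomb[OF f g f, of 1 c] by simp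
  also have "ip g ?h = cnj (ip ?h g)" by (rule ip_cnj)
  also have "ip ?h g = ip f g + c * ip g g" using ip_lincomb[OF f g g, of 1 c] by simp
  also have "ip g f = cnj (ip f g)" by (rule ip_cnj)
  finally have "of_real ((N ?h)\<^sup>2) = cnj (of_real ((N f)\<^sup>2) + c * cnj (ip f g)) + c * cnj (ip f g + c * of_real ((N g)\<^sup>2))"
    unfolding ip_self by simp
  then have "Re (of_real ((N ?h)\<^sup>2)) = Re (cnj (of_real ((N f)\<^sup>2) + c * cnj (ip f g)) + c * cnj (ip f g + c * of_real ((N g)\<^sup>2)))"
    by simp
  then show ?thesis by (simp add: algebra_simps cmod_power2) (simp add: power2_eq_square algebra_simps)
qed

lemma Cauchy_Schwarz:
  assumes f: "f \<in> H" and g: "g \<in> H" shows "cmod (ip f g) \<le> N f * N g"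
proof (cases "N g = 0")
  case True
  then have "g = (\<lambda>z. 0)" using norm_zero_iff[OF g] by simp
  then show ?thesis using norm_nonneg by simp
next
  case False
  define c where "c = - ip f g / of_real ((N g)\<^sup>2)"
  have "0 \<le> (N (\<lambda>z. f z + c * g z))\<^sup>2" by simp
  also have "\<dots> = (N f)\<^sup>2 + 2 * Re (cnj c * ip f g) + (cmod c)\<^sup>2 * (N g)\<^sup>2" by (rule norm_lincomb_sq[OF f g])
  also have "Re (cnj c * ip f g) = - (cmod (ip f g))\<^sup>2 / (N g)\<^sup>2"
  proof -
    have "cnj c * ip f g = - (of_real ((cmod (ip f g))\<^sup>2) / of_real ((N g)\<^sup>2))"
      unfolding c_def complex_norm_square by (simp add: mult.commute)
    also have "\<dots> = of_real (- (cmod (ip f g))\<^sup>2 / (N g)\<^sup>2)" by simp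
    finally show ?thesis by (simp only: Re_complex_of_real)
  qed
  also have "(cmod c)\<^sup>2 * (N g)\<^sup>2 = (cmod (ip f g))\<^sup>2 / (N g)\<^sup>2"
  proof -
    have "cmod c = cmod (ip f g) / (N g)\<^sup>2" unfolding c_def norm_divide norm_minus_cancel norm_of_real by simp
    then show ?thesis using False by (simp add: power_divide power2_eq_square)
  qed
  finally have "(cmod (ip f g))\<^sup>2 / (N g)\<^sup>2 \<le> (N f)\<^sup>2" by simp
  then have "(cmod (ip f g))\<^sup>2 \<le> (N f * N g)\<^sup>2" using False by (simp add: pos_divide_le_eq power_mult_distrib)
  then show ?thesis by (rule power2_le_imp_le) (simp add: norm_nonneg)
qed

lemma norm_add_le:
  assumes f: "f \<in> H" and g: "g \<in> H" shows "N (\<lambda>z. f z + g z) \<le> N f + N g"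
proof (rule power2_le_imp_le)
  have "(N (\<lambda>z. f z + 1 * g z))\<^sup>2 = (N f)\<^sup>2 + 2 * Re (cnj 1 * ip f g) + (cmod 1)\<^sup>2 * (N g)\<^sup>2" by (rule norm_lincomb_sq[OF f g])
  also have "Re (cnj 1 * ip f g) \<le> N f * N g" using Cauchy_Schwarz[OF f g] complex_Re_le_cmod[of "ip f g"] by simp
  finally show "(N (\<lambda>z. f z + g z))\<^sup>2 \<le> (N f + N g)\<^sup>2" by (simp add: power2_sum)
qed (simp add: norm_nonneg)

lemma norm_scale: "N (\<lambda>z. c * f z) = cmod c * N f"
proof -
  have "(N (\<lambda>z. c * f z))\<^sup>2 = (cmod c * N f)\<^sup>2"
    unfolding norm_sq power_mult_distrib by (simp add: norm_mult power_mult_distrib mult.assoc)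
  then show ?thesis using norm_nonneg by (simp add: power2_eq_iff_nonneg)
qed

lemma norm_minus: "N (\<lambda>z. g z - f z) = N (\<lambda>z. f z - g z)"
  by (simp add: bergman_norm_def norm_minus_commute)

lemma norm_diff_triangle:
  assumes "f \<in> H" "g \<in> H" "h \<in> H" shows "N (\<lambda>z. f z - h z) \<le> N (\<lambda>z. f z - g z) + N (\<lambda>z. g z - h z)"
  using norm_add_le[OF H_diff[OF assms(1,2)] H_diff[OF assms(2,3)]] by simp

definition has_coeffs :: "(nat \<Rightarrow> complex) \<Rightarrow> (complex \<Rightarrow> complex) \<Rightarrow> bool" where
  "has_coeffs a f \<longleftrightarrow> (\<forall>z\<in>unit_disc. (\<lambda>n. a n * z ^ n) sums f z) \<and> (\<forall>z. z \<notin> unit_disc \<longrightarrow> f z = 0)"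

lemma has_coeffs_ex: "f \<in> H \<Longrightarrow> \<exists>a. has_coeffs a f"
proof -
  assume f: "f \<in> H"
  have "(\<lambda>n. (deriv ^^ n) f 0 / fact n * z ^ n) sums f z" if "z \<in> unit_disc" for z
    using holomorphic_power_series[of f 0 1 z] H_holomorphic[OF f] that by (simp add: unit_disc_def)
  then show ?thesis using H_outside[OF f]
    by (intro exI[of _ "\<lambda>n. (deriv ^^ n) f 0 / fact n"]) (simp add: has_coeffs_def)
qed

lemma has_coeffs_diff: "has_coeffs a f \<Longrightarrow> has_coeffs b g \<Longrightarrow> has_coeffs (\<lambda>n. a n - b n) (\<lambda>z. f z - g z)"
  by (auto simp: has_coeffs_def left_diff_distrib intro: sums_diff)

definition mon :: "nat \<Rightarrow> complex \<Rightarrow> complex" where "mon n z = (if z \<in> unit_disc then z ^ n else 0)"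

lemma has_coeffs_poly: "has_coeffs (\<lambda>n. if n < M then a n else 0) (\<lambda>z. \<Sum>n<M. a n * mon n z)"
proof -
  have "(\<lambda>n. (if n < M then a n else 0) * z ^ n) sums (\<Sum>n<M. a n * mon n z)" if z: "z \<in> unit_disc" for z
  proof -
    have "(\<lambda>n. (if n < M then a n else 0) * z ^ n) sums (\<Sum>n<M. (if n < M then a n else 0) * z ^ n)"
      by (rule sums_finite) auto
    then show ?thesis using z by (simp add: mon_def)
  qed
  then show ?thesis by (auto simp: has_coeffs_def mon_def)
qed

text \<open>
  The Bergman space is a weighted sequence space of Taylor coefficients.
\<close>

lemma parseval_H:
  assumes a: "has_coeffs a f"
  shows "f \<in> H \<longleftrightarrow> summable (\<lambda>n. (cmod (a n))\<^sup>2 * moment n)"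
    and "f \<in> H \<Longrightarrow> (\<lambda>n. (cmod (a n))\<^sup>2 * moment n) sums (N f)\<^sup>2"
proof -
  have s: "\<And>z. z \<in> unit_disc \<Longrightarrow> (\<lambda>n. a n * z ^ n) sums f z" and o: "\<And>z. z \<notin> unit_disc \<Longrightarrow> f z = 0"
    using a by (auto simp: has_coeffs_def)
  have eq: "(\<integral>\<^sup>+z. ennreal ((cmod (f z))\<^sup>2 * \<omega> z) \<partial>disc_area) = (\<Sum>n. ennreal ((cmod (a n))\<^sup>2 * moment n))"
    using nn_norm_parseval[OF s] by (simp add: moment_nn ennreal_mult moment_nonneg)
  show 2: "(\<lambda>n. (cmod (a n))\<^sup>2 * moment n) sums (N f)\<^sup>2" if f: "f \<in> H"
  proof -
    have "(\<Sum>n. ennreal ((cmod (a n))\<^sup>2 * moment n)) = ennreal ((N f)\<^sup>2)" using eq norm_sq_nn[OF f] by simp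
    moreover have "(\<lambda>n. ennreal ((cmod (a n))\<^sup>2 * moment n)) sums (\<Sum>n. ennreal ((cmod (a n))\<^sup>2 * moment n))"
      by (intro summable_sums summableI)
    ultimately have "(\<lambda>n. ennreal ((cmod (a n))\<^sup>2 * moment n)) sums ennreal ((N f)\<^sup>2)" by simp
    then show ?thesis by (subst (asm) sums_ennreal) (auto simp: moment_nonneg)
  qed
  show "f \<in> H \<longleftrightarrow> summable (\<lambda>n. (cmod (a n))\<^sup>2 * moment n)"
  proof
    show "f \<in> H \<Longrightarrow> summable (\<lambda>n. (cmod (a n))\<^sup>2 * moment n)" using 2 by (auto simp: sums_iff)
    assume sm: "summable (\<lambda>n. (cmod (a n))\<^sup>2 * moment n)"
    have "(\<integral>\<^sup>+z. ennreal ((cmod (f z))\<^sup>2 * \<omega> z) \<partial>disc_area) = ennreal (\<Sum>n. (cmod (a n))\<^sup>2 * moment n)"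
      unfolding eq by (rule suminf_ennreal2[OF _ sm]) (auto simp: moment_nonneg)
    then show "f \<in> H"
      by (intro H_memI(1)[OF powser_disc_continuous(1)[OF s] o, where B="\<Sum>n. (cmod (a n))\<^sup>2 * moment n"])
         (auto intro!: suminf_nonneg sm simp: moment_nonneg)
  qed
qed

lemma mon_H: "mon n \<in> H"
proof -
  have "(\<lambda>k. (if k = n then 1 else 0) * z ^ k) sums mon n z" if "z \<in> unit_disc" for z
    using sums_single[of n "\<lambda>k. z ^ k"] that by (simp add: mon_def if_distrib[of "\<lambda>x. x * _"] cong: if_cong)
  then have c: "has_coeffs (\<lambda>k. if k = n then 1 else 0) (mon n)" by (auto simp: has_coeffs_def mon_def)
  have "summable (\<lambda>k. (cmod (if k = n then 1 else 0))\<^sup>2 * moment k)"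
    by (rule summable_finite[of "{n}"]) auto
  then show "mon n \<in> H" using parseval_H(1)[OF c] by simp
qed

lemma ip_mon: "ip (mon n) (mon m) = (if n = m then of_real (moment n) else 0)"
proof (cases "n = m")
  case True
  have "ip (mon n) (mon n) = (\<integral>z. of_real (cmod z ^ (2 * n) * \<omega> z) \<partial>disc_area)"
    unfolding ip_def
  proof (rule Bochner_Integration.integral_cong[OF refl])
    fix z assume "z \<in> space disc_area"
    then have "mon n z * cnj (mon n z) = of_real ((cmod (z ^ n))\<^sup>2)" unfolding complex_norm_square by (simp add: mon_def)
    then show "mon n z * cnj (mon n z) * of_real (\<omega> z) = of_real (cmod z ^ (2 * n) * \<omega> z)"
      by (simp add: norm_power power_mult mult.commute flip: power_mult)
  qed
  then show ?thesis using True unfolding integral_complex_of_real moment_def by simp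
next
  case False
  have "ip (mon n) (mon m) = (\<integral>z. z ^ n * cnj z ^ m * of_real (\<omega> z) \<partial>disc_area)"
    unfolding ip_def by (rule Bochner_Integration.integral_cong) (auto simp: mon_def)
  also have "\<dots> = 0" by (rule radial_monomials_orthogonal[OF omega_integrable omega_radial False])
  finally show ?thesis using False by simp
qed

text \<open>
  The boundedness of the evaluation at \<open>z\<close>, tested on the monomial of degree \<open>n\<close>.
\<close>

lemma moment_lower:
  assumes z: "z \<in> unit_disc" shows "cmod z ^ (2 * n) * \<tau> z \<le> 4 * KB * moment n"
proof -
  have "(N (mon n))\<^sup>2 = moment n" using ip_mon[of n n] ip_self[of "mon n"] by (metis of_real_eq_iff)
  then show ?thesis using point_evaluation[OF mon_H z, of n] z by (simp add: mon_def norm_power power_mult[symmetric] mult.commute)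
qed

lemma moment_pos: "0 < moment n"
proof -
  have "0 < (1/2) ^ (2 * n) * \<tau> (1/2)" using tau_pos[of "1/2"] by (simp add: unit_disc_iff)
  also have "\<dots> \<le> 4 * KB * moment n" using moment_lower[of "1/2" n] by (simp add: unit_disc_iff norm_divide)
  finally show ?thesis using KB_ge by (simp add: zero_less_mult_iff)
qed

text \<open>
  A square summable sequence of coefficients defines a convergent power series because \<open>moment_lower\<close> makes the
  moments decay more slowly than \<open>r ^ (2 n)\<close> for every \<open>r < 1\<close>.
\<close>

lemma Riesz_Fischer:
  assumes s: "summable (\<lambda>n. (cmod (a n))\<^sup>2 * moment n)"
  shows "\<exists>f\<in>H. has_coeffs a f"
proof -
  define B where "B = (\<Sum>n. (cmod (a n))\<^sup>2 * moment n)"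
  have B: "(cmod (a n))\<^sup>2 * moment n \<le> B" for n
    unfolding B_def using sum_le_suminf[OF s, of "{n}"] by (simp add: moment_nonneg)
  have sm: "summable (\<lambda>n. a n * z ^ n)" if z: "z \<in> unit_disc" for z
  proof -
    \<comment> \<open>The coefficients are bounded by a multiple of \<open>r ^ (- n)\<close>, which leaves a geometric series of ratio \<open>|z| / r\<close>.\<close>
    obtain r where r: "cmod z < r" "r < 1" using dense z by (auto simp: unit_disc_iff)
    have r0: "0 < r" using r by (meson le_less_trans norm_ge_zero)
    have rd: "complex_of_real r \<in> unit_disc" using r r0 by (simp add: unit_disc_iff)
    define K where "K = sqrt (B * (4 * KB) / \<tau> (complex_of_real r))"
    have le: "cmod (a n) * r ^ n \<le> K" for n
    proof -
      have "(cmod (a n))\<^sup>2 * (r ^ (2 * n) * \<tau> (of_real r)) \<le> (cmod (a n))\<^sup>2 * (4 * KB * moment n)"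
        using moment_lower[OF rd, of n] r0 by (intro mult_left_mono) auto
      also have "\<dots> \<le> B * (4 * KB)" using B[of n] KB_ge by (simp add: mult_ac mult_left_mono)
      finally have "(cmod (a n) * r ^ n)\<^sup>2 \<le> B * (4 * KB) / \<tau> (of_real r)"
        using tau_pos[OF rd] by (simp add: pos_le_divide_eq power_mult_distrib power_mult[symmetric] mult_ac)
      then have "sqrt ((cmod (a n) * r ^ n)\<^sup>2) \<le> K" unfolding K_def by (rule real_sqrt_le_mono)
      then show ?thesis using r0 by simp
    qed
    show ?thesis
    proof (rule summable_comparison_test')
      show "summable (\<lambda>n. K * (cmod z / r) ^ n)" using r r0 by (intro summable_mult summable_geometric) (simp add: divide_less_eq)
      fix n
      have "norm (a n * z ^ n) = (cmod (a n) * r ^ n) * (cmod z / r) ^ n"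
        using r0 by (simp add: norm_mult norm_power power_divide)
      also have "\<dots> \<le> K * (cmod z / r) ^ n" using le r0 by (intro mult_right_mono) auto
      finally show "norm (a n * z ^ n) \<le> K * (cmod z / r) ^ n" .
    qed
  qed
  define f where "f z = (if z \<in> unit_disc then \<Sum>n. a n * z ^ n else 0)" for z
  have c: "has_coeffs a f" using sm by (auto simp: has_coeffs_def f_def summable_sums)
  then show ?thesis using parseval_H(1)[OF c] s by blast
qed

lemma truncation_tendsto:
  assumes f: "f \<in> H" and a: "has_coeffs a f"
  shows "(\<lambda>M. N (\<lambda>z. f z - (\<Sum>n<M. a n * mon n z))) \<longlonglongrightarrow> 0"
proof -
  let ?t = "\<lambda>n. (cmod (a n))\<^sup>2 * moment n"
  have s: "?t sums (N f)\<^sup>2" by (rule parseval_H(2)[OF a f])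
  have "(N (\<lambda>z. f z - (\<Sum>n<M. a n * mon n z)))\<^sup>2 = (N f)\<^sup>2 - (\<Sum>n<M. ?t n)" for M
  proof -
    have d: "(\<lambda>z. f z - (\<Sum>n<M. a n * mon n z)) \<in> H" by (intro H_diff f H_sum mon_H)
    have h1: "(\<lambda>n. (cmod (a n - (if n < M then a n else 0)))\<^sup>2 * moment n) sums (N (\<lambda>z. f z - (\<Sum>n<M. a n * mon n z)))\<^sup>2"
      by (rule parseval_H(2)[OF has_coeffs_diff[OF a has_coeffs_poly] d])
    have h2: "(\<lambda>n. ?t n - (if n \<in> {..<M} then ?t n else 0)) sums ((N f)\<^sup>2 - (\<Sum>n<M. ?t n))"
      by (intro sums_diff s sums_If_finite_set) auto
    have h3: "(\<lambda>n. ?t n - (if n \<in> {..<M} then ?t n else 0)) = (\<lambda>n. (cmod (a n - (if n < M then a n else 0)))\<^sup>2 * moment n)" by auto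
    show ?thesis by (rule sums_unique2[OF h1 h2[unfolded h3]])
  qed
  moreover have "(\<lambda>M. (N f)\<^sup>2 - (\<Sum>n<M. ?t n)) \<longlonglongrightarrow> (N f)\<^sup>2 - (N f)\<^sup>2" using s unfolding sums_def by (intro tendsto_intros)
  ultimately have "(\<lambda>M. (N (\<lambda>z. f z - (\<Sum>n<M. a n * mon n z)))\<^sup>2) \<longlonglongrightarrow> 0" by simp
  then have "(\<lambda>M. sqrt ((N (\<lambda>z. f z - (\<Sum>n<M. a n * mon n z)))\<^sup>2)) \<longlonglongrightarrow> sqrt 0" by (rule tendsto_real_sqrt)
  then show ?thesis by (simp add: norm_nonneg)
qed

text \<open>
  A bounded linear functional is determined by its values on monomials, since the Taylor polynomials converge
  to \<open>f\<close> in norm.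
\<close>

lemma functional_coefficient_series:
  assumes L: "\<And>f g a b. f \<in> H \<Longrightarrow> g \<in> H \<Longrightarrow> L (\<lambda>z. a * f z + b * g z) = a * L f + b * L g"
    and B: "\<And>f. f \<in> H \<Longrightarrow> cmod (L f) \<le> B * N f"
    and f: "f \<in> H" and a: "has_coeffs a f"
  shows "(\<lambda>n. a n * L (mon n)) sums L f"
proof -
  have Ls: "L (\<lambda>z. \<Sum>n<M. a n * mon n z) = (\<Sum>n<M. a n * L (mon n))" for M
  proof (induction M)
    case 0
    have "L (\<lambda>z. 0 * mon 0 z + 0 * mon 0 z) = 0 * L (mon 0) + 0 * L (mon 0)" by (intro L mon_H)
    then show ?case by simp
  next
    case (Suc M)
    have "L (\<lambda>z. 1 * (\<Sum>n<M. a n * mon n z) + a M * mon M z) = 1 * L (\<lambda>z. \<Sum>n<M. a n * mon n z) + a M * L (mon M)"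
      by (intro L mon_H H_sum)
    then show ?case using Suc by simp
  qed
  have "(\<lambda>M. L f - (\<Sum>n<M. a n * L (mon n))) \<longlonglongrightarrow> 0"
  proof (rule Lim_null_comparison)
    show "\<forall>\<^sub>F M in sequentially. norm (L f - (\<Sum>n<M. a n * L (mon n))) \<le> B * N (\<lambda>z. f z - (\<Sum>n<M. a n * mon n z))"
    proof (rule always_eventually, rule allI)
      fix M
      have sH: "(\<lambda>z. \<Sum>n<M. a n * mon n z) \<in> H" by (intro H_sum mon_H)
      have "L f - (\<Sum>n<M. a n * L (mon n)) = L (\<lambda>z. 1 * f z + (-1) * (\<Sum>n<M. a n * mon n z))"
        unfolding L[OF f sH] Ls by simp
      also have "\<dots> = L (\<lambda>z. f z - (\<Sum>n<M. a n * mon n z))" by simp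
      finally show "norm (L f - (\<Sum>n<M. a n * L (mon n))) \<le> B * N (\<lambda>z. f z - (\<Sum>n<M. a n * mon n z))"
        using B[OF H_diff[OF f sH]] by simp
    qed
    show "(\<lambda>M. B * N (\<lambda>z. f z - (\<Sum>n<M. a n * mon n z))) \<longlonglongrightarrow> 0"
      using tendsto_mult_left[OF truncation_tendsto[OF f a], of B] by simp
  qed
  then have "(\<lambda>M. L f - (L f - (\<Sum>n<M. a n * L (mon n)))) \<longlonglongrightarrow> L f - 0" by (intro tendsto_intros)
  then show ?thesis by (simp add: sums_def)
qed

lemma ip_series:
  assumes f: "f \<in> H" and g: "g \<in> H" and a: "has_coeffs a f"
  shows "(\<lambda>n. a n * ip (mon n) g) sums ip f g"
proof (rule functional_coefficient_series[where L="\<lambda>f. ip f g" and B="N g", OF _ _ f a])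
  show "ip (\<lambda>z. a * f z + b * h z) g = a * ip f g + b * ip h g" if "f \<in> H" "h \<in> H" for f h a b
    by (rule ip_lincomb[OF that g])
  show "cmod (ip f g) \<le> N g * N f" if "f \<in> H" for f using Cauchy_Schwarz[OF that g] by (simp add: mult.commute)
qed

lemma ip_mon_coeff:
  assumes g: "g \<in> H" and c: "has_coeffs c g" shows "ip (mon n) g = cnj (c n) * of_real (moment n)"
proof -
  have h1: "(\<lambda>k. c k * ip (mon k) (mon n)) sums ip g (mon n)" by (rule ip_series[OF g mon_H c])
  have h2: "(\<lambda>k. c k * ip (mon k) (mon n)) = (\<lambda>k. if k = n then c k * of_real (moment k) else 0)" by (auto simp: ip_mon)
  have h3: "(\<lambda>k. if k = n then c k * of_real (moment k) else 0) sums (c n * of_real (moment n))" by (rule sums_single)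
  have "ip g (mon n) = c n * of_real (moment n)" by (rule sums_unique2[OF h1[unfolded h2] h3])
  then show ?thesis using ip_cnj[of "mon n" g] by simp
qed

text \<open>
  The representing function has the coefficients \<open>cnj (L (mon n)) / moment n\<close>. Testing \<open>L\<close> on the polynomial with
  these coefficients shows that their partial norms squared \<open>T\<close> satisfy \<open>T \<le> |B| * sqrt T\<close>, so they are square summable
  and \<open>Riesz_Fischer\<close> supplies the function.
\<close>

theorem Riesz_representation:
  assumes L: "\<And>f g a b. f \<in> H \<Longrightarrow> g \<in> H \<Longrightarrow> L (\<lambda>z. a * f z + b * g z) = a * L f + b * L g"
    and B: "\<And>f. f \<in> H \<Longrightarrow> cmod (L f) \<le> B * N f"
  shows "\<exists>g\<in>H. \<forall>f\<in>H. L f = ip f g"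
proof -
  define c where "c n = cnj (L (mon n)) / of_real (moment n)" for n
  have Lc: "L (mon n) = cnj (c n) * of_real (moment n)" for n using moment_pos[of n] by (simp add: c_def)
  have "summable (\<lambda>n. (cmod (c n))\<^sup>2 * moment n)"
  proof (rule summableI_nonneg_bounded[where x="B\<^sup>2"])
    fix M
    let ?s = "\<lambda>z. \<Sum>n<M. c n * mon n z"
    define T where "T = (\<Sum>n<M. (cmod (c n))\<^sup>2 * moment n)"
    have T0: "0 \<le> T" by (auto simp: T_def moment_nonneg intro!: sum_nonneg)
    have sH: "?s \<in> H" by (intro H_sum mon_H)
    have tr: "(\<lambda>n. x n * (if n < M then y n else 0)) sums (\<Sum>n<M. x n * y n)" for x y :: "nat \<Rightarrow> complex"
      using sums_If_finite_set[of "{..<M}" "\<lambda>n. x n * y n"] by (simp add: if_distrib[of "(*) _"] cong: if_cong)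
    have "(\<lambda>n. (if n < M then c n else 0) * L (mon n)) sums L ?s"
      by (rule functional_coefficient_series[OF L B sH has_coeffs_poly])
    moreover have "(\<lambda>n. (if n < M then c n else 0) * L (mon n)) sums (\<Sum>n<M. L (mon n) * c n)"
      using tr[of "\<lambda>n. L (mon n)" c] by (simp add: mult.commute)
    ultimately have "L ?s = (\<Sum>n<M. L (mon n) * c n)" using sums_unique2 by blast
    also have "\<dots> = of_real T" unfolding T_def Lc of_real_sum of_real_mult complex_norm_square by (simp add: mult_ac)
    finally have 1: "L ?s = of_real T" .
    have h1: "(\<lambda>n. (cmod (if n < M then c n else 0))\<^sup>2 * moment n) sums (N ?s)\<^sup>2"
      by (rule parseval_H(2)[OF has_coeffs_poly sH])
    have h2: "(\<lambda>n. (cmod (if n < M then c n else 0))\<^sup>2 * moment n) = (\<lambda>n. if n \<in> {..<M} then (cmod (c n))\<^sup>2 * moment n else 0)" by auto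
    have h3: "(\<lambda>n. if n \<in> {..<M} then (cmod (c n))\<^sup>2 * moment n else 0) sums T" unfolding T_def by (rule sums_If_finite_set) simp
    have 2: "(N ?s)\<^sup>2 = T" by (rule sums_unique2[OF h1[unfolded h2] h3])
    have "T \<le> B * N ?s" using B[OF sH] 1 T0 by simp
    then have "T\<^sup>2 \<le> (B * N ?s)\<^sup>2" using T0 by (rule power_mono)
    then have "T * T \<le> B\<^sup>2 * T" using 2 by (simp add: power_mult_distrib) (simp add: power2_eq_square)
    then show "(\<Sum>n<M. (cmod (c n))\<^sup>2 * moment n) \<le> B\<^sup>2"
      using T0 unfolding T_def[symmetric] by (cases "T = 0") auto
  qed (simp add: moment_nonneg)
  then obtain g where g: "g \<in> H" "has_coeffs c g" using Riesz_Fischer by blast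
  have "L f = ip f g" if f: "f \<in> H" for f
  proof -
    obtain a where a: "has_coeffs a f" using has_coeffs_ex[OF f] ..
    have "(\<lambda>n. a n * L (mon n)) sums L f" by (rule functional_coefficient_series[OF L B f a])
    then have h1: "(\<lambda>n. a n * ip (mon n) g) sums L f" unfolding ip_mon_coeff[OF g] Lc .
    have h2: "(\<lambda>n. a n * ip (mon n) g) sums ip f g" by (rule ip_series[OF f g(1) a])
    show ?thesis by (rule sums_unique2[OF h1 h2])
  qed
  then show ?thesis using g by blast
qed

end

section \<open>Projections and finite-rank operators\<close>

context regular_radial_weight
begin

text \<open>
  Vectors of norm \<open>0\<close> are admitted, so that orthonormalising linearly dependent vectors keeps their number; the
  formula for the projection is the same.
\<close>

definition orthonormal_upto :: "nat \<Rightarrow> (nat \<Rightarrow> complex \<Rightarrow> complex) \<Rightarrow> bool" where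
  "orthonormal_upto n u \<longleftrightarrow> (\<forall>i<n. u i \<in> H \<and> (N (u i) = 0 \<or> N (u i) = 1)) \<and>
     (\<forall>i<n. \<forall>j<n. i \<noteq> j \<longrightarrow> ip (u i) (u j) = 0)"

definition projection :: "nat \<Rightarrow> (nat \<Rightarrow> complex \<Rightarrow> complex) \<Rightarrow> (complex \<Rightarrow> complex) \<Rightarrow> complex \<Rightarrow> complex" where
  "projection n u f = (\<lambda>z. \<Sum>i<n. ip f (u i) * u i z)"

lemma orthonormal_H: "orthonormal_upto n u \<Longrightarrow> i < n \<Longrightarrow> u i \<in> H"
  by (simp add: orthonormal_upto_def)

lemma projection_H: "orthonormal_upto n u \<Longrightarrow> projection n u f \<in> H"
  unfolding projection_def by (rule H_sum) (auto dest: orthonormal_H)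

lemma orthonormal_sum_ip:
  assumes u: "orthonormal_upto n u" and j: "j < n"
  shows "ip (\<lambda>z. \<Sum>i<n. c i * u i z) (u j) = c j * of_real ((N (u j))\<^sup>2)"
proof -
  have "ip (\<lambda>z. \<Sum>i<n. c i * u i z) (u j) = (\<Sum>i<n. c i * ip (u i) (u j))"
    by (rule ip_sum) (use orthonormal_H[OF u] j in auto)
  also have "\<dots> = (\<Sum>i<n. if i = j then c j * of_real ((N (u j))\<^sup>2) else 0)"
    by (rule sum.cong) (use u j in \<open>auto simp: orthonormal_upto_def ip_self\<close>)
  also have "\<dots> = c j * of_real ((N (u j))\<^sup>2)" using j by (simp add: sum.delta)
  finally show ?thesis .
qed

lemma ip_normed:
  assumes u: "orthonormal_upto n u" and j: "j < n" and f: "f \<in> H"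
  shows "ip f (u j) * of_real ((N (u j))\<^sup>2) = ip f (u j)"
proof (cases "N (u j) = 0")
  case True
  then have "u j = (\<lambda>z. 0)" using norm_zero_iff orthonormal_H[OF u j] by blast
  then show ?thesis by simp
next
  case False
  then have "N (u j) = 1" using u j by (auto simp: orthonormal_upto_def)
  then show ?thesis by simp
qed

lemma projection_ip:
  assumes u: "orthonormal_upto n u" and j: "j < n" and f: "f \<in> H"
  shows "ip (projection n u f) (u j) = ip f (u j)"
  unfolding projection_def orthonormal_sum_ip[OF u j] by (rule ip_normed[OF u j f])

lemma residual_orthogonal:
  assumes u: "orthonormal_upto n u" and j: "j < n" and f: "f \<in> H"
  shows "ip (\<lambda>z. f z - projection n u f z) (u j) = 0"
  using ip_lincomb[OF f projection_H[OF u] orthonormal_H[OF u j], of 1 "-1"] projection_ip[OF u j f] by simp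

lemma sum_sq_ip:
  assumes u: "orthonormal_upto n u" and f: "f \<in> H"
  shows "(N (projection n u f))\<^sup>2 = (\<Sum>i<n. (cmod (ip f (u i)))\<^sup>2)"
    and "(N f)\<^sup>2 = (N (projection n u f))\<^sup>2 + (N (\<lambda>z. f z - projection n u f z))\<^sup>2"
proof -
  let ?P = "projection n u f" and ?Q = "\<lambda>z. f z - projection n u f z"
  have P: "?P \<in> H" by (rule projection_H[OF u])
  have Q: "?Q \<in> H" by (rule H_diff[OF f P])
  have ipP: "ip ?P g = (\<Sum>i<n. ip f (u i) * ip (u i) g)" if "g \<in> H" for g
    unfolding projection_def by (rule ip_sum) (use orthonormal_H[OF u] that in auto)
  have "of_real ((N ?P)\<^sup>2) = ip ?P ?P" by (simp add: ip_self)
  also have "\<dots> = (\<Sum>i<n. ip f (u i) * ip (u i) ?P)" by (rule ipP[OF P])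
  also have "\<dots> = (\<Sum>i<n. of_real ((cmod (ip f (u i)))\<^sup>2))"
  proof (rule sum.cong[OF refl])
    fix i assume "i \<in> {..<n}"
    then have "ip (u i) ?P = cnj (ip f (u i))" using ip_cnj[of "u i" ?P] projection_ip[OF u _ f, of i] by simp
    then show "ip f (u i) * ip (u i) ?P = of_real ((cmod (ip f (u i)))\<^sup>2)" by (simp only: complex_norm_square)
  qed
  finally have "complex_of_real ((N ?P)\<^sup>2) = of_real (\<Sum>i<n. (cmod (ip f (u i)))\<^sup>2)" by simp
  then show "(N ?P)\<^sup>2 = (\<Sum>i<n. (cmod (ip f (u i)))\<^sup>2)" by (simp only: of_real_eq_iff)
  have "ip ?P ?Q = (\<Sum>i<n. ip f (u i) * ip (u i) ?Q)" by (rule ipP[OF Q])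
  also have "\<dots> = 0"
    using ip_cnj[of "u _" ?Q] residual_orthogonal[OF u _ f] by (intro sum.neutral) simp
  finally have "ip ?P ?Q = 0" .
  then show "(N f)\<^sup>2 = (N ?P)\<^sup>2 + (N ?Q)\<^sup>2" using norm_lincomb_sq[OF P Q, of 1] by simp
qed

lemma projection_norm_le:
  assumes u: "orthonormal_upto n u" and f: "f \<in> H"
  shows "N (\<lambda>z. f z - projection n u f z) \<le> N f" "N (projection n u f) \<le> N f"
  using sum_sq_ip(2)[OF u f] by (auto intro!: power2_le_imp_le[OF _ norm_nonneg])

lemma projection_span:
  assumes u: "orthonormal_upto n u" and f: "f = (\<lambda>z. \<Sum>i<n. c i * u i z)"
  shows "projection n u f = f"
proof -
  have fH: "f \<in> H" unfolding f by (rule H_sum) (use orthonormal_H[OF u] in auto)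
  have "projection n u f z = f z" for z
  proof -
    have "ip f (u i) * u i z = c i * u i z" if i: "i < n" for i
    proof (cases "N (u i) = 0")
      case True
      then have "u i = (\<lambda>z. 0)" using norm_zero_iff orthonormal_H[OF u i] by blast
      then show ?thesis by simp
    next
      case False
      then have "N (u i) = 1" using u i by (auto simp: orthonormal_upto_def)
      then show ?thesis using orthonormal_sum_ip[OF u i, of c] unfolding f[symmetric] by simp
    qed
    then show ?thesis unfolding projection_def by (subst f) (auto intro!: sum.cong)
  qed
  then show ?thesis by auto
qed

text \<open>
  The new vector is the normalised residual \<open>r\<close> of \<open>e n\<close>. If \<open>e n\<close> lies in the span of its predecessors, then
  \<open>1 / N r\<close> evaluates to \<open>0\<close> and the new vector is \<open>0\<close>, which \<open>orthonormal_upto\<close> permits.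
\<close>

theorem Gram_Schmidt:
  assumes "\<And>i. i < n \<Longrightarrow> e i \<in> H"
  shows "\<exists>u. orthonormal_upto n u \<and> (\<forall>i<n. projection n u (e i) = e i)"
  using assms
proof (induction n)
  case 0
  show ?case by (auto simp: orthonormal_upto_def)
next
  case (Suc n)
  then obtain u where u: "orthonormal_upto n u" "\<And>i. i < n \<Longrightarrow> projection n u (e i) = e i" by auto
  have en: "e n \<in> H" using Suc by simp
  define r where "r = (\<lambda>z. e n z - projection n u (e n) z)"
  have r: "r \<in> H" unfolding r_def by (intro H_diff en projection_H u)
  have ro: "ip r (u j) = 0" if "j < n" for j unfolding r_def by (rule residual_orthogonal[OF u(1) that en])
  define v where "v = (\<lambda>z. complex_of_real (1 / N r) * r z)"
  have v: "v \<in> H" unfolding v_def by (rule H_scale[OF r])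
  have Nv: "N v = 0 \<or> N v = 1" unfolding v_def norm_scale using norm_nonneg[of r] by (simp add: norm_divide)
  have vo: "ip v (u j) = 0" if "j < n" for j
    unfolding v_def using ip_lincomb[OF r r orthonormal_H[OF u(1) that], of "complex_of_real (1 / N r)" 0] ro[OF that] by simp
  define w where "w = u(n := v)"
  have wu: "w i = u i" if "i < n" for i using that by (simp add: w_def)
  have wn: "w n = v" by (simp add: w_def)
  have ow: "orthonormal_upto (Suc n) w"
  proof -
    have "ip (w i) (w j) = 0" if ij: "i < Suc n" "j < Suc n" "i \<noteq> j" for i j
    proof -
      consider "i < n" "j < n" | "i = n" "j < n" | "i < n" "j = n" using ij by linarith
      then show ?thesis
      proof cases
        case 1 then show ?thesis using u(1) ij(3) by (simp add: wu orthonormal_upto_def)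
      next
        case 2 then show ?thesis using vo by (simp add: wu wn)
      next
        case 3 then show ?thesis using vo ip_cnj[of "u i" v] by (simp add: wu wn)
      qed
    qed
    then show ?thesis using u(1) v Nv by (auto simp: orthonormal_upto_def less_Suc_eq wu wn)
  qed
  have "projection (Suc n) w (e i) = e i" if "i < Suc n" for i
  proof (cases "i < n")
    case True
    have "e i = (\<lambda>z. \<Sum>k<Suc n. (if k < n then ip (e i) (u k) else 0) * w k z)"
      using u(2)[OF True] unfolding projection_def by (simp add: fun_eq_iff wu)
    then show ?thesis by (rule projection_span[OF ow])
  next
    case False
    then have [simp]: "i = n" using that by simp
    have "e n z = projection n u (e n) z + of_real (N r) * v z" for z
    proof (cases "N r = 0")
      case True
      then have "r = (\<lambda>z. 0)" using norm_zero_iff[OF r] by simp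
      then show ?thesis using True by (simp add: r_def fun_eq_iff)
    next
      case False
      then have "of_real (N r) * v z = r z" by (simp add: v_def)
      then show ?thesis by (simp add: r_def)
    qed
    then have "e n = (\<lambda>z. \<Sum>k<Suc n. (if k < n then ip (e n) (u k) else of_real (N r)) * w k z)"
      unfolding projection_def by (simp add: fun_eq_iff wu wn)
    then have "projection (Suc n) w (e n) = e n" by (rule projection_span[OF ow])
    then show ?thesis by simp
  qed
  then show ?case using ow by blast
qed

lemma operator_norm_le:
  assumes "\<And>f. f \<in> H \<Longrightarrow> N (S f) \<le> b * N f" "0 \<le> b"
  shows "operator_norm H N S \<le> b"
  unfolding operator_norm_def
proof (rule cSUP_least)
  show "{f \<in> H. N f \<le> 1} \<noteq> {}" using H_zero by auto
  fix f assume "f \<in> {f \<in> H. N f \<le> 1}"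
  then have f: "f \<in> H" "N f \<le> 1" by auto
  have "N (S f) \<le> b * N f" by (rule assms(1)[OF f(1)])
  moreover have "b * N f \<le> b * 1" by (rule mult_left_mono[OF f(2) assms(2)])
  ultimately show "N (S f) \<le> b" by simp
qed

lemma operator_norm_bound:
  assumes S: "bounded_operator H N S" and f: "f \<in> H"
  shows "N (S f) \<le> operator_norm H N S * N f"
proof -
  obtain C where C: "\<And>f. f \<in> H \<Longrightarrow> N (S f) \<le> C * N f" and lin: "linear_operator H S"
    using S by (auto simp: bounded_operator_def)
  have bdd: "bdd_above ((\<lambda>f. N (S f)) ` {f \<in> H. N f \<le> 1})"
  proof (rule bdd_aboveI2)
    fix f assume f: "f \<in> {f \<in> H. N f \<le> 1}"
    have "N (S f) \<le> C * N f" using C f by auto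
    also have "\<dots> \<le> \<bar>C\<bar> * 1" using f norm_nonneg[of f] by (intro mult_mono) auto
    finally show "N (S f) \<le> \<bar>C\<bar>" by simp
  qed
  show ?thesis
  proof (cases "N f = 0")
    case True
    then show ?thesis using C[OF f] by simp
  next
    case False
    define c where "c = complex_of_real (1 / N f)"
    have "N (\<lambda>z. c * f z) = 1" unfolding norm_scale c_def using False norm_nonneg[of f] by (simp add: norm_divide)
    then have "(\<lambda>z. c * f z) \<in> {f \<in> H. N f \<le> 1}" using H_scale[OF f] by simp
    then have "N (S (\<lambda>z. c * f z)) \<le> operator_norm H N S"
      unfolding operator_norm_def by (rule cSUP_upper[OF _ bdd])
    moreover have "S (\<lambda>z. c * f z + 0 * f z) = (\<lambda>z. c * S f z + 0 * S f z)"
      using lin f unfolding linear_operator_def by blast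
    then have "S (\<lambda>z. c * f z) = (\<lambda>z. c * S f z)" by simp
    moreover have "N (\<lambda>z. c * S f z) = N (S f) / N f" unfolding norm_scale c_def using norm_nonneg[of f] by (simp add: norm_divide)
    ultimately show ?thesis using False norm_nonneg[of f] by (simp add: pos_divide_le_eq)
  qed
qed

lemma bounded_operator_diff:
  assumes S: "bounded_operator H N S" and T: "bounded_operator H N T"
  shows "bounded_operator H N (\<lambda>f x. S f x - T f x)"
proof -
  obtain C D where C: "\<And>f. f \<in> H \<Longrightarrow> N (S f) \<le> C * N f" and D: "\<And>f. f \<in> H \<Longrightarrow> N (T f) \<le> D * N f"
    using S T by (auto simp: bounded_operator_def)
  have SH: "\<And>f. f \<in> H \<Longrightarrow> S f \<in> H" and TH: "\<And>f. f \<in> H \<Longrightarrow> T f \<in> H"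
    using S T by (auto simp: bounded_operator_def linear_operator_def)
  have "N (\<lambda>x. S f x - T f x) \<le> (C + D) * N f" if f: "f \<in> H" for f
  proof -
    have "N (\<lambda>x. S f x + (-1) * T f x) \<le> N (S f) + N (\<lambda>x. (-1) * T f x)"
      by (intro norm_add_le SH f H_scale TH)
    then have "N (\<lambda>x. S f x - T f x) \<le> N (S f) + N (T f)" using norm_scale[of "-1" "T f"] by simp
    then show ?thesis using C[OF f] D[OF f] by (simp add: distrib_right)
  qed
  moreover have "linear_operator H (\<lambda>f x. S f x - T f x)"
    using S T SH TH unfolding bounded_operator_def linear_operator_def
    by (auto intro!: H_diff simp: algebra_simps)
  ultimately show ?thesis unfolding bounded_operator_def by blast
qed

lemma bounded_zero: "bounded_operator H N (\<lambda>f x. 0)" and rank_zero: "rank_le H (\<lambda>f x. 0) 0"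
  by (auto simp: bounded_operator_def linear_operator_def H_zero rank_le_def norm_nonneg intro!: exI[of _ 0])

lemma operator_norm_nonneg: "bounded_operator H N S \<Longrightarrow> 0 \<le> operator_norm H N S"
proof -
  assume S: "bounded_operator H N S"
  have "N (mon 0) \<noteq> 0" using ip_self[of "mon 0"] ip_mon[of 0 0] moment_pos[of 0] by auto
  then have "0 < N (mon 0)" using norm_nonneg[of "mon 0"] by simp
  then show ?thesis using operator_norm_bound[OF S mon_H[of 0]] norm_nonneg[of "S (mon 0)"]
    by (meson dual_order.trans zero_le_mult_iff not_less)
qed

lemma singular_value_bdd_below:
  assumes T: "bounded_operator H N T"
  shows "bdd_below ((\<lambda>R. operator_norm H N (\<lambda>f x. T f x - R f x)) ` {R. bounded_operator H N R \<and> rank_le H R n})"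
  by (rule bdd_belowI2[of _ 0]) (auto intro!: operator_norm_nonneg bounded_operator_diff T)

lemma rank_le_mono: "rank_le H R n \<Longrightarrow> n \<le> m \<Longrightarrow> rank_le H R m"
proof -
  assume R: "rank_le H R n" and nm: "n \<le> m"
  from R obtain e :: "nat \<Rightarrow> complex \<Rightarrow> complex" where e: "\<forall>i<n. e i \<in> H" "\<forall>f\<in>H. \<exists>c::nat \<Rightarrow> complex. R f = (\<lambda>x. \<Sum>i<n. c i * e i x)"
    unfolding rank_le_def by blast
  define e' where "e' i = (if i < n then e i else (\<lambda>z. 0))" for i
  have "\<exists>c::nat \<Rightarrow> complex. R f = (\<lambda>x. \<Sum>i<m. c i * e' i x)" if "f \<in> H" for f
  proof -
    from bspec[OF e(2) that] obtain c where c: "R f = (\<lambda>x. \<Sum>i<n. c i * e i x)" ..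
    have "(\<Sum>i<m. c i * e' i x) = (\<Sum>i<n. c i * e i x)" for x
      using nm by (intro sum.mono_neutral_cong_right) (auto simp: e'_def)
    then show ?thesis using c by (intro exI[of _ c]) simp
  qed
  moreover have "\<forall>i<m. e' i \<in> H" using e(1) H_zero by (auto simp: e'_def)
  ultimately show ?thesis unfolding rank_le_def by blast
qed

lemma ex_rank_zero: "(\<lambda>f x. 0) \<in> {R. bounded_operator H N R \<and> rank_le H R n}"
  using bounded_zero rank_le_mono[OF rank_zero] by auto

lemma singular_value_le:
  assumes T: "bounded_operator H N T" and R: "bounded_operator H N R" "rank_le H R n"
    and b: "\<And>f. f \<in> H \<Longrightarrow> N (\<lambda>x. T f x - R f x) \<le> b * N f" "0 \<le> b"
  shows "singular_value H N T n \<le> b"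
proof -
  have "singular_value H N T n \<le> operator_norm H N (\<lambda>f x. T f x - R f x)"
    unfolding singular_value_def by (rule cINF_lower[OF singular_value_bdd_below[OF T]]) (simp add: R)
  also have "\<dots> \<le> b" by (rule operator_norm_le[OF b])
  finally show ?thesis .
qed

lemma singular_value_nonneg: "bounded_operator H N T \<Longrightarrow> 0 \<le> singular_value H N T n"
  unfolding singular_value_def
  by (rule cINF_greatest) (use ex_rank_zero[of n] in \<open>blast intro: operator_norm_nonneg bounded_operator_diff\<close>)+

lemma singular_value_antimono:
  assumes T: "bounded_operator H N T" and nm: "n \<le> m"
  shows "singular_value H N T m \<le> singular_value H N T n"
proof -
  have ne: "{R. bounded_operator H N R \<and> rank_le H R n} \<noteq> {}" using ex_rank_zero[of n] by blast
  have sub: "{R. bounded_operator H N R \<and> rank_le H R n} \<subseteq> {R. bounded_operator H N R \<and> rank_le H R m}"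
    using rank_le_mono[OF _ nm] by blast
  show ?thesis unfolding singular_value_def
    by (rule cINF_superset_mono[OF ne singular_value_bdd_below[OF T] sub order_refl])
qed

lemma singular_value_approx:
  assumes T: "bounded_operator H N T" and e: "0 < e"
  shows "\<exists>R. bounded_operator H N R \<and> rank_le H R n \<and> (\<forall>f\<in>H. N (\<lambda>x. T f x - R f x) \<le> (singular_value H N T n + e) * N f)"
proof -
  let ?S = "{R. bounded_operator H N R \<and> rank_le H R n}"
  have "(INF R\<in>?S. operator_norm H N (\<lambda>f x. T f x - R f x)) < singular_value H N T n + e"
    using e by (simp add: singular_value_def)
  then obtain R where R: "R \<in> ?S" "operator_norm H N (\<lambda>f x. T f x - R f x) < singular_value H N T n + e"
    using cINF_less_iff[OF _ singular_value_bdd_below[OF T]] ex_rank_zero by blast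
  have "N (\<lambda>x. T f x - R f x) \<le> (singular_value H N T n + e) * N f" if f: "f \<in> H" for f
  proof -
    have "N (\<lambda>x. T f x - R f x) \<le> operator_norm H N (\<lambda>f x. T f x - R f x) * N f"
      by (rule operator_norm_bound[OF bounded_operator_diff f]) (use T R in auto)
    also have "\<dots> \<le> (singular_value H N T n + e) * N f" using R(2) norm_nonneg by (intro mult_right_mono) auto
    finally show ?thesis .
  qed
  then show ?thesis using R(1) by auto
qed

lemma finite_rank_basis:
  assumes R: "bounded_operator H N R" "rank_le H R n"
  shows "\<exists>u. orthonormal_upto n u \<and> (\<forall>f\<in>H. projection n u (R f) = R f)"
proof -
  from R(2) obtain e :: "nat \<Rightarrow> complex \<Rightarrow> complex" where e0: "\<forall>i<n. e i \<in> H" "\<forall>f\<in>H. \<exists>c::nat \<Rightarrow> complex. R f = (\<lambda>x. \<Sum>i<n. c i * e i x)"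
    unfolding rank_le_def by blast
  have e: "\<And>i. i < n \<Longrightarrow> e i \<in> H" "\<And>f. f \<in> H \<Longrightarrow> \<exists>c::nat \<Rightarrow> complex. R f = (\<lambda>x. \<Sum>i<n. c i * e i x)"
    using e0(1) bspec[OF e0(2)] by simp_all
  obtain u where u: "orthonormal_upto n u" "\<And>i. i < n \<Longrightarrow> projection n u (e i) = e i" using Gram_Schmidt[of n e, OF e(1)] by blast
  have "projection n u (R f) = R f" if f: "f \<in> H" for f
  proof -
    from e(2)[OF f] obtain c where c: "R f = (\<lambda>x. \<Sum>i<n. c i * e i x)" ..
    have ex: "e i x = (\<Sum>k<n. ip (e i) (u k) * u k x)" if "i < n" for i x
      using u(2)[OF that] by (metis projection_def)
    have "R f = (\<lambda>x. \<Sum>k<n. (\<Sum>i<n. c i * ip (e i) (u k)) * u k x)"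
    proof
      fix x
      have "R f x = (\<Sum>i<n. c i * (\<Sum>k<n. ip (e i) (u k) * u k x))" unfolding c using ex by simp
      also have "\<dots> = (\<Sum>i<n. \<Sum>k<n. c i * ip (e i) (u k) * u k x)" by (simp add: sum_distrib_left mult.assoc)
      also have "\<dots> = (\<Sum>k<n. \<Sum>i<n. c i * ip (e i) (u k) * u k x)" by (rule sum.swap)
      finally show "R f x = (\<Sum>k<n. (\<Sum>i<n. c i * ip (e i) (u k)) * u k x)" by (simp add: sum_distrib_right)
    qed
    then show ?thesis by (rule projection_span[OF u(1)])
  qed
  then show ?thesis using u(1) by blast
qed

text \<open>
  Expand \<open>R f\<close> in an orthonormal basis of the range and apply the Cauchy-Schwarz inequality. The last factor, integrated
  against \<open>\<omega>\<close>, is at most the rank.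
\<close>

lemma finite_rank_pointwise:
  assumes R: "bounded_operator H N R" "rank_le H R n" and b: "\<And>f. f \<in> H \<Longrightarrow> N (R f) \<le> b * N f"
  shows "\<exists>u. orthonormal_upto n u \<and> (\<forall>f\<in>H. \<forall>z. (cmod (R f z))\<^sup>2 \<le> (b * N f)\<^sup>2 * (\<Sum>i<n. (cmod (u i z))\<^sup>2))"
proof -
  obtain u where u: "orthonormal_upto n u" "\<And>f. f \<in> H \<Longrightarrow> projection n u (R f) = R f" using finite_rank_basis[OF R] by blast
  have "(cmod (R f z))\<^sup>2 \<le> (b * N f)\<^sup>2 * (\<Sum>i<n. (cmod (u i z))\<^sup>2)" if f: "f \<in> H" for f z
  proof -
    have RH: "R f \<in> H" using R(1) f by (auto simp: bounded_operator_def linear_operator_def)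
    note P = u(2)[OF f]
    have "R f z = (\<Sum>i<n. ip (R f) (u i) * u i z)" using P by (metis projection_def)
    then have "cmod (R f z) \<le> (\<Sum>i<n. cmod (ip (R f) (u i)) * cmod (u i z))"
      by (simp add: sum_norm_le norm_mult)
    then have "(cmod (R f z))\<^sup>2 \<le> (\<Sum>i<n. cmod (ip (R f) (u i)) * cmod (u i z))\<^sup>2" by (rule power_mono) simp
    also have "\<dots> \<le> (\<Sum>i<n. (cmod (ip (R f) (u i)))\<^sup>2) * (\<Sum>i<n. (cmod (u i z))\<^sup>2)"
      by (rule Cauchy_Schwarz_ineq_sum)
    also have "(\<Sum>i<n. (cmod (ip (R f) (u i)))\<^sup>2) = (N (R f))\<^sup>2" using sum_sq_ip(1)[OF u(1) RH] P by simp
    also have "(N (R f))\<^sup>2 * (\<Sum>i<n. (cmod (u i z))\<^sup>2) \<le> (b * N f)\<^sup>2 * (\<Sum>i<n. (cmod (u i z))\<^sup>2)"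
      by (intro mult_right_mono power_mono b f norm_nonneg sum_nonneg) simp
    finally show ?thesis .
  qed
  then show ?thesis using u(1) by blast
qed

end

section \<open>Dyadic real interpolation\<close>

text \<open>
  With \<open>u j = 2 ^ j * b j powr p\<close> the left-hand side is, up to the geometric factor, the product
  \<open>u J powr \<theta> * u j powr (1 - \<theta>)\<close>: the exponents of \<open>b\<close> match because \<open>\<theta> = 1 - 2 / p\<close>, and those of \<open>2\<close> match
  up to \<open>2 powr (\<theta> * (J - j))\<close>. Half of this surplus is spent on the left and half becomes the decay on the right. A
  weighted geometric mean is at most the sum.
\<close>

lemma interpolation_weights:
  fixes b :: "nat \<Rightarrow> real"
  assumes p: "2 < p" and b: "0 < b J" "0 < b j" and jJ: "j \<le> J"
  defines "\<theta> \<equiv> 1 - 2 / p"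
  shows "b J powr (p - 2) * (b j)\<^sup>2 * 2 ^ j * (2 powr (\<theta> / 2)) ^ (J - j)
    \<le> (2 ^ J * b J powr p + 2 ^ j * b j powr p) * (1 / 2 powr (\<theta> / 2)) ^ (J - j)"
proof -
  define q where "q = 2 powr (\<theta> / 2)"
  have q: "0 < q" by (simp add: q_def)
  define uJ where "uJ = 2 ^ J * b J powr p"
  define uj where "uj = 2 ^ j * b j powr p"
  have u: "0 < uJ" "0 < uj" using b by (auto simp: uJ_def uj_def)
  define m where "m = max uJ uj"
  have m: "0 < m" using u by (simp add: m_def)
  have th: "0 < \<theta>" "p * \<theta> = p - 2" using p by (auto simp: \<theta>_def field_simps)
  define d where "d = real (J - j)"
  have J: "real J = real j + d" using jJ by (simp add: d_def of_nat_diff)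
  have q2: "(q ^ (J - j))\<^sup>2 = 2 powr (\<theta> * d)"
  proof -
    have "(q ^ (J - j))\<^sup>2 = q ^ (2 * (J - j))" by (simp only: power_mult[symmetric] mult.commute)
    also have "\<dots> = q powr real (2 * (J - j))" by (rule powr_realpow[OF q, symmetric])
    also have "\<dots> = 2 powr (\<theta> / 2 * real (2 * (J - j)))" unfolding q_def by (rule powr_powr)
    also have "\<theta> / 2 * real (2 * (J - j)) = \<theta> * d" by (simp add: d_def)
    finally show ?thesis .
  qed
  have "b J powr (p - 2) * (b j)\<^sup>2 * 2 ^ j * (q ^ (J - j))\<^sup>2 = uJ powr \<theta> * uj powr (2 / p)"
  proof -
    define B where "B = ln (b J)"
    define C where "C = ln (b j)"
    have e: "b J = exp B" "b j = exp C" "\<And>k::nat. (2::real) ^ k = exp (real k * ln 2)"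
      using b by (auto simp: B_def C_def exp_of_nat_mult)
    have "uJ = exp (real J * ln 2 + p * B)" "uj = exp (real j * ln 2 + p * C)"
      unfolding uJ_def uj_def e by (simp_all add: powr_def exp_add)
    then have "uJ powr \<theta> = exp (\<theta> * (real J * ln 2 + p * B))" "uj powr (2 / p) = exp ((2 / p) * (real j * ln 2 + p * C))"
      by (simp_all add: powr_def)
    moreover have "b J powr (p - 2) * (b j)\<^sup>2 * 2 ^ j * (q ^ (J - j))\<^sup>2 = exp ((p - 2) * B + 2 * C + real j * ln 2 + \<theta> * d * ln 2)"
      unfolding q2 by (simp add: e powr_def exp_add power2_eq_square) (simp add: exp_add[symmetric])
    moreover have "(p - 2) * B + 2 * C + real j * ln 2 + \<theta> * d * ln 2 = \<theta> * (real J * ln 2 + p * B) + (2 / p) * (real j * ln 2 + p * C)"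
    proof -
      have t1: "\<theta> * (p * B) = (p - 2) * B" unfolding th(2)[symmetric] by simp
      have t2: "(2 / p) * (p * C) = 2 * C" using p by simp
      have t3: "\<theta> * real J + (2 / p) * real j = real j + \<theta> * d" by (simp add: J \<theta>_def algebra_simps add_divide_distrib)
      have "\<theta> * (real J * ln 2 + p * B) + (2 / p) * (real j * ln 2 + p * C) = \<theta> * (p * B) + (2 / p) * (p * C) + (\<theta> * real J + (2 / p) * real j) * ln 2"
        by (simp only: distrib_left distrib_right mult.assoc add_ac)
      then show ?thesis unfolding t1 t2 t3 by (simp add: distrib_right)
    qed
    ultimately show ?thesis by (simp add: exp_add[symmetric])
  qed
  also have "\<dots> \<le> m powr \<theta> * m powr (2 / p)"
    using u th p by (intro mult_mono powr_mono2) (auto simp: m_def)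
  also have "\<dots> = m" using m p by (simp add: powr_add[symmetric] \<theta>_def)
  also have "\<dots> \<le> uJ + uj" using u by (simp add: m_def)
  finally have *: "b J powr (p - 2) * (b j)\<^sup>2 * 2 ^ j * (q ^ (J - j))\<^sup>2 \<le> uJ + uj" .
  have "b J powr (p - 2) * (b j)\<^sup>2 * 2 ^ j * q ^ (J - j) = (b J powr (p - 2) * (b j)\<^sup>2 * 2 ^ j * (q ^ (J - j))\<^sup>2) / q ^ (J - j)"
    using q by (simp add: power2_eq_square)
  also have "\<dots> \<le> (uJ + uj) / q ^ (J - j)" using * q by (intro divide_right_mono) auto
  also have "\<dots> = (uJ + uj) * (1 / q) ^ (J - j)" by (simp add: power_divide)
  finally show ?thesis by (simp add: q_def uJ_def uj_def)
qed

lemma summable_interpolation_double: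
  fixes u :: "nat \<Rightarrow> real"
  assumes u: "summable u" "\<And>j. 0 \<le> u j" and s: "0 < s" "s < 1"
  shows "summable (\<lambda>J. \<Sum>j\<le>J. (u J + u j) * s ^ (J - j))"
proof -
  have g: "summable (\<lambda>n. s ^ n)" using s by (intro summable_geometric) auto
  have 1: "summable (\<lambda>J. \<Sum>j\<le>J. u j * s ^ (J - j))"
    by (rule summable_Cauchy_product) (use u g s in auto)
  have 2: "summable (\<lambda>J. \<Sum>j\<le>J. u J * s ^ (J - j))"
  proof (rule summable_comparison_test')
    show "summable (\<lambda>J. (\<Sum>n. s ^ n) * u J)" using u by (intro summable_mult)
    fix J
    have "(\<Sum>j\<le>J. s ^ (J - j)) = (\<Sum>n\<le>J. s ^ n)" using sum.atLeastAtMost_rev[of "\<lambda>n. s ^ n" 0 J] by (simp add: atMost_atLeast0)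
    also have "\<dots> \<le> (\<Sum>n. s ^ n)" by (rule sum_le_suminf[OF g]) (use s in auto)
    finally have "(\<Sum>j\<le>J. s ^ (J - j)) * u J \<le> (\<Sum>n. s ^ n) * u J"
      by (rule mult_right_mono) (rule u(2))
    moreover have "(\<Sum>j\<le>J. u J * s ^ (J - j)) = (\<Sum>j\<le>J. s ^ (J - j)) * u J"
      by (subst mult.commute[of "sum _ _"]) (rule sum_distrib_left[symmetric])
    ultimately have "(\<Sum>j\<le>J. u J * s ^ (J - j)) \<le> (\<Sum>n. s ^ n) * u J" by simp
    moreover have "0 \<le> (\<Sum>j\<le>J. u J * s ^ (J - j))" using u s by (intro sum_nonneg) auto
    ultimately show "norm (\<Sum>j\<le>J. u J * s ^ (J - j)) \<le> (\<Sum>n. s ^ n) * u J" by simp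
  qed
  show ?thesis using summable_add[OF 2 1] by (simp add: sum.distrib[symmetric] distrib_right)
qed

text \<open>
  Stop just before the first index at which the tail \<open>B * b J\<close> is at most half of \<open>h\<close>. Then \<open>h powr (p - 2)\<close> is bounded by
  \<open>b J powr (p - 2)\<close>, and the remaining \<open>h\<^sup>2\<close> by the square of the sum of the \<open>x j\<close> with \<open>j \<le> J\<close>. The Cauchy-Schwarz inequality
  with the weights \<open>q ^ (J - j)\<close> turns the latter into a sum of squares.
\<close>

lemma interpolation_pointwise:
  fixes b x :: "nat \<Rightarrow> real"
  assumes p: "2 < p" and b: "\<And>j. 0 < b j" "b \<longlonglongrightarrow> 0" and B: "0 < B"
    and h: "0 < h" "\<And>J. h \<le> B * b J + (\<Sum>j<J. x j)" and x: "\<And>j. 0 \<le> x j" and q: "1 < q"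
  shows "\<exists>J. h powr p \<le> 4 * (2 * B) powr (p - 2) * (q / (q - 1)) * (\<Sum>j\<le>J. b J powr (p - 2) * q ^ (J - j) * (x j)\<^sup>2)"
proof -
  have "(\<lambda>j. B * b j) \<longlonglongrightarrow> B * 0" by (intro tendsto_intros b)
  then have "\<forall>\<^sub>F j in sequentially. B * b j < h / 2" using h(1) by (intro order_tendstoD(2)) auto
  then obtain J0 where "B * b J0 < h / 2" by (auto simp: eventually_sequentially)
  then have ex: "B * b J0 \<le> h / 2" by simp
  define K where "K = (LEAST J. B * b J \<le> h / 2)"
  have K: "B * b K \<le> h / 2" unfolding K_def by (rule LeastI[of "\<lambda>J. B * b J \<le> h / 2", OF ex])
  have "K \<noteq> 0"
  proof
    assume "K = 0"
    then show False using K h(2)[of 0] h(1) by simp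
  qed
  then obtain J where J: "K = Suc J" by (cases K) auto
  have nJ: "h / 2 < B * b J" using not_less_Least[of J "\<lambda>J. B * b J \<le> h / 2"] J by (simp add: K_def)
  have sum: "h \<le> 2 * (\<Sum>j\<le>J. x j)" using h(2)[of K] K J by (simp add: lessThan_Suc_atMost)
  have q0: "0 < q" using q by simp
  have CS: "(\<Sum>j\<le>J. x j)\<^sup>2 \<le> (q / (q - 1)) * (\<Sum>j\<le>J. q ^ (J - j) * (x j)\<^sup>2)"
  proof -
    define r where "r j = sqrt (q ^ (J - j))" for j
    have r: "0 < r j" "(r j)\<^sup>2 = q ^ (J - j)" for j using q0 by (auto simp: r_def)
    have "(\<Sum>j\<le>J. x j)\<^sup>2 = (\<Sum>j\<le>J. (1 / r j) * (r j * x j))\<^sup>2" using r(1) by (simp add: less_imp_neq[symmetric])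
    also have "\<dots> \<le> (\<Sum>j\<le>J. (1 / r j)\<^sup>2) * (\<Sum>j\<le>J. (r j * x j)\<^sup>2)" by (rule Cauchy_Schwarz_ineq_sum)
    also have "(\<Sum>j\<le>J. (r j * x j)\<^sup>2) = (\<Sum>j\<le>J. q ^ (J - j) * (x j)\<^sup>2)" by (simp add: power_mult_distrib r)
    also have "(\<Sum>j\<le>J. (1 / r j)\<^sup>2) = (\<Sum>j\<le>J. (1 / q) ^ (J - j))" by (simp add: power_divide r)
    also have "\<dots> = (\<Sum>n\<le>J. (1 / q) ^ n)" using sum.atLeastAtMost_rev[of "\<lambda>n. (1 / q) ^ n" 0 J] by (simp add: atMost_atLeast0)
    also have "\<dots> \<le> q / (q - 1)"
    proof -
      have "(\<Sum>n\<le>J. (1 / q) ^ n) \<le> (\<Sum>n. (1 / q) ^ n)"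
        by (rule sum_le_suminf) (use q in \<open>auto intro!: summable_geometric\<close>)
      also have "\<dots> = 1 / (1 - 1 / q)" by (rule suminf_geometric) (use q in auto)
      also have "\<dots> = q / (q - 1)" using q by (simp add: field_simps)
      finally show ?thesis .
    qed
    finally show ?thesis using q0 by (simp add: mult_right_mono sum_nonneg)
  qed
  have "h powr p = h powr (p - 2) * h\<^sup>2" using h(1) by (simp add: powr_diff powr_numeral)
  also have "\<dots> \<le> (2 * B * b J) powr (p - 2) * (2 * (\<Sum>j\<le>J. x j))\<^sup>2"
    using nJ h(1) sum p by (intro mult_mono powr_mono2 power_mono) auto
  also have "\<dots> = (2 * B) powr (p - 2) * b J powr (p - 2) * (4 * (\<Sum>j\<le>J. x j)\<^sup>2)"
    using B b(1)[of J] by (simp add: powr_mult power_mult_distrib)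
  also have "\<dots> \<le> (2 * B) powr (p - 2) * b J powr (p - 2) * (4 * ((q / (q - 1)) * (\<Sum>j\<le>J. q ^ (J - j) * (x j)\<^sup>2)))"
    by (intro mult_left_mono CS) auto
  also have "\<dots> = 4 * (2 * B) powr (p - 2) * (q / (q - 1)) * (\<Sum>j\<le>J. b J powr (p - 2) * q ^ (J - j) * (x j)\<^sup>2)"
    by (simp add: sum_distrib_left mult_ac)
  finally show ?thesis by blast
qed

text \<open>
  For every \<open>J\<close> the function \<open>h\<close> is at most the constant \<open>B * b J\<close> plus pieces \<open>x j\<close> whose squared \<open>L\<^sup>2\<close> norms
  are at most \<open>K * 2 ^ j * (b j)\<^sup>2\<close>. The choice of \<open>J\<close> depends on the point; \<open>interpolation_pointwise\<close> makes it, and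
  summing its bound over all \<open>J\<close> removes the dependence. The integrated double series converges
  by \<open>interpolation_weights\<close>.
\<close>

theorem dyadic_interpolation:
  fixes b :: "nat \<Rightarrow> real" and x :: "nat \<Rightarrow> 'a \<Rightarrow> real"
  assumes p: "2 < p" and b: "\<And>j. 0 < b j" "b \<longlonglongrightarrow> 0" and sb: "summable (\<lambda>j. 2 ^ j * b j powr p)" and B: "0 < B" and K: "0 \<le> K"
    and h: "\<And>z. z \<in> space M \<Longrightarrow> 0 \<le> h z" "\<And>z J. z \<in> space M \<Longrightarrow> h z \<le> B * b J + (\<Sum>j<J. x j z)"
    and x: "\<And>j z. 0 \<le> x j z" and xm: "\<And>j. x j \<in> borel_measurable M"
    and xi: "\<And>j. (\<integral>\<^sup>+z. ennreal ((x j z)\<^sup>2) \<partial>M) \<le> ennreal (K * 2 ^ j * (b j)\<^sup>2)"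
  shows "(\<integral>\<^sup>+z. ennreal (h z powr p) \<partial>M) < \<infinity>"
proof -
  define \<theta> where "\<theta> = 1 - 2 / p"
  define q where "q = 2 powr (\<theta> / 2)"
  have th: "0 < \<theta>" using p by (simp add: \<theta>_def)
  have q: "1 < q" unfolding q_def using th by simp
  define C where "C = 4 * (2 * B) powr (p - 2) * (q / (q - 1))"
  have C: "0 \<le> C" using q by (simp add: C_def)
  define w where "w J j = b J powr (p - 2) * q ^ (J - j)" for J j
  have w: "0 \<le> w J j" for J j using q by (simp add: w_def)
  note xm[measurable]
  have "(\<integral>\<^sup>+z. ennreal (h z powr p) \<partial>M) \<le> (\<integral>\<^sup>+z. ennreal C * (\<Sum>J. \<Sum>j\<le>J. ennreal (w J j) * ennreal ((x j z)\<^sup>2)) \<partial>M)"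
  proof (rule nn_integral_mono)
    fix z assume z: "z \<in> space M"
    show "ennreal (h z powr p) \<le> ennreal C * (\<Sum>J. \<Sum>j\<le>J. ennreal (w J j) * ennreal ((x j z)\<^sup>2))"
    proof (cases "h z = 0")
      case False
      then have h0: "0 < h z" using h(1)[OF z] by simp
      obtain J where J: "h z powr p \<le> C * (\<Sum>j\<le>J. w J j * (x j z)\<^sup>2)"
        using interpolation_pointwise[OF p b B h0 h(2)[OF z] x q] unfolding C_def w_def by auto
      have "ennreal (h z powr p) \<le> ennreal (C * (\<Sum>j\<le>J. w J j * (x j z)\<^sup>2))" by (rule ennreal_leI[OF J])
      also have "\<dots> = ennreal C * (\<Sum>j\<le>J. ennreal (w J j) * ennreal ((x j z)\<^sup>2))"
        using C w by (simp add: ennreal_mult sum_nonneg sum_ennreal[symmetric] del: sum_ennreal)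
      also have "\<dots> \<le> ennreal C * (\<Sum>J. \<Sum>j\<le>J. ennreal (w J j) * ennreal ((x j z)\<^sup>2))"
        using sum_le_suminf[of "\<lambda>J. \<Sum>j\<le>J. ennreal (w J j) * ennreal ((x j z)\<^sup>2)" "{J}"] by (intro mult_left_mono) auto
      finally show ?thesis .
    qed simp
  qed
  also have "\<dots> = ennreal C * (\<Sum>J. \<Sum>j\<le>J. ennreal (w J j) * (\<integral>\<^sup>+z. ennreal ((x j z)\<^sup>2) \<partial>M))"
    by (simp add: nn_integral_cmult nn_integral_suminf nn_integral_sum)
  also have "\<dots> \<le> ennreal C * (\<Sum>J. ennreal (K * (\<Sum>j\<le>J. (2 ^ J * b J powr p + 2 ^ j * b j powr p) * (1 / q) ^ (J - j))))"
  proof (intro mult_left_mono suminf_le summableI)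
    fix J
    have "(\<Sum>j\<le>J. ennreal (w J j) * (\<integral>\<^sup>+z. ennreal ((x j z)\<^sup>2) \<partial>M)) \<le> (\<Sum>j\<le>J. ennreal (w J j) * ennreal (K * 2 ^ j * (b j)\<^sup>2))"
      by (intro sum_mono mult_left_mono xi) simp
    also have "\<dots> = ennreal (\<Sum>j\<le>J. w J j * (K * 2 ^ j * (b j)\<^sup>2))"
      using w K by (subst sum_ennreal[symmetric]) (auto simp: ennreal_mult)
    also have "\<dots> \<le> ennreal (K * (\<Sum>j\<le>J. (2 ^ J * b J powr p + 2 ^ j * b j powr p) * (1 / q) ^ (J - j)))"
      unfolding sum_distrib_left
    proof (intro ennreal_leI sum_mono)
      fix j assume "j \<in> {..J}"
      then have "K * (b J powr (p - 2) * (b j)\<^sup>2 * 2 ^ j * q ^ (J - j)) \<le> K * ((2 ^ J * b J powr p + 2 ^ j * b j powr p) * (1 / q) ^ (J - j))"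
        unfolding q_def \<theta>_def using K by (intro mult_left_mono interpolation_weights p b) auto
      then show "w J j * (K * 2 ^ j * (b j)\<^sup>2) \<le> K * ((2 ^ J * b J powr p + 2 ^ j * b j powr p) * (1 / q) ^ (J - j))"
        by (simp add: w_def mult_ac)
    qed
    finally show "(\<Sum>j\<le>J. ennreal (w J j) * (\<integral>\<^sup>+z. ennreal ((x j z)\<^sup>2) \<partial>M)) \<le> ennreal (K * (\<Sum>j\<le>J. (2 ^ J * b J powr p + 2 ^ j * b j powr p) * (1 / q) ^ (J - j)))" .
  qed simp
  also have "\<dots> < \<infinity>"
  proof -
    have "summable (\<lambda>J. K * (\<Sum>j\<le>J. (2 ^ J * b J powr p + 2 ^ j * b j powr p) * (1 / q) ^ (J - j)))"
      by (intro summable_mult summable_interpolation_double[OF sb]) (use q in auto)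
    then have "(\<Sum>J. ennreal (K * (\<Sum>j\<le>J. (2 ^ J * b J powr p + 2 ^ j * b j powr p) * (1 / q) ^ (J - j)))) =
      ennreal (\<Sum>J. K * (\<Sum>j\<le>J. (2 ^ J * b J powr p + 2 ^ j * b j powr p) * (1 / q) ^ (J - j)))"
      by (intro suminf_ennreal2) (use K q in \<open>auto intro!: mult_nonneg_nonneg sum_nonneg\<close>)
    then show ?thesis by (simp add: ennreal_mult_less_top)
  qed
  finally show ?thesis .
qed

section \<open>Necessity of the integral condition\<close>

context regular_radial_weight
begin

lemma rank_diff:
  assumes R: "rank_le H R n" and S: "rank_le H S m"
  shows "rank_le H (\<lambda>f x. R f x - S f x) (n + m)"
proof -
  from R obtain e :: "nat \<Rightarrow> complex \<Rightarrow> complex" where e: "\<forall>i<n. e i \<in> H" "\<forall>f\<in>H. \<exists>c::nat \<Rightarrow> complex. R f = (\<lambda>x. \<Sum>i<n. c i * e i x)"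
    unfolding rank_le_def by blast
  from S obtain e' :: "nat \<Rightarrow> complex \<Rightarrow> complex" where e': "\<forall>i<m. e' i \<in> H" "\<forall>f\<in>H. \<exists>c::nat \<Rightarrow> complex. S f = (\<lambda>x. \<Sum>i<m. c i * e' i x)"
    unfolding rank_le_def by blast
  define g where "g i = (if i < n then e i else e' (i - n))" for i
  have "\<exists>c::nat \<Rightarrow> complex. (\<lambda>x. R f x - S f x) = (\<lambda>x. \<Sum>i<n + m. c i * g i x)" if "f \<in> H" for f
  proof -
    from bspec[OF e(2) that] obtain c where c: "R f = (\<lambda>x. \<Sum>i<n. c i * e i x)" ..
    from bspec[OF e'(2) that] obtain d where d: "S f = (\<lambda>x. \<Sum>i<m. d i * e' i x)" ..
    define k where "k i = (if i < n then c i else - d (i - n))" for i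
    have "(\<Sum>i<n + m. k i * g i x) = R f x - S f x" for x
    proof -
      have "(\<Sum>i<n + m. k i * g i x) = (\<Sum>i<n. k i * g i x) + (\<Sum>i<m. k (n + i) * g (n + i) x)"
        by (induction m) auto
      then show ?thesis by (simp add: k_def g_def c d sum_negf)
    qed
    then show ?thesis by (intro exI[of _ k]) simp
  qed
  moreover have "\<forall>i<n + m. g i \<in> H" using e(1) e'(1) by (auto simp: g_def)
  ultimately show ?thesis unfolding rank_le_def by blast
qed

text \<open>
  Cauchy condensation of the decreasing sequence of singular values. The terms \<open>(1/4) ^ j\<close> make room for operators
  that only nearly attain the infimum in the definition of singular values, and still decay fast enough to
  survive the factor \<open>2 ^ j\<close>. The term \<open>j = 0\<close> belongs to the zero operator.
\<close>

lemma summable_dyadic_singular_values: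
  assumes T: "bounded_operator H N T" and p: "2 < p" and s: "summable (\<lambda>n. singular_value H N T n powr p)"
  defines "b \<equiv> \<lambda>j. if j = 0 then operator_norm H N T + 1 else singular_value H N T (2 ^ (j - 1)) + (1 / 4) ^ j"
  shows "summable (\<lambda>j. 2 ^ j * b j powr p)" "\<And>j. 0 < b j" "b \<longlonglongrightarrow> 0" "decseq b"
proof -
  define a where "a n = singular_value H N T n" for n
  have a0: "0 \<le> a n" for n unfolding a_def by (rule singular_value_nonneg[OF T])
  have amono: "a m \<le> a n" if "n \<le> m" for n m unfolding a_def by (rule singular_value_antimono[OF T that])
  show bpos: "0 < b j" for j
    using operator_norm_nonneg[OF T] a0[of "2 ^ (j - 1)"] by (auto simp: b_def a_def intro: add_nonneg_pos)
  have cond: "summable (\<lambda>n. 2 ^ n * (a (2 ^ n) powr p))"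
  proof -
    have dec: "a (Suc m) powr p \<le> a m powr p" for m using p by (intro powr_mono2 amono a0) auto
    then show ?thesis using condensation_test[of "\<lambda>n. a n powr p"] s by (simp add: a_def)
  qed
  have "summable (\<lambda>j. 2 ^ Suc j * b (Suc j) powr p)"
  proof (rule summable_comparison_test')
    show "summable (\<lambda>j. 2 * 2 powr p * (2 ^ j * (a (2 ^ j) powr p)) + 2 powr p * (1 / 2) ^ j)"
      by (intro summable_add summable_mult cond summable_geometric) auto
    fix j
    let ?x = "a (2 ^ j)" and ?y = "(1 / 4 :: real) ^ Suc j"
    have y: "0 \<le> ?y" "?y \<le> 1" by (simp, rule power_le_one) auto
    have "b (Suc j) powr p \<le> (2 * max ?x ?y) powr p"
      using a0[of "2 ^ j"] y p by (intro powr_mono2) (auto simp: b_def a_def)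
    also have "\<dots> = 2 powr p * max ?x ?y powr p" using a0[of "2 ^ j"] y by (subst powr_mult) auto
    also have "max ?x ?y powr p \<le> ?x powr p + ?y powr p" by (simp add: max_def)
    also have "?y powr p \<le> ?y powr 1" using y p by (intro powr_mono') auto
    also have "?y powr 1 = ?y" using y by simp
    finally have "b (Suc j) powr p \<le> 2 powr p * (?x powr p + ?y)" by simp
    then have "2 ^ Suc j * b (Suc j) powr p \<le> 2 ^ Suc j * (2 powr p * (?x powr p + ?y))" by (intro mult_left_mono) auto
    also have "\<dots> = 2 * 2 powr p * (2 ^ j * (?x powr p)) + 2 powr p * (2 ^ Suc j * ?y)" by (simp add: algebra_simps)
    also have "2 ^ Suc j * ?y = (1 / 2) ^ Suc j" by (simp only: power_mult_distrib[symmetric]) simp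
    also have "(1 / 2 :: real) ^ Suc j \<le> (1 / 2) ^ j" by simp
    finally show "norm (2 ^ Suc j * b (Suc j) powr p) \<le> 2 * 2 powr p * (2 ^ j * (?x powr p)) + 2 powr p * (1 / 2) ^ j" by simp
  qed
  then show sb: "summable (\<lambda>j. 2 ^ j * b j powr p)" by (subst (asm) summable_Suc_iff)
  have le: "b j powr p \<le> 2 ^ j * b j powr p" for j
    using mult_right_mono[of 1 "2 ^ j :: real" "b j powr p"] by simp
  have "(\<lambda>j. b j powr p) \<longlonglongrightarrow> 0"
    by (rule tendsto_sandwich[OF _ _ tendsto_const summable_LIMSEQ_zero[OF sb]]) (use le in auto)
  then have "(\<lambda>j. (b j powr p) powr (1 / p)) \<longlonglongrightarrow> 0 powr (1 / p)"
    by (rule tendsto_powr'[OF _ tendsto_const]) (use p in auto)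
  then show "b \<longlonglongrightarrow> 0" using p bpos by (simp add: powr_powr less_imp_le)
  show "decseq b"
  proof (rule decseq_SucI)
    fix j show "b (Suc j) \<le> b j"
    proof (cases j)
      case 0
      have "a 1 \<le> operator_norm H N T" unfolding a_def
        by (rule singular_value_le[OF T bounded_zero rank_le_mono[OF rank_zero]])
           (use operator_norm_bound[OF T] operator_norm_nonneg[OF T] in auto)
      then show ?thesis using 0 by (simp add: b_def a_def)
    next
      case (Suc i)
      then show ?thesis using amono[of "2 ^ i" "2 ^ Suc i"] by (auto simp: b_def a_def intro!: add_mono)
    qed
  qed
qed

text \<open>
  The operators \<open>R j\<close> approximate \<open>T\<close> up to \<open>b j\<close>, and \<open>D j = R (j + 1) - R j\<close>. A test function at \<open>\<phi> z\<close> gives the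
  lower bound for \<open>|T f z|\<close>; in the upper bound the remainder \<open>T - R J\<close> is estimated by the point evaluation at \<open>z\<close>,
  and each \<open>D j\<close> by an orthonormal basis of its range.
\<close>

theorem Schatten_imp_integral_tau:
  assumes p: "2 < p" and self: "analytic_self_map \<phi>"
    and T: "bounded_operator H N (composition_operator \<phi>)"
    and s: "summable (\<lambda>n. singular_value H N (composition_operator \<phi>) n powr p)"
  shows "(\<integral>\<^sup>+z. ennreal ((\<tau> z / \<tau> (\<phi> z)) powr (p / 2) * (\<omega> z / \<tau> z)) \<partial>disc_area) < \<infinity>"
proof -
  let ?T = "composition_operator \<phi>"
  have phi: "\<phi> z \<in> unit_disc" if "z \<in> unit_disc" for z using self that by (auto simp: analytic_self_map_def)
  define b where "b j = (if j = 0 then operator_norm H N ?T + 1 else singular_value H N ?T (2 ^ (j - 1)) + (1 / 4) ^ j)" for j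
  note bfacts = summable_dyadic_singular_values[OF T p s, folded b_def]
  have "\<exists>R. bounded_operator H N R \<and> rank_le H R (2 ^ j) \<and> (\<forall>f\<in>H. N (\<lambda>x. ?T f x - R f x) \<le> b j * N f) \<and> (j = 0 \<longrightarrow> (\<forall>f x. R f x = 0))" for j
  proof (cases j)
    case 0
    have "N (\<lambda>x. ?T f x - 0) \<le> b 0 * N f" if "f \<in> H" for f
    proof -
      have "N (?T f) \<le> operator_norm H N ?T * N f" by (rule operator_norm_bound[OF T that])
      also have "\<dots> \<le> b 0 * N f" by (intro mult_right_mono norm_nonneg) (simp add: b_def)
      finally show ?thesis by simp
    qed
    then show ?thesis using 0 bounded_zero rank_le_mono[OF rank_zero, of "2 ^ j"] by (intro exI[of _ "\<lambda>f x. 0"]) auto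
  next
    case (Suc i)
    have "0 < (1 / 4 :: real) ^ j" by simp
    from singular_value_approx[OF T this, of "2 ^ i"] obtain R where
      R: "bounded_operator H N R" "rank_le H R (2 ^ i)" "\<forall>f\<in>H. N (\<lambda>x. ?T f x - R f x) \<le> (singular_value H N ?T (2 ^ i) + (1 / 4) ^ j) * N f" by blast
    have "rank_le H R (2 ^ j)" by (rule rank_le_mono[OF R(2)]) (simp add: Suc)
    then show ?thesis using R Suc by (intro exI[of _ R]) (simp add: b_def)
  qed
  then obtain R where R: "\<And>j. bounded_operator H N (R j)" "\<And>j. rank_le H (R j) (2 ^ j)"
     "\<And>j f. f \<in> H \<Longrightarrow> N (\<lambda>x. ?T f x - R j f x) \<le> b j * N f" "\<And>f x. R 0 f x = 0" by metis
  have TH: "?T f \<in> H" and RH: "R j f \<in> H" if "f \<in> H" for f j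
    using T R(1)[of j] that by (auto simp: bounded_operator_def linear_operator_def)
  define D where "D j f x = R (Suc j) f x - R j f x" for j f x
  have Db: "bounded_operator H N (D j)" for j unfolding D_def by (intro bounded_operator_diff R)
  have Dr: "rank_le H (D j) (2 ^ Suc j + 2 ^ j)" for j unfolding D_def by (intro rank_diff R)
  have Dn: "N (D j f) \<le> (2 * b j) * N f" if f: "f \<in> H" for j f
  proof -
    have "N (\<lambda>x. R (Suc j) f x - R j f x) \<le> N (\<lambda>x. R (Suc j) f x - ?T f x) + N (\<lambda>x. ?T f x - R j f x)"
      by (rule norm_diff_triangle[OF RH[OF f] TH[OF f] RH[OF f]])
    also have "\<dots> \<le> b (Suc j) * N f + b j * N f"
      using R(3)[OF f] norm_minus[of "R (Suc j) f" "?T f"] by (intro add_mono) simp_all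
    also have "\<dots> \<le> b j * N f + b j * N f"
      using bfacts(4) by (intro add_mono mult_right_mono norm_nonneg) (auto simp: decseq_Suc_iff)
    finally show ?thesis by (simp add: D_def[abs_def])
  qed
  have "\<exists>u. orthonormal_upto (2 ^ Suc j + 2 ^ j) u \<and> (\<forall>f\<in>H. \<forall>z. (cmod (D j f z))\<^sup>2 \<le> (2 * b j * N f)\<^sup>2 * (\<Sum>i<2 ^ Suc j + 2 ^ j. (cmod (u i z))\<^sup>2))" for j
    by (rule finite_rank_pointwise[OF Db Dr Dn])
  then obtain u where u: "\<And>j. orthonormal_upto (2 ^ Suc j + 2 ^ j) (u j)"
    "\<And>j f z. f \<in> H \<Longrightarrow> (cmod (D j f z))\<^sup>2 \<le> (2 * b j * N f)\<^sup>2 * (\<Sum>i<2 ^ Suc j + 2 ^ j. (cmod (u j i z))\<^sup>2)" by metis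
  define S where "S j z = (\<Sum>i<2 ^ Suc j + 2 ^ j. (cmod (u j i z))\<^sup>2)" for j z
  have S0: "0 \<le> S j z" for j z by (auto simp: S_def intro: sum_nonneg)
  obtain A where A: "0 \<le> A" "\<And>w. w \<in> unit_disc \<Longrightarrow> \<exists>f\<in>H. f w \<noteq> 0 \<and> (N f)\<^sup>2 \<le> A * ((cmod (f w))\<^sup>2 * \<tau> w)"
    by (rule test_function) blast
  define x where "x j z = sqrt A * (2 * b j) * sqrt (\<bar>\<tau> z\<bar> * S j z)" for j z
  define M where "M = density disc_area (\<lambda>z. ennreal (\<omega> z / \<tau> z))"
  have tm[measurable]: "\<tau> \<in> borel_measurable disc_area" by (rule borel_measurable_disc_area_borel[OF tau_measurable])
  have dm[measurable]: "(\<lambda>z. ennreal (\<omega> z / \<tau> z)) \<in> borel_measurable disc_area" by measurable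
  have um[measurable]: "u j i \<in> borel_measurable disc_area" if "i < 2 ^ Suc j + 2 ^ j" for i j
    by (rule H_measurable[OF orthonormal_H[OF u(1) that]])
  have Sm[measurable]: "S j \<in> borel_measurable disc_area" for j
    unfolding S_def by (intro borel_measurable_sum borel_measurable_power measurable_compose[OF um borel_measurable_norm]) auto
  have MI: "(\<integral>\<^sup>+z. F z \<partial>M) = (\<integral>\<^sup>+z. ennreal (\<omega> z / \<tau> z) * F z \<partial>disc_area)" if "F \<in> borel_measurable disc_area" for F
    unfolding M_def by (rule nn_integral_density[OF dm that])
  define h where "h z = sqrt (\<tau> z / \<tau> (\<phi> z))" for z
  have phm: "\<phi> \<in> borel_measurable disc_area"
    using self by (intro holomorphic_measurable) (simp add: analytic_self_map_def)
  have tphm[measurable]: "(\<lambda>z. \<tau> (\<phi> z)) \<in> borel_measurable disc_area" by (rule measurable_compose[OF phm tau_measurable])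
  have "(\<integral>\<^sup>+z. ennreal (h z powr p) \<partial>M) < \<infinity>"
  \<comment> \<open>The range of \<open>D j\<close> has dimension at most \<open>3 * 2 ^ j\<close>, and its norm is at most \<open>2 * b j\<close>: hence \<open>12 = 3 * 2\<^sup>2\<close>.\<close>
  proof (rule dyadic_interpolation[OF p bfacts(2,3,1), where B="sqrt A * sqrt (4 * KB) + 1" and K="12 * A" and x=x])
    show "0 < sqrt A * sqrt (4 * KB) + 1" using A KB_ge by (intro add_nonneg_pos mult_nonneg_nonneg) auto
    show "0 \<le> 12 * A" using A by simp
    fix z assume "z \<in> space M"
    then have z: "z \<in> unit_disc" by (simp add: M_def)
    show h0: "0 \<le> h z" using tau_pos[OF z] tau_pos[OF phi[OF z]] by (simp add: h_def)
    fix J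
    obtain f where f: "f \<in> H" "f (\<phi> z) \<noteq> 0" "(N f)\<^sup>2 \<le> A * ((cmod (f (\<phi> z)))\<^sup>2 * \<tau> (\<phi> z))" using A(2)[OF phi[OF z]] by blast
    have Nf: "0 < N f"
    proof -
      have "f \<noteq> (\<lambda>z. 0)" using f(2) by auto
      then show ?thesis using norm_zero_iff[OF f(1)] norm_nonneg[of f] by simp
    qed
    define t where "t = sqrt (\<tau> z)"
    have t: "0 < t" "t\<^sup>2 = \<tau> z" using tau_pos[OF z] by (auto simp: t_def)
    have Tf: "?T f z = f (\<phi> z)" using z by (simp add: composition_operator_def)
    have tele: "(\<Sum>j<J. D j f z) = R J f z" using sum_lessThan_telescope[of "\<lambda>j. R j f z" J] R(4) by (simp add: D_def)
    have "f (\<phi> z) = (?T f z - R J f z) + (\<Sum>j<J. D j f z)" using Tf tele by simp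
    then have tri: "cmod (f (\<phi> z)) \<le> cmod (?T f z - R J f z) + (\<Sum>j<J. cmod (D j f z))"
      by (metis norm_triangle_le add_left_mono norm_sum)
    have e1: "t * cmod (?T f z - R J f z) \<le> sqrt (4 * KB) * (b J * N f)"
    proof (rule power2_le_imp_le)
      have "(cmod (?T f z - R J f z))\<^sup>2 * \<tau> z \<le> 4 * KB * (N (\<lambda>x. ?T f x - R J f x))\<^sup>2"
        by (rule point_evaluation[OF H_diff[OF TH[OF f(1)] RH[OF f(1)]] z])
      also have "\<dots> \<le> 4 * KB * (b J * N f)\<^sup>2"
        using KB_ge R(3)[OF f(1)] by (intro mult_left_mono power_mono norm_nonneg) auto
      finally show "(t * cmod (?T f z - R J f z))\<^sup>2 \<le> (sqrt (4 * KB) * (b J * N f))\<^sup>2"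
        using KB_ge t by (simp add: power_mult_distrib mult.commute)
    qed (use KB_ge bfacts(2)[of J] norm_nonneg[of f] in simp)
    have e2: "t * cmod (D j f z) \<le> (2 * b j * sqrt (\<tau> z * S j z)) * N f" for j
    proof (rule power2_le_imp_le)
      have "\<tau> z * (cmod (D j f z))\<^sup>2 \<le> \<tau> z * ((2 * b j * N f)\<^sup>2 * S j z)"
        using u(2)[OF f(1), of j z] tau_pos[OF z] unfolding S_def by (intro mult_left_mono) auto
      then show "(t * cmod (D j f z))\<^sup>2 \<le> ((2 * b j * sqrt (\<tau> z * S j z)) * N f)\<^sup>2"
        using t tau_pos[OF z] S0[of j z] by (simp add: power_mult_distrib mult_ac)
    qed (use bfacts(2)[of j] norm_nonneg[of f] S0[of j z] tau_pos[OF z] in simp)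
    have e3: "N f * h z \<le> sqrt A * (t * cmod (f (\<phi> z)))"
    proof (rule power2_le_imp_le)
      have tp: "0 < \<tau> (\<phi> z)" by (rule tau_pos[OF phi[OF z]])
      have "(N f * h z)\<^sup>2 = (N f)\<^sup>2 * (\<tau> z / \<tau> (\<phi> z))" using tau_pos[OF z] tp by (simp add: h_def power_mult_distrib)
      also have "\<dots> \<le> (A * ((cmod (f (\<phi> z)))\<^sup>2 * \<tau> (\<phi> z))) * (\<tau> z / \<tau> (\<phi> z))"
        using f(3) tp tau_pos[OF z] by (intro mult_right_mono) auto
      also have "\<dots> = (sqrt A * (t * cmod (f (\<phi> z))))\<^sup>2"
        using tp A t by (simp add: power_mult_distrib)
      finally show "(N f * h z)\<^sup>2 \<le> (sqrt A * (t * cmod (f (\<phi> z))))\<^sup>2" .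
    qed (use A t in simp)
    have "t * cmod (f (\<phi> z)) \<le> t * cmod (?T f z - R J f z) + (\<Sum>j<J. t * cmod (D j f z))"
      using mult_left_mono[OF tri, of t] t by (simp add: distrib_left sum_distrib_left)
    also have "\<dots> \<le> sqrt (4 * KB) * (b J * N f) + (\<Sum>j<J. (2 * b j * sqrt (\<tau> z * S j z)) * N f)"
      by (intro add_mono e1 sum_mono e2)
    finally have "sqrt A * (t * cmod (f (\<phi> z))) \<le> sqrt A * (sqrt (4 * KB) * (b J * N f) + (\<Sum>j<J. (2 * b j * sqrt (\<tau> z * S j z)) * N f))"
      using A by (intro mult_left_mono) auto
    with e3 have "N f * h z \<le> N f * (sqrt A * sqrt (4 * KB) * b J + (\<Sum>j<J. x j z))"
      using tau_pos[OF z] by (simp add: x_def algebra_simps sum_distrib_left)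
    then have "h z \<le> sqrt A * sqrt (4 * KB) * b J + (\<Sum>j<J. x j z)" using Nf by simp
    also have "sqrt A * sqrt (4 * KB) * b J \<le> (sqrt A * sqrt (4 * KB) + 1) * b J" using bfacts(2)[of J] by (simp add: distrib_right)
    finally show "h z \<le> (sqrt A * sqrt (4 * KB) + 1) * b J + (\<Sum>j<J. x j z)" by simp
  next
    fix j
    show "0 \<le> x j z" for z using A bfacts(2)[of j] S0[of j z] by (simp add: x_def)
    have xm: "x j \<in> borel_measurable disc_area" unfolding x_def by measurable
    then show "x j \<in> borel_measurable M" by (simp add: M_def)
    let ?n = "2 ^ Suc j + 2 ^ j :: nat"
    have "(\<integral>\<^sup>+z. ennreal ((x j z)\<^sup>2) \<partial>M) = (\<integral>\<^sup>+z. ennreal (\<omega> z / \<tau> z) * ennreal ((x j z)\<^sup>2) \<partial>disc_area)"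
      by (rule MI) (use xm in measurable)
    also have "\<dots> = (\<integral>\<^sup>+z. (\<Sum>i<?n. ennreal (4 * A * (b j)\<^sup>2) * ennreal ((cmod (u j i z))\<^sup>2 * \<omega> z)) \<partial>disc_area)"
    proof (rule nn_integral_cong)
      fix z assume "z \<in> space disc_area"
      then have z: "z \<in> unit_disc" by simp
      have "(\<omega> z / \<tau> z) * (x j z)\<^sup>2 = (\<Sum>i<?n. 4 * A * (b j)\<^sup>2 * ((cmod (u j i z))\<^sup>2 * \<omega> z))"
      proof -
        have "(x j z)\<^sup>2 = A * (4 * (b j)\<^sup>2) * (\<tau> z * S j z)"
          using A S0[of j z] tau_pos[OF z] by (simp add: x_def power_mult_distrib)
        then have "(\<omega> z / \<tau> z) * (x j z)\<^sup>2 = 4 * A * (b j)\<^sup>2 * (S j z * \<omega> z)" using tau_pos[OF z] by simp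
        then show ?thesis by (simp only: S_def sum_distrib_left sum_distrib_right)
      qed
      then show "ennreal (\<omega> z / \<tau> z) * ennreal ((x j z)\<^sup>2) = (\<Sum>i<?n. ennreal (4 * A * (b j)\<^sup>2) * ennreal ((cmod (u j i z))\<^sup>2 * \<omega> z))"
        using omega_nonneg[OF z] tau_pos[OF z] A by (simp add: ennreal_mult[symmetric] sum_ennreal del: sum_ennreal) (simp add: sum_ennreal)
    qed
    also have "\<dots> = (\<Sum>i<?n. \<integral>\<^sup>+z. ennreal (4 * A * (b j)\<^sup>2) * ennreal ((cmod (u j i z))\<^sup>2 * \<omega> z) \<partial>disc_area)"
      by (rule nn_integral_sum) (use um in \<open>auto intro!: borel_measurable_times_ennreal measurable_compose[OF _ measurable_ennreal] borel_measurable_times borel_measurable_power borel_measurable_norm\<close>)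
    also have "\<dots> \<le> (\<Sum>i<?n. ennreal (4 * A * (b j)\<^sup>2) * 1)"
    proof (rule sum_mono)
      fix i assume i: "i \<in> {..<?n}"
      have uH: "u j i \<in> H" using orthonormal_H[OF u(1)] i by blast
      have N1: "N (u j i) \<le> 1" using u(1)[of j] i by (auto simp: orthonormal_upto_def)
      have "(\<integral>\<^sup>+z. ennreal (4 * A * (b j)\<^sup>2) * ennreal ((cmod (u j i z))\<^sup>2 * \<omega> z) \<partial>disc_area) = ennreal (4 * A * (b j)\<^sup>2) * (\<integral>\<^sup>+z. ennreal ((cmod (u j i z))\<^sup>2 * \<omega> z) \<partial>disc_area)"
        by (rule nn_integral_cmult) (use H_measurable[OF uH] in measurable)
      also have "\<dots> \<le> ennreal (4 * A * (b j)\<^sup>2) * 1"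
        unfolding norm_sq_nn[OF uH] using N1 norm_nonneg[of "u j i"] by (intro mult_left_mono) (auto simp: power_le_one)
      finally show "(\<integral>\<^sup>+z. ennreal (4 * A * (b j)\<^sup>2) * ennreal ((cmod (u j i z))\<^sup>2 * \<omega> z) \<partial>disc_area) \<le> ennreal (4 * A * (b j)\<^sup>2) * 1" .
    qed
    also have "\<dots> = ennreal (12 * A * 2 ^ j * (b j)\<^sup>2)"
    proof -
      have "(\<Sum>i<?n. ennreal (4 * A * (b j)\<^sup>2) * 1) = (\<Sum>i<?n. ennreal (4 * A * (b j)\<^sup>2))" by simp
      also have "\<dots> = ennreal (\<Sum>i<?n. 4 * A * (b j)\<^sup>2)" by (rule sum_ennreal) (use A in simp)
      also have "(\<Sum>i<?n. 4 * A * (b j)\<^sup>2) = 12 * A * 2 ^ j * (b j)\<^sup>2" by simp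
      finally show ?thesis .
    qed
    finally show "(\<integral>\<^sup>+z. ennreal ((x j z)\<^sup>2) \<partial>M) \<le> ennreal (12 * A * 2 ^ j * (b j)\<^sup>2)" .
  qed
  also have "(\<integral>\<^sup>+z. ennreal (h z powr p) \<partial>M) = (\<integral>\<^sup>+z. ennreal ((\<tau> z / \<tau> (\<phi> z)) powr (p / 2) * (\<omega> z / \<tau> z)) \<partial>disc_area)"
  proof (subst MI)
    show "(\<lambda>z. ennreal (h z powr p)) \<in> borel_measurable disc_area" unfolding h_def by measurable
    show "(\<integral>\<^sup>+z. ennreal (\<omega> z / \<tau> z) * ennreal (h z powr p) \<partial>disc_area) = (\<integral>\<^sup>+z. ennreal ((\<tau> z / \<tau> (\<phi> z)) powr (p / 2) * (\<omega> z / \<tau> z)) \<partial>disc_area)"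
    proof (rule nn_integral_cong)
      fix z assume "z \<in> space disc_area"
      then have z: "z \<in> unit_disc" by simp
      have pos: "0 < \<tau> z / \<tau> (\<phi> z)" using tau_pos[OF z] tau_pos[OF phi[OF z]] by simp
      have "h z = (\<tau> z / \<tau> (\<phi> z)) powr (1 / 2)" unfolding h_def using pos by (simp add: powr_half_sqrt)
      then have "h z powr p = (\<tau> z / \<tau> (\<phi> z)) powr (p / 2)" by (simp add: powr_powr)
      then show "ennreal (\<omega> z / \<tau> z) * ennreal (h z powr p) = ennreal ((\<tau> z / \<tau> (\<phi> z)) powr (p / 2) * (\<omega> z / \<tau> z))"
        using omega_nonneg[OF z] tau_pos[OF z] by (simp add: ennreal_mult[symmetric] mult.commute)
    qed
  qed
  finally show ?thesis .
qed

end

section \<open>Maps of bounded valence and Whitney covers\<close>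

text \<open>
  Off the zeros of \<open>\<phi>'\<close>, which contribute nothing, the disc is a countable union of open sets on which \<open>\<phi>\<close> is injective.
  Cut into disjoint Borel pieces \<open>A i\<close>, the integral becomes the sum of the areas of the images of the pieces, and a point
  of \<open>Q\<close> lies in at most \<open>n\<close> of them.
\<close>

lemma bounded_valent_area:
  assumes hol: "\<phi> holomorphic_on unit_disc" and self: "\<And>z. z \<in> unit_disc \<Longrightarrow> \<phi> z \<in> unit_disc"
    and val: "\<And>w. w \<in> unit_disc \<Longrightarrow> finite {z\<in>unit_disc. \<phi> z = w} \<and> card {z\<in>unit_disc. \<phi> z = w} \<le> n"
    and Q: "Q \<in> sets borel" "Q \<subseteq> unit_disc"
  shows "(\<integral>\<^sup>+z. indicator Q (\<phi> z) * ennreal ((cmod (deriv \<phi> z))\<^sup>2) \<partial>disc_area) \<le> ennreal (real n) * emeasure disc_area Q"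
proof -
  define d where "d z = (if z \<in> unit_disc then deriv \<phi> z else 0)" for z
  \<comment> \<open>The value \<open>2\<close> keeps the complement of the disc out of the preimage of \<open>Q\<close>.\<close>
  define \<psi> where "\<psi> z = (if z \<in> unit_disc then \<phi> z else 2)" for z
  have dm[measurable]: "d \<in> borel_measurable borel"
    unfolding d_def by (intro borel_measurable_continuous_on_if continuous_on_const)
       (use hol in \<open>auto intro!: holomorphic_on_imp_continuous_on holomorphic_deriv\<close>)
  have pm[measurable]: "\<psi> \<in> borel_measurable borel"
    unfolding \<psi>_def by (intro borel_measurable_continuous_on_if continuous_on_const)
       (use hol in \<open>auto intro!: holomorphic_on_imp_continuous_on\<close>)
  define P where "P = \<psi> -` Q"
  have P: "P \<in> sets borel" unfolding P_def using measurable_sets[OF pm Q(1)] by simp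
  have PD: "P \<subseteq> unit_disc" using Q(2) by (auto simp: P_def \<psi>_def unit_disc_iff split: if_splits)
  have PQ: "z \<in> P \<longleftrightarrow> \<phi> z \<in> Q" if "z \<in> unit_disc" for z using that by (simp add: P_def \<psi>_def)
  define F where "F = {U. open U \<and> U \<subseteq> unit_disc \<and> inj_on \<phi> U}"
  obtain F' where F': "F' \<subseteq> F" "countable F'" "\<Union>F' = \<Union>F"
    using Lindelof[of F] unfolding F_def by auto
  have emF: "{} \<in> F" by (simp add: F_def)
  define U where "U = from_nat_into (insert {} F')"
  have rU: "range U = insert {} F'" unfolding U_def using F'(2) by (intro range_from_nat_into) auto
  have UF: "U i \<in> F" for i
  proof -
    have "U i \<in> range U" by simp
    then have "U i = {} \<or> U i \<in> F'" unfolding rU by simp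
    then show ?thesis
    proof
      assume "U i = {}"
      then show ?thesis using emF by simp
    next
      assume "U i \<in> F'"
      then show ?thesis by (rule subsetD[OF F'(1)])
    qed
  qed
  have Ucov: "z \<in> (\<Union>i. U i)" if z: "z \<in> unit_disc" "deriv \<phi> z \<noteq> 0" for z
  proof -
    obtain r where "r > 0" "ball z r \<subseteq> unit_disc" "inj_on \<phi> (ball z r)"
      using has_complex_derivative_locally_injective[OF hol z(1) _ z(2)] by auto
    then have "z \<in> \<Union>F" by (auto simp: F_def intro!: exI[of _ "ball z r"])
    then show ?thesis using rU F'(3) by auto
  qed
  define A where "A i = P \<inter> disjointed U i" for i
  have Ub: "U i \<in> sets borel" for i using UF by (auto simp: F_def)
  have Ab[measurable]: "A i \<in> sets borel" for i
    unfolding A_def using P Ub by (auto intro!: sets.Int sets.sets_into_space simp: disjointed_def)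
  have AU: "A i \<subseteq> U i" for i using disjointed_subset[of U i] by (auto simp: A_def)
  have AP: "A i \<subseteq> P" for i by (auto simp: A_def)
  have Adisj: "i = j" if "z \<in> A i" "z \<in> A j" for i j z
    using that disjoint_family_disjointed[of U] unfolding A_def disjoint_family_on_def by blast
  have bd: "bounded (\<phi> ` A i)" for i
  proof (rule bounded_subset)
    show "\<phi> ` A i \<subseteq> ball 0 1" using self AP PD by (force simp: unit_disc_def)
  qed simp
  have UF': "open (U i)" "\<phi> holomorphic_on U i" "inj_on \<phi> (U i)" for i
    using UF[of i] hol by (auto simp: F_def intro: holomorphic_on_subset)
  note area = area_formula_inj[OF UF' Ab AU bd]
  have "(\<integral>\<^sup>+z. indicator P z * ennreal ((cmod (d z))\<^sup>2) \<partial>lborel) \<le> (\<integral>\<^sup>+z. (\<Sum>i. indicator (A i) z * ennreal ((cmod (d z))\<^sup>2)) \<partial>lborel)"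
  proof (rule nn_integral_mono)
    fix z
    show "indicator P z * ennreal ((cmod (d z))\<^sup>2) \<le> (\<Sum>i. indicator (A i) z * ennreal ((cmod (d z))\<^sup>2))"
    proof (cases "z \<in> P \<and> d z \<noteq> 0")
      case True
      then have z: "z \<in> unit_disc" "deriv \<phi> z \<noteq> 0" using PD by (auto simp: d_def)
      then have "z \<in> (\<Union>i. disjointed U i)" using Ucov UN_disjointed_eq[of U] by simp
      then obtain i where "z \<in> A i" using True by (auto simp: A_def)
      then show ?thesis using True sum_le_suminf[of "\<lambda>i. indicator (A i) z * ennreal ((cmod (d z))\<^sup>2)" "{i}"] by simp
    next
      case False
      then show ?thesis by (auto simp: indicator_def)
    qed
  qed
  also have "\<dots> = (\<Sum>i. \<integral>\<^sup>+z. indicator (A i) z * ennreal ((cmod (d z))\<^sup>2) \<partial>lborel)"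
    by (rule nn_integral_suminf) measurable
  also have "\<dots> = (\<Sum>i. emeasure lborel (\<phi> ` A i))"
  proof (rule suminf_cong)
    fix i
    have "(\<integral>\<^sup>+z. indicator (A i) z * ennreal ((cmod (d z))\<^sup>2) \<partial>lborel) = (\<integral>\<^sup>+z. indicator (A i) z * ennreal ((cmod (deriv \<phi> z))\<^sup>2) \<partial>lborel)"
      using AP PD by (intro nn_integral_cong) (auto simp: indicator_def d_def)
    then show "(\<integral>\<^sup>+z. indicator (A i) z * ennreal ((cmod (d z))\<^sup>2) \<partial>lborel) = emeasure lborel (\<phi> ` A i)"
      using area(2)[of i] by simp
  qed
  also have "\<dots> = (\<Sum>i. \<integral>\<^sup>+w. indicator (\<phi> ` A i) w \<partial>lborel)" using area(1) by simp
  also have "\<dots> = (\<integral>\<^sup>+w. (\<Sum>i. indicator (\<phi> ` A i) w) \<partial>lborel)"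
    by (rule nn_integral_suminf[symmetric]) (use area(1) in auto)
  also have "\<dots> \<le> (\<integral>\<^sup>+w. ennreal (real n) * indicator Q w \<partial>lborel)"
  proof (rule nn_integral_mono)
    fix w
    show "(\<Sum>i. indicator (\<phi> ` A i) w) \<le> ennreal (real n) * indicator Q w"
    proof (cases "w \<in> Q")
      case True
      then have w: "w \<in> unit_disc" using Q by auto
      show ?thesis
      proof (rule suminf_le_const[OF summableI])
        fix M
        define I where "I = {i. i < M \<and> w \<in> \<phi> ` A i}"
        have "\<exists>z. \<forall>i\<in>I. z i \<in> A i \<and> \<phi> (z i) = w" unfolding I_def by (intro bchoice) auto
        then obtain z where z: "\<And>i. i \<in> I \<Longrightarrow> z i \<in> A i \<and> \<phi> (z i) = w" by blast
        have "inj_on z I" using z Adisj by (intro inj_onI) metis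
        moreover have "z ` I \<subseteq> {z\<in>unit_disc. \<phi> z = w}" using z AP PD by blast
        ultimately have "card I \<le> card {z\<in>unit_disc. \<phi> z = w}" using val[OF w] card_inj_on_le by blast
        then have cI: "card I \<le> n" using val[OF w] by simp
        have "(\<Sum>i<M. indicator (\<phi> ` A i) w) = (\<Sum>i\<in>I. 1 :: ennreal)"
          unfolding I_def by (intro sum.mono_neutral_cong_right) (auto simp: indicator_def)
        also have "\<dots> = of_nat (card I)" by simp
        also have "\<dots> \<le> of_nat n" using cI by simp
        finally show "(\<Sum>i<M. indicator (\<phi> ` A i) w) \<le> ennreal (real n) * indicator Q w"
          using True by (simp add: ennreal_of_nat_eq_real_of_nat)
      qed
    next
      case False
      then have "w \<notin> \<phi> ` A i" for i using AP[of i] PQ PD by blast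
      then show ?thesis by (simp add: indicator_def)
    qed
  qed
  also have "\<dots> = ennreal (real n) * emeasure lborel Q" by (rule nn_integral_cmult_indicator) (use Q in simp)
  finally have main: "(\<integral>\<^sup>+z. indicator P z * ennreal ((cmod (d z))\<^sup>2) \<partial>lborel) \<le> ennreal (real n) * emeasure lborel Q" .
  have "(\<integral>\<^sup>+z. indicator Q (\<phi> z) * ennreal ((cmod (deriv \<phi> z))\<^sup>2) \<partial>disc_area) = (\<integral>\<^sup>+z. indicator P z * ennreal ((cmod (d z))\<^sup>2) \<partial>disc_area)"
    by (intro nn_integral_cong) (auto simp: indicator_def PQ d_def)
  also have "\<dots> = ennreal (1 / pi) * (\<integral>\<^sup>+z. indicator P z * ennreal ((cmod (d z))\<^sup>2) * indicator unit_disc z \<partial>lborel)"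
    by (rule nn_integral_disc_area, rule borel_measurable_disc_area_borel) (use P in measurable)
  also have "(\<integral>\<^sup>+z. indicator P z * ennreal ((cmod (d z))\<^sup>2) * indicator unit_disc z \<partial>lborel) = (\<integral>\<^sup>+z. indicator P z * ennreal ((cmod (d z))\<^sup>2) \<partial>lborel)"
    using PD by (intro nn_integral_cong) (auto simp: indicator_def)
  also have "ennreal (1 / pi) * \<dots> \<le> ennreal (1 / pi) * (ennreal (real n) * emeasure lborel Q)" by (intro mult_left_mono main) simp
  also have "\<dots> = ennreal (real n) * emeasure disc_area Q"
    using Q by (subst emeasure_disc_area) (auto simp: sets_disc_area mult_ac)
  finally show ?thesis .
qed

text \<open>
  The Cayley transform maps the right half-plane into the unit disc.
\<close>

lemma norm_diff_less_norm_add_cnj: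
  assumes "0 < Re a" "0 < Re b" shows "cmod (a - b) < cmod (a + cnj b)"
proof -
  have "(cmod (a - b))\<^sup>2 < (cmod (a + cnj b))\<^sup>2"
  proof -
    have "(cmod (a + cnj b))\<^sup>2 - (cmod (a - b))\<^sup>2 = 4 * (Re a * Re b)"
      unfolding cmod_power2 by (simp add: power2_eq_square algebra_simps)
    moreover have "0 < 4 * (Re a * Re b)" using assms by simp
    ultimately show ?thesis by linarith
  qed
  then show ?thesis by (rule power2_less_imp_less) simp
qed

text \<open>
  After a rotation \<open>\<phi> z\<close> is real and nonnegative, so \<open>\<psi> = 1 - c * \<phi>\<close> maps the disc of radius \<open>1 - |z|\<close> around \<open>z\<close>, rescaled to
  the unit disc, into the right half-plane and \<open>0\<close> to \<open>b = 1 - |\<phi> z|\<close>. The Cayley transform with centre \<open>b\<close> brings it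
  into the situation of the Schwarz lemma.
\<close>

lemma Schwarz_Pick_derivative:
  assumes hol: "\<phi> holomorphic_on unit_disc" and self: "\<And>z. z \<in> unit_disc \<Longrightarrow> \<phi> z \<in> unit_disc" and z: "z \<in> unit_disc"
  shows "cmod (deriv \<phi> z) * (1 - cmod z) \<le> 2 * (1 - cmod (\<phi> z))"
proof -
  define c where "c = (if \<phi> z = 0 then 1 else cnj (\<phi> z) / of_real (cmod (\<phi> z)))"
  have c: "cmod c = 1" "c * \<phi> z = of_real (cmod (\<phi> z))"
  proof -
    show "cmod c = 1" by (simp add: c_def norm_divide)
    have "cnj (\<phi> z) * \<phi> z = of_real ((cmod (\<phi> z))\<^sup>2)" unfolding complex_norm_square by (rule mult.commute)
    then show "c * \<phi> z = of_real (cmod (\<phi> z))" by (auto simp: c_def power2_eq_square)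
  qed
  define \<rho> where "\<rho> = 1 - cmod z"
  have \<rho>: "0 < \<rho>" using z by (simp add: \<rho>_def unit_disc_iff)
  define L where "L \<zeta> = z + of_real \<rho> * \<zeta>" for \<zeta> :: complex
  have LD: "L \<zeta> \<in> unit_disc" if "\<zeta> \<in> ball 0 1" for \<zeta>
  proof -
    have "cmod (L \<zeta>) \<le> cmod z + cmod (of_real \<rho> * \<zeta>)" unfolding L_def by (rule norm_triangle_ineq)
    also have "cmod (of_real \<rho> * \<zeta>) = \<rho> * cmod \<zeta>" using \<rho> by (simp add: norm_mult)
    also have "\<dots> < \<rho> * 1" using that \<rho> by (intro mult_strict_left_mono) auto
    finally show ?thesis by (simp add: unit_disc_iff \<rho>_def)
  qed
  define \<psi> where "\<psi> \<zeta> = 1 - c * \<phi> (L \<zeta>)" for \<zeta>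
  have Re\<psi>: "0 < Re (\<psi> \<zeta>)" if "\<zeta> \<in> ball 0 1" for \<zeta>
  proof -
    have "Re (c * \<phi> (L \<zeta>)) \<le> cmod (c * \<phi> (L \<zeta>))" by (rule complex_Re_le_cmod)
    also have "\<dots> < 1" using self[OF LD[OF that]] c(1) by (simp add: norm_mult unit_disc_iff)
    finally show ?thesis by (simp add: \<psi>_def)
  qed
  define b where "b = 1 - cmod (\<phi> z)"
  have b: "0 < b" using self[OF z] by (simp add: b_def unit_disc_iff)
  have \<psi>0: "\<psi> 0 = of_real b" by (simp add: \<psi>_def L_def c(2) b_def)
  have hL: "L holomorphic_on ball 0 1" unfolding L_def by (intro holomorphic_intros)
  have "(\<phi> \<circ> L) holomorphic_on ball 0 1"
    by (rule holomorphic_on_compose_gen[OF hL hol]) (use LD in auto)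
  then have h\<psi>: "\<psi> holomorphic_on ball 0 1" unfolding \<psi>_def by (intro holomorphic_intros) (simp add: o_def)
  define g where "g \<zeta> = (\<psi> \<zeta> - of_real b) / (\<psi> \<zeta> + of_real b)" for \<zeta>
  have nz: "\<psi> \<zeta> + of_real b \<noteq> 0" if "\<zeta> \<in> ball 0 1" for \<zeta>
  proof
    assume "\<psi> \<zeta> + of_real b = 0"
    then have "Re (\<psi> \<zeta> + of_real b) = 0" by simp
    then show False using Re\<psi>[OF that] b by simp
  qed
  have hg: "g holomorphic_on ball 0 1" unfolding g_def by (intro holomorphic_intros h\<psi> nz)
  have g0: "g 0 = 0" by (simp add: g_def \<psi>0)
  have gn: "cmod (g \<zeta>) < 1" if "cmod \<zeta> < 1" for \<zeta>
  proof -
    have "cmod (\<psi> \<zeta> - of_real b) < cmod (\<psi> \<zeta> + cnj (of_real b))"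
      by (rule norm_diff_less_norm_add_cnj) (use Re\<psi>[of \<zeta>] that b in auto)
    then show ?thesis using nz[of \<zeta>] that by (simp add: g_def norm_divide)
  qed
  have dg: "cmod (deriv g 0) \<le> 1" using Schwarz_Lemma(2)[OF hg g0 gn, of 0] by simp
  have dL: "(L has_field_derivative of_real \<rho>) (at 0)" unfolding L_def by (auto intro!: derivative_eq_intros)
  have "(\<phi> has_field_derivative deriv \<phi> (L 0)) (at (L 0))"
    using hol z by (intro holomorphic_derivI[of _ unit_disc]) (auto simp: L_def)
  from DERIV_chain2[OF this dL] have "((\<lambda>\<zeta>. \<phi> (L \<zeta>)) has_field_derivative deriv \<phi> z * of_real \<rho>) (at 0)" by (simp add: L_def)
  then have d\<psi>: "(\<psi> has_field_derivative - (c * (deriv \<phi> z * of_real \<rho>))) (at 0)"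
    unfolding \<psi>_def by (auto intro!: derivative_eq_intros)
  have "(g has_field_derivative - (c * (deriv \<phi> z * of_real \<rho>)) / (2 * of_real b)) (at 0)"
    unfolding g_def using b \<psi>0
    by (auto intro!: derivative_eq_intros d\<psi>)
  then have "deriv g 0 = - (c * (deriv \<phi> z * of_real \<rho>)) / (2 * of_real b)" by (rule DERIV_imp_deriv)
  then have "cmod (deriv g 0) = cmod (deriv \<phi> z) * \<rho> / (2 * b)"
    using b \<rho> c(1) by (simp add: norm_divide norm_mult)
  then show ?thesis using dg b by (simp add: \<rho>_def b_def divide_le_eq)
qed

text \<open>
  Vitali's lemma for the balls of radius \<open>(1 - |a|) / 160\<close> gives disjoint balls whose enlargements by \<open>5\<close> cover. If \<open>z\<close>
  lies in several of the balls of radius \<open>(1 - |w j|) / 4\<close>, then all these \<open>1 - |w j|\<close> are comparable to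
  \<open>s = 1 - |z|\<close>, and disjoint balls of radius at least \<open>s / 200\<close> lie in \<open>ball z s\<close>: comparing areas, there are at
  most \<open>200\<^sup>2\<close> of them.
\<close>

lemma Whitney_cover:
  obtains w :: "nat \<Rightarrow> complex" and K :: nat where
    "\<And>j. w j \<in> unit_disc"
    "\<And>z. z \<in> unit_disc \<Longrightarrow> \<exists>j. z \<in> ball (w j) ((1 - cmod (w j)) / 32)"
    "\<And>z F. finite F \<Longrightarrow> (\<And>j. j \<in> F \<Longrightarrow> z \<in> ball (w j) ((1 - cmod (w j)) / 4)) \<Longrightarrow> card F \<le> K"
proof -
  define r where "r a = (1 - cmod a) / 160" for a :: complex
  obtain C where C: "countable C" "C \<subseteq> unit_disc" "pairwise (\<lambda>i j. disjnt (ball i (r i)) (ball j (r j))) C"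
    "unit_disc \<subseteq> (\<Union>i\<in>C. ball i (5 * r i))"
  proof (rule Vitali_covering_lemma_balls[where K=unit_disc and a="\<lambda>a. a" and r=r and S=unit_disc and B=1])
    show "unit_disc \<subseteq> (\<Union>i\<in>unit_disc. ball i (r i))" by (auto simp: r_def unit_disc_iff)
    show "\<And>i. i \<in> unit_disc \<Longrightarrow> 0 < r i \<and> r i \<le> 1"
    proof -
      fix i :: complex assume "i \<in> unit_disc"
      then have "cmod i < 1" "0 \<le> cmod i" by (auto simp: unit_disc_iff)
      then have "0 < 1 - cmod i" "1 - cmod i \<le> 160" by linarith+
      then show "0 < r i \<and> r i \<le> 1" unfolding r_def by (simp only: zero_less_divide_iff divide_le_eq) simp
    qed
  qed blast
  \<comment> \<open>Finitely many of the balls stay away from the circle, hence cannot cover; so the centres can be enumerated by \<open>nat\<close>.\<close>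
  have inf: "infinite C"
  proof
    assume fin: "finite C"
    define M where "M = Max (insert 0 ((\<lambda>a. cmod a + 5 * r a) ` C))"
    have M: "cmod a + 5 * r a \<le> M" if "a \<in> C" for a unfolding M_def using fin that by (intro Max_ge) auto
    have "M \<in> insert 0 ((\<lambda>a. cmod a + 5 * r a) ` C)" unfolding M_def using fin by (intro Max_in) auto
    then have M1: "0 \<le> M" "M < 1" 
    proof -
      show "0 \<le> M" unfolding M_def using fin by (intro Max_ge) auto
      have "cmod a + 5 * r a < 1" if "a \<in> C" for a
        using C(2) that unfolding r_def by (auto simp: unit_disc_iff field_simps)
      then show "M < 1" using \<open>M \<in> _\<close> by auto
    qed
    define z where "z = complex_of_real ((1 + M) / 2)"
    have cz: "cmod z = (1 + M) / 2" unfolding z_def norm_of_real using M1 by simp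
    then have "z \<in> unit_disc" using M1 by (simp add: unit_disc_iff)
    then obtain a where a: "a \<in> C" "z \<in> ball a (5 * r a)" using C(4) by blast
    have "cmod z \<le> cmod a + cmod (z - a)" using norm_triangle_ineq[of a "z - a"] by simp
    also have "\<dots> < cmod a + 5 * r a" using a(2) by (simp add: dist_norm norm_minus_commute)
    finally have "cmod z < M" using M[OF a(1)] by simp
    then show False using cz M1 by simp
  qed
  define w where "w = from_nat_into C"
  have bij: "bij_betw w UNIV C" unfolding w_def by (rule bij_betw_from_nat_into[OF C(1) inf])
  have wC: "w j \<in> C" for j using bij by (auto simp: bij_betw_def)
  have wD: "w j \<in> unit_disc" for j using wC C(2) by blast
  show ?thesis
  proof (rule that[of w 40000])
    show "w j \<in> unit_disc" for j by (rule wD)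
    show "\<exists>j. z \<in> ball (w j) ((1 - cmod (w j)) / 32)" if "z \<in> unit_disc" for z
    proof -
      obtain a where a: "a \<in> C" "z \<in> ball a (5 * r a)" using C(4) \<open>z \<in> unit_disc\<close> by blast
      obtain j where "a = w j" using a(1) bij by (auto simp: bij_betw_def)
      then show ?thesis using a(2) by (intro exI[of _ j]) (simp add: r_def)
    qed
    fix z F assume fin: "finite F" and zF: "\<And>j. j \<in> F \<Longrightarrow> z \<in> ball (w j) ((1 - cmod (w j)) / 4)"
    show "card F \<le> 40000"
    proof (cases "F = {}")
      case False
      define s where "s = 1 - cmod z"
      have cmp: "(3/4) * (1 - cmod (w j)) \<le> s \<and> s \<le> (5/4) * (1 - cmod (w j)) \<and> cmod (z - w j) \<le> (1/3) * s" if j: "j \<in> F" for j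
      proof -
        have d: "cmod (z - w j) < (1 - cmod (w j)) / 4" using zF[OF j] by (simp add: dist_norm norm_minus_commute)
        have "cmod z - cmod (w j) \<le> cmod (z - w j)" "cmod (w j) - cmod z \<le> cmod (z - w j)"
          using norm_triangle_ineq2[of z "w j"] norm_triangle_ineq2[of "w j" z] by (auto simp: norm_minus_commute)
        then show ?thesis using d unfolding s_def by (simp add: field_simps)
      qed
      have w0: "0 < 1 - cmod (w j)" for j using wD[of j] by (simp add: unit_disc_iff)
      have s0: "0 < s" using False cmp w0 by (metis all_not_in_conv less_le_trans mult_pos_pos zero_less_divide_iff zero_less_numeral)
      have dis: "disjoint_family_on (\<lambda>j. ball (w j) (r (w j))) F"
        unfolding disjoint_family_on_def
      proof (intro ballI impI)
        fix i j assume "i \<in> F" "j \<in> F" "i \<noteq> j"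
        then have "w i \<noteq> w j" using bij by (auto simp: bij_betw_def inj_on_def)
        then show "ball (w i) (r (w i)) \<inter> ball (w j) (r (w j)) = {}"
          using C(3) wC unfolding pairwise_def disjnt_def by blast
      qed
      have "ennreal (real (card F) * (pi * (s / 200)\<^sup>2)) = (\<Sum>j\<in>F. ennreal (pi * (s / 200)\<^sup>2))"
        by (simp add: ennreal_mult ennreal_of_nat_eq_real_of_nat)
      also have "\<dots> \<le> (\<Sum>j\<in>F. emeasure lborel (ball (w j) (r (w j))))"
      proof (rule sum_mono)
        fix j assume j: "j \<in> F"
        have "s / 200 \<le> r (w j)" using cmp[OF j] by (simp add: r_def)
        then have "pi * (s / 200)\<^sup>2 \<le> pi * (r (w j))\<^sup>2" using s0 by (intro mult_left_mono power_mono) auto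
        moreover have "emeasure lborel (ball (w j) (r (w j))) = ennreal (pi * (r (w j))\<^sup>2)"
          by (rule emeasure_complex_ball(1)) (use w0[of j] in \<open>simp add: r_def\<close>)
        ultimately show "ennreal (pi * (s / 200)\<^sup>2) \<le> emeasure lborel (ball (w j) (r (w j)))" by (simp add: ennreal_leI)
      qed
      also have "\<dots> = emeasure lborel (\<Union>j\<in>F. ball (w j) (r (w j)))"
        by (rule sum_emeasure) (use dis fin in auto)
      also have "\<dots> \<le> emeasure lborel (ball z s)"
      proof (rule emeasure_mono)
        show "(\<Union>j\<in>F. ball (w j) (r (w j))) \<subseteq> ball z s"
        proof
          fix x assume "x \<in> (\<Union>j\<in>F. ball (w j) (r (w j)))"
          then obtain j where j: "j \<in> F" "cmod (w j - x) < r (w j)" by (auto simp: dist_norm)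
          have "cmod (z - x) \<le> cmod (z - w j) + cmod (w j - x)" using norm_triangle_ineq[of "z - w j" "w j - x"] by simp
          moreover have "r (w j) \<le> s / 120" using cmp[OF j(1)] by (simp add: r_def)
          ultimately show "x \<in> ball z s" using cmp[OF j(1)] j(2) s0 by (simp add: dist_norm)
        qed
      qed simp
      also have "\<dots> = ennreal (pi * s\<^sup>2)" by (rule emeasure_complex_ball(1)) (use s0 in simp)
      finally have "real (card F) * (pi * (s / 200)\<^sup>2) \<le> pi * s\<^sup>2" by (subst (asm) ennreal_le_iff) auto
      then have "real (card F) * (pi * s\<^sup>2) \<le> 40000 * (pi * s\<^sup>2)" by (simp add: power_divide)
      moreover have "0 < pi * s\<^sup>2" using s0 by simp
      ultimately have "real (card F) \<le> 40000" by (simp only: mult_le_cancel_right_pos)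
      then show ?thesis by simp
    qed simp
  qed
qed

section \<open>Estimating singular values, and compactness\<close>

context regular_radial_weight
begin

lemma ip_projection_right:
  assumes u: "orthonormal_upto n u" and h: "h \<in> H" and o: "\<And>k. k < n \<Longrightarrow> ip h (u k) = 0"
  shows "ip h (projection n u g) = 0"
proof -
  have "ip (projection n u g) h = (\<Sum>i<n. ip g (u i) * ip (u i) h)"
    unfolding projection_def by (rule ip_sum) (use orthonormal_H[OF u] h in auto)
  also have "\<dots> = 0" using o ip_cnj[of "u _" h] by (intro sum.neutral) simp
  finally show ?thesis using ip_cnj[of h "projection n u g"] by simp
qed

lemma linear_operatorD:
  assumes "linear_operator H T" "f \<in> H" "g \<in> H"
  shows "T (\<lambda>x. a * f x + b * g x) = (\<lambda>x. a * T f x + b * T g x)"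
  using assms by (simp add: linear_operator_def)

lemma linear_operator_sum:
  assumes T: "linear_operator H T" and e: "\<And>i. i < (n::nat) \<Longrightarrow> e i \<in> H"
  shows "T (\<lambda>x. \<Sum>i<n. c i * e i x) = (\<lambda>x. \<Sum>i<n. c i * T (e i) x)"
  using e
proof (induction n)
  case 0
  have "T (\<lambda>x. 0 * (0::complex) + 0 * 0) = (\<lambda>x. 0 * T (\<lambda>x. 0) x + 0 * T (\<lambda>x. 0) x)"
    by (rule linear_operatorD[OF T H_zero H_zero])
  then show ?case by simp
next
  case (Suc n)
  have "(\<lambda>x. \<Sum>i<n. c i * e i x) \<in> H" by (rule H_sum) (use Suc in auto)
  moreover have "e n \<in> H" using Suc by simp
  ultimately have "T (\<lambda>x. 1 * (\<Sum>i<n. c i * e i x) + c n * e n x) = (\<lambda>x. 1 * T (\<lambda>x. \<Sum>i<n. c i * e i x) x + c n * T (e n) x)"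
    by (rule linear_operatorD[OF T])
  then show ?case using Suc by simp
qed

text \<open>
  If \<open>T\<close> has norm at most \<open>t\<close> on the common kernel of \<open>n\<close> bounded functionals, then \<open>T\<close> composed with the orthogonal
  projection onto the span of their representing vectors has rank at most \<open>n\<close> and differs from \<open>T\<close> by at most \<open>t\<close>.
\<close>

theorem singular_value_le_on_kernel:
  assumes T: "bounded_operator H N T" and t: "0 \<le> t"
    and lin: "\<And>i f g a b. i < n \<Longrightarrow> f \<in> H \<Longrightarrow> g \<in> H \<Longrightarrow> L i (\<lambda>z. a * f z + b * g z) = a * L i f + b * L i g"
    and bd: "\<And>i. i < n \<Longrightarrow> \<exists>B. \<forall>f\<in>H. cmod (L i f) \<le> B * N f"
    and ker: "\<And>f. f \<in> H \<Longrightarrow> (\<And>i. i < n \<Longrightarrow> L i f = 0) \<Longrightarrow> N (T f) \<le> t * N f"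
  shows "singular_value H N T n \<le> t"
proof -
  have "\<exists>g\<in>H. \<forall>f\<in>H. L i f = ip f g" if i: "i < n" for i
  proof -
    obtain B where B: "\<forall>f\<in>H. cmod (L i f) \<le> B * N f" using bd[OF i] by blast
    show ?thesis by (rule Riesz_representation[OF lin[OF i]]) (use B in auto)
  qed
  then obtain g where g: "\<And>i. i < n \<Longrightarrow> g i \<in> H" "\<And>i f. i < n \<Longrightarrow> f \<in> H \<Longrightarrow> L i f = ip f (g i)" by metis
  obtain u where u: "orthonormal_upto n u" "\<And>i. i < n \<Longrightarrow> projection n u (g i) = g i" using Gram_Schmidt[of n g, OF g(1)] by blast
  have Tl: "linear_operator H T" using T by (simp add: bounded_operator_def)
  obtain C where C: "\<And>f. f \<in> H \<Longrightarrow> N (T f) \<le> C * N f" using T by (auto simp: bounded_operator_def)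
  have TH: "T f \<in> H" if "f \<in> H" for f using Tl that by (auto simp: linear_operator_def)
  have Tlc: "T (\<lambda>x. a * f x + b * h x) = (\<lambda>x. a * T f x + b * T h x)" if "f \<in> H" "h \<in> H" for f h a b
    by (rule linear_operatorD[OF Tl that])
  define R where "R f = T (projection n u f)" for f
  have Plin: "projection n u (\<lambda>x. a * f x + b * h x) = (\<lambda>x. a * projection n u f x + b * projection n u h x)" if "f \<in> H" "h \<in> H" for f h a b
    unfolding projection_def using that orthonormal_H[OF u(1)]
    by (simp add: ip_lincomb fun_eq_iff sum_distrib_left sum.distrib[symmetric] algebra_simps)
  have "linear_operator H R"
    unfolding linear_operator_def R_def using Plin Tlc[OF projection_H[OF u(1)] projection_H[OF u(1)]]
    by (auto intro!: TH projection_H[OF u(1)])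
  moreover have "N (R f) \<le> \<bar>C\<bar> * N f" if f: "f \<in> H" for f
  proof -
    have "N (R f) \<le> C * N (projection n u f)" unfolding R_def by (rule C[OF projection_H[OF u(1)]])
    also have "\<dots> \<le> \<bar>C\<bar> * N f" using projection_norm_le(2)[OF u(1) f] norm_nonneg by (intro mult_mono) auto
    finally show ?thesis .
  qed
  ultimately have Rb: "bounded_operator H N R" unfolding bounded_operator_def by blast
  have Rr: "rank_le H R n"
    unfolding rank_le_def
  proof (intro exI[of _ "\<lambda>i. T (u i)"] conjI allI impI ballI)
    show "T (u i) \<in> H" if "i < n" for i by (rule TH[OF orthonormal_H[OF u(1) that]])
    show "\<exists>c. R f = (\<lambda>x. \<Sum>i<n. c i * T (u i) x)" for f
      unfolding R_def projection_def
      by (intro exI[of _ "\<lambda>i. ip f (u i)"] linear_operator_sum[OF Tl] orthonormal_H[OF u(1)])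
  qed
  show ?thesis
  proof (rule singular_value_le[OF T Rb Rr _ t])
    fix f assume f: "f \<in> H"
    let ?Q = "\<lambda>x. f x - projection n u f x"
    have QH: "?Q \<in> H" by (rule H_diff[OF f projection_H[OF u(1)]])
    have "L i ?Q = 0" if i: "i < n" for i
    proof -
      have "L i ?Q = ip ?Q (projection n u (g i))" using g(2)[OF i QH] u(2)[OF i] by simp
      also have "\<dots> = 0" by (rule ip_projection_right[OF u(1) QH]) (rule residual_orthogonal[OF u(1) _ f])
      finally show ?thesis .
    qed
    then have "N (T ?Q) \<le> t * N ?Q" by (rule ker[OF QH])
    also have "\<dots> \<le> t * N f" using projection_norm_le(1)[OF u(1) f] t by (rule mult_left_mono)
    also have "T ?Q = (\<lambda>x. T f x - R f x)"
      using Tlc[OF f projection_H[OF u(1), of f], of 1 "-1"] by (simp add: R_def)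
    finally show "N (\<lambda>x. T f x - R f x) \<le> t * N f" .
  qed
qed

lemma singular_value_le_on_kernel_finite:
  assumes T: "bounded_operator H N T" and t: "0 \<le> t" and A: "finite A"
    and lin: "\<And>i f g a b. i \<in> A \<Longrightarrow> f \<in> H \<Longrightarrow> g \<in> H \<Longrightarrow> L i (\<lambda>z. a * f z + b * g z) = a * L i f + b * L i g"
    and bd: "\<And>i. i \<in> A \<Longrightarrow> \<exists>B. \<forall>f\<in>H. cmod (L i f) \<le> B * N f"
    and ker: "\<And>f. f \<in> H \<Longrightarrow> (\<And>i. i \<in> A \<Longrightarrow> L i f = 0) \<Longrightarrow> N (T f) \<le> t * N f"
  shows "singular_value H N T (card A) \<le> t"
proof -
  obtain e where e: "bij_betw e {..<card A} A" using ex_bij_betw_nat_finite[OF A] by (auto simp: atLeast0LessThan)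
  have eA: "e i \<in> A" if "i < card A" for i using e that by (auto simp: bij_betw_def)
  show ?thesis
  proof (rule singular_value_le_on_kernel[OF T t, where L="\<lambda>i. L (e i)"])
    fix f assume f: "f \<in> H" and 0: "\<And>i. i < card A \<Longrightarrow> L (e i) f = 0"
    show "N (T f) \<le> t * N f"
    proof (rule ker[OF f])
      fix i assume "i \<in> A"
      then obtain k where "k < card A" "i = e k" using e by (auto simp: bij_betw_def)
      then show "L i f = 0" using 0 by simp
    qed
  qed (use lin bd eA in auto)
qed

sublocale H: Metric_space H "\<lambda>f g. N (\<lambda>x. f x - g x)"
proof
  show "0 \<le> N (\<lambda>x. f x - g x)" for f g by (rule norm_nonneg)
  show "N (\<lambda>x. f x - g x) = N (\<lambda>x. g x - f x)" for f g by (rule norm_minus)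
  show "N (\<lambda>x. f x - g x) = 0 \<longleftrightarrow> f = g" if "f \<in> H" "g \<in> H" for f g
    using norm_zero_iff[OF H_diff[OF that]] by (auto simp: fun_eq_iff)
  show "N (\<lambda>x. f x - h x) \<le> N (\<lambda>x. f x - g x) + N (\<lambda>x. g x - h x)" if "f \<in> H" "g \<in> H" "h \<in> H" for f g h
    by (rule norm_diff_triangle[OF that])
qed

lemma coeff_le_norm:
  assumes f: "f \<in> H" and a: "has_coeffs a f" shows "(\<Sum>n<M. (cmod (a n))\<^sup>2 * moment n) \<le> (N f)\<^sup>2"
  using sum_le_suminf[of "\<lambda>n. (cmod (a n))\<^sup>2 * moment n" "{..<M}"] parseval_H(2)[OF a f] moment_nonneg
  by (simp add: sums_iff)

text \<open>
  The Taylor coefficients of a Cauchy sequence converge. The limits are the coefficients of a function in the space,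
  because those of the difference to one member of the sequence are square summable; convergence in norm
  follows from that of the partial sums by letting the second index tend to infinity.
\<close>

theorem H_complete: "H.mcomplete"
  unfolding H.mcomplete_def
proof (intro allI impI)
  fix s assume "H.MCauchy s"
  then have sH: "s k \<in> H" and cau: "\<And>e. 0 < e \<Longrightarrow> \<exists>M. \<forall>k l. M \<le> k \<longrightarrow> M \<le> l \<longrightarrow> N (\<lambda>x. s k x - s l x) < e" for k
    by (auto simp: H.MCauchy_def)
  have "\<forall>k. \<exists>a. has_coeffs a (s k)" using has_coeffs_ex[OF sH] by blast
  then obtain a where a: "\<And>k. has_coeffs (a k) (s k)" by metis
  have part: "(\<Sum>n<M. (cmod (a k n - a l n))\<^sup>2 * moment n) \<le> (N (\<lambda>x. s k x - s l x))\<^sup>2" for M k l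
    by (rule coeff_le_norm[OF H_diff[OF sH sH] has_coeffs_diff[OF a a]])
  have "Cauchy (\<lambda>k. a k n)" for n
  proof (rule CauchyI)
    fix e :: real assume e: "0 < e"
    define e' where "e' = e * sqrt (moment n)"
    have "0 < e'" using e moment_pos[of n] by (simp add: e'_def)
    then obtain M where M: "\<And>k l. M \<le> k \<Longrightarrow> M \<le> l \<Longrightarrow> N (\<lambda>x. s k x - s l x) < e'" using cau by blast
    have "cmod (a k n - a l n) < e" if "M \<le> k" "M \<le> l" for k l
    proof -
      have "(cmod (a k n - a l n))\<^sup>2 * moment n \<le> (\<Sum>i<Suc n. (cmod (a k i - a l i))\<^sup>2 * moment i)"
        by (simp add: sum_nonneg moment_nonneg)
      also have "\<dots> \<le> (N (\<lambda>x. s k x - s l x))\<^sup>2" by (rule part)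
      also have "\<dots> < e'\<^sup>2" using M[OF that] norm_nonneg by (intro power_strict_mono) auto
      also have "\<dots> = e\<^sup>2 * moment n" using moment_nonneg[of n] by (simp add: e'_def power_mult_distrib)
      finally have "(cmod (a k n - a l n))\<^sup>2 < e\<^sup>2" using moment_pos[of n] by simp
      then show ?thesis by (rule power2_less_imp_less) (use e in simp)
    qed
    then show "\<exists>M. \<forall>m\<ge>M. \<forall>l\<ge>M. norm (a m n - a l n) < e" by blast
  qed
  then have "\<forall>n. \<exists>c. (\<lambda>k. a k n) \<longlonglongrightarrow> c" by (simp add: Cauchy_convergent_iff convergent_def)
  then obtain c where c: "\<And>n. (\<lambda>k. a k n) \<longlonglongrightarrow> c n" by metis
  have lim: "(\<Sum>n<M. (cmod (a k n - c n))\<^sup>2 * moment n) \<le> e\<^sup>2" if e: "\<And>l. m \<le> l \<Longrightarrow> N (\<lambda>x. s k x - s l x) < e" for M k m e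
  proof (rule LIMSEQ_le_const2)
    show "(\<lambda>l. \<Sum>n<M. (cmod (a k n - a l n))\<^sup>2 * moment n) \<longlonglongrightarrow> (\<Sum>n<M. (cmod (a k n - c n))\<^sup>2 * moment n)"
      by (intro tendsto_intros c)
    show "\<exists>L. \<forall>l\<ge>L. (\<Sum>n<M. (cmod (a k n - a l n))\<^sup>2 * moment n) \<le> e\<^sup>2"
    proof (intro exI[of _ m] allI impI)
      fix l assume "m \<le> l"
      have "(\<Sum>n<M. (cmod (a k n - a l n))\<^sup>2 * moment n) \<le> (N (\<lambda>x. s k x - s l x))\<^sup>2" by (rule part)
      also have "\<dots> \<le> e\<^sup>2" using e[OF \<open>m \<le> l\<close>] norm_nonneg by (intro power_mono) auto
      finally show "(\<Sum>n<M. (cmod (a k n - a l n))\<^sup>2 * moment n) \<le> e\<^sup>2" .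
    qed
  qed
  obtain m1 where m1: "\<And>k l. m1 \<le> k \<Longrightarrow> m1 \<le> l \<Longrightarrow> N (\<lambda>x. s k x - s l x) < 1" using cau[of 1] by auto
  have "summable (\<lambda>n. (cmod (a m1 n - c n))\<^sup>2 * moment n)"
  proof (rule summableI_nonneg_bounded[where x="1\<^sup>2"])
    show "(\<Sum>n<M. (cmod (a m1 n - c n))\<^sup>2 * moment n) \<le> 1\<^sup>2" for M
      by (rule lim[of m1]) (rule m1[OF order_refl])
  qed (simp add: moment_nonneg)
  from Riesz_Fischer[OF this] obtain h where h: "h \<in> H" "has_coeffs (\<lambda>n. a m1 n - c n) h" by (elim bexE)
  \<comment> \<open>Here \<open>h\<close> has the coefficients of \<open>s m1\<close> minus those of the limit.\<close>
  define f where "f = (\<lambda>x. s m1 x - h x)"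
  have f: "f \<in> H" unfolding f_def by (rule H_diff[OF sH h(1)])
  have fc: "has_coeffs c f" using has_coeffs_diff[OF a[of m1] h(2)] by (simp add: f_def)
  have "N (\<lambda>x. s k x - f x) \<le> e" if e: "\<And>l. m \<le> l \<Longrightarrow> N (\<lambda>x. s k x - s l x) < e" "0 \<le> e" for k m e
  proof -
    have "(\<lambda>n. (cmod (a k n - c n))\<^sup>2 * moment n) sums (N (\<lambda>x. s k x - f x))\<^sup>2"
      by (rule parseval_H(2)[OF has_coeffs_diff[OF a fc] H_diff[OF sH f]])
    then have "(\<lambda>M. \<Sum>n<M. (cmod (a k n - c n))\<^sup>2 * moment n) \<longlonglongrightarrow> (N (\<lambda>x. s k x - f x))\<^sup>2" by (simp add: sums_def)
    then have "(N (\<lambda>x. s k x - f x))\<^sup>2 \<le> e\<^sup>2" by (rule LIMSEQ_le_const2) (intro exI[of _ 0] allI impI lim[OF e(1)])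
    then show ?thesis using e(2) by (rule power2_le_imp_le)
  qed note conv = this
  have "limitin H.mtopology s f sequentially"
    unfolding H.limit_metric_sequentially
  proof (intro conjI allI impI f)
    fix e :: real assume e: "0 < e"
    then obtain m where m: "\<And>k l. m \<le> k \<Longrightarrow> m \<le> l \<Longrightarrow> N (\<lambda>x. s k x - s l x) < e / 2" using cau[of "e / 2"] by auto
    have "s k \<in> H \<and> N (\<lambda>x. s k x - f x) < e" if "m \<le> k" for k
      using conv[of m k "e / 2"] m[OF that] e sH by force
    then show "\<exists>M. \<forall>n\<ge>M. s n \<in> H \<and> N (\<lambda>x. s n x - f x) < e" by blast
  qed
  then show "\<exists>x. limitin H.mtopology s x sequentially" by blast
qed

text \<open>
  A map \<open>q\<close> with finitely many values whose fibres have diameter less than \<open>e\<close> yields a finite \<open>e\<close>-net, one point per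
  fibre. The codomain is chosen for roundings of finitely many complex coordinates.
\<close>

lemma totally_bounded_of_quantization:
  assumes S: "S \<subseteq> H" and q: "\<And>e. 0 < e \<Longrightarrow> \<exists>q :: (complex \<Rightarrow> complex) \<Rightarrow> nat \<Rightarrow> int \<times> int. finite (q ` S) \<and> (\<forall>f\<in>S. \<forall>g\<in>S. q f = q g \<longrightarrow> N (\<lambda>x. f x - g x) < e)"
  shows "H.mtotally_bounded S"
  unfolding H.mtotally_bounded_def
proof (intro allI impI)
  fix e :: real assume "0 < e"
  from q[OF this] obtain q :: "(complex \<Rightarrow> complex) \<Rightarrow> nat \<Rightarrow> int \<times> int" where q: "finite (q ` S)" "\<And>f g. f \<in> S \<Longrightarrow> g \<in> S \<Longrightarrow> q f = q g \<Longrightarrow> N (\<lambda>x. f x - g x) < e" by blast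
  have iS: "inv_into S q (q f) \<in> S" "q (inv_into S q (q f)) = q f" if "f \<in> S" for f
    using inv_into_into[OF imageI[OF that, of q]] f_inv_into_f[OF imageI[OF that, of q]] by auto
  show "\<exists>K. finite K \<and> K \<subseteq> S \<and> S \<subseteq> (\<Union>x\<in>K. H.mball x e)"
  proof (intro exI[of _ "inv_into S q ` (q ` S)"] conjI)
    show "finite (inv_into S q ` (q ` S))" using q(1) by simp
    show "inv_into S q ` (q ` S) \<subseteq> S" using iS by auto
    show "S \<subseteq> (\<Union>x\<in>inv_into S q ` (q ` S). H.mball x e)"
    proof
      fix f assume f: "f \<in> S"
      have "f \<in> H.mball (inv_into S q (q f)) e" using iS[OF f] f S q(2)[OF iS(1)[OF f] f] by auto
      then show "f \<in> (\<Union>x\<in>inv_into S q ` (q ` S). H.mball x e)" using f by auto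
    qed
  qed
qed

text \<open>
  An operator close to \<open>T\<close> of finite rank maps the unit ball to bounded coordinates in an orthonormal basis of
  its range; rounding them to multiples of \<open>\<delta>\<close> shows that the image of the unit ball under \<open>T\<close> is totally bounded. In a
  complete space this means that its closure is compact.
\<close>

theorem compact_operatorI:
  assumes T: "bounded_operator H N T" and lim: "singular_value H N T \<longlonglongrightarrow> 0"
  shows "compact_operator H N T"
proof -
  let ?B = "{f \<in> H. N f \<le> 1}"
  have TH: "T f \<in> H" if "f \<in> H" for f using T that by (auto simp: bounded_operator_def linear_operator_def)
  have "H.mtotally_bounded (T ` ?B)"
  proof (rule totally_bounded_of_quantization)
    show "T ` ?B \<subseteq> H" using TH by auto
    fix e :: real assume e: "0 < e"
    have "\<forall>\<^sub>F n in sequentially. singular_value H N T n < e / 16" using lim e by (intro order_tendstoD(2)) auto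
    then obtain n where n: "singular_value H N T n < e / 16" by (auto simp: eventually_sequentially)
    have "0 < e / 16" using e by simp
    from singular_value_approx[OF T this, of n] obtain R where R: "bounded_operator H N R" "rank_le H R n"
      "\<And>f. f \<in> H \<Longrightarrow> N (\<lambda>x. T f x - R f x) \<le> (singular_value H N T n + e / 16) * N f" by blast
    have Re: "N (\<lambda>x. T f x - R f x) \<le> e / 8" if "f \<in> ?B" for f
    proof -
      have "N (\<lambda>x. T f x - R f x) \<le> (singular_value H N T n + e / 16) * N f" using R(3) that by auto
      also have "\<dots> \<le> (e / 8) * 1" using n that e norm_nonneg by (intro mult_mono) auto
      finally show ?thesis by simp
    qed
    obtain u where u: "orthonormal_upto n u" "\<And>f. f \<in> H \<Longrightarrow> projection n u (R f) = R f" using finite_rank_basis[OF R(1,2)] by blast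
    have RH: "R f \<in> H" if "f \<in> H" for f using R(1) that by (auto simp: bounded_operator_def linear_operator_def)
    define B where "B = operator_norm H N R"
    \<comment> \<open>Equal roundings leave \<open>n\<close> coordinates that differ by at most \<open>2 * \<delta>\<close>, hence a distance of at most \<open>e / 2\<close>.\<close>
    define \<delta> where "\<delta> = e / (4 * (real n + 1))"
    have \<delta>: "0 < \<delta>" using e by (simp add: \<delta>_def)
    define c where "c f k = ip (R f) (u k)" for f k
    have cB: "cmod (c f k) \<le> B" if "f \<in> ?B" "k < n" for f k
    proof -
      have "cmod (c f k) \<le> N (R f) * N (u k)" unfolding c_def by (rule Cauchy_Schwarz) (use that RH orthonormal_H[OF u(1)] in auto)
      also have "\<dots> \<le> N (R f) * 1" using u(1) that norm_nonneg by (intro mult_left_mono) (auto simp: orthonormal_upto_def)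
      also have "N (R f) * 1 \<le> B * N f" unfolding B_def using operator_norm_bound[OF R(1)] that by auto
      also have "\<dots> \<le> B * 1" using that operator_norm_nonneg[OF R(1)] by (intro mult_left_mono) (auto simp: B_def)
      finally show ?thesis by simp
    qed
    define m where "m = \<lceil>B / \<delta>\<rceil> + 1"
    \<comment> \<open>Distinct functions may have the same image, so the coordinates are taken of a chosen preimage.\<close>
    define pre where "pre = inv_into ?B T"
    have pre: "pre g \<in> ?B \<and> T (pre g) = g" if "g \<in> T ` ?B" for g
      unfolding pre_def using inv_into_into[OF that] f_inv_into_f[OF that] by blast
    define q where "q g = (\<lambda>k. if k < n then (\<lfloor>Re (c (pre g) k) / \<delta>\<rfloor>, \<lfloor>Im (c (pre g) k) / \<delta>\<rfloor>) else (0, 0))" for g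
    have fl: "\<lfloor>y / \<delta>\<rfloor> \<in> {-m..m}" if "\<bar>y\<bar> \<le> B" for y
    proof -
      have "y / \<delta> \<le> B / \<delta>" "- (B / \<delta>) \<le> y / \<delta>"
        using that \<delta> divide_right_mono[of y B \<delta>] divide_right_mono[of "- B" y \<delta>] by auto
      then have "\<lfloor>y / \<delta>\<rfloor> \<le> m" "- m \<le> \<lfloor>y / \<delta>\<rfloor>" unfolding m_def by linarith+
      then show ?thesis by simp
    qed
    have "q ` (T ` ?B) \<subseteq> (\<lambda>h k. if k < n then h k else (0, 0)) ` (PiE {..<n} (\<lambda>_. {-m..m} \<times> {-m..m}))"
    proof
      fix v assume "v \<in> q ` (T ` ?B)"
      then obtain g where g: "g \<in> T ` ?B" "v = q g" by blast
      have "restrict v {..<n} \<in> PiE {..<n} (\<lambda>_. {-m..m} \<times> {-m..m})"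
      proof (rule restrict_PiE_iff[THEN iffD2], intro ballI)
        fix k assume k: "k \<in> {..<n}"
        have "cmod (c (pre g) k) \<le> B" using cB pre[OF g(1)] k by simp
        then have "\<bar>Re (c (pre g) k)\<bar> \<le> B" "\<bar>Im (c (pre g) k)\<bar> \<le> B"
          using abs_Re_le_cmod[of "c (pre g) k"] abs_Im_le_cmod[of "c (pre g) k"] by linarith+
        then show "v k \<in> {-m..m} \<times> {-m..m}" using k fl unfolding g(2) q_def by auto
      qed
      moreover have "v = (\<lambda>k. if k < n then restrict v {..<n} k else (0, 0))"
        unfolding g(2) q_def by (auto simp: fun_eq_iff)
      ultimately show "v \<in> (\<lambda>h k. if k < n then h k else (0, 0)) ` (PiE {..<n} (\<lambda>_. {-m..m} \<times> {-m..m}))"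
        by (intro image_eqI[where x="restrict v {..<n}"])
    qed
    then have fin: "finite (q ` (T ` ?B))"
      by (rule finite_subset) (intro finite_imageI finite_PiE finite_cartesian_product; simp)
    have "N (\<lambda>x. g1 x - g2 x) < e" if g: "g1 \<in> T ` ?B" "g2 \<in> T ` ?B" "q g1 = q g2" for g1 g2
    proof -
      define f1 where "f1 = pre g1"
      define f2 where "f2 = pre g2"
      have f: "f1 \<in> ?B" "T f1 = g1" "f2 \<in> ?B" "T f2 = g2" using pre g by (auto simp: f1_def f2_def)
      have fH: "f1 \<in> H" "f2 \<in> H" using f by auto
      have close: "(cmod (c f1 k - c f2 k))\<^sup>2 \<le> (2 * \<delta>)\<^sup>2" if k: "k < n" for k
      proof (rule power_mono)
        have "q g1 k = q g2 k" using g(3) by simp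
        then have "\<lfloor>Re (c f1 k) / \<delta>\<rfloor> = \<lfloor>Re (c f2 k) / \<delta>\<rfloor>" "\<lfloor>Im (c f1 k) / \<delta>\<rfloor> = \<lfloor>Im (c f2 k) / \<delta>\<rfloor>"
          using k by (simp_all add: q_def f1_def f2_def)
        moreover have fe: "\<bar>x - y\<bar> \<le> \<delta>" if "\<lfloor>x / \<delta>\<rfloor> = \<lfloor>y / \<delta>\<rfloor>" for x y
        proof -
          have "\<bar>x / \<delta> - y / \<delta>\<bar> \<le> 1" using that by linarith
          moreover have "x / \<delta> - y / \<delta> = (x - y) / \<delta>" by (simp add: diff_divide_distrib)
          ultimately show ?thesis using \<delta> by (simp add: abs_divide pos_divide_le_eq)
        qed
        ultimately have "\<bar>Re (c f1 k - c f2 k)\<bar> \<le> \<delta>" "\<bar>Im (c f1 k - c f2 k)\<bar> \<le> \<delta>" by auto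
        then show "cmod (c f1 k - c f2 k) \<le> 2 * \<delta>" using cmod_le[of "c f1 k - c f2 k"] by linarith
      qed simp
      let ?D = "\<lambda>x. R f1 x - R f2 x"
      have DH: "?D \<in> H" by (intro H_diff RH fH)
      have ipD: "ip ?D (u k) = c f1 k - c f2 k" if "k < n" for k
        using ip_lincomb[OF RH[OF fH(1)] RH[OF fH(2)] orthonormal_H[OF u(1) that], of 1 "-1"] by (simp add: c_def)
      have "projection n u ?D = ?D"
      proof
        fix x
        have "projection n u ?D x = projection n u (R f1) x - projection n u (R f2) x"
          unfolding projection_def by (simp add: ipD c_def sum_subtractf[symmetric] left_diff_distrib)
        then show "projection n u ?D x = ?D x" using u(2) fH by simp
      qed
      then have "(N ?D)\<^sup>2 = (\<Sum>k<n. (cmod (c f1 k - c f2 k))\<^sup>2)" using sum_sq_ip(1)[OF u(1) DH] ipD by simp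
      also have "\<dots> \<le> (\<Sum>k<n. (2 * \<delta>)\<^sup>2)" by (intro sum_mono close) simp
      also have "\<dots> = real n * (2 * \<delta>)\<^sup>2" by simp
      also have "\<dots> \<le> (real n + 1)\<^sup>2 * (2 * \<delta>)\<^sup>2" by (intro mult_right_mono) (auto simp: power2_eq_square algebra_simps)
      also have "\<dots> = (e / 2)\<^sup>2" 
      proof -
        have "(real n + 1) * (2 * \<delta>) = e / 2" by (simp add: \<delta>_def field_simps)
        then show ?thesis by (simp only: power_mult_distrib[symmetric])
      qed
      finally have ND2: "(N ?D)\<^sup>2 \<le> (e / 2)\<^sup>2" .
      have ND: "N ?D \<le> e / 2" by (rule power2_le_imp_le[OF ND2]) (use e in simp)
      have "N (\<lambda>x. g1 x - g2 x) \<le> N (\<lambda>x. g1 x - R f1 x) + N (\<lambda>x. R f1 x - g2 x)"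
        using norm_diff_triangle[of g1 "R f1" g2] f fH TH RH by auto
      also have "N (\<lambda>x. R f1 x - g2 x) \<le> N ?D + N (\<lambda>x. R f2 x - g2 x)"
        using norm_diff_triangle[of "R f1" "R f2" g2] f fH TH RH by auto
      also have "N (\<lambda>x. R f2 x - g2 x) = N (\<lambda>x. g2 x - R f2 x)" by (rule norm_minus)
      finally show ?thesis using Re[OF f(1)] Re[OF f(3)] ND e f by simp
    qed
    then show "\<exists>q :: (complex \<Rightarrow> complex) \<Rightarrow> nat \<Rightarrow> int \<times> int. finite (q ` T ` ?B) \<and> (\<forall>f\<in>T ` ?B. \<forall>g\<in>T ` ?B. q f = q g \<longrightarrow> N (\<lambda>x. f x - g x) < e)"
      using fin by (intro exI[of _ q]) blast
  qed
  then have "compactin H.mtopology (H.mtopology closure_of (T ` ?B))"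
    using H.mtotally_bounded_eq_compact_closure_of[OF H_complete] by blast
  then show ?thesis using T unfolding compact_operator_def norm_topology_def by blast
qed

end

section \<open>Masses of the cells\<close>

text \<open>
  The hypothesis \<open>key\<close> says that \<open>\<sigma>\<close> exceeds \<open>a (n + 1) / (2 C)\<close> at more than \<open>n\<close> indices. An injection \<open>g\<close> with
  \<open>a (n + 1) \<le> 2 * C * \<sigma> (g n)\<close> can therefore be chosen one index after the other: the first \<open>n\<close> choices never exhaust the
  candidates. This compares \<open>a\<close> with \<open>\<sigma>\<close> without sorting the latter.
\<close>

lemma greedy_summable:
  fixes \<sigma> :: "'i \<Rightarrow> real" and a :: "nat \<Rightarrow> real"
  assumes p: "0 < p" and C: "0 < C" and a: "\<And>n. 0 \<le> a n" "\<And>n m. n \<le> m \<Longrightarrow> a m \<le> a n"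
    and s: "\<And>i. 0 \<le> \<sigma> i" and bnd: "\<And>F. finite F \<Longrightarrow> (\<Sum>i\<in>F. \<sigma> i powr p) \<le> B"
    and key: "\<And>t. 0 < t \<Longrightarrow> a (Suc (card {i. t < \<sigma> i})) \<le> C * t"
  shows "summable (\<lambda>n. a n powr p)"
proof -
  have many: "n < card {i. a (Suc n) / (2 * C) < \<sigma> i}" if pos: "0 < a (Suc n)" for n
  proof (rule ccontr)
    let ?t = "a (Suc n) / (2 * C)"
    assume "\<not> n < card {i. ?t < \<sigma> i}"
    then have "a (Suc n) \<le> a (Suc (card {i. ?t < \<sigma> i}))" by (intro a(2)) simp
    also have "\<dots> \<le> C * ?t" by (rule key) (use pos C in simp)
    also have "\<dots> = a (Suc n) / 2" using C by simp
    finally show False using pos by simp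
  qed
  have ex: "\<exists>g. inj_on g {n. n < M \<and> 0 < a (Suc n)} \<and> (\<forall>n. n < M \<and> 0 < a (Suc n) \<longrightarrow> a (Suc n) \<le> 2 * C * \<sigma> (g n))" for M
  \<comment> \<open>If the set of candidates were infinite, its cardinality would be \<open>0\<close>, which the strict bound \<open>many\<close> excludes.\<close>
  proof (induction M)
    case (Suc M)
    then obtain g where g: "inj_on g {n. n < M \<and> 0 < a (Suc n)}" "\<And>n. n < M \<Longrightarrow> 0 < a (Suc n) \<Longrightarrow> a (Suc n) \<le> 2 * C * \<sigma> (g n)" by blast
    show ?case
    proof (cases "0 < a (Suc M)")
      case False
      then have "{n. n < Suc M \<and> 0 < a (Suc n)} = {n. n < M \<and> 0 < a (Suc n)}" by (auto simp: less_Suc_eq)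
      moreover have "\<forall>n. n < Suc M \<and> 0 < a (Suc n) \<longrightarrow> a (Suc n) \<le> 2 * C * \<sigma> (g n)"
        using g(2) False by (auto simp: less_Suc_eq)
      ultimately show ?thesis using g(1) by auto
    next
      case True
      let ?S = "{i. a (Suc M) / (2 * C) < \<sigma> i}"
      have "card (g ` {n. n < M \<and> 0 < a (Suc n)}) \<le> card {n. n < M \<and> 0 < a (Suc n)}" by (rule card_image_le) simp
      also have "\<dots> \<le> card {..<M}" by (rule card_mono) auto
      finally have "card (g ` {n. n < M \<and> 0 < a (Suc n)}) < card ?S" using many[OF True] by simp
      then have "\<not> ?S \<subseteq> g ` {n. n < M \<and> 0 < a (Suc n)}"
        using card_mono[of "g ` {n. n < M \<and> 0 < a (Suc n)}" ?S] by auto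
      then obtain i where i: "i \<in> ?S" "i \<notin> g ` {n. n < M \<and> 0 < a (Suc n)}" by blast
      have set: "{n. n < Suc M \<and> 0 < a (Suc n)} = insert M {n. n < M \<and> 0 < a (Suc n)}" using True by (auto simp: less_Suc_eq)
      have "inj_on (g(M := i)) {n. n < Suc M \<and> 0 < a (Suc n)}"
        unfolding set using g(1) i(2) by (auto simp: inj_on_def)
      moreover have "a (Suc M) \<le> 2 * C * \<sigma> i" using i(1) C by (simp add: pos_divide_less_eq mult.commute)
      then have "\<forall>n. n < Suc M \<and> 0 < a (Suc n) \<longrightarrow> a (Suc n) \<le> 2 * C * \<sigma> ((g(M := i)) n)"
        using g(2) by (auto simp: less_Suc_eq)
      ultimately show ?thesis by blast
    qed
  qed simp
  have "summable (\<lambda>n. a (Suc n) powr p)"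
  proof (rule summableI_nonneg_bounded[where x="(2 * C) powr p * B"])
    fix M
    let ?I = "{n. n < M \<and> 0 < a (Suc n)}"
    obtain g where g: "inj_on g ?I" "\<And>n. n < M \<Longrightarrow> 0 < a (Suc n) \<Longrightarrow> a (Suc n) \<le> 2 * C * \<sigma> (g n)" using ex[of M] by blast
    have "(\<Sum>n<M. a (Suc n) powr p) = (\<Sum>n\<in>?I. a (Suc n) powr p)"
      by (rule sum.mono_neutral_right) (use a(1) in \<open>auto simp: order.order_iff_strict\<close>)
    also have "\<dots> \<le> (\<Sum>n\<in>?I. (2 * C) powr p * \<sigma> (g n) powr p)"
    proof (rule sum_mono)
      fix n assume "n \<in> ?I"
      then have "a (Suc n) powr p \<le> (2 * C * \<sigma> (g n)) powr p" using g(2) a(1) p by (intro powr_mono2) auto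
      then show "a (Suc n) powr p \<le> (2 * C) powr p * \<sigma> (g n) powr p" using C s by (simp add: powr_mult)
    qed
    also have "\<dots> = (2 * C) powr p * (\<Sum>i\<in>g ` ?I. \<sigma> i powr p)" by (simp add: sum.reindex[OF g(1)] sum_distrib_left)
    also have "\<dots> \<le> (2 * C) powr p * B" by (intro mult_left_mono bnd) auto
    finally show "(\<Sum>n<M. a (Suc n) powr p) \<le> (2 * C) powr p * B" .
  qed simp
  then show ?thesis by (subst (asm) summable_Suc_iff)
qed

text \<open>
  Jensen's inequality up to the constant \<open>2 powr \<alpha>\<close>, for a density of total mass at most \<open>v\<close>. Pointwise
  \<open>g \<le> l + l powr (1 - \<alpha>) * g powr \<alpha>\<close>, since one of the terms already suffices according to whether \<open>g \<le> l\<close>. With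
  \<open>l = m / (2 v)\<close> the first term integrates to at most \<open>m / 2\<close>, which is absorbed on the left.
\<close>

lemma power_mean_nn_integral:
  fixes g :: "'a \<Rightarrow> real" and u :: "'a \<Rightarrow> ennreal"
  assumes \<alpha>: "1 < \<alpha>" and um[measurable]: "u \<in> borel_measurable M" and gm[measurable]: "g \<in> borel_measurable M"
    and g: "\<And>x. x \<in> space M \<Longrightarrow> 0 < g x" and V: "(\<integral>\<^sup>+x. u x \<partial>M) \<le> ennreal v" "0 < v"
    and m: "(\<integral>\<^sup>+x. u x * ennreal (g x) \<partial>M) = ennreal m" "0 \<le> m"
  shows "ennreal (m powr \<alpha>) \<le> ennreal (2 powr \<alpha> * v powr (\<alpha> - 1)) * (\<integral>\<^sup>+x. u x * ennreal (g x powr \<alpha>) \<partial>M)"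
proof (cases "m = 0")
  case False
  then have m0: "0 < m" using m(2) by simp
  define l where "l = m / (2 * v)"
  have l: "0 < l" using m0 V(2) by (simp add: l_def)
  define Y where "Y = (\<integral>\<^sup>+x. u x * ennreal (g x powr \<alpha>) \<partial>M)"
  have "ennreal m \<le> (\<integral>\<^sup>+x. ennreal l * u x + ennreal (l powr (1 - \<alpha>)) * (u x * ennreal (g x powr \<alpha>)) \<partial>M)"
    unfolding m(1)[symmetric]
  proof (rule nn_integral_mono)
    fix x assume "x \<in> space M"
    then have gx: "0 < g x" by (rule g)
    have "g x \<le> l + l powr (1 - \<alpha>) * g x powr \<alpha>"
    proof (cases "g x \<le> l")
      case True then show ?thesis by (simp add: add_increasing2)
    next
      case False
      have "g x = g x powr (1 - \<alpha>) * g x powr \<alpha>" using gx by (simp add: powr_add[symmetric])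
      also have "\<dots> \<le> l powr (1 - \<alpha>) * g x powr \<alpha>"
        using False l \<alpha> by (intro mult_right_mono powr_mono2') auto
      finally show ?thesis using l by simp
    qed
    then have "u x * ennreal (g x) \<le> u x * ennreal (l + l powr (1 - \<alpha>) * g x powr \<alpha>)" by (intro mult_left_mono ennreal_leI) auto
    also have "\<dots> = ennreal l * u x + ennreal (l powr (1 - \<alpha>)) * (u x * ennreal (g x powr \<alpha>))"
      using l by (simp add: ennreal_plus ennreal_mult distrib_left mult_ac)
    finally show "u x * ennreal (g x) \<le> ennreal l * u x + ennreal (l powr (1 - \<alpha>)) * (u x * ennreal (g x powr \<alpha>))" .
  qed
  also have "\<dots> = ennreal l * (\<integral>\<^sup>+x. u x \<partial>M) + ennreal (l powr (1 - \<alpha>)) * Y"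
    unfolding Y_def by (simp add: nn_integral_add nn_integral_cmult)
  also have "\<dots> \<le> ennreal l * ennreal v + ennreal (l powr (1 - \<alpha>)) * Y" by (intro add_right_mono mult_left_mono V) simp
  also have "ennreal l * ennreal v = ennreal (m / 2)" using V(2) l by (simp add: ennreal_mult[symmetric] l_def)
  finally have main: "ennreal m \<le> ennreal (m / 2) + ennreal (l powr (1 - \<alpha>)) * Y" .
  show ?thesis
  proof (cases Y rule: ennreal_cases)
    case top
    then show ?thesis unfolding Y_def[symmetric] using V(2) by (simp add: ennreal_mult_top)
  next
    case (real y)
    have "ennreal m \<le> ennreal (m / 2 + l powr (1 - \<alpha>) * y)" using main real m0 by (simp add: ennreal_mult[symmetric] ennreal_plus[symmetric] del: ennreal_plus)
    then have "m \<le> m / 2 + l powr (1 - \<alpha>) * y" using real m0 by (subst (asm) ennreal_le_iff) auto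
    then have "m / 2 \<le> l powr (1 - \<alpha>) * y" by simp
    then have "(m / 2) * l powr (\<alpha> - 1) \<le> (l powr (1 - \<alpha>) * y) * l powr (\<alpha> - 1)" by (intro mult_right_mono) auto
    also have "\<dots> = (l powr (1 - \<alpha>) * l powr (\<alpha> - 1)) * y" by simp
    also have "l powr (1 - \<alpha>) * l powr (\<alpha> - 1) = 1" using l by (simp add: powr_add[symmetric])
    finally have le: "(m / 2) * l powr (\<alpha> - 1) \<le> y" by simp
    have "m powr \<alpha> = 2 powr \<alpha> * v powr (\<alpha> - 1) * ((m / 2) * l powr (\<alpha> - 1))"
    proof -
      have "l powr (\<alpha> - 1) = m powr (\<alpha> - 1) / (2 powr (\<alpha> - 1) * v powr (\<alpha> - 1))"
        unfolding l_def using m0 V(2) by (simp add: powr_divide powr_mult)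
      moreover have "m powr (\<alpha> - 1) = m powr \<alpha> / m" "2 powr (\<alpha> - 1) = (2::real) powr \<alpha> / 2" using m0 by (simp_all add: powr_diff)
      ultimately show ?thesis using m0 V(2) by simp
    qed
    also have "\<dots> \<le> 2 powr \<alpha> * v powr (\<alpha> - 1) * y" by (intro mult_left_mono le) auto
    finally show ?thesis unfolding Y_def[symmetric] using real by (simp add: ennreal_mult[symmetric] ennreal_leI)
  qed
qed simp

text \<open>
  The hypotheses of the sufficiency proof: a self-map with at most \<open>n\<close> preimages per point, the centres \<open>w\<close> of a Whitney
  cover of overlap \<open>K\<close>, and the integral condition.
\<close>

locale composition_setting = regular_radial_weight \<omega> for \<omega> +
  fixes \<phi> :: "complex \<Rightarrow> complex" and n :: nat and p :: real and w :: "nat \<Rightarrow> complex" and K :: nat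
  assumes p: "2 < p"
    and hol: "\<phi> holomorphic_on unit_disc"
    and self: "\<And>z. z \<in> unit_disc \<Longrightarrow> \<phi> z \<in> unit_disc"
    and val: "\<And>w. w \<in> unit_disc \<Longrightarrow> finite {z\<in>unit_disc. \<phi> z = w} \<and> card {z\<in>unit_disc. \<phi> z = w} \<le> n"
    and wD: "\<And>j. w j \<in> unit_disc"
    and wcov: "\<And>z. z \<in> unit_disc \<Longrightarrow> \<exists>j. z \<in> ball (w j) ((1 - cmod (w j)) / 32)"
    and wover: "\<And>z F. finite F \<Longrightarrow> (\<And>j. j \<in> F \<Longrightarrow> z \<in> ball (w j) ((1 - cmod (w j)) / 4)) \<Longrightarrow> card F \<le> K"
    and fin_int: "(\<integral>\<^sup>+z. ennreal ((\<tau> z / \<tau> (\<phi> z)) powr (p / 2) * (\<omega> z / \<tau> z)) \<partial>disc_area) < \<infinity>"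
begin

definition r where "r j = 1 - cmod (w j)" for j
text \<open>
  The covering balls made disjoint, so that every point of the disc lies in exactly one cell.
\<close>

definition Q where "Q = disjointed (\<lambda>j. ball (w j) (r j / 32))"
definition u where "u j z = indicator (Q j) (\<phi> z) * ennreal ((cmod (deriv \<phi> z))\<^sup>2)" for j z
definition mass where "mass j = enn2real (\<integral>\<^sup>+z. u j z * ennreal (\<tau> z) \<partial>disc_area)" for j
text \<open>
  The contribution of the cell \<open>Q j\<close> to the size of the operator. The denominator normalises it: for the identity map, the values \<open>s j\<close> are
  bounded.
\<close>

definition s where "s j = sqrt (mass j / ((r j)\<^sup>2 * \<tau> (w j)))" for j

lemma r_pos: "0 < r j" using wD[of j] by (simp add: r_def unit_disc_iff)
lemma ball_sub: "ball (w j) (r j / 4) \<subseteq> unit_disc"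
  using ball_half(1)[OF wD[of j]] r_pos[of j] by (force simp: r_def)
lemma Q_sub: "Q j \<subseteq> ball (w j) (r j / 32)" unfolding Q_def by (rule disjointed_subset)
lemma Q_disc: "Q j \<subseteq> unit_disc" using Q_sub[of j] ball_sub[of j] r_pos[of j] by (force simp: subset_eq)
lemma Q_borel[measurable]: "Q j \<in> sets borel" unfolding Q_def disjointed_def by auto
lemma Q_cover: "z \<in> unit_disc \<Longrightarrow> \<exists>j. z \<in> Q j"
  using wcov[of z] UN_disjointed_eq[of "\<lambda>j. ball (w j) (r j / 32)"] unfolding Q_def r_def by blast
lemma Q_disjoint: "z \<in> Q i \<Longrightarrow> z \<in> Q j \<Longrightarrow> i = j"
  using disjoint_family_disjointed[of "\<lambda>j. ball (w j) (r j / 32)"] unfolding Q_def disjoint_family_on_def by blast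

lemma phi_measurable[measurable]: "\<phi> \<in> borel_measurable disc_area" by (rule holomorphic_measurable[OF hol])
lemma dphi_measurable[measurable]: "deriv \<phi> \<in> borel_measurable disc_area"
  by (intro holomorphic_measurable holomorphic_deriv hol) simp
lemma tau_measurable_disc[measurable]: "\<tau> \<in> borel_measurable disc_area" by (rule borel_measurable_disc_area_borel[OF tau_measurable])
lemma indicator_Q_measurable[measurable]: "(\<lambda>z. indicator (Q j) (\<phi> z) :: ennreal) \<in> borel_measurable disc_area"
  by (rule measurable_compose[OF phi_measurable]) (intro borel_measurable_indicator Q_borel)
lemma u_measurable[measurable]: "u j \<in> borel_measurable disc_area" unfolding u_def by measurable
lemma tau_phi_measurable[measurable]: "(\<lambda>z. \<tau> (\<phi> z)) \<in> borel_measurable disc_area"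
  by (rule measurable_compose[OF phi_measurable tau_measurable])

text \<open>
  The area formula for maps of bounded valence, with the cell contained in a disc of radius \<open>r j\<close>. The constant \<open>n + 1\<close>
  is positive for every \<open>n\<close>.
\<close>

lemma u_integral: "(\<integral>\<^sup>+z. u j z \<partial>disc_area) \<le> ennreal ((real n + 1) * (r j)\<^sup>2)"
proof -
  have "(\<integral>\<^sup>+z. u j z \<partial>disc_area) \<le> ennreal (real n) * emeasure disc_area (Q j)"
    unfolding u_def by (rule bounded_valent_area[OF hol self val Q_borel Q_disc])
  also have "emeasure disc_area (Q j) \<le> ennreal ((r j)\<^sup>2)"
  proof -
    have "emeasure disc_area (Q j) = ennreal (1 / pi) * emeasure lborel (Q j)"
      using emeasure_disc_area[of "Q j"] Q_disc by (simp add: sets_disc_area)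
    also have "emeasure lborel (Q j) \<le> emeasure lborel (ball (w j) (r j))"
      using Q_sub[of j] r_pos[of j] by (intro emeasure_mono) (auto simp: subset_eq)
    also have "emeasure lborel (ball (w j) (r j)) = ennreal (pi * (r j)\<^sup>2)" using r_pos[of j] by (intro emeasure_complex_ball) simp
    also have "ennreal (1 / pi) * ennreal (pi * (r j)\<^sup>2) = ennreal ((r j)\<^sup>2)" by (simp add: ennreal_mult[symmetric])
    finally show ?thesis by (simp add: mult_left_mono)
  qed
  also have "ennreal (real n) * ennreal ((r j)\<^sup>2) \<le> ennreal ((real n + 1) * (r j)\<^sup>2)"
    by (simp add: ennreal_mult[symmetric] ennreal_leI mult_right_mono)
  finally show ?thesis by (simp add: mult_left_mono)
qed

lemma mass_nn: "(\<integral>\<^sup>+z. u j z * ennreal (\<tau> z) \<partial>disc_area) = ennreal (mass j)"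
proof -
  have "(\<integral>\<^sup>+z. u j z * ennreal (\<tau> z) \<partial>disc_area) \<le> (\<integral>\<^sup>+z. ennreal (W 0) * u j z \<partial>disc_area)"
    by (intro nn_integral_mono) (simp add: mult.commute mult_right_mono ennreal_leI tau_le)
  also have "\<dots> = ennreal (W 0) * (\<integral>\<^sup>+z. u j z \<partial>disc_area)" by (rule nn_integral_cmult) measurable
  also have "\<dots> \<le> ennreal (W 0) * ennreal ((real n + 1) * (r j)\<^sup>2)" by (intro mult_left_mono u_integral) simp
  also have "\<dots> < \<infinity>" by (simp add: ennreal_mult_less_top)
  finally show ?thesis unfolding mass_def by (intro ennreal_enn2real[symmetric]) simp
qed

lemma mass_nonneg: "0 \<le> mass j" by (simp add: mass_def)
lemma s_nonneg: "0 \<le> s j" by (simp add: s_def mass_nonneg less_imp_le[OF tau_pos[OF wD]])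
lemma s_sq: "mass j = (s j)\<^sup>2 * ((r j)\<^sup>2 * \<tau> (w j))"
  using tau_pos[OF wD[of j]] r_pos[of j] mass_nonneg[of j] by (simp add: s_def)

text \<open>
  Here \<open>s j powr p = (mass j / R) powr \<alpha>\<close> with \<open>\<alpha> = p / 2 > 1\<close>. Jensen's inequality for the density \<open>u j\<close>, of mass at most
  \<open>(n + 1) * (r j)\<^sup>2\<close>, moves the power onto \<open>\<tau>\<close>. On the preimage of the cell \<open>\<tau> (w j)\<close> is comparable to \<open>\<tau> (\<phi> z)\<close>, and the
  Schwarz-Pick inequality bounds \<open>|\<phi>' z|\<^sup>2 / (r j)\<^sup>2\<close> by a multiple of \<open>1 / (1 - |z|)\<^sup>2\<close>, that is, of \<open>\<omega> z / \<tau> z\<close>. So \<open>s j powr p\<close>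
  is at most a multiple of the part of the integral over the preimage of the cell.
\<close>

lemma s_summable: "\<exists>B. \<forall>F. finite F \<longrightarrow> (\<Sum>j\<in>F. s j powr p) \<le> B"
proof -
  define \<alpha> where "\<alpha> = p / 2"
  have \<alpha>: "1 < \<alpha>" using p by (simp add: \<alpha>_def)
  let ?G = "\<lambda>z. ennreal ((\<tau> z / \<tau> (\<phi> z)) powr (p / 2) * (\<omega> z / \<tau> z))"
  have Gm[measurable]: "?G \<in> borel_measurable disc_area" by measurable
  define C where "C = 2 powr \<alpha> * (real n + 1) powr (\<alpha> - 1) * (16 * (2 * CD) powr \<alpha> * CR)"
  have C: "0 \<le> C" using CR(1) by (simp add: C_def)
  have one: "ennreal (s j powr p) \<le> ennreal C * (\<integral>\<^sup>+z. indicator (Q j) (\<phi> z) * ?G z \<partial>disc_area)" for j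
  proof -
    define v where "v = (real n + 1) * (r j)\<^sup>2"
    have v: "0 < v" using r_pos[of j] by (simp add: v_def)
    define R where "R = (r j)\<^sup>2 * \<tau> (w j)"
    have R: "0 < R" using r_pos[of j] tau_pos[OF wD[of j]] by (simp add: R_def)
    have "ennreal (mass j powr \<alpha>) \<le> ennreal (2 powr \<alpha> * v powr (\<alpha> - 1)) * (\<integral>\<^sup>+z. u j z * ennreal (\<tau> z powr \<alpha>) \<partial>disc_area)"
      by (rule power_mean_nn_integral[OF \<alpha> u_measurable tau_measurable_disc _ u_integral[of j, folded v_def] v mass_nn mass_nonneg]) (use tau_pos in simp)
    then have "ennreal (1 / R powr \<alpha>) * ennreal (mass j powr \<alpha>) \<le> ennreal (1 / R powr \<alpha>) * (ennreal (2 powr \<alpha> * v powr (\<alpha> - 1)) * (\<integral>\<^sup>+z. u j z * ennreal (\<tau> z powr \<alpha>) \<partial>disc_area))"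
      by (rule mult_left_mono) simp
    also have "\<dots> = ennreal (2 powr \<alpha> * (real n + 1) powr (\<alpha> - 1)) * (ennreal (1 / ((r j)\<^sup>2 * \<tau> (w j) powr \<alpha>)) * (\<integral>\<^sup>+z. u j z * ennreal (\<tau> z powr \<alpha>) \<partial>disc_area))"
    proof -
      have "(1 / R powr \<alpha>) * (2 powr \<alpha> * v powr (\<alpha> - 1)) = 2 powr \<alpha> * (real n + 1) powr (\<alpha> - 1) * (1 / ((r j)\<^sup>2 * \<tau> (w j) powr \<alpha>))"
      proof -
        have rr: "0 < (r j)\<^sup>2" using r_pos[of j] by simp
        have "v powr (\<alpha> - 1) = (real n + 1) powr (\<alpha> - 1) * ((r j)\<^sup>2 powr \<alpha> / (r j)\<^sup>2)"
          unfolding v_def using rr by (simp add: powr_mult powr_diff)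
        moreover have "R powr \<alpha> = (r j)\<^sup>2 powr \<alpha> * \<tau> (w j) powr \<alpha>"
          unfolding R_def using rr tau_pos[OF wD[of j]] by (simp add: powr_mult)
        ultimately show ?thesis using rr by simp
      qed
      then show ?thesis by (simp add: mult.assoc[symmetric] ennreal_mult[symmetric])
    qed
    also have "ennreal (1 / ((r j)\<^sup>2 * \<tau> (w j) powr \<alpha>)) * (\<integral>\<^sup>+z. u j z * ennreal (\<tau> z powr \<alpha>) \<partial>disc_area) =
      (\<integral>\<^sup>+z. ennreal (1 / ((r j)\<^sup>2 * \<tau> (w j) powr \<alpha>)) * (u j z * ennreal (\<tau> z powr \<alpha>)) \<partial>disc_area)"
      by (rule nn_integral_cmult[symmetric]) measurable
    also have "\<dots> \<le> (\<integral>\<^sup>+z. ennreal (16 * (2 * CD) powr \<alpha> * CR) * (indicator (Q j) (\<phi> z) * ?G z) \<partial>disc_area)"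
    proof (rule nn_integral_mono)
      fix z assume "z \<in> space disc_area"
      then have z: "z \<in> unit_disc" by simp
      show "ennreal (1 / ((r j)\<^sup>2 * \<tau> (w j) powr \<alpha>)) * (u j z * ennreal (\<tau> z powr \<alpha>)) \<le> ennreal (16 * (2 * CD) powr \<alpha> * CR) * (indicator (Q j) (\<phi> z) * ?G z)"
      proof (cases "\<phi> z \<in> Q j")
        case True
        have ph: "\<phi> z \<in> ball (w j) ((1 - cmod (w j)) / 2)" using Q_sub[of j] True r_pos[of j] by (auto simp: r_def)
        note bh = ball_half[OF wD[of j] ph]
        have z1: "0 < 1 - cmod z" using z by (simp add: unit_disc_iff)
        have tz: "0 < \<tau> z" and tp: "0 < \<tau> (\<phi> z)" and tw: "0 < \<tau> (w j)" using tau_pos z self wD by auto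
        have "cmod (deriv \<phi> z) * (1 - cmod z) \<le> 2 * (1 - cmod (\<phi> z))" by (rule Schwarz_Pick_derivative[OF hol self z])
        also have "\<dots> \<le> 4 * r j" using bh(3) by (simp add: r_def)
        finally have "(cmod (deriv \<phi> z) * (1 - cmod z))\<^sup>2 \<le> (4 * r j)\<^sup>2" using z1 by (intro power_mono) auto
        then have d: "(cmod (deriv \<phi> z))\<^sup>2 / (r j)\<^sup>2 \<le> 16 * (1 / (1 - cmod z)\<^sup>2)"
        proof -
          define x where "x = (1 - cmod z)\<^sup>2"
          define y where "y = (r j)\<^sup>2"
          have "0 < x" "0 < y" using z1 r_pos[of j] by (simp_all add: x_def y_def)
          moreover have "(cmod (deriv \<phi> z))\<^sup>2 * x \<le> 16 * y"
            using \<open>(cmod (deriv \<phi> z) * (1 - cmod z))\<^sup>2 \<le> (4 * r j)\<^sup>2\<close> unfolding x_def y_def power_mult_distrib by simp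
          ultimately have "(cmod (deriv \<phi> z))\<^sup>2 / y \<le> 16 * (1 / x)" by (simp add: field_simps)
          then show ?thesis unfolding x_def y_def .
        qed
        also have "1 / (1 - cmod z)\<^sup>2 \<le> CR * (\<omega> z / \<tau> z)" using omega_tau(2)[OF z] tz z1 by (simp add: field_simps)
        finally have d: "(cmod (deriv \<phi> z))\<^sup>2 / (r j)\<^sup>2 \<le> 16 * (CR * (\<omega> z / \<tau> z))" by simp
        have "\<tau> (\<phi> z) \<le> (2 * CD) ^ 1 * \<tau> (w j)" by (rule tau_compare[OF self[OF z] wD]) (use bh(3) in simp)
        then have "\<tau> (\<phi> z) powr \<alpha> \<le> (2 * CD * \<tau> (w j)) powr \<alpha>" using \<alpha> tp by (intro powr_mono2) auto
        also have "\<dots> = (2 * CD) powr \<alpha> * \<tau> (w j) powr \<alpha>" using CD(1) tw by (simp add: powr_mult)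
        finally have e: "1 / \<tau> (w j) powr \<alpha> \<le> (2 * CD) powr \<alpha> / \<tau> (\<phi> z) powr \<alpha>" using tw tp by (simp add: field_simps)
        have "(1 / ((r j)\<^sup>2 * \<tau> (w j) powr \<alpha>)) * ((cmod (deriv \<phi> z))\<^sup>2 * \<tau> z powr \<alpha>) = ((cmod (deriv \<phi> z))\<^sup>2 / (r j)\<^sup>2) * (1 / \<tau> (w j) powr \<alpha>) * \<tau> z powr \<alpha>" by simp
        also have "\<dots> \<le> (16 * (CR * (\<omega> z / \<tau> z))) * ((2 * CD) powr \<alpha> / \<tau> (\<phi> z) powr \<alpha>) * \<tau> z powr \<alpha>"
          by (intro mult_right_mono mult_mono d e) (use CR(1) omega_nonneg[OF z] tz in auto)
        also have "\<dots> = (16 * (2 * CD) powr \<alpha> * CR) * ((\<tau> z / \<tau> (\<phi> z)) powr (p / 2) * (\<omega> z / \<tau> z))"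
          using tz tp by (simp add: powr_divide \<alpha>_def mult_ac)
        finally have le: "(1 / ((r j)\<^sup>2 * \<tau> (w j) powr \<alpha>)) * ((cmod (deriv \<phi> z))\<^sup>2 * \<tau> z powr \<alpha>) \<le> (16 * (2 * CD) powr \<alpha> * CR) * ((\<tau> z / \<tau> (\<phi> z)) powr (p / 2) * (\<omega> z / \<tau> z))" .
        have "ennreal (1 / ((r j)\<^sup>2 * \<tau> (w j) powr \<alpha>)) * ennreal ((cmod (deriv \<phi> z))\<^sup>2 * \<tau> z powr \<alpha>) = ennreal ((1 / ((r j)\<^sup>2 * \<tau> (w j) powr \<alpha>)) * ((cmod (deriv \<phi> z))\<^sup>2 * \<tau> z powr \<alpha>))"
          by (rule ennreal_mult[symmetric]) auto
        also have "\<dots> \<le> ennreal ((16 * (2 * CD) powr \<alpha> * CR) * ((\<tau> z / \<tau> (\<phi> z)) powr (p / 2) * (\<omega> z / \<tau> z)))"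
          by (rule ennreal_leI[OF le])
        also have "\<dots> = ennreal (16 * (2 * CD) powr \<alpha> * CR) * ?G z"
          by (rule ennreal_mult) (use CR(1) omega_nonneg[OF z] tz in auto)
        finally show ?thesis using True by (simp add: u_def ennreal_mult)
      qed (simp add: u_def)
    qed
    also have "\<dots> = ennreal (16 * (2 * CD) powr \<alpha> * CR) * (\<integral>\<^sup>+z. indicator (Q j) (\<phi> z) * ?G z \<partial>disc_area)"
      by (rule nn_integral_cmult) measurable
    also have "ennreal (1 / R powr \<alpha>) * ennreal (mass j powr \<alpha>) = ennreal (s j powr p)"
    proof -
      have "s j powr p = (mass j / R) powr \<alpha>"
        unfolding s_def R_def[symmetric] using mass_nonneg[of j] R by (simp add: powr_half_sqrt[symmetric] powr_powr \<alpha>_def)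
      then show ?thesis using mass_nonneg[of j] R by (simp add: powr_divide ennreal_mult[symmetric])
    qed
    finally show ?thesis using CR(1) by (simp add: C_def ennreal_mult mult.assoc mult_left_mono)
  qed
  define B where "B = enn2real (ennreal C * (\<integral>\<^sup>+z. ?G z \<partial>disc_area))"
  have fin: "ennreal C * (\<integral>\<^sup>+z. ?G z \<partial>disc_area) < \<infinity>" using fin_int by (simp add: ennreal_mult_less_top)
  have "(\<Sum>j\<in>F. s j powr p) \<le> B" if F: "finite F" for F
  proof -
    have "ennreal (\<Sum>j\<in>F. s j powr p) = (\<Sum>j\<in>F. ennreal (s j powr p))" by simp
    also have "\<dots> \<le> (\<Sum>j\<in>F. ennreal C * (\<integral>\<^sup>+z. indicator (Q j) (\<phi> z) * ?G z \<partial>disc_area))" by (intro sum_mono one)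
    also have "\<dots> = ennreal C * (\<integral>\<^sup>+z. (\<Sum>j\<in>F. indicator (Q j) (\<phi> z) * ?G z) \<partial>disc_area)"
      by (subst nn_integral_sum) (auto simp: sum_distrib_left)
    also have "\<dots> \<le> ennreal C * (\<integral>\<^sup>+z. ?G z \<partial>disc_area)"
    proof (intro mult_left_mono nn_integral_mono)
      fix z
      have "(\<Sum>j\<in>F. indicator (Q j) (\<phi> z) :: ennreal) \<le> 1"
      proof (cases "\<exists>i\<in>F. \<phi> z \<in> Q i")
        case True
        then obtain i where i: "i \<in> F" "\<phi> z \<in> Q i" by blast
        have "(\<Sum>j\<in>F. indicator (Q j) (\<phi> z) :: ennreal) = (\<Sum>j\<in>{i}. indicator (Q j) (\<phi> z))"
          by (rule sum.mono_neutral_right) (use F i Q_disjoint in \<open>auto simp: indicator_def\<close>)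
        then show ?thesis using i by simp
      qed (auto simp: indicator_def)
      then have "(\<Sum>j\<in>F. indicator (Q j) (\<phi> z)) * ?G z \<le> 1 * ?G z" by (rule mult_right_mono) simp
      then show "(\<Sum>j\<in>F. indicator (Q j) (\<phi> z) * ?G z) \<le> ?G z" by (simp add: sum_distrib_right)
    qed simp
    also have "\<dots> = ennreal B" unfolding B_def using fin by (intro ennreal_enn2real[symmetric]) simp
    finally show ?thesis by (subst (asm) ennreal_le_iff) (simp_all add: B_def)
  qed
  then show ?thesis by blast
qed

end

section \<open>Sufficiency of the integral condition\<close>

context composition_setting
begin

abbreviation "T \<equiv> composition_operator \<phi>"

lemma composition_derivative:
  assumes f: "f \<in> H"
  shows "(\<lambda>z. f (\<phi> z)) holomorphic_on unit_disc"
    and "z \<in> unit_disc \<Longrightarrow> deriv (\<lambda>z. f (\<phi> z)) z = deriv f (\<phi> z) * deriv \<phi> z"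
proof -
  have "(f \<circ> \<phi>) holomorphic_on unit_disc"
    by (rule holomorphic_on_compose_gen[OF hol H_holomorphic[OF f]]) (use self in auto)
  then show "(\<lambda>z. f (\<phi> z)) holomorphic_on unit_disc" by (simp add: o_def)
  assume z: "z \<in> unit_disc"
  have "(f has_field_derivative deriv f (\<phi> z)) (at (\<phi> z))" by (rule holomorphic_derivI[OF H_holomorphic[OF f] open_unit_disc self[OF z]])
  moreover have "(\<phi> has_field_derivative deriv \<phi> z) (at z)" by (rule holomorphic_derivI[OF hol open_unit_disc z])
  ultimately have "((\<lambda>z. f (\<phi> z)) has_field_derivative deriv f (\<phi> z) * deriv \<phi> z) (at z)" by (rule DERIV_chain2)
  then show "deriv (\<lambda>z. f (\<phi> z)) z = deriv f (\<phi> z) * deriv \<phi> z" by (rule DERIV_imp_deriv)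
qed

text \<open>
  On the cell \<open>|f'|\<^sup>2\<close> is at most \<open>4 ^ (- d)\<close> times a local area integral of \<open>|f|\<^sup>2\<close>, so the integral of \<open>|f' \<circ> \<phi>|\<^sup>2 |\<phi>'|\<^sup>2 \<tau>\<close>
  over the preimage of the cell is at most that constant times \<open>mass j\<close>. Written in terms of \<open>s j\<close>, the powers
  of \<open>r j\<close> and \<open>\<tau> (w j)\<close> cancel, and \<open>4 ^ (- d) * (s j)\<^sup>2 \<le> t\<^sup>2\<close>.
\<close>

lemma cell_integral_bound:
  assumes f: "f \<in> H" and t: "0 \<le> t" "s j \<le> t * 2 ^ d"
    and van: "\<And>i. i < d \<Longrightarrow> (deriv ^^ Suc i) f (w j) = 0"
  shows "(\<integral>\<^sup>+z. indicator (Q j) (\<phi> z) * ennreal ((cmod (deriv f (\<phi> z) * deriv \<phi> z))\<^sup>2 * \<tau> z) \<partial>disc_area) \<le>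
    ennreal (4096 * KB * t\<^sup>2) * (\<integral>\<^sup>+z. ennreal ((cmod (f z))\<^sup>2 * \<omega> z) * indicator (ball (w j) (r j / 4)) z \<partial>disc_area)"
proof -
  \<comment> \<open>The cell lies in the ball of an eighth of this radius, as \<open>deriv_L2_bound_vanishing\<close> asks.\<close>
  define \<rho> where "\<rho> = r j / 4"
  have \<rho>: "0 < \<rho>" "r j = 4 * \<rho>" using r_pos[of j] by (simp_all add: \<rho>_def)
  have tw: "0 < \<tau> (w j)" by (rule tau_pos[OF wD])
  let ?J = "\<integral>\<^sup>+z. ennreal ((cmod (f z))\<^sup>2) * indicator (ball (w j) \<rho>) z \<partial>disc_area"
  let ?I = "\<integral>\<^sup>+z. ennreal ((cmod (f z))\<^sup>2 * \<omega> z) * indicator (ball (w j) \<rho>) z \<partial>disc_area"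
  have IJ: "ennreal (\<tau> (w j)) * ?J \<le> ennreal (KB * (r j)\<^sup>2) * ?I"
    unfolding r_def by (rule local_norm_compare[OF wD _ H_holomorphic[OF f]]) (use \<rho> in \<open>simp add: r_def\<close>)
  have "?I \<le> (\<integral>\<^sup>+z. ennreal ((cmod (f z))\<^sup>2 * \<omega> z) \<partial>disc_area)" by (intro nn_integral_mono) (auto simp: indicator_def)
  then have Ifin: "?I < \<infinity>" unfolding norm_sq_nn[OF f] by (simp add: le_less_trans)
  define I where "I = enn2real ?I"
  have I: "?I = ennreal I" "0 \<le> I" using Ifin by (simp_all add: I_def)
  have Jfin: "?J < \<infinity>"
  proof (rule ccontr)
    assume "\<not> ?J < \<infinity>"
    then have "?J = \<infinity>" by (simp add: less_top[symmetric])
    then show False using IJ I tw by (simp add: ennreal_mult_top ennreal_mult_eq_top_iff top_unique)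
  qed
  define J where "J = enn2real ?J"
  have J: "?J = ennreal J" "0 \<le> J" using Jfin by (simp_all add: J_def)
  have IJ': "\<tau> (w j) * J \<le> KB * (r j)\<^sup>2 * I"
    using IJ I J tw KB_ge by (simp add: ennreal_mult[symmetric] ennreal_le_iff)
  have sub: "ball (w j) \<rho> \<subseteq> unit_disc" using ball_sub[of j] by (simp add: \<rho>_def)
  define c where "c = 16 / 4 ^ d * J / \<rho> ^ 4"
  have c: "0 \<le> c" using J \<rho> by (simp add: c_def)
  have "(\<integral>\<^sup>+z. indicator (Q j) (\<phi> z) * ennreal ((cmod (deriv f (\<phi> z) * deriv \<phi> z))\<^sup>2 * \<tau> z) \<partial>disc_area) \<le>
    (\<integral>\<^sup>+z. ennreal c * (u j z * ennreal (\<tau> z)) \<partial>disc_area)"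
  proof (rule nn_integral_mono)
    fix z assume "z \<in> space disc_area"
    then have z: "z \<in> unit_disc" by simp
    show "indicator (Q j) (\<phi> z) * ennreal ((cmod (deriv f (\<phi> z) * deriv \<phi> z))\<^sup>2 * \<tau> z) \<le> ennreal c * (u j z * ennreal (\<tau> z))"
    proof (cases "\<phi> z \<in> Q j")
      case True
      have "\<phi> z \<in> cball (w j) (\<rho> / 8)" using Q_sub[of j] True by (auto simp: \<rho>_def)
      then have "(cmod (deriv f (\<phi> z)))\<^sup>2 \<le> c"
        unfolding c_def by (rule deriv_L2_bound_vanishing[OF H_holomorphic[OF f] \<rho>(1) sub _ van]) (use J in simp_all)
      then have "(cmod (deriv f (\<phi> z)))\<^sup>2 * ((cmod (deriv \<phi> z))\<^sup>2 * \<tau> z) \<le> c * ((cmod (deriv \<phi> z))\<^sup>2 * \<tau> z)"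
        using tau_pos[OF z] by (intro mult_right_mono) auto
      then show ?thesis using True c tau_pos[OF z]
        by (simp add: u_def norm_mult power_mult_distrib ennreal_mult[symmetric] mult.assoc ennreal_leI)
    qed simp
  qed
  also have "\<dots> = ennreal c * ennreal (mass j)" unfolding mass_nn[symmetric] by (rule nn_integral_cmult) measurable
  also have "\<dots> = ennreal (c * mass j)" using c mass_nonneg by (simp add: ennreal_mult)
  also have "\<dots> \<le> ennreal (4096 * KB * t\<^sup>2 * I)"
  proof (rule ennreal_leI)
    have "(s j)\<^sup>2 \<le> (t * 2 ^ d)\<^sup>2" using t(2) s_nonneg by (intro power_mono) auto
    also have "\<dots> = t\<^sup>2 * 4 ^ d" by (simp add: power_mult_distrib power_mult[symmetric] mult.commute[of d]) (simp add: power_mult)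
    finally have ss: "(s j)\<^sup>2 / 4 ^ d \<le> t\<^sup>2" by (simp add: divide_le_eq)
    have "c * mass j = (16 * (s j)\<^sup>2 / 4 ^ d) * ((\<tau> (w j) * J) * (r j)\<^sup>2 / \<rho> ^ 4)" by (simp add: c_def s_sq)
    also have "\<dots> \<le> (16 * (s j)\<^sup>2 / 4 ^ d) * ((KB * (r j)\<^sup>2 * I) * (r j)\<^sup>2 / \<rho> ^ 4)"
      by (intro mult_left_mono divide_right_mono mult_right_mono IJ') (use \<rho> in auto)
    also have "\<dots> = 4096 * KB * I * ((s j)\<^sup>2 / 4 ^ d)"
    proof -
      have "(r j)\<^sup>2 * (r j)\<^sup>2 / \<rho> ^ 4 = 256" using \<rho> by (simp add: power_mult_distrib power2_eq_square power4_eq_xxxx)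
      then have "(KB * (r j)\<^sup>2 * I) * (r j)\<^sup>2 / \<rho> ^ 4 = KB * I * 256" by (simp add: mult_ac flip: times_divide_eq_right)
      then show ?thesis by simp
    qed
    also have "\<dots> \<le> 4096 * KB * I * t\<^sup>2" using KB_ge I by (intro mult_left_mono ss) auto
    finally show "c * mass j \<le> 4096 * KB * t\<^sup>2 * I" by (simp add: mult_ac)
  qed
  also have "\<dots> = ennreal (4096 * KB * t\<^sup>2) * ?I" using I KB_ge by (simp add: ennreal_mult)
  finally show ?thesis by (simp add: \<rho>_def)
qed

text \<open>
  The Littlewood-Paley estimate for \<open>f \<circ> \<phi>\<close>, with the integral split over the preimages of the cells. The local norms of \<open>f\<close> on the
  right add up to at most \<open>K\<close> times the norm, by the bounded overlap. The depth \<open>d j\<close> to which \<open>f\<close> has to vanish at \<open>w j\<close> is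
  free: depth \<open>0\<close> gives boundedness, larger depths the singular values.
\<close>

lemma composition_norm_bound:
  "\<exists>C\<ge>0. \<forall>f t d. f \<in> H \<longrightarrow> 0 \<le> t \<longrightarrow> (\<forall>j. s j \<le> t * 2 ^ d j) \<longrightarrow> (\<forall>j. \<forall>i<d j. (deriv ^^ Suc i) f (w j) = 0) \<longrightarrow>
     T f \<in> H \<and> (N (T f))\<^sup>2 \<le> C * ((cmod (f (\<phi> 0)))\<^sup>2 + t\<^sup>2 * (N f)\<^sup>2)"
proof -
  obtain L where L: "0 \<le> L" "\<And>g. g holomorphic_on unit_disc \<Longrightarrow> (\<integral>\<^sup>+z. ennreal ((cmod (g z))\<^sup>2 * \<omega> z) \<partial>disc_area) \<le>
       ennreal L * (ennreal ((cmod (g 0))\<^sup>2) + (\<integral>\<^sup>+z. ennreal ((cmod (deriv g z))\<^sup>2 * \<tau> z) \<partial>disc_area))"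
    using littlewood_paley_upper by blast
  define D where "D = 4096 * KB * real K"
  have D: "0 \<le> D" using KB_ge by (simp add: D_def)
  define C where "C = L * max 1 D"
  have C: "0 \<le> C" using L(1) by (simp add: C_def)
  have "T f \<in> H \<and> (N (T f))\<^sup>2 \<le> C * ((cmod (f (\<phi> 0)))\<^sup>2 + t\<^sup>2 * (N f)\<^sup>2)"
    if f: "f \<in> H" and t: "0 \<le> t" and d: "\<And>j. s j \<le> t * 2 ^ d j" and van: "\<And>j i. i < d j \<Longrightarrow> (deriv ^^ Suc i) f (w j) = 0" for f t d
  proof -
    define g where "g = (\<lambda>z. f (\<phi> z))"
    have g: "g holomorphic_on unit_disc" unfolding g_def by (rule composition_derivative(1)[OF f])
    have dg: "deriv g z = deriv f (\<phi> z) * deriv \<phi> z" if "z \<in> unit_disc" for z unfolding g_def by (rule composition_derivative(2)[OF f that])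
    have Tg: "T f z = g z" if "z \<in> unit_disc" for z using that by (simp add: composition_operator_def g_def)
    have fm[measurable]: "f \<in> borel_measurable disc_area" by (rule H_measurable[OF f])
    have dgm[measurable]: "deriv g \<in> borel_measurable disc_area" by (intro holomorphic_measurable holomorphic_deriv g) simp
    have im[measurable]: "(\<lambda>z. indicator (ball (w j) (r j / 4)) z :: ennreal) \<in> borel_measurable disc_area" for j
      by (intro borel_measurable_disc_area_borel borel_measurable_indicator) simp
    let ?A = "\<lambda>z. ennreal ((cmod (deriv g z))\<^sup>2 * \<tau> z)"
    let ?F = "\<lambda>z. ennreal ((cmod (f z))\<^sup>2 * \<omega> z)"
    have "(\<integral>\<^sup>+z. ?A z \<partial>disc_area) \<le> (\<integral>\<^sup>+z. (\<Sum>j. indicator (Q j) (\<phi> z) * ?A z) \<partial>disc_area)"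
    proof (rule nn_integral_mono)
      fix z assume "z \<in> space disc_area"
      then obtain j where j: "\<phi> z \<in> Q j" using Q_cover[OF self] by auto
      show "?A z \<le> (\<Sum>j. indicator (Q j) (\<phi> z) * ?A z)"
        using sum_le_suminf[of "\<lambda>j. indicator (Q j) (\<phi> z) * ?A z" "{j}"] j by simp
    qed
    also have "\<dots> = (\<Sum>j. \<integral>\<^sup>+z. indicator (Q j) (\<phi> z) * ?A z \<partial>disc_area)" by (rule nn_integral_suminf) measurable
    also have "\<dots> \<le> (\<Sum>j. ennreal (4096 * KB * t\<^sup>2) * (\<integral>\<^sup>+z. ?F z * indicator (ball (w j) (r j / 4)) z \<partial>disc_area))"
    proof (intro suminf_le summableI)
      fix j
      have "(\<integral>\<^sup>+z. indicator (Q j) (\<phi> z) * ?A z \<partial>disc_area) = (\<integral>\<^sup>+z. indicator (Q j) (\<phi> z) * ennreal ((cmod (deriv f (\<phi> z) * deriv \<phi> z))\<^sup>2 * \<tau> z) \<partial>disc_area)"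
        by (intro nn_integral_cong) (simp add: dg)
      also have "\<dots> \<le> ennreal (4096 * KB * t\<^sup>2) * (\<integral>\<^sup>+z. ?F z * indicator (ball (w j) (r j / 4)) z \<partial>disc_area)"
        by (rule cell_integral_bound[OF f t d van])
      finally show "(\<integral>\<^sup>+z. indicator (Q j) (\<phi> z) * ?A z \<partial>disc_area) \<le> ennreal (4096 * KB * t\<^sup>2) * (\<integral>\<^sup>+z. ?F z * indicator (ball (w j) (r j / 4)) z \<partial>disc_area)" .
    qed
    also have "\<dots> = ennreal (4096 * KB * t\<^sup>2) * (\<integral>\<^sup>+z. (\<Sum>j. ?F z * indicator (ball (w j) (r j / 4)) z) \<partial>disc_area)"
    proof -
      have "(\<Sum>j. \<integral>\<^sup>+z. ?F z * indicator (ball (w j) (r j / 4)) z \<partial>disc_area) = (\<integral>\<^sup>+z. (\<Sum>j. ?F z * indicator (ball (w j) (r j / 4)) z) \<partial>disc_area)"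
        by (rule nn_integral_suminf[symmetric]) measurable
      then show ?thesis by (simp only: ennreal_suminf_cmult)
    qed
    also have "\<dots> \<le> ennreal (4096 * KB * t\<^sup>2) * (\<integral>\<^sup>+z. ennreal (real K) * ?F z \<partial>disc_area)"
    proof (intro mult_left_mono nn_integral_mono)
      fix z
      show "(\<Sum>j. ?F z * indicator (ball (w j) (r j / 4)) z) \<le> ennreal (real K) * ?F z"
      proof (rule suminf_le_const[OF summableI])
        fix M
        have "(\<Sum>j<M. indicator (ball (w j) (r j / 4)) z :: ennreal) = of_nat (card {j\<in>{..<M}. z \<in> ball (w j) (r j / 4)})"
        proof -
          have "(\<Sum>j<M. indicator (ball (w j) (r j / 4)) z :: ennreal) = (\<Sum>j\<in>{j\<in>{..<M}. z \<in> ball (w j) (r j / 4)}. 1)"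
            by (rule sum.mono_neutral_cong_right) (auto simp: indicator_def)
          then show ?thesis by simp
        qed
        also have "\<dots> \<le> of_nat K"
        proof -
          have "card {j\<in>{..<M}. z \<in> ball (w j) (r j / 4)} \<le> K" by (rule wover[where z=z]) (auto simp: r_def)
          then show ?thesis by simp
        qed
        finally have "?F z * (\<Sum>j<M. indicator (ball (w j) (r j / 4)) z) \<le> ?F z * of_nat K" by (rule mult_left_mono) simp
        then show "(\<Sum>j<M. ?F z * indicator (ball (w j) (r j / 4)) z) \<le> ennreal (real K) * ?F z"
          by (simp add: sum_distrib_left ennreal_of_nat_eq_real_of_nat mult.commute)
      qed
    qed simp
    also have "\<dots> = ennreal (4096 * KB * t\<^sup>2) * (ennreal (real K) * ennreal ((N f)\<^sup>2))"
      unfolding norm_sq_nn[OF f, symmetric] by (subst nn_integral_cmult) auto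
    also have "\<dots> = ennreal (D * (t\<^sup>2 * (N f)\<^sup>2))"
      using KB_ge by (simp add: D_def ennreal_mult[symmetric] mult_ac)
    finally have A: "(\<integral>\<^sup>+z. ?A z \<partial>disc_area) \<le> ennreal (D * (t\<^sup>2 * (N f)\<^sup>2))" .
    have "(\<integral>\<^sup>+z. ennreal ((cmod (T f z))\<^sup>2 * \<omega> z) \<partial>disc_area) = (\<integral>\<^sup>+z. ennreal ((cmod (g z))\<^sup>2 * \<omega> z) \<partial>disc_area)"
      by (intro nn_integral_cong) (simp add: Tg)
    also have "\<dots> \<le> ennreal L * (ennreal ((cmod (g 0))\<^sup>2) + (\<integral>\<^sup>+z. ?A z \<partial>disc_area))" by (rule L(2)[OF g])
    also have "\<dots> \<le> ennreal L * (ennreal ((cmod (g 0))\<^sup>2) + ennreal (D * (t\<^sup>2 * (N f)\<^sup>2)))" by (intro mult_left_mono add_left_mono A) simp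
    also have "\<dots> = ennreal (L * ((cmod (g 0))\<^sup>2 + D * (t\<^sup>2 * (N f)\<^sup>2)))" using L(1) D by (simp add: ennreal_mult ennreal_plus)
    also have "\<dots> \<le> ennreal (C * ((cmod (f (\<phi> 0)))\<^sup>2 + t\<^sup>2 * (N f)\<^sup>2))"
    proof (rule ennreal_leI)
      have "(cmod (g 0))\<^sup>2 + D * (t\<^sup>2 * (N f)\<^sup>2) \<le> max 1 D * (cmod (f (\<phi> 0)))\<^sup>2 + max 1 D * (t\<^sup>2 * (N f)\<^sup>2)"
        using mult_right_mono[of 1 "max 1 D" "(cmod (f (\<phi> 0)))\<^sup>2"] by (intro add_mono mult_right_mono) (auto simp: g_def)
      then have "L * ((cmod (g 0))\<^sup>2 + D * (t\<^sup>2 * (N f)\<^sup>2)) \<le> L * (max 1 D * (cmod (f (\<phi> 0)))\<^sup>2 + max 1 D * (t\<^sup>2 * (N f)\<^sup>2))"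
        using L(1) by (rule mult_left_mono)
      then show "L * ((cmod (g 0))\<^sup>2 + D * (t\<^sup>2 * (N f)\<^sup>2)) \<le> C * ((cmod (f (\<phi> 0)))\<^sup>2 + t\<^sup>2 * (N f)\<^sup>2)"
        by (simp add: C_def distrib_left mult.assoc)
    qed
    finally have le: "(\<integral>\<^sup>+z. ennreal ((cmod (T f z))\<^sup>2 * \<omega> z) \<partial>disc_area) \<le> ennreal (C * ((cmod (f (\<phi> 0)))\<^sup>2 + t\<^sup>2 * (N f)\<^sup>2))" .
    have hT: "T f holomorphic_on unit_disc" by (rule holomorphic_transform[OF g]) (simp add: Tg)
    have "0 \<le> C * ((cmod (f (\<phi> 0)))\<^sup>2 + t\<^sup>2 * (N f)\<^sup>2)" using C by simp
    from H_memI[OF hT _ le this] show ?thesis by (simp add: composition_operator_def)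
  qed
  then show ?thesis using C by blast
qed

lemma s_bounded: "\<exists>S\<ge>0. \<forall>j. s j \<le> S"
proof -
  obtain B where B: "\<And>F. finite F \<Longrightarrow> (\<Sum>j\<in>F. s j powr p) \<le> B" using s_summable by blast
  have "s j \<le> (max 0 B) powr (1 / p)" for j
  proof -
    have "s j powr p \<le> max 0 B" using B[of "{j}"] by simp
    then have "(s j powr p) powr (1 / p) \<le> (max 0 B) powr (1 / p)" using p by (intro powr_mono2) auto
    then show ?thesis using p s_nonneg[of j] by (simp add: powr_powr)
  qed
  then show ?thesis by (intro exI[of _ "(max 0 B) powr (1 / p)"]) auto
qed

lemma point_functional_bounded: "z \<in> unit_disc \<Longrightarrow> \<exists>B. \<forall>f\<in>H. cmod (f z) \<le> B * N f"
proof -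
  assume z: "z \<in> unit_disc"
  have "cmod (f z) \<le> sqrt (4 * KB / \<tau> z) * N f" if f: "f \<in> H" for f
  proof (rule power2_le_imp_le)
    have "(cmod (f z))\<^sup>2 \<le> 4 * KB / \<tau> z * (N f)\<^sup>2"
      using point_evaluation[OF f z] tau_pos[OF z] by (simp add: field_simps)
    then show "(cmod (f z))\<^sup>2 \<le> (sqrt (4 * KB / \<tau> z) * N f)\<^sup>2"
      using KB_ge tau_pos[OF z] by (simp add: power_mult_distrib)
  qed (use KB_ge tau_pos[OF z] norm_nonneg in simp)
  then show ?thesis by blast
qed

text \<open>
  The conditions imposed on \<open>f\<close> have to be bounded functionals in order to have representing vectors.
\<close>

lemma derivative_functional_bounded: "\<exists>B. \<forall>f\<in>H. cmod ((deriv ^^ k) f (w j)) \<le> B * N f"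
proof -
  define \<rho> where "\<rho> = r j / 4"
  have \<rho>: "0 < \<rho>" using r_pos[of j] by (simp add: \<rho>_def)
  have sub: "ball (w j) \<rho> \<subseteq> unit_disc" using ball_sub[of j] by (simp add: \<rho>_def)
  have tw: "0 < \<tau> (w j)" by (rule tau_pos[OF wD])
  define E where "E = KB * (r j)\<^sup>2 / \<tau> (w j) * (real k + 1) / \<rho> ^ (2 * k + 2)"
  have E: "0 \<le> E" using KB_ge tw \<rho> by (simp add: E_def)
  have "cmod ((deriv ^^ k) f (w j)) \<le> (fact k * sqrt E) * N f" if f: "f \<in> H" for f
  proof -
    define c where "c = cmod ((deriv ^^ k) f (w j) / fact k)"
    have "ennreal (\<tau> (w j)) * ennreal (c\<^sup>2 * \<rho> ^ (2 * k + 2) / (real k + 1)) \<le> ennreal (\<tau> (w j)) * (\<integral>\<^sup>+z. ennreal ((cmod (f z))\<^sup>2) * indicator (ball (w j) \<rho>) z \<partial>disc_area)"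
      unfolding c_def by (intro mult_left_mono taylor_coeff_L2_bound[OF H_holomorphic[OF f] \<rho> sub]) simp
    also have "\<dots> \<le> ennreal (KB * (r j)\<^sup>2) * (\<integral>\<^sup>+z. ennreal ((cmod (f z))\<^sup>2 * \<omega> z) * indicator (ball (w j) \<rho>) z \<partial>disc_area)"
      unfolding r_def by (rule local_norm_compare[OF wD _ H_holomorphic[OF f]]) (use r_pos[of j] in \<open>simp add: \<rho>_def r_def\<close>)
    also have "\<dots> \<le> ennreal (KB * (r j)\<^sup>2) * ennreal ((N f)\<^sup>2)"
      unfolding norm_sq_nn[OF f, symmetric] by (intro mult_left_mono nn_integral_mono) (auto simp: indicator_def)
    finally have "\<tau> (w j) * (c\<^sup>2 * \<rho> ^ (2 * k + 2) / (real k + 1)) \<le> KB * (r j)\<^sup>2 * (N f)\<^sup>2"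
      using tw KB_ge \<rho> by (simp add: ennreal_mult[symmetric])
    then have "c\<^sup>2 \<le> E * (N f)\<^sup>2"
      unfolding E_def using tw \<rho> by (simp add: divide_simps mult_ac)
    then have "c\<^sup>2 \<le> (sqrt E * N f)\<^sup>2" using E by (simp add: power_mult_distrib)
    then have "c \<le> sqrt E * N f" by (rule power2_le_imp_le) (use E norm_nonneg in simp)
    then show ?thesis by (simp add: c_def norm_divide divide_le_eq mult_ac)
  qed
  then show ?thesis by blast
qed

lemma derivative_functional_linear:
  assumes "f \<in> H" "g \<in> H"
  shows "(deriv ^^ k) (\<lambda>z. a * f z + b * g z) (w j) = a * (deriv ^^ k) f (w j) + b * (deriv ^^ k) g (w j)"
proof -
  have hf: "f holomorphic_on unit_disc" "g holomorphic_on unit_disc" using assms H_holomorphic by auto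
  have "(deriv ^^ k) (\<lambda>z. a * f z + b * g z) (w j) = (deriv ^^ k) (\<lambda>z. a * f z) (w j) + (deriv ^^ k) (\<lambda>z. b * g z) (w j)"
    by (rule higher_deriv_add[OF _ _ open_unit_disc wD]) (intro holomorphic_intros hf)+
  then show ?thesis using higher_deriv_cmult[OF hf(1) wD open_unit_disc] higher_deriv_cmult[OF hf(2) wD open_unit_disc] by simp
qed

lemma composition_bounded: "bounded_operator H N T"
proof -
  obtain C where C: "0 \<le> C" and b: "\<And>f t d. f \<in> H \<Longrightarrow> 0 \<le> t \<Longrightarrow> (\<forall>j. s j \<le> t * 2 ^ d j) \<Longrightarrow> (\<forall>j. \<forall>i<d j. (deriv ^^ Suc i) f (w j) = 0) \<Longrightarrow>
     T f \<in> H \<and> (N (T f))\<^sup>2 \<le> C * ((cmod (f (\<phi> 0)))\<^sup>2 + t\<^sup>2 * (N f)\<^sup>2)"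
    using composition_norm_bound by blast
  obtain S where S: "0 \<le> S" "\<And>j. s j \<le> S" using s_bounded by blast
  have 0: "0 \<in> unit_disc" by (simp add: unit_disc_iff)
  obtain B where B: "\<And>f. f \<in> H \<Longrightarrow> cmod (f (\<phi> 0)) \<le> B * N f" using point_functional_bounded[OF self[OF 0]] by blast
  have bf: "T f \<in> H \<and> (N (T f))\<^sup>2 \<le> C * ((cmod (f (\<phi> 0)))\<^sup>2 + S\<^sup>2 * (N f)\<^sup>2)" if "f \<in> H" for f
    by (rule b[OF that S(1), of "\<lambda>_. 0"]) (use S in auto)
  have "N (T f) \<le> sqrt (C * (B\<^sup>2 + S\<^sup>2)) * N f" if f: "f \<in> H" for f
  proof (rule power2_le_imp_le)
    have "(cmod (f (\<phi> 0)))\<^sup>2 \<le> (B * N f)\<^sup>2" using B[OF f] by (intro power_mono) auto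
    then have "C * ((cmod (f (\<phi> 0)))\<^sup>2 + S\<^sup>2 * (N f)\<^sup>2) \<le> C * ((B * N f)\<^sup>2 + S\<^sup>2 * (N f)\<^sup>2)" using C by (intro mult_left_mono) auto
    also have "\<dots> = (sqrt (C * (B\<^sup>2 + S\<^sup>2)) * N f)\<^sup>2" using C by (simp add: power_mult_distrib distrib_left distrib_right mult.assoc)
    finally show "(N (T f))\<^sup>2 \<le> (sqrt (C * (B\<^sup>2 + S\<^sup>2)) * N f)\<^sup>2" using bf[OF f] by linarith
  qed (use C norm_nonneg in simp)
  moreover have "linear_operator H T"
    unfolding linear_operator_def using bf by (auto simp: composition_operator_def fun_eq_iff)
  ultimately show ?thesis unfolding bounded_operator_def by blast
qed

text \<open>
  For given \<open>t\<close> let \<open>d j\<close> be the least \<open>i\<close> with \<open>s j \<le> t * 2 ^ i\<close>. The pairs \<open>(j, i)\<close> with \<open>i < d j\<close> are those with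
  \<open>t < s j / 2 ^ i\<close>; requiring the derivative of order \<open>i + 1\<close> to vanish at \<open>w j\<close> for each of them, and \<open>f\<close> to vanish at \<open>\<phi> 0\<close>,
  puts \<open>f\<close> in the situation of \<open>composition_norm_bound\<close>. The value at \<open>\<phi> 0\<close> is the additional condition counted by \<open>Suc\<close>.
\<close>

lemma singular_value_estimate:
  "\<exists>C>0. \<forall>t>0. singular_value H N T (Suc (card {(j, i). t < s j / 2 ^ i})) \<le> C * t"
proof -
  obtain C where C: "0 \<le> C" and b: "\<And>f t d. f \<in> H \<Longrightarrow> 0 \<le> t \<Longrightarrow> (\<forall>j. s j \<le> t * 2 ^ d j) \<Longrightarrow> (\<forall>j. \<forall>i<d j. (deriv ^^ Suc i) f (w j) = 0) \<Longrightarrow>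
     T f \<in> H \<and> (N (T f))\<^sup>2 \<le> C * ((cmod (f (\<phi> 0)))\<^sup>2 + t\<^sup>2 * (N f)\<^sup>2)"
    using composition_norm_bound by blast
  obtain B where B: "\<And>F. finite F \<Longrightarrow> (\<Sum>j\<in>F. s j powr p) \<le> B" using s_summable by blast
  obtain S where S: "0 \<le> S" "\<And>j. s j \<le> S" using s_bounded by blast
  have 0: "\<phi> 0 \<in> unit_disc" by (rule self) (simp add: unit_disc_iff)
  have "singular_value H N T (Suc (card {(j, i). t < s j / 2 ^ i})) \<le> (sqrt C + 1) * t" if t: "0 < t" for t
  proof -
    define A where "A = {(j, i). t < s j / 2 ^ i}"
    \<comment> \<open>Only finitely many \<open>s j\<close> exceed \<open>t\<close>, by summability, and for each of them only finitely many \<open>i\<close> count.\<close>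
    have fin: "finite A"
    proof -
      have f1: "finite {j. t < s j}"
      proof (rule ccontr)
        assume inf: "infinite {j. t < s j}"
        define k where "k = nat \<lceil>B / t powr p\<rceil> + 1"
        obtain F where F: "F \<subseteq> {j. t < s j}" "finite F" "card F = k" using infinite_arbitrarily_large[OF inf] by blast
        have "real k * t powr p = (\<Sum>j\<in>F. t powr p)" using F by simp
        also have "\<dots> \<le> (\<Sum>j\<in>F. s j powr p)" using F t p by (intro sum_mono powr_mono2) auto
        also have "\<dots> \<le> B" by (rule B[OF F(2)])
        finally have "real k \<le> B / t powr p" using t by (simp add: pos_le_divide_eq)
        then show False unfolding k_def by linarith
      qed
      obtain m where m: "S / t < 2 ^ m" using real_arch_pow[of 2 "S / t"] by auto
      have "A \<subseteq> {j. t < s j} \<times> {..<m}"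
      proof
        fix x assume "x \<in> A"
        then obtain j i where x: "x = (j, i)" "t < s j / 2 ^ i" by (auto simp: A_def)
        have ge1: "(1::real) \<le> 2 ^ i" by simp
        have "t * 2 ^ i < s j" using x(2) by (simp add: pos_less_divide_eq)
        moreover have "t * 1 \<le> t * 2 ^ i" using t ge1 by (intro mult_left_mono) auto
        ultimately have 1: "t < s j" by linarith
        have "t * 2 ^ i < S" using \<open>t * 2 ^ i < s j\<close> S(2)[of j] by linarith
        then have "2 ^ i < S / t" using t by (simp add: pos_less_divide_eq mult.commute)
        then have "(2::real) ^ i < 2 ^ m" using m by linarith
        then have "i < m" by simp
        then show "x \<in> {j. t < s j} \<times> {..<m}" using x 1 by simp
      qed
      then show ?thesis by (rule finite_subset) (use f1 in simp)
    qed
    define A' where "A' = insert None (Some ` A)"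
    define L where "L x f = (case x of None \<Rightarrow> f (\<phi> 0) | Some (j, i) \<Rightarrow> (deriv ^^ Suc i) f (w j))" for x :: "(nat \<times> nat) option" and f :: "complex \<Rightarrow> complex"
    have cA: "card A' = Suc (card A)" unfolding A'_def using fin by (simp add: card_image)
    have "singular_value H N T (card A') \<le> (sqrt C + 1) * t"
    proof (rule singular_value_le_on_kernel_finite[OF composition_bounded, where L=L])
      show "0 \<le> (sqrt C + 1) * t" using C t by simp
      show "finite A'" using fin by (simp add: A'_def)
      show "L x (\<lambda>z. a * f z + b * g z) = a * L x f + b * L x g" if "f \<in> H" "g \<in> H" for x f g a b
        using derivative_functional_linear[OF that] by (auto simp: L_def simp del: funpow.simps split: option.split)
      show "\<exists>B. \<forall>f\<in>H. cmod (L x f) \<le> B * N f" for x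
        using point_functional_bounded[OF 0] derivative_functional_bounded by (cases x) (auto simp: L_def simp del: funpow.simps)
      fix f assume f: "f \<in> H" and van: "\<And>x. x \<in> A' \<Longrightarrow> L x f = 0"
      define d where "d j = (LEAST i. s j \<le> t * 2 ^ i)" for j
      have ex: "\<exists>i. s j \<le> t * 2 ^ i" for j
      proof -
        obtain i where "s j / t < 2 ^ i" using real_arch_pow[of 2 "s j / t"] by auto
        then show ?thesis using t by (intro exI[of _ i]) (simp add: pos_divide_less_eq mult.commute less_imp_le)
      qed
      have d: "s j \<le> t * 2 ^ d j" for j unfolding d_def using ex[of j] by (rule LeastI_ex)
      have dv: "(deriv ^^ Suc i) f (w j) = 0" if "i < d j" for i j
      proof -
        have "\<not> s j \<le> t * 2 ^ i" using not_less_Least that unfolding d_def by blast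
        then have "(j, i) \<in> A" by (simp add: A_def pos_less_divide_eq)
        then have "Some (j, i) \<in> A'" by (simp add: A'_def)
        from van[OF this] show ?thesis by (simp add: L_def)
      qed
      have f0: "f (\<phi> 0) = 0" using van[of None] by (simp add: A'_def L_def)
      have "(N (T f))\<^sup>2 \<le> C * ((cmod (f (\<phi> 0)))\<^sup>2 + t\<^sup>2 * (N f)\<^sup>2)"
        using b[OF f less_imp_le[OF t], of d] d dv by blast
      also have "\<dots> = (sqrt C * t * N f)\<^sup>2" using C f0 by (simp add: power_mult_distrib)
      finally have "N (T f) \<le> sqrt C * t * N f" by (rule power2_le_imp_le) (use C t norm_nonneg in simp)
      also have "\<dots> \<le> (sqrt C + 1) * t * N f" using t norm_nonneg by (intro mult_right_mono) auto
      finally show "N (T f) \<le> (sqrt C + 1) * t * N f" .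
    qed
    then show ?thesis unfolding cA A_def .
  qed
  moreover have "0 < sqrt C + 1" using C by (intro add_nonneg_pos) auto
  ultimately show ?thesis by blast
qed

text \<open>
  The family \<open>s j / 2 ^ i\<close> is \<open>p\<close>-summable: the sum over \<open>i\<close> is geometric and that over \<open>j\<close> is \<open>s_summable\<close>.
\<close>

theorem composition_Schatten: "T \<in> Schatten_class p H N"
proof -
  obtain C where C: "0 < C" "\<And>t. 0 < t \<Longrightarrow> singular_value H N T (Suc (card {(j, i). t < s j / 2 ^ i})) \<le> C * t"
    using singular_value_estimate by blast
  obtain B where B: "\<And>F. finite F \<Longrightarrow> (\<Sum>j\<in>F. s j powr p) \<le> B" using s_summable by blast
  define q where "q = (1 / 2) powr p"
  have q: "0 < q" "q < 1" using p powr_less_mono2[of p "1/2" 1] by (auto simp: q_def)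
  have B0: "0 \<le> B" using B[of "{}"] by simp
  define \<sigma> where "\<sigma> = (\<lambda>(j, i). s j / 2 ^ i)"
  have sp: "\<sigma> (j, i) powr p = s j powr p * q ^ i" for j i
  proof -
    have "(2 ^ i) powr p = (2 powr p) ^ i" by (simp add: powr_realpow[symmetric] powr_powr mult.commute)
    then show ?thesis using s_nonneg[of j] by (simp add: \<sigma>_def q_def powr_divide power_divide)
  qed
  have "summable (\<lambda>n. singular_value H N T n powr p)"
  proof (rule greedy_summable[where \<sigma>=\<sigma> and C=C and B="B * (1 / (1 - q))"])
    show "0 < p" using p by simp
    show "0 < C" by (rule C)
    show "0 \<le> singular_value H N T n" for n by (rule singular_value_nonneg[OF composition_bounded])
    show "singular_value H N T m \<le> singular_value H N T n" if "n \<le> m" for n m by (rule singular_value_antimono[OF composition_bounded that])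
    show "0 \<le> \<sigma> x" for x using s_nonneg by (cases x) (simp add: \<sigma>_def)
    show "singular_value H N T (Suc (card {x. t < \<sigma> x})) \<le> C * t" if "0 < t" for t
    proof -
      have "{x. t < \<sigma> x} = {(j, i). t < s j / 2 ^ i}" by (auto simp: \<sigma>_def)
      then show ?thesis using C(2)[OF that] by simp
    qed
    fix F :: "(nat \<times> nat) set" assume F: "finite F"
    have "(\<Sum>x\<in>F. \<sigma> x powr p) \<le> (\<Sum>x\<in>fst ` F \<times> snd ` F. \<sigma> x powr p)"
      by (rule sum_mono2) (use F subset_fst_snd in auto)
    also have "\<dots> = (\<Sum>j\<in>fst ` F. \<Sum>i\<in>snd ` F. s j powr p * q ^ i)"
    proof -
      have "(\<Sum>x\<in>fst ` F \<times> snd ` F. \<sigma> x powr p) = (\<Sum>(j, i)\<in>fst ` F \<times> snd ` F. s j powr p * q ^ i)"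
        by (rule sum.cong) (auto simp: sp)
      then show ?thesis by (simp only: sum.cartesian_product)
    qed
    also have "\<dots> = (\<Sum>j\<in>fst ` F. s j powr p) * (\<Sum>i\<in>snd ` F. q ^ i)" by (simp add: sum_product)
    also have "\<dots> \<le> B * (1 / (1 - q))"
    proof (intro mult_mono B)
      have "(\<Sum>i\<in>snd ` F. q ^ i) \<le> (\<Sum>i. q ^ i)" by (rule sum_le_suminf) (use F q in \<open>auto intro!: summable_geometric\<close>)
      also have "\<dots> = 1 / (1 - q)" by (rule suminf_geometric) (use q in auto)
      finally show "(\<Sum>i\<in>snd ` F. q ^ i) \<le> 1 / (1 - q)" .
    qed (use F q B0 in \<open>auto intro: sum_nonneg\<close>)
    finally show "(\<Sum>x\<in>F. \<sigma> x powr p) \<le> B * (1 / (1 - q))" .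
  qed note summ = this
  have "(\<lambda>n. (singular_value H N T n powr p) powr (1 / p)) \<longlonglongrightarrow> 0 powr (1 / p)"
    by (rule tendsto_powr'[OF summable_LIMSEQ_zero[OF summ] tendsto_const]) (use p in auto)
  then have "singular_value H N T \<longlonglongrightarrow> 0"
    using p singular_value_nonneg[OF composition_bounded] by (simp add: powr_powr)
  then have "compact_operator H N T" by (rule compact_operatorI[OF composition_bounded])
  then show ?thesis using summ by (simp add: Schatten_class_def)
qed

end

section \<open>The associated weight, and the theorem\<close>

context regular_radial_weight
begin

abbreviation "\<omega>s \<equiv> weight_star \<omega>"

lemma omega_star_zero: "\<omega>s 0 = 0"
  by (simp add: weight_star_def set_lebesgue_integral_def)

text \<open>
  The logarithm is at most \<open>ln (1 / |z|)\<close> on the whole range of integration, and \<open>s * ln (s / |z|)\<close> is at least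
  \<open>s - |z|\<close>, hence at least \<open>(1 - |z|) / 2\<close> on the outer half; the outer half carries a fixed proportion of the
  integral of the weight by the doubling property.
\<close>

lemma omega_star_bounds:
  assumes z: "z \<in> unit_disc" "z \<noteq> 0"
  shows "\<omega>s z \<le> ln (1 / cmod z) * W (cmod z)" and "\<tau> z \<le> 2 * CD * \<omega>s z"
proof -
  define x where "x = cmod z"
  have x: "0 < x" "x < 1" using z by (auto simp: x_def unit_disc_iff)
  define V where "V s = indicator {x..<1} s *\<^sub>R \<omega> (complex_of_real s)" for s
  define F where "F s = V s * (ln (s / x) * s)" for s
  have V: "integrable lebesgue V" using omega_line_integrable[of x] x by (simp add: V_def[abs_def] set_integrable_def)
  have V0: "0 \<le> V s" for s using omega_line_nonneg[of s] x by (auto simp: V_def indicator_def)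
  have star: "\<omega>s z = (\<integral>s. F s \<partial>lebesgue)"
    unfolding weight_star_def set_lebesgue_integral_def F_def V_def x_def by (simp add: mult_ac)
  have F: "0 \<le> F s" "F s \<le> ln (1 / x) * V s" for s
  proof -
    have "0 \<le> ln (s / x) * s \<and> ln (s / x) * s \<le> ln (1 / x)" if s: "x \<le> s" "s < 1"
    proof
      have l: "0 \<le> ln (s / x)" "ln (s / x) \<le> ln (1 / x)" using s x by (auto simp: ln_ge_zero_iff divide_right_mono)
      show "0 \<le> ln (s / x) * s" using l s x by simp
      have "ln (s / x) * s \<le> ln (s / x) * 1" using l s by (intro mult_left_mono) auto
      then show "ln (s / x) * s \<le> ln (1 / x)" using l by simp
    qed
    then show "0 \<le> F s" "F s \<le> ln (1 / x) * V s"
      using V0[of s] by (auto simp: F_def V_def indicator_def mult.commute intro!: mult_left_mono)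
  qed
  have Fm: "F \<in> borel_measurable lebesgue"
  proof -
    have "(\<lambda>s. ln (s / x) * s) \<in> borel_measurable lebesgue" by (rule measurable_completion) measurable
    then show ?thesis unfolding F_def by (rule borel_measurable_times[OF borel_measurable_integrable[OF V]])
  qed
  have Fi: "integrable lebesgue F"
    by (rule Bochner_Integration.integrable_bound[where f="\<lambda>s. ln (1 / x) * V s"]) (use V Fm F in \<open>auto intro!: AE_I2 order_trans[OF _ abs_ge_self]\<close>)
  have WV: "W x = (\<integral>s. V s \<partial>lebesgue)" using W_eq[of x] x by (simp add: V_def set_lebesgue_integral_def)
  have "\<omega>s z \<le> (\<integral>s. ln (1 / x) * V s \<partial>lebesgue)"
    unfolding star by (rule integral_mono[OF Fi]) (use V F in auto)
  then show "\<omega>s z \<le> ln (1 / cmod z) * W (cmod z)" using WV by (simp add: x_def)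
  define y where "y = (1 + x) / 2"
  have y: "x < y" "y < 1" using x by (auto simp: y_def)
  define V' where "V' s = indicator {y..<1} s *\<^sub>R \<omega> (complex_of_real s)" for s
  have V': "integrable lebesgue V'" using omega_line_integrable[of y] x y by (simp add: V'_def[abs_def] set_integrable_def)
  have WV': "W y = (\<integral>s. V' s \<partial>lebesgue)" using W_eq[of y] x y by (simp add: V'_def set_lebesgue_integral_def)
  have "(\<integral>s. ((1 - x) / 2) * V' s \<partial>lebesgue) \<le> \<omega>s z"
    unfolding star
  proof (rule integral_mono[OF _ Fi])
    show "integrable lebesgue (\<lambda>s. ((1 - x) / 2) * V' s)" using V' by simp
    fix s
    show "((1 - x) / 2) * V' s \<le> F s"
    proof (cases "y \<le> s \<and> s < 1")
      case True
      have "1 - x / s \<le> ln (s / x)"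
      proof -
        have "ln (x / s) \<le> x / s - 1" using True x y by (intro ln_le_minus_one) auto
        moreover have "ln (x / s) = - ln (s / x)" using True x y by (simp add: ln_div)
        ultimately show ?thesis by simp
      qed
      then have "(1 - x / s) * s \<le> ln (s / x) * s" using True x y by (intro mult_right_mono) auto
      moreover have "(1 - x / s) * s = s - x" using True x y by (simp add: field_simps)
      moreover have "(1 - x) / 2 = y - x" by (simp add: y_def field_simps)
      ultimately have "(1 - x) / 2 \<le> ln (s / x) * s" using True by linarith
      then have "((1 - x) / 2) * V s \<le> (ln (s / x) * s) * V s" using V0 by (intro mult_right_mono) auto
      moreover have "V s = V' s" using True y by (simp add: V_def V'_def)
      ultimately show ?thesis by (simp add: F_def mult_ac)
    next
      case False
      then have "V' s = 0" by (simp add: V'_def)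
      then show ?thesis using F(1)[of s] by simp
    qed
  qed
  then have "(1 - x) / 2 * W y \<le> \<omega>s z" using WV' by simp
  moreover have "W x \<le> CD * W y" unfolding y_def by (rule CD(2)[OF x(2)])
  then have "(1 - x) * W x \<le> (1 - x) * (CD * W y)" using x by (intro mult_left_mono) auto
  moreover have "CD * ((1 - x) / 2 * W y) \<le> CD * \<omega>s z"
    using CD(1) \<open>(1 - x) / 2 * W y \<le> \<omega>s z\<close> by (intro mult_left_mono) auto
  then have "(1 - x) * (CD * W y) \<le> 2 * CD * \<omega>s z" by (simp add: mult_ac)
  ultimately have "(1 - x) * W x \<le> 2 * CD * \<omega>s z" by linarith
  then show "\<tau> z \<le> 2 * CD * \<omega>s z" by (simp add: \<tau>_def x_def)
qed

lemma omega_star_pos: "z \<in> unit_disc \<Longrightarrow> z \<noteq> 0 \<Longrightarrow> 0 < \<omega>s z"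
proof -
  assume z: "z \<in> unit_disc" "z \<noteq> 0"
  have "0 < 2 * CD * \<omega>s z" using omega_star_bounds(2)[OF z] tau_pos[OF z(1)] by linarith
  then show ?thesis using CD(1) by (simp add: zero_less_mult_iff)
qed

lemma omega_star_upper:
  assumes z: "z \<in> unit_disc" "1 / 2 \<le> cmod z" shows "\<omega>s z \<le> 2 * \<tau> z"
proof -
  have x: "0 < cmod z" "cmod z < 1" using z by (auto simp: unit_disc_iff)
  have z0: "z \<noteq> 0" using x by auto
  have "ln (1 / cmod z) \<le> 1 / cmod z - 1" using x by (intro ln_le_minus_one) simp
  also have "\<dots> = (1 - cmod z) * (1 / cmod z)" using x by (simp add: field_simps)
  also have "\<dots> \<le> (1 - cmod z) * 2" using x z by (intro mult_left_mono) (auto simp: field_simps)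
  finally have "ln (1 / cmod z) * W (cmod z) \<le> (1 - cmod z) * 2 * W (cmod z)" by (intro mult_right_mono W_nonneg)
  then show ?thesis using omega_star_bounds(1)[OF z(1) z0] by (simp add: \<tau>_def algebra_simps)
qed

text \<open>
  In this form the exponents of both powers are positive, so that each factor can be estimated separately; for \<open>a\<close> this uses
  \<open>2 < p\<close>.
\<close>

lemma ratio_powr:
  fixes a b c :: real
  assumes "0 < a" "0 < b" shows "(a / b) powr (p / 2) * (c / a) = a powr (p / 2 - 1) * c / b powr (p / 2)"
  using assms by (simp add: powr_divide powr_diff)

lemma AE_disc_area_nonzero: "AE z in disc_area. z \<noteq> 0"
proof -
  have "{0} \<in> sets disc_area" by (simp add: sets_disc_area unit_disc_iff)
  then have "{0} \<in> null_sets disc_area" by (intro null_setsI) (simp_all add: emeasure_disc_area)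
  from AE_not_in[OF this] show ?thesis by simp
qed

text \<open>
  Where both \<open>|z|\<close> and \<open>|\<phi> z|\<close> are at least \<open>1/2\<close>, the integrands are comparable. Points with \<open>|\<phi> z| < 1/2\<close> matter only for the
  implication from left to right, where \<open>\<tau> (\<phi> z)\<close> is bounded below and the integrand on the right is at most a multiple of
  \<open>\<omega>\<close>. Points with \<open>|z| < 1/2\<close> matter only for the converse: there \<open>|\<phi> z|\<close> is bounded away from \<open>1\<close>, and
  \<open>weight_star \<omega> z\<close> has a logarithmic singularity at the origin, of which every power is dominated by the integrable
  function \<open>1 / |z|\<close>.
\<close>

theorem star_integral_iff:
  assumes p: "2 < p" and hol: "\<phi> holomorphic_on unit_disc" and self: "\<And>z. z \<in> unit_disc \<Longrightarrow> \<phi> z \<in> unit_disc"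
  shows "(\<integral>\<^sup>+z. ennreal ((\<omega>s z / \<omega>s (\<phi> z)) powr (p / 2) * (\<omega> z / \<omega>s z)) \<partial>disc_area) < \<infinity> \<longleftrightarrow>
    (\<integral>\<^sup>+z. ennreal ((\<tau> z / \<tau> (\<phi> z)) powr (p / 2) * (\<omega> z / \<tau> z)) \<partial>disc_area) < \<infinity>"
    (is "?S < \<infinity> \<longleftrightarrow> ?I < \<infinity>")
proof
  define q where "q = p / 2 - 1"
  have q: "0 < q" using p by (simp add: q_def)
  let ?s = "\<lambda>z. (\<omega>s z / \<omega>s (\<phi> z)) powr (p / 2) * (\<omega> z / \<omega>s z)"
  let ?g = "\<lambda>z. (\<tau> z / \<tau> (\<phi> z)) powr (p / 2) * (\<omega> z / \<tau> z)"
  have phm[measurable]: "\<phi> \<in> borel_measurable disc_area" by (rule holomorphic_measurable[OF hol])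
  have tm[measurable]: "\<tau> \<in> borel_measurable disc_area" by (rule borel_measurable_disc_area_borel[OF tau_measurable])
  have tpm[measurable]: "(\<lambda>z. \<tau> (\<phi> z)) \<in> borel_measurable disc_area" by (rule measurable_compose[OF phm tau_measurable])
  have gm[measurable]: "(\<lambda>z. ennreal (?g z)) \<in> borel_measurable disc_area" by measurable
  have g_eq: "?g z = \<tau> z powr q * \<omega> z / \<tau> (\<phi> z) powr (p / 2)" if "z \<in> unit_disc" for z
    unfolding q_def by (rule ratio_powr[OF tau_pos[OF that] tau_pos[OF self[OF that]]])
  have g_nonneg: "0 \<le> ?g z" if "z \<in> unit_disc" for z using omega_nonneg[OF that] tau_pos[OF that] by simp
  {
    assume fin: "?S < \<infinity>"
    define t0 where "t0 = (1 / 2) * W (1 / 2)"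
    have t0: "0 < t0" using W_pos[of "1/2"] by (simp add: t0_def)
    define C1 where "C1 = W 0 powr q / t0 powr (p / 2)"
    define C2 where "C2 = (2 * CD) powr q * 2 powr (p / 2)"
    have C2: "0 < C2" using CD(1) by (simp add: C2_def)
    define I where "I z = (indicator {1 / 2..} (cmod (\<phi> z)) :: ennreal)" for z
    have Im[measurable]: "I \<in> borel_measurable disc_area"
      unfolding I_def by (rule measurable_compose[OF phm]) measurable
    have "?I \<le> (\<integral>\<^sup>+z. ennreal C1 * ennreal (\<omega> z) + ennreal (?g z) * I z \<partial>disc_area)"
    proof (rule nn_integral_mono)
      fix z assume "z \<in> space disc_area"
      then have z: "z \<in> unit_disc" by simp
      show "ennreal (?g z) \<le> ennreal C1 * ennreal (\<omega> z) + ennreal (?g z) * I z"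
      proof (cases "1 / 2 \<le> cmod (\<phi> z)")
        case False
        have "t0 \<le> \<tau> (\<phi> z)" unfolding t0_def \<tau>_def using False by (intro mult_mono W_antimono W_nonneg) auto
        moreover have "\<tau> z \<le> W 0" by (rule tau_le[OF z])
        ultimately have "\<tau> z powr q * \<omega> z / \<tau> (\<phi> z) powr (p / 2) \<le> W 0 powr q * \<omega> z / t0 powr (p / 2)"
          using t0 p q tau_pos[OF z] omega_nonneg[OF z] by (intro frac_le mult_right_mono powr_mono2) auto
        then have "?g z \<le> C1 * \<omega> z" unfolding g_eq[OF z] by (simp add: C1_def)
        then have "ennreal (?g z) \<le> ennreal (C1 * \<omega> z)" by (rule ennreal_leI)
        also have "\<dots> = ennreal C1 * ennreal (\<omega> z)" by (rule ennreal_mult) (auto simp: C1_def omega_nonneg[OF z])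
        finally show ?thesis by (rule add_increasing2[rotated]) simp
      qed (simp add: I_def add_increasing)
    qed
    also have "\<dots> = (\<integral>\<^sup>+z. ennreal C1 * ennreal (\<omega> z) \<partial>disc_area) + (\<integral>\<^sup>+z. ennreal (?g z) * I z \<partial>disc_area)"
      by (rule nn_integral_add) measurable
    also have "(\<integral>\<^sup>+z. ennreal C1 * ennreal (\<omega> z) \<partial>disc_area) = ennreal C1 * ennreal (\<integral>z. \<omega> z \<partial>disc_area)"
      using nn_integral_eq_integral[OF omega_integrable AE_I2] omega_nonneg by (simp add: nn_integral_cmult)
    also have "\<dots> + (\<integral>\<^sup>+z. ennreal (?g z) * I z \<partial>disc_area) < \<infinity>"
    proof -
      have "ennreal (1 / C2) * (\<integral>\<^sup>+z. ennreal (?g z) * I z \<partial>disc_area) = (\<integral>\<^sup>+z. ennreal (1 / C2) * (ennreal (?g z) * I z) \<partial>disc_area)"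
        by (rule nn_integral_cmult[symmetric]) measurable
      also have "\<dots> \<le> ?S"
      proof (rule nn_integral_mono_AE)
        show "AE z in disc_area. ennreal (1 / C2) * (ennreal (?g z) * I z) \<le> ennreal (?s z)"
          using AE_disc_area_nonzero AE_space
        proof eventually_elim
          fix z assume z0: "z \<noteq> 0" and "z \<in> space disc_area"
          then have z: "z \<in> unit_disc" by simp
          show "ennreal (1 / C2) * (ennreal (?g z) * I z) \<le> ennreal (?s z)"
          proof (cases "1 / 2 \<le> cmod (\<phi> z)")
            case True
            then have p0: "\<phi> z \<noteq> 0" by auto
            have sp: "0 < \<omega>s z" "0 < \<omega>s (\<phi> z)" using omega_star_pos[OF z z0] omega_star_pos[OF self[OF z] p0] by auto
            have "\<tau> z powr q \<le> (2 * CD * \<omega>s z) powr q"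
              using omega_star_bounds(2)[OF z z0] tau_pos[OF z] q by (intro powr_mono2) auto
            also have "\<dots> = (2 * CD) powr q * \<omega>s z powr q" using CD(1) sp by (simp add: powr_mult)
            finally have 1: "\<tau> z powr q \<le> (2 * CD) powr q * \<omega>s z powr q" .
            have "\<omega>s (\<phi> z) powr (p / 2) \<le> (2 * \<tau> (\<phi> z)) powr (p / 2)"
              using omega_star_upper[OF self[OF z] True] sp p by (intro powr_mono2) auto
            also have "\<dots> = 2 powr (p / 2) * \<tau> (\<phi> z) powr (p / 2)" using tau_pos[OF self[OF z]] by (simp add: powr_mult)
            finally have 2: "1 / \<tau> (\<phi> z) powr (p / 2) \<le> 2 powr (p / 2) / \<omega>s (\<phi> z) powr (p / 2)"
              using sp tau_pos[OF self[OF z]] by (simp add: field_simps)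
            have "?g z = \<tau> z powr q * \<omega> z * (1 / \<tau> (\<phi> z) powr (p / 2))" unfolding g_eq[OF z] by simp
            also have "\<dots> \<le> ((2 * CD) powr q * \<omega>s z powr q) * \<omega> z * (2 powr (p / 2) / \<omega>s (\<phi> z) powr (p / 2))"
              using omega_nonneg[OF z] by (intro mult_mono mult_right_mono 1 2) auto
            also have "\<dots> = C2 * (\<omega>s z powr q * \<omega> z / \<omega>s (\<phi> z) powr (p / 2))" by (simp add: C2_def)
            also have "\<dots> = C2 * ?s z" unfolding q_def ratio_powr[OF sp] ..
            finally have le: "?g z \<le> C2 * ?s z" .
            have "(1 / C2) * a \<le> b" if "a \<le> C2 * b" for a b using that C2 by (simp add: field_simps)
            from this[OF le] have "(1 / C2) * ?g z \<le> ?s z" .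
            moreover have "ennreal (1 / C2) * ennreal (?g z) = ennreal ((1 / C2) * ?g z)"
              by (rule ennreal_mult[symmetric]) (use C2 g_nonneg[OF z] in auto)
            ultimately show ?thesis using True by (simp only: I_def) (simp add: ennreal_leI)
          qed (simp add: I_def)
        qed
      qed
      finally have "ennreal (1 / C2) * (\<integral>\<^sup>+z. ennreal (?g z) * I z \<partial>disc_area) < \<infinity>" using fin by (rule le_less_trans)
      then have "(\<integral>\<^sup>+z. ennreal (?g z) * I z \<partial>disc_area) < \<infinity>" using C2 by (auto simp: ennreal_mult_less_top)
      then show ?thesis by (simp add: ennreal_mult_less_top)
    qed
    finally show "?I < \<infinity>" .
  }
  {
    assume fin: "?I < \<infinity>"
    \<comment> \<open>A power \<open>y ^ k\<close> with integer \<open>k \<ge> q\<close> controls the power \<open>q\<close> of the logarithm \<open>y\<close> of \<open>1 / |z|\<close>.\<close>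
    define k where "k = nat \<lceil>q\<rceil>"
    have qk: "q \<le> real k" unfolding k_def by linarith
    have "compact ((\<lambda>z. cmod (\<phi> z)) ` cball 0 (1 / 2))"
      by (intro compact_continuous_image continuous_intros continuous_on_subset[OF holomorphic_on_imp_continuous_on[OF hol]])
         (auto simp: unit_disc_iff)
    moreover have "(\<lambda>z. cmod (\<phi> z)) ` cball 0 (1 / 2) \<noteq> {}" by simp
    ultimately obtain M where M: "M \<in> (\<lambda>z. cmod (\<phi> z)) ` cball 0 (1 / 2)" and M_max: "\<forall>t\<in>(\<lambda>z. cmod (\<phi> z)) ` cball 0 (1 / 2). t \<le> M"
      using compact_attains_sup by blast
    have M_ge: "cmod (\<phi> z) \<le> M" if "cmod z \<le> 1 / 2" for z using M_max that by simp
    have M1: "0 \<le> M" "M < 1"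
    proof -
      obtain z where z: "z \<in> cball 0 (1 / 2)" "M = cmod (\<phi> z)" using M by blast
      then have "z \<in> unit_disc" by (simp add: unit_disc_iff)
      then show "0 \<le> M" "M < 1" using z self[of z] by (auto simp: unit_disc_iff)
    qed
    define t0 where "t0 = (1 - M) * W M / (2 * CD)"
    have t0: "0 < t0" using M1 W_pos[of M] CD(1) by (simp add: t0_def)
    define C1 where "C1 = 2 powr q * (2 * CD) powr (p / 2)"
    have C1: "0 \<le> C1" by (simp add: C1_def)
    define C3 where "C3 = (1 + fact k) * W 0 powr q * (2 * CR * W 0) / t0 powr (p / 2)"
    have C3: "0 \<le> C3" using CR(1) W_nonneg by (simp add: C3_def)
    have "?S \<le> (\<integral>\<^sup>+z. ennreal C1 * ennreal (?g z) + ennreal C3 * ennreal (1 / cmod z) \<partial>disc_area)"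
    proof (rule nn_integral_mono)
      fix z assume "z \<in> space disc_area"
      then have z: "z \<in> unit_disc" by simp
      show "ennreal (?s z) \<le> ennreal C1 * ennreal (?g z) + ennreal C3 * ennreal (1 / cmod z)"
      proof (cases "z = 0 \<or> \<phi> z = 0")
        case True
        \<comment> \<open>At the origin \<open>weight_star \<omega>\<close> has the value \<open>0\<close>, and so has every quotient formed with it.\<close>
        then have s0: "?s z = 0" by (auto simp: omega_star_zero)
        show ?thesis by (simp only: s0 ennreal_0 zero_le)
      next
        case False
        then have sp: "0 < \<omega>s z" "0 < \<omega>s (\<phi> z)" using omega_star_pos[OF z] omega_star_pos[OF self[OF z]] by auto
        have s_eq: "?s z = \<omega>s z powr q * \<omega> z / \<omega>s (\<phi> z) powr (p / 2)" unfolding q_def by (rule ratio_powr[OF sp])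
        have tp: "\<tau> (\<phi> z) / (2 * CD) \<le> \<omega>s (\<phi> z)" "0 < \<tau> (\<phi> z)"
          using omega_star_bounds(2)[OF self[OF z]] False CD(1) tau_pos[OF self[OF z]] by (auto simp: divide_le_eq mult.commute)
        show ?thesis
        proof (cases "1 / 2 \<le> cmod z")
          case True
          have "\<omega>s z powr q * \<omega> z / \<omega>s (\<phi> z) powr (p / 2) \<le> (2 * \<tau> z) powr q * \<omega> z / (\<tau> (\<phi> z) / (2 * CD)) powr (p / 2)"
            using omega_star_upper[OF z True] sp tp q p CD(1) omega_nonneg[OF z]
            by (intro frac_le mult_right_mono powr_mono2) auto
          also have "\<dots> = C1 * ?g z"
            unfolding g_eq[OF z] using tau_pos[OF z] tp CD(1) by (simp add: C1_def powr_mult powr_divide)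
          finally have "ennreal (?s z) \<le> ennreal (C1 * ?g z)" unfolding s_eq by (rule ennreal_leI)
          also have "\<dots> = ennreal C1 * ennreal (?g z)" by (rule ennreal_mult[OF C1 g_nonneg[OF z]])
          finally show ?thesis by (rule add_increasing2[rotated]) simp
        next
          case small: False
          define y where "y = ln (1 / cmod z)"
          have cz: "0 < cmod z" "cmod z < 1" using False z by (auto simp: unit_disc_iff)
          have y0: "0 \<le> y" using cz by (simp add: y_def)
          have ey: "exp y = 1 / cmod z" using cz by (simp add: y_def)
          have yq: "y powr q \<le> (1 + fact k) * (1 / cmod z)"
          proof -
            have "y powr q \<le> 1 + y ^ k"
            proof (cases "y \<le> 1")
              case True
              then have "y powr q \<le> 1 powr q" using y0 q by (intro powr_mono2) auto
              then show ?thesis using y0 by (simp add: add_increasing2)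
            next
              case False
              then have "y powr q \<le> y powr real k" using qk by (intro powr_mono) auto
              then show ?thesis using False by (simp add: powr_realpow)
            qed
            also have "\<dots> \<le> exp y + fact k * exp y" using power_le_fact_exp[OF y0, of k] y0 by (intro add_mono) auto
            finally show ?thesis unfolding ey[symmetric] by (simp add: distrib_right)
          qed
          have "\<omega>s z \<le> y * W 0"
          proof -
            have "y * W (cmod z) \<le> y * W 0" using y0 by (intro mult_left_mono W_antimono) auto
            then show ?thesis using omega_star_bounds(1)[OF z] False by (simp add: y_def)
          qed
          then have "\<omega>s z powr q \<le> (y * W 0) powr q" using sp q by (intro powr_mono2) auto
          also have "\<dots> = y powr q * W 0 powr q" using y0 W_nonneg by (simp add: powr_mult)
          also have "\<dots> \<le> ((1 + fact k) * (1 / cmod z)) * W 0 powr q" by (intro mult_right_mono yq) auto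
          finally have a: "\<omega>s z powr q \<le> ((1 + fact k) * (1 / cmod z)) * W 0 powr q" .
          have b: "\<omega> z \<le> 2 * CR * W 0"
          proof -
            have "W (cmod z) / (1 - cmod z) \<le> W 0 / (1 / 2)"
              using small cz by (intro frac_le W_antimono W_nonneg) auto
            then have "CR * (W (cmod z) / (1 - cmod z)) \<le> CR * (W 0 / (1 / 2))" using CR(1) by (intro mult_left_mono) auto
            then show ?thesis using CR(2)[OF z] by simp
          qed
          have c: "t0 \<le> \<omega>s (\<phi> z)"
          proof -
            have "cmod (\<phi> z) \<le> M" using M_ge[of z] small by simp
            then have "(1 - M) * W M \<le> \<tau> (\<phi> z)" unfolding \<tau>_def using M1 by (intro mult_mono W_antimono W_nonneg) auto
            then have "t0 \<le> \<tau> (\<phi> z) / (2 * CD)" unfolding t0_def using CD(1) by (intro divide_right_mono) auto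
            then show ?thesis using tp by linarith
          qed
          have "?s z \<le> (((1 + fact k) * (1 / cmod z)) * W 0 powr q) * (2 * CR * W 0) / t0 powr (p / 2)"
            unfolding s_eq using a b c t0 p omega_nonneg[OF z] cz by (intro frac_le mult_mono powr_mono2) auto
          also have "\<dots> = C3 * (1 / cmod z)" by (simp add: C3_def)
          finally have "ennreal (?s z) \<le> ennreal (C3 * (1 / cmod z))" by (rule ennreal_leI)
          also have "\<dots> = ennreal C3 * ennreal (1 / cmod z)" by (rule ennreal_mult[OF C3]) simp
          finally show ?thesis by (rule add_increasing[rotated]) simp
        qed
      qed
    qed
    also have "\<dots> = ennreal C1 * ?I + ennreal C3 * (\<integral>\<^sup>+z. ennreal (1 / cmod z) \<partial>disc_area)"
    proof -
      have cm[measurable]: "(\<lambda>z. ennreal (1 / cmod z)) \<in> borel_measurable disc_area"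
        by (rule borel_measurable_disc_area_borel) measurable
      have "(\<integral>\<^sup>+z. ennreal C1 * ennreal (?g z) + ennreal C3 * ennreal (1 / cmod z) \<partial>disc_area) =
        (\<integral>\<^sup>+z. ennreal C1 * ennreal (?g z) \<partial>disc_area) + (\<integral>\<^sup>+z. ennreal C3 * ennreal (1 / cmod z) \<partial>disc_area)"
        by (intro nn_integral_add borel_measurable_times_ennreal gm cm borel_measurable_const)
      also have "(\<integral>\<^sup>+z. ennreal C1 * ennreal (?g z) \<partial>disc_area) = ennreal C1 * ?I" by (rule nn_integral_cmult[OF gm])
      also have "(\<integral>\<^sup>+z. ennreal C3 * ennreal (1 / cmod z) \<partial>disc_area) = ennreal C3 * (\<integral>\<^sup>+z. ennreal (1 / cmod z) \<partial>disc_area)" by (rule nn_integral_cmult[OF cm])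
      finally show ?thesis .
    qed
    also have "\<dots> < \<infinity>"
    proof -
      have "(\<integral>\<^sup>+z. ennreal (1 / cmod z) \<partial>disc_area) = (\<integral>\<^sup>+r. ennreal (1 / r) * ennreal (2 * r) * indicator {0..<1} r \<partial>lborel)"
        by (rule nn_integral_disc_area_radial[where F="\<lambda>r. ennreal (1 / r)"]) measurable
      also have "\<dots> \<le> (\<integral>\<^sup>+r. ennreal 2 * indicator {0..<1::real} r \<partial>lborel)"
        by (intro nn_integral_mono) (auto simp: indicator_def ennreal_mult[symmetric] ennreal_leI)
      also have "\<dots> < \<infinity>" by (subst nn_integral_cmult_indicator) (auto simp: ennreal_mult_less_top)
      finally show ?thesis using fin by (simp add: ennreal_mult_less_top)
    qed
    finally show "?S < \<infinity>" .
  }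
qed

end

theorem theorem4:
  fixes p :: real and \<omega> :: "complex \<Rightarrow> real" and \<phi> :: "complex \<Rightarrow> complex"
  assumes "2 < p"
    and "regular_weight \<omega>"
    and "analytic_self_map \<phi>"
    and "bounded_valent \<phi>"
  shows "composition_operator \<phi> \<in> Schatten_class p (bergman_space \<omega>) (bergman_norm \<omega>) \<longleftrightarrow>
    (\<integral>\<^sup>+z. ennreal ((weight_star \<omega> z / weight_star \<omega> (\<phi> z)) powr (p / 2) * (\<omega> z / weight_star \<omega> z))
       \<partial>disc_area) < \<infinity>"
proof -
  interpret regular_radial_weight \<omega> by (rule regular_radial_weight.intro) fact
  have hol: "\<phi> holomorphic_on unit_disc" and self: "\<And>z. z \<in> unit_disc \<Longrightarrow> \<phi> z \<in> unit_disc"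
    using assms(3) by (auto simp: analytic_self_map_def)
  obtain n :: nat where val: "\<And>w. w \<in> unit_disc \<Longrightarrow> finite {z\<in>unit_disc. \<phi> z = w} \<and> card {z\<in>unit_disc. \<phi> z = w} \<le> n"
    using assms(4) unfolding bounded_valent_def by blast
  note iff = star_integral_iff[OF assms(1) hol self]
  show ?thesis
  proof
    assume "composition_operator \<phi> \<in> Schatten_class p H N"
    then have "bounded_operator H N (composition_operator \<phi>)" "summable (\<lambda>n. singular_value H N (composition_operator \<phi>) n powr p)"
      by (auto simp: Schatten_class_def compact_operator_def)
    from Schatten_imp_integral_tau[OF assms(1,3) this] iff
    show "(\<integral>\<^sup>+z. ennreal ((\<omega>s z / \<omega>s (\<phi> z)) powr (p / 2) * (\<omega> z / \<omega>s z)) \<partial>disc_area) < \<infinity>" by blast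
  next
    assume "(\<integral>\<^sup>+z. ennreal ((\<omega>s z / \<omega>s (\<phi> z)) powr (p / 2) * (\<omega> z / \<omega>s z)) \<partial>disc_area) < \<infinity>"
    then have I: "(\<integral>\<^sup>+z. ennreal ((\<tau> z / \<tau> (\<phi> z)) powr (p / 2) * (\<omega> z / \<tau> z)) \<partial>disc_area) < \<infinity>" using iff by blast
    obtain w :: "nat \<Rightarrow> complex" and K where w: "\<And>j. w j \<in> unit_disc"
      "\<And>z. z \<in> unit_disc \<Longrightarrow> \<exists>j. z \<in> ball (w j) ((1 - cmod (w j)) / 32)"
      "\<And>z F. finite F \<Longrightarrow> (\<And>j. j \<in> F \<Longrightarrow> z \<in> ball (w j) ((1 - cmod (w j)) / 4)) \<Longrightarrow> card F \<le> K"
      by (fact Whitney_cover)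
    interpret composition_setting \<omega> \<phi> n p w K
      by unfold_locales (fact assms(1) hol self val w I)+
    show "composition_operator \<phi> \<in> Schatten_class p H N" by (rule composition_Schatten)
  qed
qed

end
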